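(* Let $n\ge 1$, let $\alpha=(\alpha_1,\dots,\alpha_n)$ be a vector of positive real numbers, $|\alpha|=\sum_{i=1}^n\alpha_i$, and let $g:(0,\infty)\to(0,\infty)$. Let $\mu$ be the multivariate Liouville distribution on $(0,\infty)^n$ with parameters $\alpha$ and $g$, i.e. the probability measure with density $$\rho(x)=Z^{-1}\prod_{i=1}^n x_i^{\alpha_i-1}\,g\Big(\sum_{i=1}^n x_i\Big),\qquad x\in(0,\infty)^n,$$ where $Z$ is the normalization constant. Let $\mu_S$ be the probability measure on $(0,\infty)$ with density proportional to $s\mapsto s^{|\alpha|-1}g(s)$. Suppose that $\mu_S$ satisfies a weighted Poincaré inequality with weight $w_S:(0,\infty)\to(0,\infty)$, with optimal constant $C_P(\mu_S,w_S)$. Denote $s(x)=\sum_{i=1}^n x_i$ for $x\in(0,\infty)^n$ and $$K=\int_{(0,\infty)}\frac{s^2}{w_S(s)}\,d\mu_S(s).$$ Then $\mu$ satisfies the weighted Poincaré inequality $$\mathrm{Var}_\mu(f)\le \max\left(C_P(\mu_S,w_S),\frac{K}{|\alpha|}\right)\int_{(0,\infty)^n}\frac{w_S(s(x))}{s(x)}\sum_{i=1}^n x_i\left(\frac{\partial f}{\partial x_i}(x)\right)^2 d\mu(x)$$ for all $f\in L^2(\mu)$ for which the right-hand side is finite.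
   Context: For a connected open set $\Omega\subset\mathbb{R}^n$ with piecewise $C^1$ boundary, consider probability measures $\mu$ on $\Omega$ having a Lebesgue density that is positive in $\Omega$. A weight on $\Omega$ is a (measurable) function $W$ from $\Omega$ to the set of symmetric positive definite $n\times n$ matrices (for $n=1$: a positive function). For a symmetric positive definite matrix $A$, $\|x\|_A=\sqrt{\langle Ax,x\rangle}$. The measure $\mu$ satisfies a weighted Poincaré inequality with weight $W$ and finite constant $C>0$ if $$\mathrm{Var}_\mu(f):=\int_\Omega f^2\,d\mu-\Big(\int_\Omega f\,d\mu\Big)^2\le C\int_\Omega\|\nabla f\|_W^2\,d\mu$$ for all $f\in L^2(\mu)$ for which the right-hand side is finite, where $\nabla f$ is the gradient of weak partial derivatives (so $f$ is understood to be weakly differentiable). $C_P(\mu,W)$ denotes the smallest such constant. All functions are measurable and $g$ is such that the density $\rho$ is normalizable. If $K=+\infty$ the stated inequality carries no information. *)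

theory Defs
  imports "HOL-Analysis.Analysis"
begin

fun C_k :: "nat \<Rightarrow> ('a::euclidean_space \<Rightarrow> real) \<Rightarrow> bool" where
  "C_k 0 f \<longleftrightarrow> continuous_on UNIV f"
| "C_k (Suc k) f \<longleftrightarrow> (\<forall>x. f differentiable (at x)) \<and>
     (\<forall>b\<in>Basis. C_k k (\<lambda>x. frechet_derivative f (at x) b))"

definition test_function :: "'a::euclidean_space set \<Rightarrow> ('a \<Rightarrow> real) \<Rightarrow> bool" where
  "test_function \<Omega> \<phi> \<longleftrightarrow> (\<forall>k. C_k k \<phi>) \<and>
     compact (closure {x. \<phi> x \<noteq> 0}) \<and> closure {x. \<phi> x \<noteq> 0} \<subseteq> \<Omega>"

definition locally_integrable_on :: "'a::euclidean_space set \<Rightarrow> ('a \<Rightarrow> real) \<Rightarrow> bool" where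
  "locally_integrable_on \<Omega> f \<longleftrightarrow>
     (\<forall>K. compact K \<and> K \<subseteq> \<Omega> \<longrightarrow> set_integrable lborel K f)"

definition weak_partial ::
  "'a::euclidean_space set \<Rightarrow> 'a \<Rightarrow> ('a \<Rightarrow> real) \<Rightarrow> ('a \<Rightarrow> real) \<Rightarrow> bool" where
  "weak_partial \<Omega> b f h \<longleftrightarrow> locally_integrable_on \<Omega> f \<and> locally_integrable_on \<Omega> h \<and>
     (\<forall>\<phi>. test_function \<Omega> \<phi> \<longrightarrow>
        (LINT x:\<Omega>|lborel. f x * frechet_derivative \<phi> (at x) b) =
        - (LINT x:\<Omega>|lborel. h x * \<phi> x))"

text \<open>\<open>weak_gradient \<Omega> f G\<close>: the function \<open>f\<close> is weakly differentiable on \<open>\<Omega>\<close> with gradient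
  (a version of) \<open>G\<close>. Values of \<open>f\<close> and \<open>G\<close> outside \<open>\<Omega>\<close> are irrelevant.\<close>

definition weak_gradient ::
  "'a::euclidean_space set \<Rightarrow> ('a \<Rightarrow> real) \<Rightarrow> ('a \<Rightarrow> 'a) \<Rightarrow> bool" where
  "weak_gradient \<Omega> f G \<longleftrightarrow> (\<forall>b\<in>Basis. weak_partial \<Omega> b f (\<lambda>x. G x \<bullet> b))"

definition L2 :: "'a measure \<Rightarrow> ('a \<Rightarrow> real) \<Rightarrow> bool" where
  "L2 \<mu> f \<longleftrightarrow> f \<in> borel_measurable \<mu> \<and> integrable \<mu> (\<lambda>x. (f x)\<^sup>2)"

definition Var :: "'a measure \<Rightarrow> ('a \<Rightarrow> real) \<Rightarrow> real" where
  "Var \<mu> f = (LINT x|\<mu>. (f x)\<^sup>2) - (LINT x|\<mu>. f x)\<^sup>2"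

definition weighted_norm :: "('a::euclidean_space \<Rightarrow> 'a) \<Rightarrow> 'a \<Rightarrow> real" where
  "weighted_norm A v = sqrt (A v \<bullet> v)"

text \<open>A weight is given by the linear operators \<open>W x\<close> rather than by their matrices, so that
  the line (type \<^typ>\<open>real\<close>) is covered: there a positive function \<open>w\<close> is the weight
  \<open>\<lambda>x v. w x * v\<close>. The integrand on the right is nonnegative, so its integrability
  says that the right-hand side is finite.\<close>

definition weighted_poincare ::
  "'a::euclidean_space set \<Rightarrow> 'a measure \<Rightarrow> ('a \<Rightarrow> 'a \<Rightarrow> 'a) \<Rightarrow> real \<Rightarrow> bool" where
  "weighted_poincare \<Omega> \<mu> W C \<longleftrightarrow> C > 0 \<and>
     (\<forall>f G. L2 \<mu> f \<and> weak_gradient \<Omega> f G \<and>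
            integrable \<mu> (\<lambda>x. (weighted_norm (W x) (G x))\<^sup>2) \<longrightarrow>
        Var \<mu> f \<le> C * (LINT x|\<mu>. (weighted_norm (W x) (G x))\<^sup>2))"

definition poincare_const ::
  "'a::euclidean_space set \<Rightarrow> 'a measure \<Rightarrow> ('a \<Rightarrow> 'a \<Rightarrow> 'a) \<Rightarrow> real" where
  "poincare_const \<Omega> \<mu> W = Inf {C. weighted_poincare \<Omega> \<mu> W C}"

text \<open>The measure on \<open>\<Omega>\<close> with Lebesgue density proportional to \<open>h\<close>; it is a probability measure
  if \<open>h\<close> is integrable on \<open>\<Omega>\<close> and positive there, and \<open>\<Omega>\<close> is open and nonempty.\<close>

definition normalized_measure ::
  "'a::euclidean_space set \<Rightarrow> ('a \<Rightarrow> real) \<Rightarrow> 'a measure" where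
  "normalized_measure \<Omega> h =
     density (restrict_space lborel \<Omega>) (\<lambda>x. ennreal (h x / (LINT y:\<Omega>|lborel. h y)))"

definition orthant :: "(real ^ 'n) set" where
  "orthant = {x. \<forall>i. 0 < x $ i}"

definition coord_sum :: "real ^ 'n \<Rightarrow> real" where
  "coord_sum x = (\<Sum>i\<in>UNIV. x $ i)"

definition liouville_kernel :: "real ^ 'n \<Rightarrow> (real \<Rightarrow> real) \<Rightarrow> real ^ 'n \<Rightarrow> real" where
  "liouville_kernel \<alpha> g x = (\<Prod>i\<in>UNIV. (x $ i) powr (\<alpha> $ i - 1)) * g (coord_sum x)"

definition liouville :: "real ^ 'n \<Rightarrow> (real \<Rightarrow> real) \<Rightarrow> (real ^ 'n) measure" where
  "liouville \<alpha> g = normalized_measure orthant (liouville_kernel \<alpha> g)"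

definition liouville_radial :: "real ^ 'n \<Rightarrow> (real \<Rightarrow> real) \<Rightarrow> real measure" where
  "liouville_radial \<alpha> g = normalized_measure {0<..} (\<lambda>s. s powr (coord_sum \<alpha> - 1) * g s)"

end

theory Submission
  imports Defs "HOL-Probability.Probability"
begin

text \<open>
  Write \<open>\<bar>y\<bar>\<close> for \<open>coord_sum y\<close> and \<open>a = \<bar>\<alpha>\<bar>\<close>. A Liouville vector is \<open>X = S D\<close>, where \<open>S\<close> has the
  radial law and \<open>D = Y / \<bar>Y\<bar>\<close> comes from a vector \<open>Y\<close> of independent Gamma variables with
  parameters \<open>\<alpha>\<^sub>i\<close>, independent of \<open>S\<close> (\<open>nn_integral_liouville_polar\<close>). Let \<open>F y\<close> be the mean of \<open>f\<close>
  along the ray through \<open>y\<close>, taken with respect to \<open>S\<close>. The variance of \<open>f\<close> is the mean over the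
  directions of the variance along the ray, plus the variance of \<open>F Y\<close>.

  Along almost every ray, \<open>f\<close> is weakly differentiable with derivative \<open>h = \<Sum>i. D\<^sub>i \<partial>\<^sub>i f\<close>
  (\<open>radial_weak_gradient\<close>), so the one-dimensional inequality bounds the variance on that ray by
  \<open>CP R\<close>, where \<open>R\<close> is the mean of \<open>w h\<^sup>2\<close>.

  The angular part is controlled by a Poincare inequality for the law of \<open>Y\<close>: the variance of \<open>u\<close>
  is at most the mean of \<open>\<Sum>i. y\<^sub>i (\<partial>\<^sub>i u)\<^sup>2\<close> (\<open>gamma_poincare\<close>). It tensorizes from dimension one by
  the Efron-Stein inequality, and in dimension one it is the Cauchy-Schwarz inequality along segments
  together with an explicit formula for the resulting kernel (\<open>gamma_kernel\<close>).
  It is applied to the extension \<open>u y = \<bar>y\<bar> F y\<close> of degree one. The extension of degree zero would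
  bring in the mean of \<open>1 / \<bar>Y\<bar>\<close>, that is \<open>1 / (a - 1)\<close>, and so a worse constant for \<open>a > 1\<close> and
  nothing for \<open>a \<le> 1\<close>. The gradient of \<open>u\<close> is \<open>F + T\<close> with
  \<open>T\<^sub>i = H\<^sub>i - (\<Sum>j. D\<^sub>j H\<^sub>j)\<close>, where \<open>H\<^sub>j\<close> is the mean of \<open>S \<partial>\<^sub>j f\<close> on the ray
  (\<open>weak_gradient_spherical_average\<close>). As \<open>\<Sum>i. D\<^sub>i T\<^sub>i = 0\<close> and \<open>\<bar>Y\<bar>\<close> is independent of \<open>D\<close> with
  moments \<open>a\<close> and \<open>a (a + 1)\<close> (\<open>integral_homogeneous\<close>), the inequality for \<open>u\<close> says that the variance
  of \<open>F Y\<close> is at most the mean of \<open>\<Sum>i. D\<^sub>i T\<^sub>i\<^sup>2\<close> divided by \<open>a\<close>.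

  Finally \<open>T\<^sub>i\<close> is the mean of \<open>S (\<partial>\<^sub>i f - h)\<close>, so the Cauchy-Schwarz inequality with weight \<open>w\<close> gives
  \<open>(\<Sum>i. D\<^sub>i T\<^sub>i\<^sup>2) \<le> K (N - R)\<close>, where \<open>N\<close> is the mean on the ray of \<open>w (\<Sum>i. D\<^sub>i (\<partial>\<^sub>i f)\<^sup>2)\<close>. The radial
  part uses the share \<open>R\<close> of the energy \<open>N\<close> and the angular part the share \<open>N - R\<close>, which is why
  the maximum of \<open>CP\<close> and \<open>K / a\<close> suffices (\<open>radial_estimate\<close>). Averaging over the directions
  turns \<open>N\<close> into the weighted energy of \<open>f\<close>.

  All gradients are weak. The analytic core is therefore a change of variables under the integral
  against test functions, once along coordinate dilations (\<open>weak_gradient_scale_increment\<close>) and once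
  across them (\<open>AE_spherical_weak_identity\<close>).
\<close>

section \<open>Smooth test functions\<close>

lemma C_k_Suc_D: "C_k (Suc k) f \<Longrightarrow> C_k k f"
proof (induction k arbitrary: f)
  case 0
  then show ?case
    by (auto intro!: continuous_at_imp_continuous_on differentiable_imp_continuous_within)
next
  case (Suc k)
  then show ?case by simp
qed

lemma C_k_const: "C_k k (\<lambda>x. c)"
  by (induction k arbitrary: c) (auto simp: frechet_derivative_const)

lemma C_k_add:
  assumes "C_k k f" "C_k k g"
  shows "C_k k (\<lambda>x. f x + g x)"
  using assms
proof (induction k arbitrary: f g)
  case 0
  then show ?case by (auto intro!: continuous_intros)
next
  case (Suc k)
  then have "frechet_derivative (\<lambda>x. f x + g x) (at x) b
      = frechet_derivative f (at x) b + frechet_derivative g (at x) b" for x b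
    by (intro fun_cong[OF frechet_derivative_at[symmetric], THEN trans] has_derivative_add)
       (auto simp: frechet_derivative_works)
  with Suc show ?case by auto
qed

lemma C_k_mult:
  assumes "C_k k f" "C_k k g"
  shows "C_k k (\<lambda>x. f x * g x)"
  using assms
proof (induction k arbitrary: f g)
  case 0
  then show ?case by (auto intro!: continuous_intros)
next
  case (Suc k)
  then have "frechet_derivative (\<lambda>x. f x * g x) (at x) b
      = f x * frechet_derivative g (at x) b + frechet_derivative f (at x) b * g x" for x b
    by (intro fun_cong[OF frechet_derivative_at[symmetric], THEN trans] has_derivative_mult)
       (auto simp: frechet_derivative_works)
  moreover have "C_k k f" "C_k k g"
    using Suc.prems by (blast dest: C_k_Suc_D)+
  ultimately show ?case
    using Suc by (auto intro!: C_k_add)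
qed

lemma C_k_sum: "(\<And>i. i \<in> A \<Longrightarrow> C_k k (f i)) \<Longrightarrow> C_k k (\<lambda>x. \<Sum>i\<in>A. f i x)"
  by (induction A rule: infinite_finite_induct) (auto intro!: C_k_const C_k_add)

lemma C_k_prod: "(\<And>i. i \<in> A \<Longrightarrow> C_k k (f i)) \<Longrightarrow> C_k k (\<lambda>x. \<Prod>i\<in>A. f i x)"
  by (induction A rule: infinite_finite_induct) (auto intro!: C_k_const C_k_mult)

lemma C_k_bounded_linear:
  assumes "bounded_linear f"
  shows "C_k k f"
proof (cases k)
  case 0
  then show ?thesis using assms by (simp add: linear_continuous_on)
next
  case (Suc k)
  have "frechet_derivative f (at x) = f" for x
    using bounded_linear_imp_has_derivative[OF assms, of "at x"] frechet_derivative_at by metis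
  then show ?thesis
    using assms by (auto simp: Suc C_k_const bounded_linear_imp_differentiable)
qed

lemma C_k_compose_linear:
  assumes L: "bounded_linear (L :: 'a::euclidean_space \<Rightarrow> 'b::euclidean_space)" and "C_k k f"
  shows "C_k k (\<lambda>x. f (L x))"
  using assms(2)
proof (induction k arbitrary: f)
  case 0
  have "continuous_on UNIV (f \<circ> L)"
    using 0 L by (intro continuous_on_compose linear_continuous_on[OF L]) (auto intro: continuous_on_subset)
  then show ?case by (simp add: o_def)
next
  case (Suc k)
  have f: "(f has_derivative frechet_derivative f (at x)) (at x)" for x
    using Suc.prems by (auto simp: frechet_derivative_works)
  then have lin: "linear (frechet_derivative f (at x))" for x
    using has_derivative_linear by blast
  have d: "((\<lambda>x. f (L x)) has_derivative (\<lambda>h. frechet_derivative f (at (L x)) (L h))) (at x)" for x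
    using has_derivative_compose[OF bounded_linear_imp_has_derivative[OF L] f] by simp
  have eq: "frechet_derivative (\<lambda>x. f (L x)) (at x) b
      = (\<Sum>c\<in>Basis. (L b \<bullet> c) * frechet_derivative f (at (L x)) c)" for x b
  proof -
    have "frechet_derivative (\<lambda>x. f (L x)) (at x) b = frechet_derivative f (at (L x)) (\<Sum>c\<in>Basis. (L b \<bullet> c) *\<^sub>R c)"
      using frechet_derivative_at[OF d] by (metis euclidean_representation)
    also have "\<dots> = (\<Sum>c\<in>Basis. (L b \<bullet> c) * frechet_derivative f (at (L x)) c)"
      using lin[of "L x"] by (simp add: linear_sum linear_scale)
    finally show ?thesis .
  qed
  show ?case
    using Suc d by (auto simp: eq differentiable_def intro!: C_k_sum C_k_mult C_k_const)
qed

lemma smooth_compose: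
  assumes "\<And>k. C_k k (F :: real \<Rightarrow> real)" "\<And>k. C_k k f"
  shows "C_k k (\<lambda>x. F (f x))"
  using assms
proof (induction k arbitrary: F f)
  case 0
  have "continuous_on UNIV (F \<circ> f)"
    using 0[of 0] by (intro continuous_on_compose) (auto intro: continuous_on_subset)
  then show ?case by (simp add: o_def)
next
  case (Suc k)
  have F: "(F has_derivative frechet_derivative F (at y)) (at y)" for y
    using Suc.prems(1)[of 1] by (auto simp: frechet_derivative_works)
  have f: "(f has_derivative frechet_derivative f (at x)) (at x)" for x
    using Suc.prems(2)[of 1] by (auto simp: frechet_derivative_works)
  have d: "((\<lambda>x. F (f x)) has_derivative
      (\<lambda>h. frechet_derivative F (at (f x)) (frechet_derivative f (at x) h))) (at x)" for x
    using has_derivative_compose[OF f F] by simp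
  have lin: "frechet_derivative F (at y) h = frechet_derivative F (at y) 1 * h" for y h
    using linear_scale[OF has_derivative_linear[OF F[of y]], of h 1] by simp
  have eq: "frechet_derivative (\<lambda>x. F (f x)) (at x) b
      = frechet_derivative F (at (f x)) 1 * frechet_derivative f (at x) b" for x b
    using frechet_derivative_at[OF d] lin by metis
  have "C_k k (\<lambda>x. frechet_derivative F (at (f x)) 1)"
    using Suc.prems(1)[of "Suc _"] Suc.prems(2) by (intro Suc.IH) auto
  moreover have "C_k k (\<lambda>x. frechet_derivative f (at x) b)" if "b \<in> Basis" for b
    using Suc.prems(2)[of "Suc k"] that by auto
  ultimately show ?case
    using d by (auto simp: eq differentiable_def intro!: C_k_mult)
qed

text \<open>
  A family of functions whose derivatives are combinations of its own members is smooth. This covers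
  \<open>exp\<close> and the functions \<open>flat_exp m\<close> below, for which no closed form of the iterated derivatives is
  needed.
\<close>

lemma C_k_real_derivative_family:
  fixes F :: "nat \<Rightarrow> real \<Rightarrow> real"
  assumes "\<And>m x. (F m has_real_derivative (\<Sum>j\<le>N. c m j * F (m + j) x)) (at x)"
  shows "C_k k (F m)"
proof (induction k arbitrary: m)
  case 0
  show ?case
    using assms by (auto intro!: continuous_at_imp_continuous_on DERIV_isCont)
next
  case (Suc k)
  have "frechet_derivative (F m) (at x) 1 = (\<Sum>j\<le>N. c m j * F (m + j) x)" for x
    using frechet_derivative_at[OF assms[unfolded has_field_derivative_def]] by (metis mult.right_neutral)
  with Suc assms show ?case
    by (auto simp: differentiable_def has_field_derivative_def intro!: C_k_sum C_k_mult C_k_const)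
qed

lemma C_k_exp: "C_k k (exp :: real \<Rightarrow> real)"
  using C_k_real_derivative_family[where F = "\<lambda>_. exp" and N = 0 and c = "\<lambda>_ _. 1"] by (auto intro!: derivative_eq_intros)

text \<open>
  The powers \<open>(1 / x) ^ m\<close> are included because differentiation of \<open>exp (- (1 / x))\<close> produces them; with
  them the family is closed under derivatives.
\<close>

definition flat_exp :: "nat \<Rightarrow> real \<Rightarrow> real" where
  "flat_exp m x = (if x > 0 then (1 / x) ^ m * exp (- (1 / x)) else 0)"

lemma flat_exp_tendsto_0: "(flat_exp m \<longlongrightarrow> 0) (at 0)"
proof -
  have "((\<lambda>x. inverse x ^ m / exp (inverse x :: real)) \<longlongrightarrow> 0) (at_right 0)"
    by (rule filterlim_compose[OF tendsto_power_div_exp_0 filterlim_inverse_at_top_right])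
  then have "(flat_exp m \<longlongrightarrow> 0) (at_right 0)"
    by (rule Lim_transform_eventually)
       (auto simp: eventually_at_filter flat_exp_def exp_minus divide_simps)
  moreover have "(flat_exp m \<longlongrightarrow> 0) (at_left 0)"
    by (rule Lim_transform_eventually[OF tendsto_const])
       (auto simp: eventually_at_filter flat_exp_def)
  ultimately show ?thesis by (simp add: filterlim_split_at)
qed

lemma DERIV_flat_exp:
  "(flat_exp m has_real_derivative (flat_exp (m + 2) x - m * flat_exp (m + 1) x)) (at x)"
proof -
  consider "x > 0" | "x < 0" | "x = 0" by linarith
  then show ?thesis
  proof cases
    case 1
    have "((\<lambda>x. (1 / x) ^ m * exp (- (1 / x))) has_real_derivative
        (flat_exp (m + 2) x - m * flat_exp (m + 1) x)) (at x)"
    proof (cases m)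
      case 0
      then show ?thesis using 1
        by (auto intro!: derivative_eq_intros simp: flat_exp_def power2_eq_square divide_simps)
    next
      case (Suc k)
      define z where "z = 1 / x"
      have d: "((\<lambda>x. 1 / x) has_real_derivative - (z\<^sup>2)) (at x)"
        using 1 unfolding z_def by (auto intro!: derivative_eq_intros simp: power2_eq_square)
      have "((\<lambda>x. (1 / x) ^ Suc k * exp (- (1 / x))) has_real_derivative
         z ^ Suc k * (exp (- z) * z\<^sup>2) + real (Suc k) * z ^ k * (- (z\<^sup>2)) * exp (- z)) (at x)"
        unfolding z_def
        by (rule DERIV_cong[OF DERIV_mult[OF DERIV_power_Suc[OF d] DERIV_fun_exp[OF DERIV_minus[OF d]]]])
           (simp add: z_def algebra_simps)
      also have "z ^ Suc k * (exp (- z) * z\<^sup>2) + real (Suc k) * z ^ k * (- (z\<^sup>2)) * exp (- z)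
         = flat_exp (m + 2) x - m * flat_exp (m + 1) x"
        using 1 by (simp add: Suc flat_exp_def power2_eq_square algebra_simps flip: z_def)
      finally show ?thesis using Suc by simp
    qed
    moreover have "\<forall>\<^sub>F x in nhds x. flat_exp m x = (1 / x) ^ m * exp (- (1 / x))"
      using eventually_nhds_in_open[of "{0<..}" x] 1
      by (auto elim!: eventually_mono simp: flat_exp_def)
    ultimately show ?thesis by (subst DERIV_cong_ev[OF refl _ refl]) auto
  next
    case 2
    have "\<forall>\<^sub>F x in nhds x. flat_exp m x = 0"
      using eventually_nhds_in_open[of "{..<0}" x] 2
      by (auto elim!: eventually_mono simp: flat_exp_def)
    then show ?thesis using 2 by (subst DERIV_cong_ev[OF refl _ refl]) (auto simp: flat_exp_def)
  next
    case 3
    have "((\<lambda>h. (flat_exp m (0 + h) - flat_exp m 0) / h) \<longlongrightarrow> 0) (at 0)"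
      by (rule Lim_transform_eventually[OF flat_exp_tendsto_0[of "Suc m"]])
         (auto simp: flat_exp_def eventually_at_filter power_one_over)
    then show ?thesis using 3 by (simp add: DERIV_def flat_exp_def)
  qed
qed

lemma C_k_flat_exp: "C_k k (flat_exp m)"
proof (rule C_k_real_derivative_family)
  fix m x
  have "(\<Sum>j\<le>2. (if j = 2 then 1 else if j = 1 then - real m else 0) * flat_exp (m + j) x) =
     flat_exp (m + 2) x - m * flat_exp (m + 1) x"
    by (simp add: numeral_2_eq_2)
  then show "(flat_exp m has_real_derivative (\<Sum>j\<le>2. (if j = 2 then 1 else if j = 1 then - real m else 0) * flat_exp (m + j) x)) (at x)"
    using DERIV_flat_exp by simp
qed

text \<open>
  The product is positive exactly on the open box, so these smooth functions increase with \<open>k\<close> to the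
  indicator of the box.
\<close>

definition box_bump :: "'a::euclidean_space \<Rightarrow> 'a \<Rightarrow> nat \<Rightarrow> 'a \<Rightarrow> real" where
  "box_bump l u k x =
     1 - exp (- real k * (\<Prod>b\<in>Basis. flat_exp 0 ((x - l) \<bullet> b) * flat_exp 0 ((u - x) \<bullet> b)))"

lemma smooth_box_bump: "C_k j (box_bump l u k)"
proof -
  have "C_k j (\<lambda>x. flat_exp 0 ((x - l) \<bullet> b))" for b :: 'a and j
  proof (rule smooth_compose[where F = "flat_exp 0"])
    show "C_k j (\<lambda>x. (x - l) \<bullet> b)" for j
      using C_k_add[OF C_k_bounded_linear[OF bounded_linear_inner_left[of b]] C_k_const[of _ "- (l \<bullet> b)"]]
      by (simp add: inner_diff_left)
  qed (rule C_k_flat_exp)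
  moreover have "C_k j (\<lambda>x. flat_exp 0 ((u - x) \<bullet> b))" for b :: 'a and j
  proof (rule smooth_compose[where F = "flat_exp 0"])
    show "C_k j (\<lambda>x. (u - x) \<bullet> b)" for j
      using C_k_add[OF C_k_const[of _ "u \<bullet> b"] C_k_mult[OF C_k_const[of _ "-1"] C_k_bounded_linear[OF bounded_linear_inner_left[of b]]]]
      by (simp add: inner_diff_left)
  qed (rule C_k_flat_exp)
  ultimately have "C_k j (\<lambda>x. - real k * (\<Prod>b\<in>Basis. flat_exp 0 ((x - l) \<bullet> b) * flat_exp 0 ((u - x) \<bullet> b)))" for j
    by (intro C_k_mult C_k_prod C_k_const)
  from smooth_compose[OF C_k_exp this]
  have "C_k j (\<lambda>x. exp (- real k * (\<Prod>b\<in>Basis. flat_exp 0 ((x - l) \<bullet> b) * flat_exp 0 ((u - x) \<bullet> b))))" .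
  then have "C_k j (\<lambda>x. 1 + (-1) * exp (- real k * (\<Prod>b\<in>Basis. flat_exp 0 ((x - l) \<bullet> b) * flat_exp 0 ((u - x) \<bullet> b))))"
    by (intro C_k_mult C_k_add C_k_const)
  then show ?thesis by (simp add: box_bump_def[abs_def])
qed

lemma flat_exp_nonneg: "0 \<le> flat_exp m x"
  by (simp add: flat_exp_def)

lemma box_bump_bounds: "0 \<le> box_bump l u k x" "box_bump l u k x \<le> 1"
  by (auto simp: box_bump_def intro!: mult_nonneg_nonneg prod_nonneg flat_exp_nonneg)

lemma box_bump_eq_0: "x \<notin> box l u \<Longrightarrow> box_bump l u k x = 0"
  by (auto simp: box_bump_def flat_exp_def mem_box inner_diff_left)

lemma box_bump_tendsto: "(\<lambda>k. box_bump l u k x) \<longlonglongrightarrow> indicator (box l u) x"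
proof (cases "x \<in> box l u")
  case True
  define B where "B = (\<Prod>b\<in>Basis. flat_exp 0 ((x - l) \<bullet> b) * flat_exp 0 ((u - x) \<bullet> b))"
  have "B > 0"
    unfolding B_def using True by (intro prod_pos) (auto simp: flat_exp_def mem_box inner_diff_left)
  then have "(\<lambda>k. 1 - exp (- real k * B)) \<longlonglongrightarrow> 1 - 0"
    by (intro tendsto_intros) real_asymp
  then show ?thesis using True by (simp add: box_bump_def B_def)
qed (simp add: box_bump_eq_0)

lemma test_function_box_bump:
  assumes "cbox l u \<subseteq> \<Omega>"
  shows "test_function \<Omega> (box_bump l u k)"
proof -
  have "closure {x. box_bump l u k x \<noteq> 0} \<subseteq> cbox l u"
    using box_bump_eq_0 box_subset_cbox by (intro closure_minimal) fastforce+
  moreover from this have "compact (closure {x. box_bump l u k x \<noteq> 0})"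
    using bounded_subset[OF bounded_cbox] by (auto simp: compact_eq_bounded_closed)
  ultimately show ?thesis using assms smooth_box_bump by (auto simp: test_function_def)
qed

section \<open>The fundamental lemma of the calculus of variations\<close>

text \<open>
  Boxes form an intersection-stable generator of the Borel sets, so the vanishing of the integrals
  extends to all Borel sets by a Dynkin system argument.
\<close>

lemma AE_eq_0_if_box_integrals:
  fixes q :: "'a::euclidean_space \<Rightarrow> real"
  assumes q: "integrable lborel q"
    and box: "\<And>l u. (LINT x:box l u|lborel. q x) = 0"
  shows "AE x in lborel. q x = 0"
proof (rule sigma_finite_measure.density_zero[OF sigma_finite_lborel q])
  have set_int: "set_integrable lborel A q" if "A \<in> sets borel" for A
    using q that unfolding set_integrable_def by (intro integrable_mult_indicator) auto
  have "(\<lambda>k::nat. LINT x:box (- (real k *\<^sub>R One)) (real k *\<^sub>R One)|lborel. q x)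
      \<longlonglongrightarrow> (LINT x:(\<Union>k::nat. box (- (real k *\<^sub>R One)) (real k *\<^sub>R One))|lborel. q x)"
  proof (rule set_integral_cont_up)
    show "incseq (\<lambda>k::nat. box (- (real k *\<^sub>R One)) (real k *\<^sub>R One :: 'a))"
    proof (rule monoI)
      fix m n :: nat assume "m \<le> n"
      then show "box (- (real m *\<^sub>R One)) (real m *\<^sub>R One :: 'a) \<subseteq> box (- (real n *\<^sub>R One)) (real n *\<^sub>R One)"
        by (intro subset_box_imp) auto
    qed
  qed (auto intro!: set_int)
  then have "(\<lambda>k::nat. 0) \<longlonglongrightarrow> (LINT x:UNIV|lborel. q x)"
    unfolding UN_box_eq_UNIV box .
  then have UNIV: "(LINT x:UNIV|lborel. q x) = 0"
    by (rule LIMSEQ_unique[OF _ tendsto_const])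
  fix A :: "'a set" assume "A \<in> sets lborel"
  then have A: "A \<in> sigma_sets UNIV (range (\<lambda>(a, b). box a b))"
    by (simp add: borel_eq_box)
  have Int_stable_boxes: "Int_stable (range (\<lambda>(a, b). box a b :: 'a set))"
    by (auto simp: Int_stable_def box_Int_box)
  have Pow_UNIV_ge: "range (\<lambda>(a, b). box a b :: 'a set) \<subseteq> Pow UNIV"
    by simp
  from A show "(LINT x:A|lborel. q x) = 0"
  proof (induct rule: sigma_sets_induct_disjoint[OF Int_stable_boxes Pow_UNIV_ge, consumes 1, case_names basic empty compl union])
    case (basic A)
    then show ?case using box by auto
  next
    case (compl A)
    then have A: "A \<in> sets borel" by (simp add: borel_eq_box)
    have "(LINT x:UNIV|lborel. q x) = (LINT x:(UNIV - A)|lborel. q x) + (LINT x:A|lborel. q x)"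
      using A set_int by (subst set_integral_Un[symmetric]) auto
    with compl UNIV show ?case by simp
  next
    case (union A)
    then have "A i \<in> sets borel" for i by (auto simp: borel_eq_box)
    then have "(LINT x:(\<Union>i. A i)|lborel. q x) = (\<Sum>i. LINT x:A i|lborel. q x)"
      using union(1) set_int by (intro lebesgue_integral_countable_add) (auto simp: disjoint_family_on_def)
    with union show ?case by simp
  qed (auto simp: set_lebesgue_integral_def)
qed

lemma AE_eq_0_on_open_if_cboxes:
  fixes q :: "'a::euclidean_space \<Rightarrow> real"
  assumes "open \<Omega>" "\<And>a b. cbox a b \<subseteq> \<Omega> \<Longrightarrow> AE x in lborel. x \<in> cbox a b \<longrightarrow> P x"
  shows "AE x in lborel. x \<in> \<Omega> \<longrightarrow> P x"
proof -
  obtain \<D> where D: "countable \<D>" "\<D> \<subseteq> Pow \<Omega>" "\<And>X. X \<in> \<D> \<Longrightarrow> \<exists>a b. X = cbox a b" "\<Union>\<D> = \<Omega>"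
    by (rule open_countable_Union_open_cbox[OF \<open>open \<Omega>\<close>]) (rule that)
  have "\<forall>X\<in>\<D>. AE x in lborel. x \<in> X \<longrightarrow> P x"
    using D(2,3) assms(2) by blast
  then have "AE x in lborel. \<forall>X\<in>\<D>. x \<in> X \<longrightarrow> P x"
    by (subst AE_ball_countable[OF D(1)])
  then show ?thesis
  proof eventually_elim
    case (elim x)
    then show ?case using D(4) by blast
  qed
qed

text \<open>
  The bumps \<open>box_bump c d k\<close> tend boundedly to the indicator of \<open>box c d\<close>, so \<open>q\<close> has integral zero
  over every box inside a closed box contained in \<open>\<Omega>\<close>, and countably many closed boxes cover \<open>\<Omega>\<close>.
\<close>

lemma fundamental_lemma:
  fixes q :: "'a::euclidean_space \<Rightarrow> real"
  assumes "open \<Omega>" "locally_integrable_on \<Omega> q"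
    and test: "\<And>\<phi>. test_function \<Omega> \<phi> \<Longrightarrow> (LINT x:\<Omega>|lborel. q x * \<phi> x) = 0"
  shows "AE x in lborel. x \<in> \<Omega> \<longrightarrow> q x = 0"
proof (rule AE_eq_0_on_open_if_cboxes[OF \<open>open \<Omega>\<close>])
  fix a b assume ab: "cbox a b \<subseteq> \<Omega>"
  have int: "integrable lborel (\<lambda>x. indicator (cbox a b) x * q x)"
    using assms(2) ab unfolding locally_integrable_on_def set_integrable_def by auto
  have box0: "(LINT x|lborel. indicator (box c d) x * (indicator (cbox a b) x * q x)) = 0"
    if cd: "cbox c d \<subseteq> cbox a b" for c d
  proof -
    have "(\<lambda>k. LINT x|lborel. box_bump c d k x * (indicator (cbox a b) x * q x)) \<longlonglongrightarrow>
        (LINT x|lborel. indicator (box c d) x * (indicator (cbox a b) x * q x))"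
    proof (rule integral_dominated_convergence)
      show "integrable lborel (\<lambda>x. norm (indicator (cbox a b) x * q x))"
        using int by (rule integrable_norm)
      show "AE x in lborel. norm (box_bump c d k x * (indicator (cbox a b) x * q x))
          \<le> norm (indicator (cbox a b) x * q x)" for k
      proof (rule AE_I2)
        fix x
        show "norm (box_bump c d k x * (indicator (cbox a b) x * q x)) \<le> norm (indicator (cbox a b) x * q x)"
          using box_bump_bounds[of c d k x] by (simp add: abs_mult mult_left_le_one_le)
      qed
      show "AE x in lborel. (\<lambda>k. box_bump c d k x * (indicator (cbox a b) x * q x))
          \<longlonglongrightarrow> indicator (box c d) x * (indicator (cbox a b) x * q x)"
        by (intro AE_I2 tendsto_intros box_bump_tendsto)
      have "box_bump c d k \<in> borel_measurable borel" for k
        using smooth_box_bump[of 0 c d k] by (auto intro: borel_measurable_continuous_onI)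
      then show "(\<lambda>x. box_bump c d k x * (indicator (cbox a b) x * q x)) \<in> borel_measurable lborel" for k
        using int by auto
      show "(\<lambda>x. indicator (box c d) x * (indicator (cbox a b) x * q x)) \<in> borel_measurable lborel"
        using int by auto
    qed
    moreover have "(LINT x|lborel. box_bump c d k x * (indicator (cbox a b) x * q x)) = 0" for k
    proof -
      have "(LINT x|lborel. box_bump c d k x * (indicator (cbox a b) x * q x))
          = (LINT x:\<Omega>|lborel. q x * box_bump c d k x)"
        unfolding set_lebesgue_integral_def
      proof (rule Bochner_Integration.integral_cong)
        fix x
        show "box_bump c d k x * (indicator (cbox a b) x * q x) = indicator \<Omega> x *\<^sub>R (q x * box_bump c d k x)"
          using cd ab box_bump_eq_0[of x c d k] box_subset_cbox[of c d] by (auto simp: indicator_def)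
      qed simp
      also have "\<dots> = 0"
        using test_function_box_bump cd ab by (intro test) blast
      finally show ?thesis .
    qed
    ultimately show ?thesis by (simp add: LIMSEQ_const_iff)
  qed
  have "AE x in lborel. indicator (box a b) x * (indicator (cbox a b) x * q x) = 0"
  proof (rule AE_eq_0_if_box_integrals)
    show "integrable lborel (\<lambda>x. indicator (box a b) x * (indicator (cbox a b) x * q x))"
      using integrable_mult_indicator[OF _ int, of "box a b"] by simp
    fix l u
    obtain c d where cd: "box l u \<inter> box a b = box c d"
      using box_Int_box by blast
    have "(LINT x:box l u|lborel. indicator (box a b) x * (indicator (cbox a b) x * q x))
        = (LINT x|lborel. indicator (box c d) x * (indicator (cbox a b) x * q x))"
      unfolding set_lebesgue_integral_def
      by (simp add: indicator_inter_arith mult.assoc flip: cd)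
    also have "\<dots> = 0"
    proof (cases "box c d = {}")
      case False
      then have "cbox c d \<subseteq> cbox a b"
        using closure_minimal[of "box c d" "cbox a b"] cd box_subset_cbox[of a b] by auto
      then show ?thesis by (rule box0)
    qed simp
    finally show "(LINT x:box l u|lborel. indicator (box a b) x * (indicator (cbox a b) x * q x)) = 0" .
  qed
  moreover have "AE x in lborel. x \<in> cbox a b \<longrightarrow> x \<in> box a b"
    using AE_not_in[OF null_sets_cbox_Diff_box[of a b]] by eventually_elim auto
  ultimately show "AE x in lborel. x \<in> cbox a b \<longrightarrow> q x = 0"
  proof eventually_elim
    case (elim x)
    then show ?case using box_subset_cbox[of a b] by (auto simp: indicator_def split: if_splits)
  qed
qed

section \<open>Local integrability, supports and coordinate scalings\<close>

text \<open>
  Fubini's theorem is used repeatedly for functions of \<open>(r, y)\<close> that live on a strip \<open>p \<le> r \<le> q\<close> and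
  whose slices are uniformly integrable.
\<close>

lemma integrable_strip:
  fixes F :: "real \<times> 'a::euclidean_space \<Rightarrow> real"
  assumes [measurable]: "F \<in> borel_measurable (borel \<Otimes>\<^sub>M borel)"
    and bound: "\<And>r. (\<integral>\<^sup>+y. ennreal \<bar>F (r, y)\<bar> \<partial>lborel) \<le> C * indicator {p..q} r"
    and "C < \<infinity>"
  shows "integrable (lborel \<Otimes>\<^sub>M lborel) F"
proof (rule integrableI_bounded)
  have "(\<integral>\<^sup>+z. ennreal (norm (F z)) \<partial>(lborel \<Otimes>\<^sub>M lborel)) = (\<integral>\<^sup>+r. \<integral>\<^sup>+y. ennreal \<bar>F (r, y)\<bar> \<partial>lborel \<partial>lborel)"
    by (subst lborel.nn_integral_fst[symmetric]) auto
  also have "\<dots> \<le> (\<integral>\<^sup>+r. C * indicator {p..q} r \<partial>lborel)"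
    by (intro nn_integral_mono bound)
  also have "\<dots> < \<infinity>"
    using \<open>C < \<infinity>\<close> by (simp add: nn_integral_cmult_indicator ennreal_mult_less_top emeasure_lborel_Icc_eq)
  finally show "(\<integral>\<^sup>+z. ennreal (norm (F z)) \<partial>(lborel \<Otimes>\<^sub>M lborel)) < \<infinity>" .
qed simp

lemma locally_integrable_on_mult_continuous:
  fixes f c :: "'a::euclidean_space \<Rightarrow> real"
  assumes "locally_integrable_on \<Omega> f" "continuous_on UNIV c"
  shows "locally_integrable_on \<Omega> (\<lambda>x. c x * f x)"
  unfolding locally_integrable_on_def
proof safe
  fix K assume K: "compact K" "K \<subseteq> \<Omega>"
  then have int: "integrable lborel (\<lambda>x. indicator K x * f x)"
    using assms(1) by (auto simp: locally_integrable_on_def set_integrable_def)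
  have [measurable]: "c \<in> borel_measurable borel"
    using assms(2) by (rule borel_measurable_continuous_onI)
  have "bounded (c ` K)"
    using K assms(2) by (intro compact_imp_bounded compact_continuous_image) (auto intro: continuous_on_subset)
  then obtain B where B: "\<And>x. x \<in> K \<Longrightarrow> \<bar>c x\<bar> \<le> B"
    unfolding bounded_iff by auto
  have "integrable lborel (\<lambda>x. c x * (indicator K x * f x))"
  proof (rule Bochner_Integration.integrable_bound)
    show "integrable lborel (\<lambda>x. B * (indicator K x * f x))"
      using int by simp
    show "(\<lambda>x. c x * (indicator K x * f x)) \<in> borel_measurable lborel"
      using int by auto
    show "AE x in lborel. norm (c x * (indicator K x * f x)) \<le> norm (B * (indicator K x * f x))"
      using B by (intro AE_I2) (fastforce simp: indicator_def abs_mult intro!: mult_right_mono)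
  qed
  then show "set_integrable lborel K (\<lambda>x. c x * f x)"
    by (simp add: set_integrable_def ac_simps)
qed

lemma locally_integrable_on_sum:
  assumes "\<And>i. i \<in> A \<Longrightarrow> locally_integrable_on \<Omega> (f i)"
  shows "locally_integrable_on \<Omega> (\<lambda>x. \<Sum>i\<in>A. f i x)"
  using assms unfolding locally_integrable_on_def set_integrable_def
  by (auto simp: sum_distrib_left)

lemma integrable_mult_compact_support:
  fixes f c :: "'a::euclidean_space \<Rightarrow> real"
  assumes "locally_integrable_on \<Omega> f" "continuous_on UNIV c"
    and "compact K" "K \<subseteq> \<Omega>" "\<And>x. x \<notin> K \<Longrightarrow> c x = 0"
  shows "integrable lborel (\<lambda>x. f x * c x)"
proof -
  have "integrable lborel (\<lambda>x. indicator K x *\<^sub>R (c x * f x))"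
    using locally_integrable_on_mult_continuous[OF assms(1,2)] assms(3,4)
    by (auto simp: locally_integrable_on_def set_integrable_def)
  also have "(\<lambda>x. indicator K x *\<^sub>R (c x * f x)) = (\<lambda>x. f x * c x)"
    using assms(5) by (intro ext) (auto simp: indicator_def)
  finally show ?thesis .
qed

lemma test_functionI:
  assumes "\<And>k. C_k k \<phi>" "compact K" "K \<subseteq> \<Omega>" "\<And>x. x \<notin> K \<Longrightarrow> \<phi> x = 0"
  shows "test_function \<Omega> \<phi>"
proof -
  have "closure {x. \<phi> x \<noteq> 0} \<subseteq> K"
    using assms by (intro closure_minimal compact_imp_closed) auto
  moreover from this have "compact (closure {x. \<phi> x \<noteq> 0})"
    using bounded_subset[OF compact_imp_bounded[OF assms(2)]] by (auto simp: compact_eq_bounded_closed)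
  ultimately show ?thesis using assms by (auto simp: test_function_def)
qed

definition support :: "('a::topological_space \<Rightarrow> real) \<Rightarrow> 'a set" where
  "support \<phi> = closure {x. \<phi> x \<noteq> 0}"

lemma
  assumes "test_function \<Omega> \<phi>"
  shows test_function_smooth: "C_k k \<phi>"
    and compact_support: "compact (support \<phi>)"
    and support_subset: "support \<phi> \<subseteq> \<Omega>"
    and test_function_differentiable: "\<phi> differentiable (at x)"
    and continuous_on_test_function: "continuous_on UNIV \<phi>"
    and continuous_on_test_function_derivative:
      "b \<in> Basis \<Longrightarrow> continuous_on UNIV (\<lambda>x. frechet_derivative \<phi> (at x) b)"
proof -
  have C: "C_k k \<phi>" for k
    using assms by (simp add: test_function_def)
  show "C_k k \<phi>" "compact (support \<phi>)" "support \<phi> \<subseteq> \<Omega>"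
    using assms by (auto simp: test_function_def support_def)
  show "\<phi> differentiable (at x)" "continuous_on UNIV \<phi>"
    "b \<in> Basis \<Longrightarrow> continuous_on UNIV (\<lambda>x. frechet_derivative \<phi> (at x) b)"
    using C[of 0] C[of "Suc 0"] by simp_all
qed

lemma not_in_support: "x \<notin> support \<phi> \<Longrightarrow> \<phi> x = 0"
  unfolding support_def using closure_subset[of "{x. \<phi> x \<noteq> 0}"] by auto

lemma derivative_not_in_support:
  assumes "x \<notin> support \<phi>"
  shows "frechet_derivative \<phi> (at x) b = 0"
proof -
  have "open (- support \<phi>)"
    by (simp add: support_def open_Compl)
  then have "(\<phi> has_derivative (\<lambda>_. 0)) (at x)"
    using assms not_in_support[of _ \<phi>]
    by (intro has_derivative_transform_within_open[OF has_derivative_const[where c = 0]]) auto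
  from frechet_derivative_at[OF this] show ?thesis by metis
qed

text \<open>
  Only the coordinates in \<open>I\<close> are dilated. With \<open>I = {i}\<close> a point moves parallel to an axis, with
  \<open>I = UNIV\<close> it moves on its ray, and one theorem on increments serves both.
\<close>

definition scale :: "'n set \<Rightarrow> real \<Rightarrow> real ^ 'n \<Rightarrow> real ^ 'n" where
  "scale I r x = (\<chi> i. if i \<in> I then r * x $ i else x $ i)"

lemma scale_nth [simp]: "scale I r x $ i = (if i \<in> I then r * x $ i else x $ i)"
  by (simp add: scale_def)

lemma scale_scale: "scale I r (scale I s x) = scale I (r * s) x"
  by (simp add: vec_eq_iff)

lemma scale_1 [simp]: "scale I 1 x = x"
  by (simp add: vec_eq_iff)

lemma scale_inverse [simp]: "r \<noteq> 0 \<Longrightarrow> scale I r (scale I (1 / r) x) = x" "r \<noteq> 0 \<Longrightarrow> scale I (1 / r) (scale I r x) = x"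
  by (simp_all add: scale_scale)

lemma scale_UNIV: "scale UNIV r x = r *\<^sub>R x"
  by (simp add: vec_eq_iff)

lemma scale_in_orthant_iff: "r > 0 \<Longrightarrow> scale I r x \<in> orthant \<longleftrightarrow> x \<in> orthant"
  by (simp add: orthant_def zero_less_mult_iff)

lemma bounded_linear_scale: "bounded_linear (scale I r :: real ^ 'n \<Rightarrow> _)"
  by (intro linear_conv_bounded_linear[THEN iffD1] linearI)
     (auto simp: vec_eq_iff algebra_simps)

lemma continuous_scale_pair: "continuous_on S (\<lambda>z :: real \<times> (real ^ 'n). scale I (fst z) (snd z))"
  unfolding scale_def
proof (rule continuous_on_vec_lambda)
  show "continuous_on S (\<lambda>z :: real \<times> (real ^ 'n). if i \<in> I then fst z * snd z $ i else snd z $ i)" for i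
    by (cases "i \<in> I") (auto intro!: continuous_intros)
qed

lemma measurable_scale [measurable]:
  assumes "f \<in> borel_measurable M" "g \<in> borel_measurable M"
  shows "(\<lambda>x. scale I (f x) (g x)) \<in> borel_measurable M"
proof -
  have "(\<lambda>z. scale I (fst z) (snd z)) \<in> borel_measurable borel"
    by (intro borel_measurable_continuous_onI continuous_scale_pair)
  from measurable_compose[OF borel_measurable_Pair[OF assms] this] show ?thesis by simp
qed

lemma lborel_eq_scale:
  assumes "r > 0"
  shows "lborel = density (distr lborel borel (scale I r :: real ^ 'n \<Rightarrow> _)) (\<lambda>_. ennreal (r ^ card I))"
proof -
  define c where "c = (\<lambda>b :: real ^ 'n. if b \<in> (\<lambda>i. axis i 1) ` I then r else 1)"
  have Basis: "(Basis :: (real ^ 'n) set) = range (\<lambda>i. axis i 1)"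
    by (auto simp: Basis_vec_def)
  have inj: "inj (\<lambda>i. axis i (1::real) :: real ^ 'n)"
    by (auto simp: inj_def axis_eq_axis)
  have c_axis: "c (axis i 1) = (if i \<in> I then r else 1)" for i
    by (auto simp: c_def axis_eq_axis)
  have "(\<Sum>j\<in>Basis. (c j * (x \<bullet> j)) *\<^sub>R j) = scale I r x" for x
  proof -
    have "(\<Sum>j\<in>Basis. (c j * (x \<bullet> j)) *\<^sub>R j) = (\<Sum>i\<in>UNIV. ((if i \<in> I then r else 1) * x $ i) *\<^sub>R axis i 1)"
      unfolding Basis by (subst sum.reindex[OF inj]) (simp add: c_axis inner_axis)
    also have "\<dots> = scale I r x"
      by (auto simp: vec_eq_iff axis_def if_distrib cong: if_cong)
    finally show ?thesis .
  qed
  moreover have "(\<Prod>j\<in>Basis. \<bar>c j\<bar>) = r ^ card I"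
  proof -
    have "(\<Prod>j\<in>Basis. \<bar>c j\<bar>) = (\<Prod>i\<in>UNIV. if i \<in> I then r else 1)"
      unfolding Basis using assms by (subst prod.reindex[OF inj]) (auto simp: c_axis intro!: prod.cong)
    also have "\<dots> = r ^ card I"
      by (simp add: prod.If_cases)
    finally show ?thesis .
  qed
  ultimately show ?thesis
    using lborel_affine_euclidean[of c 0] assms by (simp add: c_def)
qed

lemma nn_integral_scale:
  assumes [measurable]: "f \<in> borel_measurable borel" and r: "r > 0"
  shows "(\<integral>\<^sup>+x. f (scale I r x) \<partial>lborel) = ennreal (1 / r ^ card I) * (\<integral>\<^sup>+x. f x \<partial>lborel)"
proof -
  have "(\<integral>\<^sup>+x. f x \<partial>lborel) = ennreal (r ^ card I) * (\<integral>\<^sup>+x. f (scale I r x) \<partial>lborel)"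
    by (subst lborel_eq_scale[OF r, of I])
       (simp add: nn_integral_density nn_integral_distr nn_integral_cmult)
  then show ?thesis
    using r by (simp add: mult.assoc[symmetric] ennreal_mult[symmetric] flip: mult.assoc)
qed

lemma
  fixes f :: "real ^ 'n \<Rightarrow> real"
  assumes r: "r > 0"
  shows integrable_scale_iff: "f \<in> borel_measurable borel \<Longrightarrow>
      integrable lborel (\<lambda>x. f (scale I r x)) \<longleftrightarrow> integrable lborel f"
    and integral_scale: "f \<in> borel_measurable borel \<Longrightarrow>
      (LINT x|lborel. f (scale I r x)) = (LINT x|lborel. f x) / r ^ card I"
proof -
  assume [measurable]: "f \<in> borel_measurable borel"
  have "integrable lborel f \<longleftrightarrow> integrable lborel (\<lambda>x. r ^ card I * f (scale I r x))"
    by (subst lborel_eq_scale[OF r, of I])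
       (simp add: integrable_real_density integrable_distr_eq r less_imp_le)
  then show "integrable lborel (\<lambda>x. f (scale I r x)) \<longleftrightarrow> integrable lborel f"
    using r by simp
  have "(LINT x|lborel. f x) = (LINT x|lborel. r ^ card I * f (scale I r x))"
    by (subst lborel_eq_scale[OF r, of I])
       (simp add: integral_real_density integral_distr r less_imp_le)
  then show "(LINT x|lborel. f (scale I r x)) = (LINT x|lborel. f x) / r ^ card I"
    using r by simp
qed

section \<open>The scaling flow and weak gradients\<close>

lemma open_orthant: "open (orthant :: (real ^ 'n) set)"
proof -
  have "(orthant :: (real ^ 'n) set) = (\<Inter>i\<in>UNIV. {x. 0 < x $ i})"
    by (auto simp: orthant_def)
  also have "open \<dots>"
    by (intro open_INT ballI open_Collect_less continuous_intros) auto
  finally show ?thesis .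
qed

lemma axis_in_Basis: "axis i (1::real) \<in> Basis"
  by (simp add: axis_in_Basis_iff)

lemma weak_partial_axis:
  "weak_gradient \<Omega> f G \<Longrightarrow> weak_partial \<Omega> (axis i 1) f (\<lambda>x. G x $ i)"
  unfolding weak_gradient_def by (drule bspec[OF _ axis_in_Basis[of i]]) (simp add: inner_axis)

lemma frechet_derivative_sum_axis:
  fixes \<phi> :: "real ^ 'n \<Rightarrow> real"
  assumes "\<phi> differentiable (at z)"
  shows "frechet_derivative \<phi> (at z) v = (\<Sum>i\<in>UNIV. v $ i * frechet_derivative \<phi> (at z) (axis i 1))"
proof -
  have lin: "linear (frechet_derivative \<phi> (at z))"
    using assms by (rule linear_frechet_derivative)
  have "frechet_derivative \<phi> (at z) v = frechet_derivative \<phi> (at z) (\<Sum>i\<in>UNIV. (v $ i) *\<^sub>R axis i 1)"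
    using basis_expansion[of v] by (simp add: scalar_mult_eq_scaleR)
  then show ?thesis
    by (simp add: linear_sum[OF lin] linear_scale[OF lin])
qed

text \<open>
  The divergence of \<open>\<phi>\<close> times the vector field whose components are \<open>x\<^sub>i\<close> for \<open>i \<in> I\<close> and \<open>0\<close>
  otherwise, the generator of the flow \<open>r \<mapsto> scale I r\<close>.
\<close>

definition euler :: "'n set \<Rightarrow> (real ^ 'n \<Rightarrow> real) \<Rightarrow> real ^ 'n \<Rightarrow> real" where
  "euler I \<phi> x = real (card I) * \<phi> x + (\<Sum>i\<in>I. x $ i * frechet_derivative \<phi> (at x) (axis i 1))"

lemma continuous_on_euler:
  "test_function \<Omega> \<phi> \<Longrightarrow> continuous_on UNIV (euler I \<phi>)"
  unfolding euler_def[abs_def]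
  by (intro continuous_on_add continuous_on_mult continuous_on_const continuous_on_sum continuous_on_component
      continuous_on_id continuous_on_test_function continuous_on_test_function_derivative axis_in_Basis)

lemma euler_not_in_support: "x \<notin> support \<phi> \<Longrightarrow> euler I \<phi> x = 0"
  by (simp add: euler_def not_in_support derivative_not_in_support)

text \<open>
  Sum of the defining identities of the weak partial derivatives for the test functions \<open>x\<^sub>i \<phi> x\<close>.
\<close>

lemma euler_weak_gradient:
  fixes f :: "real ^ 'n \<Rightarrow> real"
  assumes wg: "weak_gradient orthant f G" and \<phi>: "test_function orthant \<phi>"
    and f0: "\<And>x. x \<notin> orthant \<Longrightarrow> f x = 0" and G0: "\<And>x. x \<notin> orthant \<Longrightarrow> G x = 0"
  shows "(LINT x|lborel. f x * euler I \<phi> x) = - (LINT x|lborel. (\<Sum>i\<in>I. x $ i * G x $ i) * \<phi> x)"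
proof -
  have wp: "weak_partial orthant (axis i 1) f (\<lambda>x. G x $ i)" for i
    using wg by (rule weak_partial_axis)
  have D: "frechet_derivative (\<lambda>x. x $ i * \<phi> x) (at x) (axis i 1)
      = \<phi> x + x $ i * frechet_derivative \<phi> (at x) (axis i 1)" for i x
  proof -
    have "((\<lambda>x. x $ i * \<phi> x) has_derivative (\<lambda>h. x $ i * frechet_derivative \<phi> (at x) h + h $ i * \<phi> x)) (at x)"
      using test_function_differentiable[OF \<phi>]
      by (intro has_derivative_mult bounded_linear_imp_has_derivative bounded_linear_vec_nth)
         (auto simp: frechet_derivative_works)
    from frechet_derivative_at[OF this, symmetric] show ?thesis by simp
  qed
  have test: "test_function orthant (\<lambda>x. x $ i * \<phi> x)" for i
  proof (rule test_functionI[where K = "support \<phi>"])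
    show "C_k k (\<lambda>x. x $ i * \<phi> x)" for k
      by (rule C_k_mult[OF C_k_bounded_linear[OF bounded_linear_vec_nth] test_function_smooth[OF \<phi>]])
  qed (use compact_support[OF \<phi>] support_subset[OF \<phi>] not_in_support in auto)
  have eq: "(LINT x|lborel. f x * (\<phi> x + x $ i * frechet_derivative \<phi> (at x) (axis i 1)))
      = - (LINT x|lborel. G x $ i * (x $ i * \<phi> x))" for i
  proof -
    have "(LINT x:orthant|lborel. f x * (\<phi> x + x $ i * frechet_derivative \<phi> (at x) (axis i 1)))
        = - (LINT x:orthant|lborel. G x $ i * (x $ i * \<phi> x))"
      using wp[of i, unfolded weak_partial_def, THEN conjunct2, THEN conjunct2, rule_format, OF test[of i]]
      by (simp only: D)
    moreover have "indicator orthant x * f x = f x" "indicator orthant x * G x $ i = G x $ i" for x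
      using f0[of x] G0[of x] by (auto simp: indicator_def)
    ultimately show ?thesis
      by (simp add: set_lebesgue_integral_def mult.assoc[symmetric])
  qed
  have loc: "locally_integrable_on orthant f" "locally_integrable_on orthant (\<lambda>x. G x $ i)" for i
    using wp[of i] by (auto simp: weak_partial_def)
  have int1: "integrable lborel (\<lambda>x. f x * (\<phi> x + x $ i * frechet_derivative \<phi> (at x) (axis i 1)))" for i
  proof (rule integrable_mult_compact_support[OF loc(1) _ compact_support[OF \<phi>] support_subset[OF \<phi>]])
    show "continuous_on UNIV (\<lambda>x. \<phi> x + x $ i * frechet_derivative \<phi> (at x) (axis i 1))"
      by (intro continuous_intros continuous_on_test_function[OF \<phi>]
          continuous_on_test_function_derivative[OF \<phi>] axis_in_Basis)
  qed (simp add: not_in_support derivative_not_in_support)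
  have int2: "integrable lborel (\<lambda>x. G x $ i * (x $ i * \<phi> x))" for i
  proof (rule integrable_mult_compact_support[OF loc(2) _ compact_support[OF \<phi>] support_subset[OF \<phi>]])
    show "continuous_on UNIV (\<lambda>x. x $ i * \<phi> x)"
      by (intro continuous_intros continuous_on_test_function[OF \<phi>])
  qed (simp add: not_in_support)
  have "(LINT x|lborel. f x * euler I \<phi> x)
      = (\<Sum>i\<in>I. LINT x|lborel. f x * (\<phi> x + x $ i * frechet_derivative \<phi> (at x) (axis i 1)))"
    by (subst Bochner_Integration.integral_sum[symmetric, OF int1])
       (simp add: euler_def sum_distrib_left sum.distrib distrib_left algebra_simps)
  also have "\<dots> = - (\<Sum>i\<in>I. LINT x|lborel. G x $ i * (x $ i * \<phi> x))"
    by (simp only: eq sum_negf)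
  also have "(\<Sum>i\<in>I. LINT x|lborel. G x $ i * (x $ i * \<phi> x)) = (LINT x|lborel. (\<Sum>i\<in>I. x $ i * G x $ i) * \<phi> x)"
    by (subst Bochner_Integration.integral_sum[symmetric, OF int2])
       (simp add: sum_distrib_left sum_distrib_right algebra_simps)
  finally show ?thesis .
qed

text \<open>
  The factor \<open>1 / r ^ card I\<close> is the Jacobian that appears when a test function is transported by the
  flow; with it the derivative in \<open>r\<close> is again a transported function, namely \<open>euler I \<phi>\<close>.
\<close>

lemma has_derivative_scale_test:
  fixes \<phi> :: "real ^ 'n \<Rightarrow> real"
  assumes \<phi>: "\<And>x. \<phi> differentiable (at x)" and r: "r > 0"
  shows "((\<lambda>r. \<phi> (scale I (1 / r) y) / r ^ card I) has_real_derivative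
    - euler I \<phi> (scale I (1 / r) y) / r ^ Suc (card I)) (at r)"
proof -
  define v where "v = (\<chi> i. if i \<in> I then - (y $ i / r\<^sup>2) else 0)"
  define z where "z = scale I (1 / r) y"
  have "((\<lambda>r. scale I (1 / r) y) has_derivative (\<lambda>h. h *\<^sub>R v)) (at r)"
  proof (subst has_derivative_componentwise_within, intro ballI)
    fix b :: "real ^ 'n" assume "b \<in> Basis"
    then obtain i where b: "b = axis i 1"
      by (auto simp: Basis_vec_def)
    have "((\<lambda>r. if i \<in> I then 1 / r * y $ i else y $ i) has_derivative (\<lambda>h. h * v $ i)) (at r)"
      using r by (cases "i \<in> I") (auto simp: v_def power2_eq_square intro!: derivative_eq_intros)
    then show "((\<lambda>x. scale I (1 / x) y \<bullet> b) has_derivative (\<lambda>x. x *\<^sub>R v \<bullet> b)) (at r)"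
      by (simp add: b inner_axis)
  qed
  from has_derivative_compose[OF this, of \<phi> "frechet_derivative \<phi> (at z)"] \<phi>[of z]
  have "((\<lambda>r. \<phi> (scale I (1 / r) y)) has_derivative (\<lambda>h. frechet_derivative \<phi> (at z) (h *\<^sub>R v))) (at r)"
    by (simp add: frechet_derivative_works z_def)
  moreover have fd: "frechet_derivative \<phi> (at z) (h *\<^sub>R v) = (- (\<Sum>i\<in>I. z $ i * frechet_derivative \<phi> (at z) (axis i 1)) / r) * h" for h
  proof -
    have "frechet_derivative \<phi> (at z) (h *\<^sub>R v) = (\<Sum>i\<in>UNIV. if i \<in> I then - h * z $ i / r * frechet_derivative \<phi> (at z) (axis i 1) else 0)"
      using \<phi> r by (subst frechet_derivative_sum_axis) (auto simp: v_def z_def power2_eq_square intro!: sum.cong)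
    also have "\<dots> = (\<Sum>i\<in>I. - h * z $ i / r * frechet_derivative \<phi> (at z) (axis i 1))"
      by (simp add: sum.If_cases)
    also have "\<dots> = (- (\<Sum>i\<in>I. z $ i * frechet_derivative \<phi> (at z) (axis i 1)) / r) * h"
      by (simp add: sum_distrib_left sum_distrib_right sum_negf sum_divide_distrib algebra_simps)
    finally show ?thesis .
  qed
  ultimately have d: "((\<lambda>r. \<phi> (scale I (1 / r) y)) has_real_derivative
      - (\<Sum>i\<in>I. z $ i * frechet_derivative \<phi> (at z) (axis i 1)) / r) (at r)"
    by (simp only: has_field_derivative_def)
  have p: "((\<lambda>r. r ^ card I) has_real_derivative real (card I) * r ^ card I / r) (at r)"
    by (rule DERIV_cong[OF DERIV_pow]) (use r in \<open>cases "card I", auto\<close>)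
  show ?thesis
    by (rule DERIV_cong[OF DERIV_divide[OF d p]])
       (use r in \<open>auto simp: euler_def z_def[symmetric] field_simps\<close>)
qed

lemma euler_scale:
  fixes \<phi> :: "real ^ 'n \<Rightarrow> real"
  assumes \<phi>: "\<And>x. \<phi> differentiable (at x)" and r: "r > 0"
  shows "euler I (\<lambda>y. \<phi> (scale I (1 / r) y)) y = euler I \<phi> (scale I (1 / r) y)"
proof -
  have "frechet_derivative (\<lambda>y. \<phi> (scale I (1 / r) y)) (at y) (axis i 1)
      = (1 / r) * frechet_derivative \<phi> (at (scale I (1 / r) y)) (axis i 1)" if "i \<in> I" for i
  proof -
    have "((\<lambda>y. \<phi> (scale I (1 / r) y)) has_derivative
        (\<lambda>h. frechet_derivative \<phi> (at (scale I (1 / r) y)) (scale I (1 / r) h))) (at y)"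
      using has_derivative_compose[OF bounded_linear_imp_has_derivative[OF bounded_linear_scale[of I "1 / r"]],
          of \<phi> "frechet_derivative \<phi> (at (scale I (1 / r) y))" y UNIV] \<phi>[of "scale I (1 / r) y"]
      by (simp add: frechet_derivative_works)
    from frechet_derivative_at[OF this, symmetric]
    have "frechet_derivative (\<lambda>y. \<phi> (scale I (1 / r) y)) (at y) (axis i 1)
       = frechet_derivative \<phi> (at (scale I (1 / r) y)) (scale I (1 / r) (axis i 1))" by simp
    also have "scale I (1 / r) (axis i 1) = (1 / r) *\<^sub>R axis i 1"
      using that by (auto simp: vec_eq_iff axis_def)
    finally show ?thesis
      using linear_scale[OF linear_frechet_derivative[OF \<phi>]] by simp
  qed
  then show ?thesis by (simp add: euler_def)
qed

lemma test_function_scale: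
  fixes \<phi> :: "real ^ 'n \<Rightarrow> real"
  assumes \<phi>: "test_function orthant \<phi>" and r: "r > 0"
  shows "test_function orthant (\<lambda>y. \<phi> (scale I (1 / r) y))"
proof (rule test_functionI[where K = "scale I r ` support \<phi>"])
  show "C_k k (\<lambda>y. \<phi> (scale I (1 / r) y))" for k
    by (rule C_k_compose_linear[OF bounded_linear_scale test_function_smooth[OF \<phi>]])
  show "compact (scale I r ` support \<phi>)"
    by (rule compact_continuous_image[OF linear_continuous_on[OF bounded_linear_scale] compact_support[OF \<phi>]])
  show "scale I r ` support \<phi> \<subseteq> orthant"
    using support_subset[OF \<phi>] r by (auto simp: scale_in_orthant_iff)
  show "\<phi> (scale I (1 / r) x) = 0" if "x \<notin> scale I r ` support \<phi>" for x
  proof (rule not_in_support[of _ \<phi>], rule notI)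
    assume "scale I (1 / r) x \<in> support \<phi>"
    then have "scale I r (scale I (1 / r) x) \<in> scale I r ` support \<phi>" by blast
    with that r show False by simp
  qed
qed

lemma compact_scale_image:
  fixes K :: "(real ^ 'n) set"
  assumes K: "compact K" "K \<subseteq> orthant" and p: "0 < p"
  obtains L where "compact L" "L \<subseteq> orthant" "\<And>r x. p \<le> r \<Longrightarrow> r \<le> q \<Longrightarrow> x \<in> K \<Longrightarrow> scale I r x \<in> L"
proof -
  let ?L = "(\<lambda>z. scale I (fst z) (snd z)) ` ({p..q} \<times> K)"
  have "compact ?L"
    by (rule compact_continuous_image[OF continuous_scale_pair compact_Times[OF compact_Icc K(1)]])
  moreover have "?L \<subseteq> orthant"
  proof (rule image_subsetI)
    fix z assume "z \<in> {p..q} \<times> K"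
    then have "0 < fst z" "snd z \<in> orthant"
      using K p by auto
    then show "scale I (fst z) (snd z) \<in> orthant"
      by (simp only: scale_in_orthant_iff)
  qed
  moreover have "scale I r x \<in> ?L" if "p \<le> r" "r \<le> q" "x \<in> K" for r x
    using that by (intro image_eqI[of _ _ "(r, x)"]) auto
  ultimately show thesis
    by (rule that)
qed

lemma borel_measurable_vec_nth [measurable]:
  fixes f :: "'a \<Rightarrow> real ^ 'n"
  assumes "f \<in> borel_measurable M"
  shows "(\<lambda>x. f x $ i) \<in> borel_measurable M"
  using assms
  by (rule measurable_compose) (auto intro!: borel_measurable_continuous_onI continuous_intros)

lemma integrable_mult_test_function:
  assumes "locally_integrable_on \<Omega> f" "test_function \<Omega> \<phi>"
  shows "integrable lborel (\<lambda>x. f x * \<phi> x)"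
  by (rule integrable_mult_compact_support[OF assms(1) continuous_on_test_function[OF assms(2)]
        compact_support[OF assms(2)] support_subset[OF assms(2)]]) (rule not_in_support)

lemma integrable_scale_strip:
  fixes g c :: "real ^ 'n \<Rightarrow> real"
  assumes g: "locally_integrable_on orthant g" and [measurable]: "g \<in> borel_measurable borel" "c \<in> borel_measurable borel"
    and K: "compact K" "K \<subseteq> orthant" "\<And>x. x \<notin> K \<Longrightarrow> c x = 0" and B: "\<And>x. \<bar>c x\<bar> \<le> B"
    and p: "0 < p"
  shows "integrable (lborel \<Otimes>\<^sub>M lborel) (\<lambda>(r, x). indicator {p..q} r * (c x * (g (scale I r x) / r)))"
proof -
  obtain L where L: "compact L" "L \<subseteq> orthant" "\<And>r x. p \<le> r \<Longrightarrow> r \<le> q \<Longrightarrow> x \<in> K \<Longrightarrow> scale I r x \<in> L"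
    using compact_scale_image[OF K(1,2) p] by blast
  define h where "h = (\<lambda>x. indicator L x * g x)"
  have hi: "integrable lborel h"
    using g L(1,2) unfolding h_def by (auto simp: locally_integrable_on_def set_integrable_def)
  then have [measurable]: "h \<in> borel_measurable borel"
    by auto
  define C where "C = (\<integral>\<^sup>+x. ennreal \<bar>h x\<bar> \<partial>lborel)"
  have C: "C < \<infinity>"
    using hi unfolding C_def integrable_iff_bounded by simp
  have B0: "0 \<le> B"
    using B[of 0] by simp
  show ?thesis
  proof (rule integrable_strip[where C = "ennreal (B / p * (1 / p ^ card I)) * C"])
    show "(\<lambda>(r, x). indicator {p..q} r * (c x * (g (scale I r x) / r))) \<in> borel_measurable (borel \<Otimes>\<^sub>M borel)"
      by measurable
    show "ennreal (B / p * (1 / p ^ card I)) * C < \<infinity>"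
      using C by (simp add: ennreal_mult_less_top)
    fix r
    show "(\<integral>\<^sup>+x. ennreal \<bar>case (r, x) of (r, x) \<Rightarrow> indicator {p..q} r * (c x * (g (scale I r x) / r))\<bar> \<partial>lborel)
        \<le> ennreal (B / p * (1 / p ^ card I)) * C * indicator {p..q} r"
    proof (cases "r \<in> {p..q}")
      case True
      then have r: "0 < r" "p \<le> r" "r \<le> q" using p by auto
      have "ennreal \<bar>c x * (g (scale I r x) / r)\<bar> \<le> ennreal (B / p) * ennreal \<bar>h (scale I r x)\<bar>" for x
      proof (cases "x \<in> K")
        case True
        then have h: "h (scale I r x) = g (scale I r x)"
          using L(3)[OF r(2,3)] by (simp add: h_def)
        have "\<bar>c x\<bar> * (\<bar>g (scale I r x)\<bar> / r) \<le> B * (\<bar>g (scale I r x)\<bar> / p)"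
          using B B0 r p by (intro mult_mono divide_left_mono) auto
        then show ?thesis
          using B0 p r by (simp add: h abs_mult ennreal_mult[symmetric])
      qed (simp add: K)
      then have "(\<integral>\<^sup>+x. ennreal \<bar>c x * (g (scale I r x) / r)\<bar> \<partial>lborel)
          \<le> (\<integral>\<^sup>+x. ennreal (B / p) * ennreal \<bar>h (scale I r x)\<bar> \<partial>lborel)"
        by (rule nn_integral_mono)
      also have "\<dots> = ennreal (B / p) * (ennreal (1 / r ^ card I) * C)"
        unfolding C_def
        by (subst nn_integral_scale[OF _ r(1), symmetric]) (auto simp: nn_integral_cmult)
      also have "\<dots> \<le> ennreal (B / p) * (ennreal (1 / p ^ card I) * C)"
        using r p B0 by (intro mult_mono ennreal_leI divide_left_mono power_mono) auto
      also have "\<dots> = ennreal (B / p * (1 / p ^ card I)) * C"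
        using B0 p by (subst ennreal_mult) (auto simp: mult.assoc)
      finally show ?thesis using True by simp
    qed simp
  qed
qed

text \<open>
  Absolute continuity along the flow, from weak differentiability alone. Integrated against a test
  function \<open>\<phi>\<close>, the increment of \<open>f\<close> is moved onto \<open>\<phi>\<close> by a change of variables, written as an integral
  over \<open>r\<close> of \<open>euler I \<phi>\<close>, and moved back by the weak identity. Hence both sides of the claim have the
  same integral against every \<open>\<phi>\<close>.
\<close>

lemma weak_gradient_scale_increment:
  fixes f :: "real ^ 'n \<Rightarrow> real" and G :: "real ^ 'n \<Rightarrow> real ^ 'n" and I :: "'n set"
  assumes wg: "weak_gradient orthant f G"
    and [measurable]: "f \<in> borel_measurable borel" "G \<in> borel_measurable borel"
    and f0: "\<And>x. x \<notin> orthant \<Longrightarrow> f x = 0" and G0: "\<And>x. x \<notin> orthant \<Longrightarrow> G x = 0"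
    and pq: "0 < p" "p \<le> q"
  defines "g \<equiv> \<lambda>x. \<Sum>i\<in>I. x $ i * G x $ i"
  shows "AE x in lborel. x \<in> orthant \<longrightarrow> set_integrable lborel {p..q} (\<lambda>r. g (scale I r x) / r) \<and>
    f (scale I q x) - f (scale I p x) = (LINT r:{p..q}|lborel. g (scale I r x) / r)"
proof -
  define m where "m = card I"
  have q: "0 < q" using pq by simp
  have f_loc: "locally_integrable_on orthant f"
    using weak_partial_axis[OF wg] by (auto simp: weak_partial_def)
  have G_loc: "locally_integrable_on orthant (\<lambda>x. G x $ i)" for i
    using weak_partial_axis[OF wg, of i] by (auto simp: weak_partial_def)
  have g_loc: "locally_integrable_on orthant g"
    unfolding g_def
    by (intro locally_integrable_on_sum locally_integrable_on_mult_continuous G_loc continuous_on_component continuous_on_id)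
  have [measurable]: "g \<in> borel_measurable borel"
    unfolding g_def by measurable
  have f_scale_loc: "locally_integrable_on orthant (\<lambda>x. f (scale I r x))" if r: "0 < r" for r
    unfolding locally_integrable_on_def
  proof safe
    fix K :: "(real ^ 'n) set" assume K: "compact K" "K \<subseteq> orthant"
    define L where "L = scale I r ` K"
    have L: "compact L" "L \<subseteq> orthant"
      unfolding L_def using K r scale_in_orthant_iff[OF r]
      by (auto intro!: compact_continuous_image linear_continuous_on bounded_linear_scale)
    have [measurable]: "L \<in> sets borel"
      using L(1) by (simp add: borel_compact)
    have "integrable lborel (\<lambda>x. indicator L x * f x)"
      using f_loc L by (auto simp: locally_integrable_on_def set_integrable_def)
    then have "integrable lborel (\<lambda>x. indicator L (scale I r x) * f (scale I r x))"
      by (subst integrable_scale_iff[OF r]) auto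
    moreover have "scale I r x \<in> L \<longleftrightarrow> x \<in> K" for x
    proof
      assume "scale I r x \<in> L"
      then obtain z where "z \<in> K" "scale I r x = scale I r z" by (auto simp: L_def)
      then have "scale I (1 / r) (scale I r x) = scale I (1 / r) (scale I r z)" by simp
      then show "x \<in> K" using r \<open>z \<in> K\<close> by simp
    qed (simp add: L_def)
    ultimately show "set_integrable lborel K (\<lambda>x. f (scale I r x))"
      by (simp add: set_integrable_def indicator_def)
  qed
  define J where "J = (\<lambda>x. LINT r|lborel. indicator {p..q} r * (g (scale I r x) / r))"
  have [measurable]: "J \<in> borel_measurable borel"
    unfolding J_def by measurable
  have strip: "integrable (lborel \<Otimes>\<^sub>M lborel) (\<lambda>(r, x). indicator {p..q} r * (c x * (g (scale I r x) / r)))"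
    if [measurable]: "c \<in> borel_measurable borel" and "compact K" "K \<subseteq> orthant" "\<And>x. x \<notin> K \<Longrightarrow> c x = 0"
      "\<And>x. \<bar>c x\<bar> \<le> B" for c K B
    using that pq(1) by (intro integrable_scale_strip[OF g_loc]) auto
  have J_c: "(\<lambda>x. LINT r|lborel. indicator {p..q} r * (c x * (g (scale I r x) / r))) = (\<lambda>x. J x * c x)" for c
    unfolding J_def by (subst integral_mult_left_zero[symmetric]) (simp only: mult_ac)
  have J_loc: "locally_integrable_on orthant J"
    unfolding locally_integrable_on_def
  proof safe
    fix K :: "(real ^ 'n) set" assume K: "compact K" "K \<subseteq> orthant"
    have [measurable]: "K \<in> sets borel"
      using K(1) by (simp add: borel_compact)
    have "integrable lborel (\<lambda>x. LINT r|lborel. indicator {p..q} r * (indicator K x * (g (scale I r x) / r)))"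
      using K by (intro lborel_pair.integrable_snd strip[of "indicator K" K 1]) (auto simp: indicator_def)
    then show "set_integrable lborel K J"
      by (subst (asm) J_c) (simp add: set_integrable_def mult.commute)
  qed
  have ae_int: "AE x in lborel. x \<in> orthant \<longrightarrow> set_integrable lborel {p..q} (\<lambda>r. g (scale I r x) / r)"
  proof (rule AE_eq_0_on_open_if_cboxes[OF open_orthant])
    fix a b :: "real ^ 'n" assume ab: "cbox a b \<subseteq> orthant"
    have "AE x in lborel. integrable lborel (\<lambda>r. indicator {p..q} r * (indicator (cbox a b) x * (g (scale I r x) / r)))"
      using ab by (intro lborel_pair.AE_integrable_snd strip[of "indicator (cbox a b)" "cbox a b" 1]) (auto simp: indicator_def)
    then show "AE x in lborel. x \<in> cbox a b \<longrightarrow> set_integrable lborel {p..q} (\<lambda>r. g (scale I r x) / r)"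
      by eventually_elim (auto simp: set_integrable_def)
  qed
  define Q where "Q = (\<lambda>x. f (scale I q x) - f (scale I p x) - J x)"
  have "AE x in lborel. x \<in> orthant \<longrightarrow> Q x = 0"
  proof (rule fundamental_lemma[OF open_orthant])
    show "locally_integrable_on orthant Q"
      unfolding Q_def using f_scale_loc[OF pq(1)] f_scale_loc[OF q] J_loc
      by (auto simp: locally_integrable_on_def set_integral_diff)
    fix \<phi> :: "real ^ 'n \<Rightarrow> real" assume \<phi>: "test_function orthant \<phi>"
    note diff = test_function_differentiable[OF \<phi>]
    have cont: "continuous_on UNIV \<phi>" using \<phi> by (rule continuous_on_test_function)
    have cont_e: "continuous_on UNIV (euler I \<phi>)" using \<phi> by (rule continuous_on_euler)
    have [measurable]: "\<phi> \<in> borel_measurable borel" "euler I \<phi> \<in> borel_measurable borel"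
      using cont cont_e by (auto intro: borel_measurable_continuous_onI)
    note supp = compact_support[OF \<phi>] support_subset[OF \<phi>]
    have bdd: "\<exists>B. \<forall>x. \<bar>\<psi> x\<bar> \<le> B" if "continuous_on UNIV \<psi>" "\<And>x. x \<notin> support \<phi> \<Longrightarrow> \<psi> x = 0" for \<psi> :: "real ^ 'n \<Rightarrow> real"
    proof -
      have "bounded (\<psi> ` support \<phi>)"
        using supp(1) that(1) by (intro compact_imp_bounded compact_continuous_image) (auto intro: continuous_on_subset)
      then obtain B where "\<And>x. x \<in> support \<phi> \<Longrightarrow> \<bar>\<psi> x\<bar> \<le> B"
        unfolding bounded_iff by auto
      then have "\<bar>\<psi> x\<bar> \<le> max B 0" for x
        using that(2)[of x] by (cases "x \<in> support \<phi>") (auto simp: le_max_iff_disj)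
      then show ?thesis by blast
    qed
    obtain B where B: "\<And>x. \<bar>\<phi> x\<bar> \<le> B"
      using bdd[OF cont] not_in_support[of _ \<phi>] by blast
    obtain B' where B': "\<And>x. \<bar>euler I \<phi> x\<bar> \<le> B'"
      using bdd[OF cont_e] euler_not_in_support[of _ \<phi> I] by blast
    have B'0: "0 \<le> B'" using B'[of 0] by simp
    obtain L where L: "compact L" "L \<subseteq> orthant" "\<And>r x. p \<le> r \<Longrightarrow> r \<le> q \<Longrightarrow> x \<in> support \<phi> \<Longrightarrow> scale I r x \<in> L"
      using compact_scale_image[OF supp pq(1)] by blast
    have L_int: "integrable lborel (\<lambda>y. indicator L y * f y)"
      using f_loc L by (auto simp: locally_integrable_on_def set_integrable_def)
    \<comment> \<open>The same double integral before (\<open>F1\<close>) and after (\<open>F2\<close>) the weak identity is applied.\<close>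
    define F1 where "F1 = (\<lambda>r y. indicator {p..q} r * (f y * (euler I \<phi> (scale I (1 / r) y) / r ^ Suc m)))"
    have F1: "integrable (lborel \<Otimes>\<^sub>M lborel) (\<lambda>(r, y). F1 r y)"
    proof (rule integrable_strip)
      show "(\<lambda>(r, y). F1 r y) \<in> borel_measurable (borel \<Otimes>\<^sub>M borel)"
        unfolding F1_def by measurable
      show "ennreal (B' / p ^ Suc m) * (\<integral>\<^sup>+y. ennreal \<bar>indicator L y * f y\<bar> \<partial>lborel) < \<infinity>"
        using L_int unfolding integrable_iff_bounded by (simp add: ennreal_mult_less_top)
      fix r
      show "(\<integral>\<^sup>+y. ennreal \<bar>case (r, y) of (r, y) \<Rightarrow> F1 r y\<bar> \<partial>lborel)
          \<le> ennreal (B' / p ^ Suc m) * (\<integral>\<^sup>+y. ennreal \<bar>indicator L y * f y\<bar> \<partial>lborel) * indicator {p..q} r"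
      proof (cases "r \<in> {p..q}")
        case True
        then have r: "0 < r" "p \<le> r" "r \<le> q" using pq by auto
        have "ennreal \<bar>F1 r y\<bar> \<le> ennreal (B' / p ^ Suc m) * ennreal \<bar>indicator L y * f y\<bar>" for y
        proof (cases "scale I (1 / r) y \<in> support \<phi>")
          case True
          then have "y \<in> L"
            using L(3)[OF r(2,3) True] r by simp
          have "\<bar>euler I \<phi> (scale I (1 / r) y)\<bar> / r ^ Suc m \<le> B' / p ^ Suc m"
            using B' B'0 r pq by (intro frac_le power_mono) auto
          then have "\<bar>f y\<bar> * (\<bar>euler I \<phi> (scale I (1 / r) y)\<bar> / r ^ Suc m) \<le> \<bar>f y\<bar> * (B' / p ^ Suc m)"
            by (intro mult_left_mono) auto
          then show ?thesis
            using \<open>y \<in> L\<close> B'0 pq r \<open>r \<in> {p..q}\<close>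
            by (simp add: F1_def abs_mult ennreal_mult[symmetric] mult.commute)
        qed (simp add: F1_def euler_not_in_support)
        then have "(\<integral>\<^sup>+y. ennreal \<bar>F1 r y\<bar> \<partial>lborel) \<le> (\<integral>\<^sup>+y. ennreal (B' / p ^ Suc m) * ennreal \<bar>indicator L y * f y\<bar> \<partial>lborel)"
          by (rule nn_integral_mono)
        also have "\<dots> = ennreal (B' / p ^ Suc m) * (\<integral>\<^sup>+y. ennreal \<bar>indicator L y * f y\<bar> \<partial>lborel)"
          using L_int by (intro nn_integral_cmult) auto
        finally show ?thesis using True by simp
      qed (simp add: F1_def)
    qed
    define F2 where "F2 = (\<lambda>r x. indicator {p..q} r * (\<phi> x * (g (scale I r x) / r)))"
    have F2: "integrable (lborel \<Otimes>\<^sub>M lborel) (\<lambda>(r, x). F2 r x)"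
      unfolding F2_def using supp B not_in_support by (intro strip) auto
    have J_int: "integrable lborel (\<lambda>x. J x * \<phi> x)"
      using lborel_pair.integrable_snd[OF F2] unfolding F2_def by (subst (asm) J_c)
    have transport: "(LINT x|lborel. f (scale I r x) * \<phi> x) = (LINT y|lborel. f y * (\<phi> (scale I (1 / r) y) / r ^ m))"
      and transport_int: "integrable lborel (\<lambda>y. f y * (\<phi> (scale I (1 / r) y) / r ^ m))"
      if r: "0 < r" for r
    proof -
      have "(LINT x|lborel. f (scale I r x) * \<phi> (scale I (1 / r) (scale I r x)))
          = (LINT y|lborel. f y * \<phi> (scale I (1 / r) y)) / r ^ m"
        unfolding m_def by (rule integral_scale[OF r]) simp
      then show "(LINT x|lborel. f (scale I r x) * \<phi> x) = (LINT y|lborel. f y * (\<phi> (scale I (1 / r) y) / r ^ m))"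
        using r by simp
      have \<phi>r: "test_function orthant (\<lambda>y. \<phi> (scale I (1 / r) y))"
        by (rule test_function_scale[OF \<phi> r])
      show "integrable lborel (\<lambda>y. f y * (\<phi> (scale I (1 / r) y) / r ^ m))"
        using integrable_mult_test_function[OF f_loc \<phi>r] by simp
    qed
    have FTC: "\<phi> (scale I (1 / q) y) / q ^ m - \<phi> (scale I (1 / p) y) / p ^ m
        = - (LINT r|lborel. indicator {p..q} r * (euler I \<phi> (scale I (1 / r) y) / r ^ Suc m))" for y
    proof -
      have "(LINT r|lborel. indicator {p..q} r *\<^sub>R (- euler I \<phi> (scale I (1 / r) y) / r ^ Suc m))
          = \<phi> (scale I (1 / q) y) / q ^ m - \<phi> (scale I (1 / p) y) / p ^ m"
      proof (rule integral_FTC_Icc[OF pq(2)])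
        fix r assume "p \<le> r" "r \<le> q"
        then have r: "0 < r" using pq by simp
        show "((\<lambda>r. \<phi> (scale I (1 / r) y) / r ^ m) has_vector_derivative - euler I \<phi> (scale I (1 / r) y) / r ^ Suc m) (at r within {p..q})"
          using has_derivative_scale_test[OF diff r, of I y]
          by (auto simp: m_def has_real_derivative_iff_has_vector_derivative intro: has_vector_derivative_at_within)
      next
        have "continuous_on {p..q} (\<lambda>r. scale I (fst (1 / r, y)) (snd (1 / r, y)))"
          using pq by (intro continuous_on_compose2[OF continuous_scale_pair[of UNIV]] continuous_intros) auto
        then have "continuous_on {p..q} (\<lambda>r. euler I \<phi> (scale I (1 / r) y))"
          by (intro continuous_on_compose2[OF cont_e]) auto
        then show "continuous_on {p..q} (\<lambda>r. - euler I \<phi> (scale I (1 / r) y) / r ^ Suc m)"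
          using pq by (intro continuous_intros) auto
      qed
      then show ?thesis by simp
    qed
    \<comment> \<open>For each fixed dilation factor the weak identity is used with the transported test function.\<close>
    have slice: "(LINT y|lborel. F1 r y) = - (LINT x|lborel. F2 r x)" for r
    proof (cases "r \<in> {p..q}")
      case True
      then have r: "0 < r" using pq by simp
      have "(LINT y|lborel. f y * euler I \<phi> (scale I (1 / r) y)) = - (LINT y|lborel. g y * \<phi> (scale I (1 / r) y))"
        using euler_weak_gradient[OF wg test_function_scale[OF \<phi> r] f0 G0, of I I] unfolding g_def
        by (simp add: euler_scale[OF diff r])
      also have "(LINT y|lborel. g y * \<phi> (scale I (1 / r) y)) = r ^ m * (LINT x|lborel. g (scale I r x) * \<phi> x)"
      proof -
        have "(LINT x|lborel. g (scale I r x) * \<phi> (scale I (1 / r) (scale I r x)))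
          = (LINT y|lborel. g y * \<phi> (scale I (1 / r) y)) / r ^ m"
          unfolding m_def by (rule integral_scale[OF r]) simp
        then show ?thesis using r by (simp add: field_simps)
      qed
      finally have *: "(LINT y|lborel. f y * euler I \<phi> (scale I (1 / r) y)) = - (r ^ m * (LINT x|lborel. g (scale I r x) * \<phi> x))" .
      have "(LINT y|lborel. F1 r y) = (LINT y|lborel. f y * euler I \<phi> (scale I (1 / r) y)) / r ^ Suc m"
        using True by (simp add: F1_def)
      also have "\<dots> = - ((LINT x|lborel. g (scale I r x) * \<phi> x) / r)"
        using r by (simp add: *)
      also have "\<dots> = - (LINT x|lborel. F2 r x)"
        using True by (simp add: F2_def mult.commute)
      finally show ?thesis .
    qed (simp add: F1_def F2_def)
    have "(LINT x|lborel. f (scale I q x) * \<phi> x) - (LINT x|lborel. f (scale I p x) * \<phi> x)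
        = (LINT y|lborel. f y * (\<phi> (scale I (1 / q) y) / q ^ m - \<phi> (scale I (1 / p) y) / p ^ m))"
      using transport_int[OF q] transport_int[OF pq(1)]
      by (simp add: transport q pq(1) right_diff_distrib)
    also have "\<dots> = - (LINT y|lborel. LINT r|lborel. F1 r y)"
    proof -
      have "(LINT r|lborel. F1 r y) = f y * (LINT r|lborel. indicator {p..q} r * (euler I \<phi> (scale I (1 / r) y) / r ^ Suc m))" for y
        unfolding F1_def by (subst integral_mult_right_zero[symmetric]) (simp only: mult.left_commute)
      then show ?thesis
        unfolding FTC by simp
    qed
    also have "\<dots> = - (LINT r|lborel. LINT y|lborel. F1 r y)"
      by (subst lborel_pair.Fubini_integral[OF F1]) simp
    also have "\<dots> = (LINT r|lborel. LINT x|lborel. F2 r x)"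
      by (simp add: slice)
    also have "\<dots> = (LINT x|lborel. LINT r|lborel. F2 r x)"
      by (rule lborel_pair.Fubini_integral[OF F2, symmetric])
    also have "\<dots> = (LINT x|lborel. J x * \<phi> x)"
      unfolding F2_def J_c ..
    finally have main: "(LINT x|lborel. f (scale I q x) * \<phi> x) - (LINT x|lborel. f (scale I p x) * \<phi> x) = (LINT x|lborel. J x * \<phi> x)" .
    have f_int: "integrable lborel (\<lambda>x. f (scale I r x) * \<phi> x)" if "0 < r" for r
      using integrable_mult_test_function[OF f_scale_loc[OF that] \<phi>] .
    have "indicator orthant x * (Q x * \<phi> x) = f (scale I q x) * \<phi> x - f (scale I p x) * \<phi> x - J x * \<phi> x" for x
      using not_in_support[of x \<phi>] supp(2) by (cases "x \<in> support \<phi>") (auto simp: Q_def indicator_def algebra_simps)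
    then have "(LINT x:orthant|lborel. Q x * \<phi> x) = (LINT x|lborel. f (scale I q x) * \<phi> x - f (scale I p x) * \<phi> x - J x * \<phi> x)"
      by (simp add: set_lebesgue_integral_def)
    also have "\<dots> = 0"
      using f_int[OF q] f_int[OF pq(1)] J_int main by simp
    finally show "(LINT x:orthant|lborel. Q x * \<phi> x) = 0" .
  qed
  with ae_int show ?thesis
    by eventually_elim (auto simp: Q_def J_def set_lebesgue_integral_def)
qed

section \<open>Weak derivatives along coordinate lines and rays\<close>

text \<open>
  Absolute continuity as a relation between two end points: for an arbitrary version of a weakly
  differentiable function it can only be expected for a given \<open>p\<close> and almost every \<open>q\<close>.
\<close>

definition ftc_between :: "(real \<Rightarrow> real) \<Rightarrow> (real \<Rightarrow> real) \<Rightarrow> real \<Rightarrow> real \<Rightarrow> bool" where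
  "ftc_between F h p q \<longleftrightarrow> integrable lborel (\<lambda>r. if p \<le> r \<and> r \<le> q then h r else 0) \<and>
     F q - F p = (LINT r|lborel. (if p \<le> r \<and> r \<le> q then h r else 0))"

text \<open>
  The exceptional set of points in \<open>weak_gradient_scale_increment\<close> depends on the end point \<open>q\<close>; by
  Fubini's theorem the quantifiers can be exchanged.
\<close>

lemma AE_ftc_between_scale:
  fixes f :: "real ^ 'n \<Rightarrow> real" and G :: "real ^ 'n \<Rightarrow> real ^ 'n" and I :: "'n set"
  assumes wg: "weak_gradient orthant f G"
    and [measurable]: "f \<in> borel_measurable borel" "G \<in> borel_measurable borel"
    and f0: "\<And>x. x \<notin> orthant \<Longrightarrow> f x = 0" and G0: "\<And>x. x \<notin> orthant \<Longrightarrow> G x = 0"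
    and p: "0 < p"
  shows "AE x in lborel. AE q in lborel. x \<in> orthant \<longrightarrow> p < q \<longrightarrow>
    ftc_between (\<lambda>r. f (scale I r x)) (\<lambda>r. (\<Sum>i\<in>I. scale I r x $ i * G (scale I r x) $ i) / r) p q"
proof -
  have [measurable]: "orthant \<in> sets (borel :: (real ^ 'n) measure)"
    using open_orthant by (rule borel_open)
  have "AE x in lborel. x \<in> orthant \<longrightarrow> p < q \<longrightarrow>
      ftc_between (\<lambda>r. f (scale I r x)) (\<lambda>r. (\<Sum>i\<in>I. scale I r x $ i * G (scale I r x) $ i) / r) p q" for q
  proof (cases "p < q")
    case True
    have ind: "indicator {p..q} r *\<^sub>R h r = (if p \<le> r \<and> r \<le> q then h r else 0)" for r and h :: "real \<Rightarrow> real"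
      by (auto simp: indicator_def)
    show ?thesis
      using weak_gradient_scale_increment[OF wg assms(2,3) f0 G0 p less_imp_le[OF True], of I] True
      unfolding ftc_between_def set_integrable_def set_lebesgue_integral_def ind by simp
  qed simp
  then have "AE q in lborel. AE x in lborel. x \<in> orthant \<longrightarrow> p < q \<longrightarrow>
      ftc_between (\<lambda>r. f (scale I r x)) (\<lambda>r. (\<Sum>i\<in>I. scale I r x $ i * G (scale I r x) $ i) / r) p q"
    by (simp only: AE_I2)
  then show ?thesis
  proof (subst lborel_pair.AE_commute)
    show "{z \<in> space (lborel \<Otimes>\<^sub>M lborel). fst z \<in> orthant \<longrightarrow> p < snd z \<longrightarrow>
      ftc_between (\<lambda>r. f (scale I r (fst z)))
        (\<lambda>r. (\<Sum>i\<in>I. scale I r (fst z) $ i * G (scale I r (fst z)) $ i) / r) p (snd z)}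
      \<in> sets (lborel \<Otimes>\<^sub>M lborel)"
      unfolding ftc_between_def by measurable
  qed
qed

lemma compact_subset_halfline:
  fixes K :: "real set"
  assumes K: "compact K" "K \<subseteq> {0<..}"
  shows "\<exists>b c. 0 < b \<and> K \<subseteq> {b..c}"
proof (cases "K = {}")
  case False
  then obtain b c where "b \<in> K" "c \<in> K" "\<And>x. x \<in> K \<Longrightarrow> b \<le> x" "\<And>x. x \<in> K \<Longrightarrow> x \<le> c"
    using compact_attains_inf[OF K(1)] compact_attains_sup[OF K(1)] by blast
  then show ?thesis using K(2) by (intro exI[of _ b] exI[of _ c]) auto
qed (auto intro: exI[of _ 1])

text \<open>
  Base points \<open>a k\<close> tending to \<open>0\<close> are needed because neither \<open>F\<close> nor \<open>h\<close> is assumed to behave well at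
  \<open>0\<close>: any compact subset of the half-line lies beyond one of them. From such a base point, integration by
  parts is Fubini's theorem on the triangle \<open>a k \<le> r \<le> s\<close>.
\<close>

lemma weak_gradient_halfline:
  fixes F h :: "real \<Rightarrow> real"
  assumes [measurable]: "F \<in> borel_measurable borel" "h \<in> borel_measurable borel"
    and a: "\<And>k::nat. 0 < a k" "a \<longlonglongrightarrow> 0"
    and ftc: "\<And>k. AE q in lborel. a k < q \<longrightarrow> ftc_between F h (a k) q"
  shows "weak_gradient {0<..} F h"
proof -
  have base: "\<exists>k. \<exists>q>c. a k < b \<and> ftc_between F h (a k) q \<and> (AE s in lborel. a k < s \<longrightarrow> ftc_between F h (a k) s)"
    if "0 < b" for b c
  proof -
    have "\<forall>\<^sub>F k in sequentially. a k < b"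
      by (rule order_tendstoD(2)[OF a(2) that])
    then obtain k where k: "a k < b"
      by (auto simp: eventually_sequentially)
    have "\<not> (AE q in lborel. \<not> max c (a k) < q)"
    proof
      assume "AE q in lborel. \<not> max c (a k) < q"
      then have "emeasure lborel {q \<in> space lborel. max c (a k) < q} = 0"
        by (rule emeasure_eq_0_AE)
      moreover have "emeasure lborel {max c (a k)<..max c (a k) + 1} \<le> emeasure lborel {q \<in> space lborel. max c (a k) < q}"
        by (rule emeasure_mono) auto
      ultimately show False by simp
    qed
    moreover have "AE q in lborel. \<not> max c (a k) < q" if "\<not> (\<exists>q. max c (a k) < q \<and> ftc_between F h (a k) q)"
      using ftc[of k]
    proof eventually_elim
      case (elim q)
      then show ?case using that by auto
    qed
    ultimately have "\<exists>q. max c (a k) < q \<and> ftc_between F h (a k) q"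
      by blast
    then show ?thesis using k ftc[of k] by auto
  qed
  have h_loc: "locally_integrable_on {0<..} h"
    unfolding locally_integrable_on_def
  proof safe
    fix K :: "real set" assume K: "compact K" "K \<subseteq> {0<..}"
    obtain b c where bc: "0 < b" "K \<subseteq> {b..c}" using compact_subset_halfline[OF K] by blast
    obtain k q where kq: "c < q" "a k < b" "ftc_between F h (a k) q" using base[OF bc(1)] by blast
    have "integrable lborel (\<lambda>r. indicator K r *\<^sub>R (if a k \<le> r \<and> r \<le> q then h r else 0))"
      using kq(3) K(1) unfolding ftc_between_def by (intro integrable_mult_indicator) (auto simp: borel_compact)
    also have "(\<lambda>r. indicator K r *\<^sub>R (if a k \<le> r \<and> r \<le> q then h r else 0)) = (\<lambda>r. indicator K r *\<^sub>R h r)"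
      using bc(2) kq by (force simp: indicator_def)
    finally show "set_integrable lborel K h" by (simp add: set_integrable_def)
  qed
  have F_loc: "locally_integrable_on {0<..} F"
    unfolding locally_integrable_on_def
  proof safe
    fix K :: "real set" assume K: "compact K" "K \<subseteq> {0<..}"
    obtain b c where bc: "0 < b" "K \<subseteq> {b..c}" using compact_subset_halfline[OF K] by blast
    obtain k q where kq: "c < q" "a k < b" "ftc_between F h (a k) q"
      "AE s in lborel. a k < s \<longrightarrow> ftc_between F h (a k) s" using base[OF bc(1)] by blast
    define C where "C = \<bar>F (a k)\<bar> + (LINT r|lborel. \<bar>if a k \<le> r \<and> r \<le> q then h r else 0\<bar>)"
    have [measurable]: "K \<in> sets borel" using K(1) by (rule borel_compact)
    show "set_integrable lborel K F"
      unfolding set_integrable_def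
    proof (rule Bochner_Integration.integrable_bound)
      show "integrable lborel (\<lambda>s. indicator K s * C)"
        using K(1) emeasure_compact_finite[OF K(1)] by (intro integrable_mult_left integrable_real_indicator) auto
      show "AE s in lborel. norm (indicator K s *\<^sub>R F s) \<le> norm (indicator K s * C)"
        using kq(4)
      proof eventually_elim
        case (elim s)
        show ?case
        proof (cases "s \<in> K")
          case True
          then have s: "a k < s" "s \<le> q" using bc(2) kq by auto
          then have ftc_s: "ftc_between F h (a k) s" using elim by simp
          then have "F s = F (a k) + (LINT r|lborel. (if a k \<le> r \<and> r \<le> s then h r else 0))"
            by (simp add: ftc_between_def)
          also have "\<bar>\<dots>\<bar> \<le> \<bar>F (a k)\<bar> + \<bar>(LINT r|lborel. (if a k \<le> r \<and> r \<le> s then h r else 0))\<bar>"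
            by (rule abs_triangle_ineq)
          also have "\<bar>(LINT r|lborel. (if a k \<le> r \<and> r \<le> s then h r else 0))\<bar> \<le> (LINT r|lborel. \<bar>if a k \<le> r \<and> r \<le> s then h r else 0\<bar>)"
            by (rule integral_abs_bound)
          also have "\<dots> \<le> (LINT r|lborel. \<bar>if a k \<le> r \<and> r \<le> q then h r else 0\<bar>)"
            using ftc_s kq(3) s by (intro integral_mono integrable_abs) (auto simp: ftc_between_def)
          finally show ?thesis using True by (simp add: C_def)
        qed simp
      qed
    qed simp
  qed
  have "weak_partial {0<..} 1 F h"
    unfolding weak_partial_def
  proof (intro conjI allI impI h_loc F_loc)
    fix \<phi> :: "real \<Rightarrow> real" assume \<phi>: "test_function {0<..} \<phi>"
    define \<phi>' where "\<phi>' = (\<lambda>s. frechet_derivative \<phi> (at s) 1)"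
    note K = compact_support[OF \<phi>] support_subset[OF \<phi>]
    have d: "(\<phi> has_real_derivative \<phi>' s) (at s)" for s
    proof -
      have D: "(\<phi> has_derivative frechet_derivative \<phi> (at s)) (at s)"
        using test_function_differentiable[OF \<phi>] by (simp add: frechet_derivative_works)
      have "frechet_derivative \<phi> (at s) = (*) (\<phi>' s)"
      proof
        fix u show "frechet_derivative \<phi> (at s) u = \<phi>' s * u"
          using linear_scale[OF has_derivative_linear[OF D], of u 1] by (simp add: \<phi>'_def mult.commute)
      qed
      with D show ?thesis by (simp add: has_field_derivative_def)
    qed
    have cont: "continuous_on UNIV \<phi>'"
      unfolding \<phi>'_def by (rule continuous_on_test_function_derivative[OF \<phi>]) simp
    have [measurable]: "\<phi>' \<in> borel_measurable borel" "\<phi> \<in> borel_measurable borel"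
      using cont continuous_on_test_function[OF \<phi>] by (auto intro: borel_measurable_continuous_onI)
    have 0: "\<phi>' s = 0" "\<phi> s = 0" if "s \<notin> support \<phi>" for s
      using that by (auto simp: \<phi>'_def derivative_not_in_support not_in_support)
    obtain b c where bc: "0 < b" "support \<phi> \<subseteq> {b..c}" using compact_subset_halfline[OF K] by blast
    obtain k q where kq: "max b c < q" "a k < b" "ftc_between F h (a k) q"
      "AE s in lborel. a k < s \<longrightarrow> ftc_between F h (a k) s" using base[OF bc(1)] by blast
    define hh where "hh = (\<lambda>r. if a k \<le> r \<and> r \<le> q then h r else 0)"
    have hh: "integrable lborel hh" using kq(3) by (simp add: ftc_between_def hh_def)
    then have [measurable]: "hh \<in> borel_measurable borel" by auto
    have "bounded (\<phi>' ` support \<phi>)"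
      using K(1) cont by (intro compact_imp_bounded compact_continuous_image) (auto intro: continuous_on_subset)
    then obtain B where B: "\<And>s. s \<in> support \<phi> \<Longrightarrow> \<bar>\<phi>' s\<bar> \<le> B"
      unfolding bounded_iff by auto
    have tail: "(LINT s|lborel. (if r \<le> s then \<phi>' s else 0)) = - \<phi> r" if "a k \<le> r" "r \<le> q" for r
    proof -
      have "(LINT s|lborel. indicator {r..q} s *\<^sub>R \<phi>' s) = \<phi> q - \<phi> r"
      proof (rule integral_FTC_Icc[OF that(2)])
        show "(\<phi> has_vector_derivative \<phi>' x) (at x within {r..q})" for x
          using d[of x]
          by (simp add: has_real_derivative_iff_has_vector_derivative has_vector_derivative_at_within)
        show "continuous_on {r..q} \<phi>'"
          by (rule continuous_on_subset[OF cont subset_UNIV])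
      qed
      also have "\<phi> q = 0" using kq bc(2) by (intro 0) auto
      also have "(\<lambda>s. indicator {r..q} s *\<^sub>R \<phi>' s) = (\<lambda>s. if r \<le> s then \<phi>' s else 0)"
      proof
        fix s show "indicator {r..q} s *\<^sub>R \<phi>' s = (if r \<le> s then \<phi>' s else 0)"
          using 0(1)[of s] bc(2) kq(1) by (cases "s \<in> support \<phi>") (auto simp: indicator_def)
      qed
      finally show ?thesis by simp
    qed
    have \<phi>'_total: "(LINT s|lborel. \<phi>' s) = 0"
    proof -
      have "(\<lambda>s. if a k \<le> s then \<phi>' s else 0) = \<phi>'"
        using 0(1) bc(2) kq(2) by (auto simp: fun_eq_iff) (metis atLeastAtMost_iff less_eq_real_def order.trans subsetD)
      then show ?thesis
        using tail[of "a k"] kq 0(2)[of "a k"] bc(2) by force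
    qed
    have \<phi>'_int: "integrable lborel \<phi>'"
    proof -
      have "locally_integrable_on UNIV (\<lambda>_::real. 1::real)"
        by (auto simp: locally_integrable_on_def set_integrable_def borel_compact
          intro!: integrable_real_indicator emeasure_compact_finite)
      from integrable_mult_compact_support[OF this cont K(1) subset_UNIV 0(1)]
      show ?thesis by simp
    qed
    \<comment> \<open>The integrand on the triangle; integrating \<open>r\<close> out gives the increments of \<open>F\<close> times the derivative of \<open>\<phi>\<close>, integrating \<open>s\<close> out gives \<open>- h \<phi>\<close>.\<close>
    define P where "P = (\<lambda>s r. (if r \<le> s then \<phi>' s else 0) * hh r)"
    have P0: "P s r = 0" if "s \<notin> support \<phi>" for s r
      using 0(1)[OF that] by (simp add: P_def)
    have P_int: "integrable (lborel \<Otimes>\<^sub>M lborel) (\<lambda>(s, r). P s r)"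
    proof (rule integrable_strip)
      show "(\<lambda>(s, r). P s r) \<in> borel_measurable (borel \<Otimes>\<^sub>M borel)"
        unfolding P_def by measurable
      show "ennreal B * (\<integral>\<^sup>+r. ennreal \<bar>hh r\<bar> \<partial>lborel) < \<infinity>"
        using hh unfolding integrable_iff_bounded by (simp add: ennreal_mult_less_top)
      fix s
      show "(\<integral>\<^sup>+r. ennreal \<bar>case (s, r) of (s, r) \<Rightarrow> P s r\<bar> \<partial>lborel)
        \<le> ennreal B * (\<integral>\<^sup>+r. ennreal \<bar>hh r\<bar> \<partial>lborel) * indicator {b..c} s"
      proof (cases "s \<in> support \<phi>")
        case True
        then have B0: "0 \<le> B" using B[OF True] by simp
        have "ennreal \<bar>P s r\<bar> \<le> ennreal B * ennreal \<bar>hh r\<bar>" for r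
          using B[OF True] B0 by (auto simp: P_def abs_mult ennreal_mult[symmetric] intro!: ennreal_leI mult_right_mono)
        then have "(\<integral>\<^sup>+r. ennreal \<bar>P s r\<bar> \<partial>lborel) \<le> (\<integral>\<^sup>+r. ennreal B * ennreal \<bar>hh r\<bar> \<partial>lborel)"
          by (rule nn_integral_mono)
        also have "\<dots> = ennreal B * (\<integral>\<^sup>+r. ennreal \<bar>hh r\<bar> \<partial>lborel)"
          by (rule nn_integral_cmult) simp
        finally show ?thesis using True bc(2) by (auto simp: indicator_def)
      qed (simp add: P0 0)
    qed
    have P_s: "(LINT r|lborel. P s r) = \<phi>' s * (LINT r|lborel. (if a k \<le> r \<and> r \<le> s then h r else 0))" for s
    proof (cases "s \<in> support \<phi>")
      case True
      then have "s \<le> q" using bc(2) kq by auto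
      then have "P s = (\<lambda>r. \<phi>' s * (if a k \<le> r \<and> r \<le> s then h r else 0))"
        by (auto simp: P_def hh_def fun_eq_iff)
      then show ?thesis by simp
    qed (simp add: P0 0)
    have "AE s in lborel. F s * \<phi>' s = F (a k) * \<phi>' s + (LINT r|lborel. P s r)"
      using kq(4)
    proof eventually_elim
      case (elim s)
      show ?case
      proof (cases "s \<in> support \<phi>")
        case True
        then have "ftc_between F h (a k) s" using elim bc(2) kq(2) by force
        then show ?thesis by (simp add: P_s ftc_between_def algebra_simps)
      qed (simp add: P0 0)
    qed
    then have "(LINT s|lborel. F s * \<phi>' s) = (LINT s|lborel. F (a k) * \<phi>' s + (LINT r|lborel. P s r))"
      by (intro integral_cong_AE) (auto simp: P_def)
    also have "\<dots> = (LINT s|lborel. LINT r|lborel. P s r)"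
      using \<phi>'_int lborel_pair.integrable_fst[OF P_int] \<phi>'_total by simp
    also have "\<dots> = (LINT r|lborel. LINT s|lborel. P s r)"
      by (rule lborel_pair.Fubini_integral[OF P_int, symmetric])
    also have "\<dots> = (LINT r|lborel. - (h r * \<phi> r))"
    proof (rule Bochner_Integration.integral_cong[OF refl])
      fix r
      show "(LINT s|lborel. P s r) = - (h r * \<phi> r)"
      proof (cases "a k \<le> r \<and> r \<le> q")
        case True
        then show ?thesis by (simp add: P_def tail hh_def)
      next
        case False
        then have "\<phi> r = 0" using bc(2) kq by (intro 0) auto
        then show ?thesis using False by (auto simp: P_def hh_def)
      qed
    qed
    finally have main: "(LINT s|lborel. F s * \<phi>' s) = - (LINT r|lborel. h r * \<phi> r)" by simp
    have ind: "indicator {0<..} s * (u * \<phi>' s) = u * \<phi>' s" "indicator {0<..} s * (u * \<phi> s) = u * \<phi> s" for s u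
      using 0[of s] K(2) by (auto simp: indicator_def)
    show "(LINT s:{0<..}|lborel. F s * frechet_derivative \<phi> (at s) 1) = - (LINT s:{0<..}|lborel. h s * \<phi> s)"
      using main unfolding \<phi>'_def
      by (simp only: set_lebesgue_integral_def real_scaleR_def ind[unfolded \<phi>'_def])
  qed
  then show ?thesis by (simp add: weak_gradient_def)
qed

text \<open>
  The flow \<open>r \<mapsto> scale I r x\<close> starts at \<open>x\<close> for \<open>r = 1\<close>; this converts its parameter into a coordinate of
  the point.
\<close>

lemma ftc_between_rescale:
  assumes "ftc_between (\<lambda>r. F (c * r)) H p q" and c: "0 < c"
    and H: "\<And>r. p \<le> r \<Longrightarrow> H r = c * h (c * r)"
  shows "ftc_between F h (c * p) (c * q)"
proof -
  have eq: "(if c * p \<le> 0 + c * r \<and> 0 + c * r \<le> c * q then h (0 + c * r) else 0)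
      = (if p \<le> r \<and> r \<le> q then H r else 0) / c" for r
    using c H by simp
  have int: "integrable lborel (\<lambda>r. (if p \<le> r \<and> r \<le> q then H r else 0))"
    using assms(1) by (simp add: ftc_between_def)
  have "integrable lborel (\<lambda>r. if c * p \<le> r \<and> r \<le> c * q then h r else 0)"
    using c int by (subst lborel_integrable_real_affine_iff[of c _ 0, symmetric]) (simp_all only: eq integrable_divide)
  moreover have "(LINT r|lborel. (if c * p \<le> r \<and> r \<le> c * q then h r else 0))
      = (LINT r|lborel. (if p \<le> r \<and> r \<le> q then H r else 0))"
    using c by (subst lborel_integral_real_affine[of c _ 0]) (simp_all only: eq, simp)
  ultimately show ?thesis
    using assms(1) by (simp add: ftc_between_def)
qed

lemma AE_ftc_between_rescale:
  fixes F H h :: "real \<Rightarrow> real"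
  assumes ae: "AE q in lborel. p < q \<longrightarrow> ftc_between (\<lambda>r. F (c * r)) H p q" and c: "0 < c"
    and H: "\<And>r. p \<le> r \<Longrightarrow> H r = c * h (c * r)"
    and [measurable]: "F \<in> borel_measurable borel" "H \<in> borel_measurable borel"
  shows "AE q in lborel. c * p < q \<longrightarrow> ftc_between F h (c * p) q"
proof -
  define P where "P = (\<lambda>q. p < q \<longrightarrow> ftc_between (\<lambda>r. F (c * r)) H p q)"
  have "Measurable.pred borel P"
    unfolding P_def ftc_between_def by measurable
  moreover have "AE q in lborel. P q"
    using ae by (simp only: P_def)
  ultimately have "AE q in lborel. P (0 + (1 / c) * q)"
    using c by (intro AE_borel_affine) auto
  then show ?thesis
  proof eventually_elim
    case (elim q)
    show ?case
    proof
      assume "c * p < q"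
      then have "p < 0 + (1 / c) * q"
        using c by (simp add: field_simps)
      with elim have "ftc_between (\<lambda>r. F (c * r)) H p (0 + (1 / c) * q)"
        by (simp only: P_def simp_thms)
      from ftc_between_rescale[OF this c H]
      show "ftc_between F h (c * p) q"
        using c by simp
    qed
  qed
qed

lemma borel_measurable_coord_sum [measurable]:
  assumes [measurable]: "f \<in> borel_measurable M"
  shows "(\<lambda>x. coord_sum (f x)) \<in> borel_measurable M"
  unfolding coord_sum_def by measurable

lemma coord_sum_pos: "x \<in> orthant \<Longrightarrow> 0 < coord_sum x"
  unfolding coord_sum_def orthant_def by (intro sum_pos) auto

text \<open>
  The ray is parametrized by the coordinate sum of its points, so that the restriction of \<open>f\<close> is a
  function of the radial variable \<open>s\<close>.
\<close>

lemma radial_weak_gradient: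
  fixes f :: "real ^ 'n \<Rightarrow> real" and G :: "real ^ 'n \<Rightarrow> real ^ 'n"
  assumes wg: "weak_gradient orthant f G"
    and [measurable]: "f \<in> borel_measurable borel" "G \<in> borel_measurable borel"
    and f0: "\<And>x. x \<notin> orthant \<Longrightarrow> f x = 0" and G0: "\<And>x. x \<notin> orthant \<Longrightarrow> G x = 0"
  shows "AE x in lborel. x \<in> orthant \<longrightarrow> weak_gradient {0<..}
    (\<lambda>s. f ((s / coord_sum x) *\<^sub>R x))
    (\<lambda>s. \<Sum>i\<in>UNIV. x $ i / coord_sum x * G ((s / coord_sum x) *\<^sub>R x) $ i)"
proof -
  define H where "H = (\<lambda>x r. (\<Sum>i\<in>UNIV. scale UNIV r x $ i * G (scale UNIV r x) $ i) / r)"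
  have "AE x in lborel. \<forall>k::nat. AE q in lborel. x \<in> orthant \<longrightarrow> 1 / Suc k < q \<longrightarrow>
      ftc_between (\<lambda>r. f (scale UNIV r x)) (H x) (1 / Suc k) q"
    unfolding AE_all_countable H_def
    by (intro allI AE_ftc_between_scale[OF wg assms(2,3) f0 G0]) auto
  then show ?thesis
  proof eventually_elim
    case (elim x)
    show ?case
    proof
      assume x: "x \<in> orthant"
      define c where "c = coord_sum x"
      have c: "0 < c" using coord_sum_pos[OF x] by (simp add: c_def)
      let ?F = "\<lambda>s. f ((s / c) *\<^sub>R x)" and ?h = "\<lambda>s. \<Sum>i\<in>UNIV. x $ i / c * G ((s / c) *\<^sub>R x) $ i"
      have "weak_gradient {0<..} ?F ?h"
      proof (rule weak_gradient_halfline)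
        show "(\<lambda>k. c * (1 / real (Suc k))) \<longlonglongrightarrow> 0"
          by real_asymp
        fix k :: nat
        define p where "p = 1 / real (Suc k)"
        have p: "0 < p" by (simp add: p_def)
        show "0 < c * (1 / real (Suc k))"
          using c p by (simp add: p_def)
        have "AE q in lborel. p < q \<longrightarrow> ftc_between (\<lambda>r. ?F (c * r)) (H x) p q"
          using spec[OF elim, of k, folded p_def] x c by (simp add: scale_UNIV)
        then have "AE q in lborel. c * p < q \<longrightarrow> ftc_between ?F ?h (c * p) q"
        proof (rule AE_ftc_between_rescale[OF _ c])
          fix r assume "p \<le> r"
          then have "0 < r" using p by simp
          then show "H x r = c * ?h (c * r)"
            using c by (simp add: H_def scale_UNIV sum_distrib_left sum_divide_distrib mult.assoc)
        qed (auto simp: H_def)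
        then show "AE q in lborel. c * (1 / real (Suc k)) < q \<longrightarrow> ftc_between ?F ?h (c * (1 / real (Suc k))) q"
          by (simp only: p_def)
      qed auto
      then show "weak_gradient {0<..} (\<lambda>s. f ((s / coord_sum x) *\<^sub>R x))
          (\<lambda>s. \<Sum>i\<in>UNIV. x $ i / coord_sum x * G ((s / coord_sum x) *\<^sub>R x) $ i)"
        by (simp add: c_def)
    qed
  qed
qed

section \<open>The one-dimensional Gamma distribution\<close>

definition gamma_density :: "real \<Rightarrow> real \<Rightarrow> real" where
  "gamma_density a t = (if 0 < t then t powr (a - 1) * exp (- t) / Gamma a else 0)"

lemma borel_measurable_gamma_density [measurable]: "gamma_density a \<in> borel_measurable borel"
  unfolding gamma_density_def[abs_def] by measurable

lemma gamma_density_nonneg: "0 < a \<Longrightarrow> 0 \<le> gamma_density a t"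
  by (simp add: gamma_density_def Gamma_real_pos less_imp_le)

lemma nn_integral_gamma_density:
  assumes a: "0 < a"
  shows "(\<integral>\<^sup>+t. ennreal (gamma_density a t) \<partial>lborel) = 1"
proof -
  have "((\<lambda>t. t powr (a - 1) / exp t / Gamma a) has_integral Gamma a / Gamma a) {0..}"
    by (intro has_integral_divide Gamma_integral_real a)
  then have "((\<lambda>t. t powr (a - 1) / exp t / Gamma a) has_integral 1) {0..}"
    using Gamma_real_pos[OF a] by simp
  then have "((\<lambda>t. if t \<in> {0..} then t powr (a - 1) / exp t / Gamma a else 0) has_integral 1) UNIV"
    by (simp only: has_integral_restrict_UNIV)
  also have "(\<lambda>t. if t \<in> {0..} then t powr (a - 1) / exp t / Gamma a else 0) = gamma_density a"
    by (auto simp: gamma_density_def fun_eq_iff exp_minus field_simps)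
  finally show ?thesis
    using a by (subst nn_integral_has_integral_lborel) (auto intro: gamma_density_nonneg)
qed

lemma
  assumes a: "0 < a"
  shows integrable_gamma_density: "integrable lborel (gamma_density a)"
    and integral_gamma_density: "(LINT t|lborel. gamma_density a t) = 1"
proof -
  have "has_bochner_integral lborel (gamma_density a) 1"
    using nn_integral_gamma_density[OF a] gamma_density_nonneg[OF a]
    by (intro has_bochner_integral_nn_integral) auto
  then show "integrable lborel (gamma_density a)" "(LINT t|lborel. gamma_density a t) = 1"
    by (auto simp: has_bochner_integral_iff)
qed

lemma gamma_density_mult:
  assumes "0 < a"
  shows "t * gamma_density a t = a * gamma_density (a + 1) t"
  using assms Gamma_plus1[of a] Gamma_real_pos[of a]
  by (auto simp: gamma_density_def powr_diff nonpos_Ints_def)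

lemma
  assumes a: "0 < a"
  shows integrable_gamma_mean: "integrable lborel (\<lambda>t. t * gamma_density a t)"
    and integral_gamma_mean: "(LINT t|lborel. t * gamma_density a t) = a"
  using integrable_gamma_density[of "a + 1"] integral_gamma_density[of "a + 1"] a
  by (simp_all add: gamma_density_mult)

text \<open>
  The function \<open>p \<mapsto> p * gamma_density a p\<close> is a primitive of the integrand.
\<close>

lemma gamma_lower_moment:
  assumes a: "0 < a" and t: "0 < t"
  shows "(LINT p|lborel. (if p \<le> t then (a - p) * gamma_density a p else 0)) = t * gamma_density a t"
proof -
  have int: "integrable lborel (\<lambda>p. (if p \<le> t then (a - p) * gamma_density a p else 0))"
  proof -
    have "integrable lborel (\<lambda>p. indicator {..t} p *\<^sub>R (a * gamma_density a p - p * gamma_density a p))"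
      using integrable_gamma_density[OF a] integrable_gamma_mean[OF a]
      by (intro integrable_mult_indicator) auto
    also have "(\<lambda>p. indicator {..t} p *\<^sub>R (a * gamma_density a p - p * gamma_density a p))
        = (\<lambda>p. (if p \<le> t then (a - p) * gamma_density a p else 0))"
      by (auto simp: indicator_def fun_eq_iff algebra_simps)
    finally show ?thesis .
  qed
  have "((\<lambda>p. (a - p) * gamma_density a p) has_integral
      t powr a * exp (- t) / Gamma a - 0 powr a * exp (- 0) / Gamma a) {0..t}"
  proof (rule fundamental_theorem_of_calculus_interior)
    show "continuous_on {0..t} (\<lambda>p. p powr a * exp (- p) / Gamma a)"
      using a Gamma_real_pos[OF a, THEN less_imp_neq]
      by (intro continuous_on_divide continuous_on_mult continuous_on_powr' continuous_on_exp
          continuous_on_minus continuous_on_id continuous_on_const) (auto simp del: Gamma_eq_zero_iff)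
    fix p assume "p \<in> {0<..<t}"
    then have p: "0 < p" by simp
    have "((\<lambda>p. p powr a * exp (- p) / Gamma a) has_real_derivative (a - p) * gamma_density a p) (at p)"
      using p Gamma_real_pos[OF a]
      by (auto intro!: derivative_eq_intros simp: gamma_density_def powr_diff field_simps)
    then show "((\<lambda>p. p powr a * exp (- p) / Gamma a) has_vector_derivative (a - p) * gamma_density a p) (at p)"
      by (simp add: has_real_derivative_iff_has_vector_derivative)
  qed (use t in auto)
  also have "t powr a * exp (- t) / Gamma a - 0 powr a * exp (- 0) / Gamma a = t * gamma_density a t"
    using t by (simp add: gamma_density_def powr_diff)
  finally have "((\<lambda>p. if p \<in> {0..t} then (a - p) * gamma_density a p else 0) has_integral t * gamma_density a t) UNIV"
    by (simp only: has_integral_restrict_UNIV)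
  also have "(\<lambda>p. if p \<in> {0..t} then (a - p) * gamma_density a p else 0) = (\<lambda>p. (if p \<le> t then (a - p) * gamma_density a p else 0))"
    by (auto simp: gamma_density_def fun_eq_iff)
  finally show ?thesis
    using has_integral_integral_lborel[OF int] has_integral_unique by blast
qed

text \<open>
  Two independent Gamma variables \<open>P, Q\<close> straddle \<open>t\<close> with mean gap \<open>t\<close> times the density at \<open>t\<close>; this
  is where the weight \<open>y\<^sub>i\<close> of the Gamma inequality comes from. Splitting \<open>q - p\<close> as
  \<open>(q - a) + (a - p)\<close> separates the variables, and the first moments of the two tails about the mean
  \<open>a\<close> coincide.
\<close>

lemma gamma_kernel:
  assumes a: "0 < a" and t: "0 < t"
  shows "(\<integral>\<^sup>+p. \<integral>\<^sup>+q. ennreal (if p \<le> t \<and> t \<le> q then (q - p) * gamma_density a p * gamma_density a q else 0) \<partial>lborel \<partial>lborel)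
    = ennreal (t * gamma_density a t)"
proof -
  define \<gamma> where "\<gamma> = gamma_density a"
  define M where "M = t * \<gamma> t"
  have nn: "0 \<le> \<gamma> x" for x unfolding \<gamma>_def by (rule gamma_density_nonneg[OF a])
  note i0 = integrable_gamma_density[OF a, folded \<gamma>_def] and i1 = integrable_gamma_mean[OF a, folded \<gamma>_def]
  have ind: "integrable lborel (\<lambda>x. if P x then h x else 0)"
    if [measurable]: "Measurable.pred borel P" and h: "integrable lborel h" for P and h :: "real \<Rightarrow> real"
    using h by (rule Bochner_Integration.integrable_bound) (use h in auto)
  have iA: "integrable lborel (\<lambda>p. if p \<le> t then \<gamma> p else 0)"
    and iB: "integrable lborel (\<lambda>q. if t \<le> q then \<gamma> q else 0)"
    and iMA: "integrable lborel (\<lambda>p. if p \<le> t then (a - p) * \<gamma> p else 0)"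
    and iMB: "integrable lborel (\<lambda>q. if t \<le> q then (q - a) * \<gamma> q else 0)"
    using i0 i1 by (auto intro!: ind simp: left_diff_distrib)
  \<comment> \<open>The masses of the two tails; \<open>M\<close> is their common first moment about \<open>a\<close>.\<close>
  define A where "A = (LINT p|lborel. (if p \<le> t then \<gamma> p else 0))"
  define B where "B = (LINT q|lborel. (if t \<le> q then \<gamma> q else 0))"
  have ne: "AE x in lborel. x \<noteq> t" by (rule AE_lborel_singleton)
  have AB: "A + B = 1"
  proof -
    have "A + B = (LINT x|lborel. (if x \<le> t then \<gamma> x else 0) + (if t \<le> x then \<gamma> x else 0))"
      unfolding A_def B_def using iA iB by simp
    also have "\<dots> = (LINT x|lborel. \<gamma> x)"
    proof (rule integral_cong_AE)
      show "AE x in lborel. (if x \<le> t then \<gamma> x else 0) + (if t \<le> x then \<gamma> x else 0) = \<gamma> x"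
        using ne by eventually_elim auto
    qed (use i0 iA iB in auto)
    also have "\<dots> = 1" unfolding \<gamma>_def by (rule integral_gamma_density[OF a])
    finally show ?thesis .
  qed
  have MA: "(LINT p|lborel. (if p \<le> t then (a - p) * \<gamma> p else 0)) = M"
    unfolding \<gamma>_def M_def by (rule gamma_lower_moment[OF a t])
  have MB: "(LINT q|lborel. (if t \<le> q then (q - a) * \<gamma> q else 0)) = M"
  proof -
    have "(LINT q|lborel. (if t \<le> q then (q - a) * \<gamma> q else 0)) - M
       = (LINT q|lborel. (if t \<le> q then (q - a) * \<gamma> q else 0) - (if q \<le> t then (a - q) * \<gamma> q else 0))"
      using iMA iMB by (simp add: MA)
    also have "\<dots> = (LINT q|lborel. q * \<gamma> q - a * \<gamma> q)"
    proof (rule integral_cong_AE)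
      show "AE q in lborel. (if t \<le> q then (q - a) * \<gamma> q else 0) - (if q \<le> t then (a - q) * \<gamma> q else 0)
          = q * \<gamma> q - a * \<gamma> q"
        using ne by eventually_elim (auto simp: algebra_simps)
    qed (use i0 i1 iMA iMB in auto)
    also have "\<dots> = 0"
      using i0 i1 integral_gamma_density[OF a] integral_gamma_mean[OF a] by (simp add: \<gamma>_def)
    finally show ?thesis by simp
  qed
  have inner: "(\<integral>\<^sup>+q. ennreal (if p \<le> t \<and> t \<le> q then (q - p) * \<gamma> p * \<gamma> q else 0) \<partial>lborel)
      = ennreal (M * (if p \<le> t then \<gamma> p else 0) + B * (if p \<le> t then (a - p) * \<gamma> p else 0))" for p
  proof (cases "p \<le> t")
    case True
    have eq: "(if p \<le> t \<and> t \<le> q then (q - p) * \<gamma> p * \<gamma> q else 0)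
      = \<gamma> p * (if t \<le> q then (q - a) * \<gamma> q else 0) + (a - p) * \<gamma> p * (if t \<le> q then \<gamma> q else 0)" for q
      using True by (auto simp: algebra_simps)
    have "(\<integral>\<^sup>+q. ennreal (if p \<le> t \<and> t \<le> q then (q - p) * \<gamma> p * \<gamma> q else 0) \<partial>lborel)
      = ennreal (LINT q|lborel. (if p \<le> t \<and> t \<le> q then (q - p) * \<gamma> p * \<gamma> q else 0))"
    proof (rule nn_integral_eq_integral)
      show "integrable lborel (\<lambda>q. if p \<le> t \<and> t \<le> q then (q - p) * \<gamma> p * \<gamma> q else 0)"
        unfolding eq using iMB iB by simp
    qed (auto intro!: AE_I2 mult_nonneg_nonneg nn)
    also have "(LINT q|lborel. (if p \<le> t \<and> t \<le> q then (q - p) * \<gamma> p * \<gamma> q else 0)) = M * \<gamma> p + B * ((a - p) * \<gamma> p)"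
      unfolding eq using iMB iB by (simp add: MB B_def[symmetric] mult.commute)
    finally show ?thesis using True by simp
  qed simp
  have "(\<integral>\<^sup>+p. \<integral>\<^sup>+q. ennreal (if p \<le> t \<and> t \<le> q then (q - p) * \<gamma> p * \<gamma> q else 0) \<partial>lborel \<partial>lborel)
    = (\<integral>\<^sup>+p. ennreal (M * (if p \<le> t then \<gamma> p else 0) + B * (if p \<le> t then (a - p) * \<gamma> p else 0)) \<partial>lborel)"
    unfolding inner ..
  also have "\<dots> = ennreal (LINT p|lborel. M * (if p \<le> t then \<gamma> p else 0) + B * (if p \<le> t then (a - p) * \<gamma> p else 0))"
  proof (rule nn_integral_eq_integral)
    show "integrable lborel (\<lambda>p. M * (if p \<le> t then \<gamma> p else 0) + B * (if p \<le> t then (a - p) * \<gamma> p else 0))"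
      using iA iMA by simp
    have "0 \<le> M * (if p \<le> t then \<gamma> p else 0) + B * (if p \<le> t then (a - p) * \<gamma> p else 0)" for p
    proof (cases "p \<le> t")
      case True
      have "0 \<le> (LINT q|lborel. \<gamma> p * (if t \<le> q then (q - p) * \<gamma> q else 0))"
        using True by (intro integral_nonneg_AE AE_I2) (auto intro!: mult_nonneg_nonneg nn)
      also have "(\<lambda>q. \<gamma> p * (if t \<le> q then (q - p) * \<gamma> q else 0)) =
        (\<lambda>q. \<gamma> p * (if t \<le> q then (q - a) * \<gamma> q else 0) + (a - p) * \<gamma> p * (if t \<le> q then \<gamma> q else 0))"
        by (auto simp: fun_eq_iff algebra_simps)
      also have "(LINT q|lborel. \<gamma> p * (if t \<le> q then (q - a) * \<gamma> q else 0) + (a - p) * \<gamma> p * (if t \<le> q then \<gamma> q else 0))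
        = M * \<gamma> p + B * ((a - p) * \<gamma> p)"
        using iMB iB by (simp add: MB B_def[symmetric] mult.commute)
      finally show ?thesis using True by simp
    qed simp
    then show "AE p in lborel. 0 \<le> M * (if p \<le> t then \<gamma> p else 0) + B * (if p \<le> t then (a - p) * \<gamma> p else 0)"
      by (rule AE_I2)
  qed
  also have "(LINT p|lborel. M * (if p \<le> t then \<gamma> p else 0) + B * (if p \<le> t then (a - p) * \<gamma> p else 0)) = M * (A + B)"
    using iA iMA by (simp add: MA A_def[symmetric] algebra_simps)
  finally show ?thesis by (simp only: AB M_def \<gamma>_def mult_1_right)
qed

section \<open>Product Gamma measures and the Efron-Stein inequality\<close>

text \<open>
  A linear involution that permutes the basis is its own inverse and preserves inner products with basis
  vectors, so it pulls a box back to the box whose corners have the permuted coordinates.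
\<close>

lemma lborel_distr_Basis_involution:
  fixes T :: "'a::euclidean_space \<Rightarrow> 'a"
  assumes lin: "linear T" and inv: "\<And>x. T (T x) = x" and Basis: "\<And>b. b \<in> Basis \<Longrightarrow> T b \<in> Basis"
  shows "distr lborel borel T = lborel"
proof (rule lborel_eqI[symmetric])
  have [measurable]: "T \<in> borel_measurable borel"
    using lin by (intro borel_measurable_continuous_onI linear_continuous_on) (simp add: linear_conv_bounded_linear)
  show "sets (distr lborel borel T) = sets borel" by simp
  have inj: "T b = T c \<longleftrightarrow> b = c" for b c using inv by metis
  have bij: "bij_betw T Basis Basis"
    unfolding bij_betw_def
  proof
    show "inj_on T Basis" by (simp add: inj_on_def inj)
    have "b \<in> T ` Basis" if "b \<in> Basis" for b
      using Basis[OF that] inv[of b] by (metis imageI)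
    then show "T ` Basis = Basis" using Basis by auto
  qed
  have inner: "T x \<bullet> T b = x \<bullet> b" if b: "b \<in> Basis" for x b
  proof -
    have "T x = T (\<Sum>c\<in>Basis. (x \<bullet> c) *\<^sub>R c)"
      by (simp only: euclidean_representation)
    also have "\<dots> = (\<Sum>c\<in>Basis. (x \<bullet> c) *\<^sub>R T c)"
      by (simp only: linear_sum[OF lin] linear_scale[OF lin])
    finally have "T x \<bullet> T b = (\<Sum>c\<in>Basis. (x \<bullet> c) * (T c \<bullet> T b))"
      by (simp add: inner_sum_left)
    also have "\<dots> = (\<Sum>c\<in>Basis. if c = b then x \<bullet> c else 0)"
      using Basis b by (intro sum.cong refl) (auto simp: inner_Basis inj)
    finally show ?thesis using b by simp
  qed
  fix l u :: 'a assume le: "\<And>b. b \<in> Basis \<Longrightarrow> l \<bullet> b \<le> u \<bullet> b"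
  define l' where "l' = (\<Sum>b\<in>Basis. (l \<bullet> T b) *\<^sub>R b)"
  define u' where "u' = (\<Sum>b\<in>Basis. (u \<bullet> T b) *\<^sub>R b)"
  have l'b: "l' \<bullet> b = l \<bullet> T b" and u'b: "u' \<bullet> b = u \<bullet> T b" if "b \<in> Basis" for b
    using that by (auto simp: l'_def u'_def)
  have "T -` box l u = box l' u'"
  proof (intro set_eqI)
    fix x
    have "T x \<in> box l u \<longleftrightarrow> (\<forall>b\<in>T ` Basis. l \<bullet> b < T x \<bullet> b \<and> T x \<bullet> b < u \<bullet> b)"
      using bij by (simp add: mem_box bij_betw_def)
    then show "x \<in> T -` box l u \<longleftrightarrow> x \<in> box l' u'"
      by (simp add: mem_box inner l'b u'b)
  qed
  then have "emeasure (distr lborel borel T) (box l u) = emeasure lborel (box l' u')"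
    by (simp add: emeasure_distr)
  also have "\<dots> = ennreal (\<Prod>b\<in>Basis. (u' - l') \<bullet> b)"
    using le Basis by (simp add: emeasure_lborel_box_eq inner_diff_left l'b u'b)
  also have "(\<Prod>b\<in>Basis. (u' - l') \<bullet> b) = (\<Prod>b\<in>Basis. (u - l) \<bullet> T b)"
    by (intro prod.cong) (auto simp: inner_diff_left l'b u'b)
  also have "\<dots> = (\<Prod>b\<in>Basis. (u - l) \<bullet> b)"
    using prod.reindex_bij_betw[OF bij, of "\<lambda>b. (u - l) \<bullet> b"] .
  finally show "emeasure (distr lborel borel T) (box l u) = (\<Prod>b\<in>Basis. (u - l) \<bullet> b)" .
qed

lemma nn_integral_lborel_vec_prod:
  fixes F :: "'n::finite \<Rightarrow> real \<Rightarrow> ennreal"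
  assumes [measurable]: "\<And>i. F i \<in> borel_measurable borel"
  shows "(\<integral>\<^sup>+y. (\<Prod>i\<in>UNIV. F i (y $ i)) \<partial>(lborel :: (real ^ 'n) measure)) = (\<Prod>i\<in>UNIV. \<integral>\<^sup>+t. F i t \<partial>lborel)"
proof -
  define e where "e = (\<lambda>i :: 'n. axis i (1::real))"
  have inj: "inj e" by (auto simp: inj_def e_def axis_eq_axis)
  have Basis: "(Basis :: (real ^ 'n) set) = e ` UNIV"
    by (auto simp: Basis_vec_def e_def)
  define F' where "F' = (\<lambda>b. F (inv e b))"
  have F': "F' (axis i 1) = F i" for i
    using inv_f_f[OF inj, of i] by (simp add: F'_def e_def)
  have "(\<integral>\<^sup>+y. (\<Prod>b\<in>Basis. F' b (y \<bullet> b)) \<partial>(lborel :: (real ^ 'n) measure)) = (\<Prod>b\<in>Basis. \<integral>\<^sup>+t. F' b t \<partial>lborel)"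
    by (rule nn_integral_lborel_prod) (auto simp: F'_def)
  then show ?thesis
    unfolding Basis prod.reindex[OF inj] by (simp add: F' o_def e_def inner_axis)
qed

definition gamma_prod :: "real ^ 'n \<Rightarrow> real ^ 'n \<Rightarrow> real" where
  "gamma_prod \<alpha> y = (\<Prod>i\<in>UNIV. gamma_density (\<alpha> $ i) (y $ i))"

definition gamma_measure :: "real ^ 'n \<Rightarrow> (real ^ 'n) measure" where
  "gamma_measure \<alpha> = density lborel (\<lambda>y. ennreal (gamma_prod \<alpha> y))"

lemma borel_measurable_gamma_prod [measurable]: "gamma_prod \<alpha> \<in> borel_measurable borel"
  unfolding gamma_prod_def[abs_def] by measurable

lemma sets_gamma_measure [simp, measurable_cong]: "sets (gamma_measure \<alpha>) = sets borel"
  by (simp add: gamma_measure_def)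

lemma space_gamma_measure [simp]: "space (gamma_measure \<alpha>) = UNIV"
  by (simp add: gamma_measure_def)

lemma gamma_prod_not_in_orthant: "y \<notin> orthant \<Longrightarrow> gamma_prod \<alpha> y = 0"
  by (auto simp: orthant_def gamma_prod_def gamma_density_def)

definition upd :: "'n \<Rightarrow> real ^ 'n \<Rightarrow> real \<Rightarrow> real ^ 'n" where
  "upd i y t = (\<chi> j. if j = i then t else y $ j)"

lemma upd_nth [simp]: "upd i y t $ j = (if j = i then t else y $ j)"
  by (simp add: upd_def)

lemma upd_same [simp]: "upd i y (y $ i) = y"
  by (simp add: vec_eq_iff)

lemma upd_upd [simp]: "upd i (upd i y s) t = upd i y t"
  by (simp add: vec_eq_iff)

lemma measurable_upd [measurable]:
  fixes f :: "'b \<Rightarrow> real ^ 'n"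
  assumes "f \<in> borel_measurable M" "g \<in> borel_measurable M"
  shows "(\<lambda>x. upd i (f x) (g x)) \<in> borel_measurable M"
proof -
  have "continuous_on UNIV (\<lambda>z :: (real ^ 'n) \<times> real. upd i (fst z) (snd z))"
    unfolding upd_def
  proof (rule continuous_on_vec_lambda)
    show "continuous_on UNIV (\<lambda>z :: (real ^ 'n) \<times> real. if j = i then snd z else fst z $ j)" for j
      by (cases "j = i") (auto intro!: continuous_intros)
  qed
  from measurable_compose[OF borel_measurable_Pair[OF assms] borel_measurable_continuous_onI[OF this]]
  show ?thesis by simp
qed

lemma borel_measurable_fst_snd:
  "(fst :: 'a::topological_space \<times> 'b::topological_space \<Rightarrow> 'a) \<in> borel_measurable borel"
  "(snd :: 'a \<times> 'b \<Rightarrow> 'b) \<in> borel_measurable borel"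
  by (intro borel_measurable_continuous_onI continuous_intros)+

text \<open>
  A transposition of two coordinates of the product space, which preserves Lebesgue measure.
\<close>

lemma nn_integral_swap_coordinate:
  fixes \<Phi> :: "real ^ 'n \<Rightarrow> real \<Rightarrow> ennreal"
  assumes [measurable]: "case_prod \<Phi> \<in> borel_measurable (borel \<Otimes>\<^sub>M borel)"
  shows "(\<integral>\<^sup>+y. \<integral>\<^sup>+t. \<Phi> y t \<partial>lborel \<partial>lborel) = (\<integral>\<^sup>+y. \<integral>\<^sup>+t. \<Phi> (upd i y t) (y $ i) \<partial>lborel \<partial>lborel)"
proof -
  define T where "T = (\<lambda>z :: (real ^ 'n) \<times> real. (upd i (fst z) (snd z), fst z $ i))"
  have lin: "linear T"
    by (rule linearI) (auto simp: T_def vec_eq_iff)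
  have T: "distr lborel borel T = lborel"
  proof (rule lborel_distr_Basis_involution[OF lin])
    show "T (T x) = x" for x by (cases x) (simp add: T_def)
    fix b :: "(real ^ 'n) \<times> real" assume "b \<in> Basis"
    then consider j where "b = (axis j 1, 0)" | "b = (0, 1)"
      by (auto simp: Basis_prod_def Basis_vec_def)
    then show "T b \<in> Basis"
    proof cases
      case 1
      have "T b = (if j = i then (0, 1) else (axis j 1, 0))"
        by (auto simp: 1 T_def vec_eq_iff axis_def)
      then show ?thesis by (auto simp: Basis_prod_def axis_in_Basis)
    next
      case 2
      have "T b = (axis i 1, 0)"
        by (auto simp: 2 T_def vec_eq_iff axis_def)
      then show ?thesis by (auto simp: Basis_prod_def axis_in_Basis)
    qed
  qed
  have [measurable]: "T \<in> borel_measurable borel"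
    using lin by (intro borel_measurable_continuous_onI linear_continuous_on) (simp add: linear_conv_bounded_linear)
  have m: "case_prod \<Phi> \<in> borel_measurable borel"
    using assms by (simp add: borel_prod)
  have "(\<integral>\<^sup>+y. \<integral>\<^sup>+t. \<Phi> y t \<partial>lborel \<partial>lborel) = (\<integral>\<^sup>+z. case_prod \<Phi> z \<partial>lborel)"
    by (subst lborel_prod[symmetric]) (subst lborel.nn_integral_fst[symmetric], auto)
  also have "\<dots> = (\<integral>\<^sup>+z. case_prod \<Phi> z \<partial>distr lborel borel T)"
    by (simp only: T)
  also have "\<dots> = (\<integral>\<^sup>+z. case_prod \<Phi> (T z) \<partial>lborel)"
    using m by (intro nn_integral_distr) auto
  also have "\<dots> = (\<integral>\<^sup>+z. (\<lambda>(y, t). \<Phi> (upd i y t) (y $ i)) z \<partial>(lborel \<Otimes>\<^sub>M lborel))"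
    by (simp add: T_def lborel_prod split_beta)
  also have "\<dots> = (\<integral>\<^sup>+y. \<integral>\<^sup>+t. \<Phi> (upd i y t) (y $ i) \<partial>lborel \<partial>lborel)"
    by (subst lborel.nn_integral_fst[symmetric]) auto
  finally show ?thesis .
qed

text \<open>
  Resampling of the coordinates in \<open>J\<close> from an independent copy. Keeping the replaced values in the second
  component makes it an involution that preserves the joint law.
\<close>

definition exchange :: "'n set \<Rightarrow> (real ^ 'n) \<times> (real ^ 'n) \<Rightarrow> (real ^ 'n) \<times> (real ^ 'n)" where
  "exchange J z = ((\<chi> j. if j \<in> J then snd z $ j else fst z $ j), (\<chi> j. if j \<in> J then fst z $ j else snd z $ j))"

lemma exchange_exchange: "exchange J (exchange K z) = exchange (sym_diff J K) z"
  by (auto simp: exchange_def vec_eq_iff)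

lemma exchange_empty [simp]: "exchange {} z = z"
  by (simp add: exchange_def)

lemma fst_exchange_UNIV [simp]: "fst (exchange UNIV z) = snd z"
  by (simp add: exchange_def)

lemma fst_exchange_singleton: "fst (exchange {i} z) = upd i (fst z) (snd z $ i)"
  by (simp add: exchange_def vec_eq_iff)

lemma linear_exchange: "linear (exchange J)"
  by (rule linearI) (auto simp: exchange_def vec_eq_iff)

lemma measurable_exchange [measurable]: "exchange J \<in> borel_measurable borel"
  using linear_exchange[of J]
  by (intro borel_measurable_continuous_onI linear_continuous_on) (simp add: linear_conv_bounded_linear)

lemma distr_exchange_lborel:
  fixes J :: "'n::finite set"
  shows "distr lborel borel (exchange J) = lborel"
proof (rule lborel_distr_Basis_involution[OF linear_exchange])
  show "exchange J (exchange J z) = z" for z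
    by (simp add: exchange_exchange)
  fix b :: "(real ^ 'n) \<times> (real ^ 'n)" assume "b \<in> Basis"
  then consider j where "b = (axis j 1, 0)" | j where "b = (0, axis j 1)"
    by (auto simp: Basis_prod_def Basis_vec_def)
  then show "exchange J b \<in> Basis"
  proof cases
    case 1
    have "exchange J b = (if j \<in> J then (0, axis j 1) else (axis j 1, 0))"
      by (auto simp: 1 exchange_def vec_eq_iff axis_def)
    then show ?thesis by (auto simp: Basis_prod_def axis_in_Basis)
  next
    case 2
    have "exchange J b = (if j \<in> J then (axis j 1, 0) else (0, axis j 1))"
      by (auto simp: 2 exchange_def vec_eq_iff axis_def)
    then show ?thesis by (auto simp: Basis_prod_def axis_in_Basis)
  qed
qed

lemma gamma_prod_exchange:
  "gamma_prod \<alpha> (fst (exchange J z)) * gamma_prod \<alpha> (snd (exchange J z)) = gamma_prod \<alpha> (fst z) * gamma_prod \<alpha> (snd z)"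
  unfolding gamma_prod_def prod.distrib[symmetric] by (intro prod.cong) (auto simp: exchange_def)

context
  fixes \<alpha> :: "real ^ 'n"
  assumes alpha_pos: "\<And>i. 0 < \<alpha> $ i"
begin

lemma gamma_prod_nonneg: "0 \<le> gamma_prod \<alpha> y"
  unfolding gamma_prod_def by (intro prod_nonneg gamma_density_nonneg ballI alpha_pos)

lemma nn_integral_gamma_marginal:
  assumes [measurable]: "h \<in> borel_measurable borel"
  shows "(\<integral>\<^sup>+y. h (y $ i) \<partial>gamma_measure \<alpha>) = (\<integral>\<^sup>+t. ennreal (gamma_density (\<alpha> $ i) t) * h t \<partial>lborel)"
proof -
  have "(\<integral>\<^sup>+y. h (y $ i) \<partial>gamma_measure \<alpha>) = (\<integral>\<^sup>+y. ennreal (gamma_prod \<alpha> y) * h (y $ i) \<partial>lborel)"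
    unfolding gamma_measure_def by (rule nn_integral_density) auto
  also have "\<dots> = (\<integral>\<^sup>+y. (\<Prod>j\<in>UNIV. ennreal (gamma_density (\<alpha> $ j) (y $ j)) * (if j = i then h (y $ j) else 1)) \<partial>lborel)"
    by (simp add: gamma_prod_def prod.distrib prod_ennreal gamma_density_nonneg alpha_pos)
  also have "\<dots> = (\<Prod>j\<in>UNIV. \<integral>\<^sup>+t. ennreal (gamma_density (\<alpha> $ j) t) * (if j = i then h t else 1) \<partial>lborel)"
    by (rule nn_integral_lborel_vec_prod) auto
  also have "\<dots> = (\<Prod>j\<in>UNIV. if j = i then (\<integral>\<^sup>+t. ennreal (gamma_density (\<alpha> $ j) t) * h t \<partial>lborel) else 1)"
    using nn_integral_gamma_density[OF alpha_pos] by (intro prod.cong) auto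
  finally show ?thesis by simp
qed

lemma prob_space_gamma_measure: "prob_space (gamma_measure \<alpha>)"
proof
  obtain i :: 'n where True by simp
  have "emeasure (gamma_measure \<alpha>) (space (gamma_measure \<alpha>)) = (\<integral>\<^sup>+y. 1 \<partial>gamma_measure \<alpha>)"
    by simp
  also have "\<dots> = 1"
    using nn_integral_gamma_marginal[of "\<lambda>_. 1" i] nn_integral_gamma_density[OF alpha_pos] by simp
  finally show "emeasure (gamma_measure \<alpha>) (space (gamma_measure \<alpha>)) = 1" .
qed

lemma pair_gamma_measure:
  "gamma_measure \<alpha> \<Otimes>\<^sub>M gamma_measure \<alpha> = density lborel (\<lambda>z. ennreal (gamma_prod \<alpha> (fst z) * gamma_prod \<alpha> (snd z)))"
proof -
  interpret prob_space "gamma_measure \<alpha>" by (rule prob_space_gamma_measure)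
  have "sigma_finite_measure (density lborel (\<lambda>y. ennreal (gamma_prod \<alpha> y)))"
    using sigma_finite_measure_axioms by (simp add: gamma_measure_def)
  then show ?thesis
    unfolding gamma_measure_def
    by (subst pair_measure_density) (auto simp: sigma_finite_lborel lborel_prod case_prod_unfold ennreal_mult gamma_prod_nonneg)
qed

lemma distr_exchange_gamma:
  "distr (gamma_measure \<alpha> \<Otimes>\<^sub>M gamma_measure \<alpha>) borel (exchange J) = gamma_measure \<alpha> \<Otimes>\<^sub>M gamma_measure \<alpha>"
proof -
  note [measurable] = borel_measurable_fst_snd[where 'a = "real ^ 'n" and 'b = "real ^ 'n"]
  let ?p = "\<lambda>z. ennreal (gamma_prod \<alpha> (fst z) * gamma_prod \<alpha> (snd z))"
  have "distr (density lborel ?p) borel (exchange J) = distr (density lborel (\<lambda>z. ?p (exchange J z))) borel (exchange J)"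
    by (simp only: gamma_prod_exchange)
  also have "\<dots> = density (distr lborel borel (exchange J)) ?p"
    by (rule density_distr[symmetric]) auto
  finally show ?thesis
    by (simp add: pair_gamma_measure distr_exchange_lborel)
qed

abbreviation gamma_pair :: "((real ^ 'n) \<times> (real ^ 'n)) measure" where
  "gamma_pair \<equiv> gamma_measure \<alpha> \<Otimes>\<^sub>M gamma_measure \<alpha>"

lemma
  fixes h :: "(real ^ 'n) \<times> (real ^ 'n) \<Rightarrow> real"
  assumes h: "h \<in> borel_measurable borel"
  shows integrable_exchange: "integrable gamma_pair h \<Longrightarrow> integrable gamma_pair (\<lambda>z. h (exchange J z))"
    and integral_exchange: "(LINT z|gamma_pair. h (exchange J z)) = (LINT z|gamma_pair. h z)"
proof -
  have sets: "sets gamma_pair = sets borel"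
    by (simp only: pair_gamma_measure sets_density sets_lborel)
  have [measurable]: "exchange J \<in> measurable gamma_pair borel"
    using measurable_exchange by (simp add: measurable_cong_sets[OF sets refl])
  have "integrable gamma_pair (\<lambda>z. h (exchange J z)) \<longleftrightarrow> integrable (distr gamma_pair borel (exchange J)) h"
    using h by (subst integrable_distr_eq) auto
  then show "integrable gamma_pair h \<Longrightarrow> integrable gamma_pair (\<lambda>z. h (exchange J z))"
    by (simp only: distr_exchange_gamma)
  have "(LINT z|gamma_pair. h (exchange J z)) = (LINT z|distr gamma_pair borel (exchange J). h z)"
    using h by (subst integral_distr) auto
  then show "(LINT z|gamma_pair. h (exchange J z)) = (LINT z|gamma_pair. h z)"
    by (simp only: distr_exchange_gamma)
qed

text \<open>
  With an independent copy, let \<open>v J\<close> be the value of \<open>u\<close> after the coordinates in \<open>J\<close> have been resampled.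
  The mean \<open>A J\<close> of \<open>v {} * v J\<close> interpolates between the second moment of \<open>u\<close> (\<open>J = {}\<close>) and the square of
  its mean (\<open>J = UNIV\<close>). Resampling one more coordinate \<open>i\<close> lowers \<open>A\<close> by half the mean of
  \<open>(v {} - v {i}) * (v J - v (insert i J))\<close>, because exchanges preserve the joint law. Both
  factors have the same second moment, which \<open>2 x y \<le> x\<^sup>2 + y\<^sup>2\<close> turns into the summand for \<open>i\<close>.
\<close>

lemma efron_stein:
  fixes u :: "real ^ 'n \<Rightarrow> real"
  assumes [measurable]: "u \<in> borel_measurable borel"
    and u2: "integrable (gamma_measure \<alpha>) (\<lambda>y. (u y)\<^sup>2)"
  shows "Var (gamma_measure \<alpha>) u
    \<le> (\<Sum>i\<in>UNIV. (LINT z|gamma_pair. (u (fst z) - u (fst (exchange {i} z)))\<^sup>2) / 2)"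
    and "integrable gamma_pair (\<lambda>z. (u (fst z) - u (fst (exchange {i} z)))\<^sup>2)"
proof -
  interpret \<gamma>: prob_space "gamma_measure \<alpha>" by (rule prob_space_gamma_measure)
  interpret pair_prob_space "gamma_measure \<alpha>" "gamma_measure \<alpha>" ..
  have sets: "sets gamma_pair = sets borel"
    by (simp only: pair_gamma_measure sets_density sets_lborel)
  have meas [simp]: "h \<in> borel_measurable gamma_pair \<longleftrightarrow> h \<in> borel_measurable borel" for h :: "_ \<Rightarrow> real"
    by (simp add: measurable_cong_sets[OF sets refl])
  note [measurable] = borel_measurable_fst_snd[where 'a = "real ^ 'n" and 'b = "real ^ 'n"]
  define v where "v = (\<lambda>J z. u (fst (exchange J z)))"
  have v_m [measurable]: "v J \<in> borel_measurable borel" for J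
    unfolding v_def by measurable
  have v0: "v {} z = u (fst z)" for z by (simp add: v_def)
  have v_ex: "v J (exchange K z) = v (sym_diff J K) z" for J K z
    by (simp add: v_def exchange_exchange)
  have u1: "integrable (gamma_measure \<alpha>) u"
    by (rule \<gamma>.square_integrable_imp_integrable[OF _ u2]) simp
  have fst_int: "integrable gamma_pair (\<lambda>z. h (fst z))" and fst_eq: "(LINT z|gamma_pair. h (fst z)) = (LINT y|gamma_measure \<alpha>. h y)"
    if "integrable (gamma_measure \<alpha>) h" for h :: "real ^ 'n \<Rightarrow> real"
  proof -
    have d: "distr gamma_pair (gamma_measure \<alpha>) fst = gamma_measure \<alpha>"
      by (rule \<gamma>.distr_pair_fst)
    have hm: "h \<in> borel_measurable (gamma_measure \<alpha>)" using that by auto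
    show "integrable gamma_pair (\<lambda>z. h (fst z))"
      by (rule integrable_distr[OF measurable_fst]) (simp only: d that)
    have "(LINT y|distr gamma_pair (gamma_measure \<alpha>) fst. h y) = (LINT z|gamma_pair. h (fst z))"
      by (rule integral_distr[OF measurable_fst hm])
    then show "(LINT z|gamma_pair. h (fst z)) = (LINT y|gamma_measure \<alpha>. h y)"
      by (simp only: d)
  qed
  have v2: "integrable gamma_pair (\<lambda>z. (v J z)\<^sup>2)" for J
    using integrable_exchange[of "\<lambda>z. (u (fst z))\<^sup>2" J] fst_int[OF u2] by (simp add: v_def)
  have vv: "integrable gamma_pair (\<lambda>z. v J z * v K z)" for J K
  proof (rule Bochner_Integration.integrable_bound)
    show "integrable gamma_pair (\<lambda>z. (v J z)\<^sup>2 + (v K z)\<^sup>2)"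
      using v2 by simp
    have "\<bar>a * b\<bar> \<le> a\<^sup>2 + b\<^sup>2" for a b :: real
    proof -
      have "2 * (\<bar>a\<bar> * \<bar>b\<bar>) \<le> a\<^sup>2 + b\<^sup>2"
        using sum_squares_bound[of "\<bar>a\<bar>" "\<bar>b\<bar>"] by simp
      then show ?thesis using abs_ge_zero[of "a * b"] unfolding abs_mult by linarith
    qed
    then show "AE z in gamma_pair. norm (v J z * v K z) \<le> norm ((v J z)\<^sup>2 + (v K z)\<^sup>2)"
      by (intro AE_I2) simp
  qed simp
  have dd: "integrable gamma_pair (\<lambda>z. (v J z - v K z) * (v L z - v M z))" for J K L M
    using vv by (simp add: algebra_simps)
  then have d2: "integrable gamma_pair (\<lambda>z. (v J z - v K z)\<^sup>2)" for J K
    by (simp add: power2_eq_square)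
  define A where "A = (\<lambda>J. LINT z|gamma_pair. v {} z * v J z)"
  define V where "V = (\<lambda>i. (LINT z|gamma_pair. (v {} z - v {i} z)\<^sup>2) / 2)"
  have step: "A J - A (insert i J) \<le> V i" if i: "i \<notin> J" for i J
  proof -
    have sd: "sym_diff J {i} = insert i J" "sym_diff (insert i J) {i} = J" "sym_diff {i} J = insert i J" "sym_diff {} J = J" "sym_diff {} {i} = {i}"
      using i by auto
    have A1: "A J = (LINT z|gamma_pair. v {i} z * v (insert i J) z)"
      unfolding A_def by (subst integral_exchange[of "\<lambda>z. v {} z * v J z" "{i}", symmetric]) (measurable, simp only: v_ex sd)
    have A2: "A (insert i J) = (LINT z|gamma_pair. v {i} z * v J z)"
      unfolding A_def by (subst integral_exchange[of "\<lambda>z. v {} z * v (insert i J) z" "{i}", symmetric]) (measurable, simp only: v_ex sd)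
    have A3: "(LINT z|gamma_pair. (v J z - v (insert i J) z)\<^sup>2) = 2 * V i"
      unfolding V_def by (subst integral_exchange[of "\<lambda>z. (v {} z - v {i} z)\<^sup>2" J, symmetric]) (measurable, simp add: v_ex sd)
    have "2 * (A J - A (insert i J)) = (LINT z|gamma_pair. v {} z * v J z) + (LINT z|gamma_pair. v {i} z * v (insert i J) z)
        - (LINT z|gamma_pair. v {} z * v (insert i J) z) - (LINT z|gamma_pair. v {i} z * v J z)"
      using A1 A2 by (simp add: A_def)
    also have "\<dots> = (LINT z|gamma_pair. v {} z * v J z + v {i} z * v (insert i J) z - v {} z * v (insert i J) z - v {i} z * v J z)"
      using vv by simp
    also have "\<dots> \<le> (LINT z|gamma_pair. ((v {} z - v {i} z)\<^sup>2 + (v J z - v (insert i J) z)\<^sup>2) / 2)"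
    proof (rule integral_mono)
      fix z
      have "(v {} z - v {i} z) * (v J z - v (insert i J) z) * 2 \<le> (v {} z - v {i} z)\<^sup>2 + (v J z - v (insert i J) z)\<^sup>2"
        using sum_squares_bound[of "v {} z - v {i} z" "v J z - v (insert i J) z"] by (simp add: algebra_simps)
      then show "v {} z * v J z + v {i} z * v (insert i J) z - v {} z * v (insert i J) z - v {i} z * v J z
          \<le> ((v {} z - v {i} z)\<^sup>2 + (v J z - v (insert i J) z)\<^sup>2) / 2"
        by (simp add: algebra_simps)
    qed (use vv d2 in auto)
    also have "\<dots> = 2 * V i"
      using d2 A3 by (simp add: V_def)
    finally show ?thesis by simp
  qed
  have ind: "A {} - A J \<le> (\<Sum>i\<in>J. V i)" for J
    using finite[of J]
  proof induction
    case (insert i J)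
    then show ?case using step[of i J] by simp
  qed simp
  have A0: "A {} = (LINT y|gamma_measure \<alpha>. (u y)\<^sup>2)"
    using fst_eq[OF u2] by (simp add: A_def v0 power2_eq_square)
  have AU: "A UNIV = (LINT y|gamma_measure \<alpha>. u y)\<^sup>2"
  proof -
    have "integrable gamma_pair (\<lambda>(x, y). u x * u y)"
      using vv[of "{}" UNIV] by (simp add: v_def case_prod_unfold)
    from integral_fst[OF this] show ?thesis
      by (simp add: A_def v_def case_prod_unfold power2_eq_square)
  qed
  show "Var (gamma_measure \<alpha>) u
    \<le> (\<Sum>i\<in>UNIV. (LINT z|gamma_pair. (u (fst z) - u (fst (exchange {i} z)))\<^sup>2) / 2)"
    using ind[of UNIV] by (simp add: A0 AU Var_def V_def v_def)
  show "integrable gamma_pair (\<lambda>z. (u (fst z) - u (fst (exchange {i} z)))\<^sup>2)"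
    using d2[of "{}" "{i}"] by (simp add: v_def)
qed

end

section \<open>The Poincare inequality for product Gamma measures\<close>

lemma AE_ftc_between_coordinate:
  fixes u :: "real ^ 'n \<Rightarrow> real" and U :: "real ^ 'n \<Rightarrow> real ^ 'n"
  assumes wg: "weak_gradient orthant u U"
    and [measurable]: "u \<in> borel_measurable borel" "U \<in> borel_measurable borel"
    and u0: "\<And>x. x \<notin> orthant \<Longrightarrow> u x = 0" and U0: "\<And>x. x \<notin> orthant \<Longrightarrow> U x = 0"
  shows "AE y in lborel. y \<in> orthant \<longrightarrow> (AE t in lborel. y $ i < t \<longrightarrow>
    ftc_between (\<lambda>t. u (upd i y t)) (\<lambda>t. U (upd i y t) $ i) (y $ i) t)"
proof -
  define H where "H = (\<lambda>y r. (\<Sum>j\<in>{i}. scale {i} r y $ j * U (scale {i} r y) $ j) / r)"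
  have "AE y in lborel. AE q in lborel. y \<in> orthant \<longrightarrow> 1 < q \<longrightarrow>
      ftc_between (\<lambda>r. u (scale {i} r y)) (H y) 1 q"
    unfolding H_def by (rule AE_ftc_between_scale[OF wg assms(2,3) u0 U0]) auto
  then show ?thesis
  proof eventually_elim
    case (elim y)
    show ?case
    proof
      assume y: "y \<in> orthant"
      then have c: "0 < y $ i" by (simp add: orthant_def)
      have sc: "scale {i} r y = upd i y (y $ i * r)" for r
        by (simp add: vec_eq_iff mult.commute)
      have "AE q in lborel. 1 < q \<longrightarrow> ftc_between (\<lambda>r. u (upd i y (y $ i * r))) (H y) 1 q"
        using elim by (simp only: y simp_thms sc)
      from AE_ftc_between_rescale[OF this c, of "\<lambda>t. U (upd i y t) $ i"]
      have "AE q in lborel. y $ i * 1 < q \<longrightarrow> ftc_between (\<lambda>t. u (upd i y t)) (\<lambda>t. U (upd i y t) $ i) (y $ i * 1) q"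
        by (simp add: H_def sc)
      then show "AE t in lborel. y $ i < t \<longrightarrow> ftc_between (\<lambda>t. u (upd i y t)) (\<lambda>t. U (upd i y t) $ i) (y $ i) t"
        by simp
    qed
  qed
qed

text \<open>
  The Cauchy-Schwarz inequality, in a form that allows an infinite right-hand side.
\<close>

lemma ftc_between_square_le:
  assumes ftc: "ftc_between F h p q" and pq: "p < q" and [measurable]: "h \<in> borel_measurable borel"
  shows "ennreal ((F q - F p)\<^sup>2) \<le> ennreal (q - p) * (\<integral>\<^sup>+r. ennreal (if p \<le> r \<and> r \<le> q then (h r)\<^sup>2 else 0) \<partial>lborel)"
proof (cases "(\<integral>\<^sup>+r. ennreal (if p \<le> r \<and> r \<le> q then (h r)\<^sup>2 else 0) \<partial>lborel) = \<infinity>")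
  case True
  then show ?thesis using pq by (simp add: ennreal_mult_top)
next
  case False
  define k where "k = (\<lambda>r. if p \<le> r \<and> r \<le> q then h r else 0)"
  have k: "integrable lborel k" and inc: "F q - F p = (LINT r|lborel. k r)"
    using ftc by (simp_all add: ftc_between_def k_def)
  have k2_eq: "(if p \<le> r \<and> r \<le> q then (h r)\<^sup>2 else 0) = (k r)\<^sup>2" for r
    by (simp add: k_def)
  have k2: "integrable lborel (\<lambda>r. (k r)\<^sup>2)"
    using False k unfolding k2_eq by (intro integrableI_bounded) (auto simp: top.not_eq_extremum)
  define m where "m = (LINT r|lborel. k r) / (q - p)"
  have i1: "integrable lborel (\<lambda>r. indicator {p..q} r * m\<^sup>2)"
    by (intro integrable_mult_left integrable_real_indicator) (auto simp: emeasure_lborel_Icc_eq)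
  have "0 \<le> (LINT r|lborel. (k r - indicator {p..q} r * m)\<^sup>2)"
    by simp
  also have "(\<lambda>r. (k r - indicator {p..q} r * m)\<^sup>2) = (\<lambda>r. (k r)\<^sup>2 - 2 * m * k r + indicator {p..q} r * m\<^sup>2)"
    by (auto simp: fun_eq_iff k_def indicator_def power2_eq_square algebra_simps)
  also have "(LINT r|lborel. (k r)\<^sup>2 - 2 * m * k r + indicator {p..q} r * m\<^sup>2)
      = (LINT r|lborel. (k r)\<^sup>2) - 2 * m * (LINT r|lborel. k r) + (q - p) * m\<^sup>2"
    using k k2 i1 pq by simp
  also have "\<dots> = (LINT r|lborel. (k r)\<^sup>2) - (LINT r|lborel. k r)\<^sup>2 / (q - p)"
  proof -
    define D where "D = q - p"
    have "0 < D" using pq by (simp add: D_def)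
    then show ?thesis
      unfolding m_def D_def[symmetric] by (simp add: power2_eq_square field_simps)
  qed
  finally have "(LINT r|lborel. k r)\<^sup>2 \<le> (q - p) * (LINT r|lborel. (k r)\<^sup>2)"
    using pq by (simp add: field_simps)
  then show ?thesis
    unfolding k2_eq using k2 pq
    by (subst nn_integral_eq_integral) (auto simp: inc ennreal_mult[symmetric] intro!: ennreal_leI)
qed

context
  fixes \<alpha> :: "real ^ 'n"
  assumes alpha_pos: "\<And>i. 0 < \<alpha> $ i"
begin

text \<open>
  After the Cauchy-Schwarz inequality on the segment from \<open>y $ i\<close> to \<open>t\<close>, the integral over the two end
  points of the segment with its inner point fixed is the kernel of \<open>gamma_kernel\<close>.
\<close>

lemma gamma_coordinate_energy:
  fixes u :: "real ^ 'n \<Rightarrow> real" and U :: "real ^ 'n \<Rightarrow> real ^ 'n"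
  assumes wg: "weak_gradient orthant u U"
    and [measurable]: "u \<in> borel_measurable borel" "U \<in> borel_measurable borel"
    and u0: "\<And>x. x \<notin> orthant \<Longrightarrow> u x = 0" and U0: "\<And>x. x \<notin> orthant \<Longrightarrow> U x = 0"
  shows "(\<integral>\<^sup>+y. \<integral>\<^sup>+t. ennreal (gamma_density (\<alpha> $ i) t) *
      ennreal (if y $ i < t then (u y - u (upd i y t))\<^sup>2 else 0) \<partial>lborel \<partial>gamma_measure \<alpha>)
    \<le> (\<integral>\<^sup>+y. ennreal (y $ i * (U y $ i)\<^sup>2) \<partial>gamma_measure \<alpha>)"
proof -
  note \<alpha>i = alpha_pos[of i]
  define g where "g = gamma_density (\<alpha> $ i)"
  define R where "R = (\<lambda>y :: real ^ 'n. \<Prod>j\<in>UNIV - {i}. gamma_density (\<alpha> $ j) (y $ j))"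
  have g0: "0 \<le> g t" for t unfolding g_def by (rule gamma_density_nonneg[OF \<alpha>i])
  have R0: "0 \<le> R y" for y unfolding R_def by (intro prod_nonneg gamma_density_nonneg ballI alpha_pos)
  have [measurable]: "g \<in> borel_measurable borel" "R \<in> borel_measurable borel"
    unfolding g_def R_def by measurable
  have gR: "gamma_prod \<alpha> y = g (y $ i) * R y" for y
    unfolding gamma_prod_def g_def R_def by (subst prod.remove[of _ i]) auto
  have R_upd: "R (upd i y t) = R y" for y t
    unfolding R_def by (intro prod.cong) auto
  \<comment> \<open>The end points are \<open>y $ i\<close> and \<open>t\<close>, the inner point is \<open>\<tau>\<close>; swapping \<open>y $ i\<close> with \<open>\<tau>\<close> makes the inner point the one that is integrated last.\<close>
  define \<Psi> where "\<Psi> = (\<lambda>y \<tau> t. R y * (U (upd i y \<tau>) $ i)\<^sup>2 * (if y $ i \<le> \<tau> \<and> \<tau> \<le> t then (t - y $ i) * g (y $ i) * g t else 0))"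
  have \<Psi>_m [measurable]: "(\<lambda>w. \<Psi> (a w) (b w) (c w)) \<in> borel_measurable M"
    if [measurable]: "a \<in> borel_measurable M" "b \<in> borel_measurable M" "c \<in> borel_measurable M" for a b c and M :: "'z measure"
    unfolding \<Psi>_def by measurable
  have coordinate_ftc: "AE y in lborel. y \<in> orthant \<longrightarrow> (AE t in lborel. y $ i < t \<longrightarrow>
    ftc_between (\<lambda>t. u (upd i y t)) (\<lambda>t. U (upd i y t) $ i) (y $ i) t)"
    by (rule AE_ftc_between_coordinate[OF wg assms(2,3)]) (auto intro: u0 U0)
  have "(\<integral>\<^sup>+y. \<integral>\<^sup>+t. ennreal (g t) * ennreal (if y $ i < t then (u y - u (upd i y t))\<^sup>2 else 0) \<partial>lborel \<partial>gamma_measure \<alpha>)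
    = (\<integral>\<^sup>+y. ennreal (gamma_prod \<alpha> y) * (\<integral>\<^sup>+t. ennreal (g t) * ennreal (if y $ i < t then (u y - u (upd i y t))\<^sup>2 else 0) \<partial>lborel) \<partial>lborel)"
    unfolding gamma_measure_def by (rule nn_integral_density) auto
  also have "\<dots> \<le> (\<integral>\<^sup>+y. \<integral>\<^sup>+t. \<integral>\<^sup>+\<tau>. ennreal (\<Psi> y \<tau> t) \<partial>lborel \<partial>lborel \<partial>lborel)"
  proof (rule nn_integral_mono_AE)
    show "AE y in lborel. ennreal (gamma_prod \<alpha> y) * (\<integral>\<^sup>+t. ennreal (g t) * ennreal (if y $ i < t then (u y - u (upd i y t))\<^sup>2 else 0) \<partial>lborel)
        \<le> (\<integral>\<^sup>+t. \<integral>\<^sup>+\<tau>. ennreal (\<Psi> y \<tau> t) \<partial>lborel \<partial>lborel)"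
      using coordinate_ftc
    proof eventually_elim
      case (elim y)
      show ?case
      proof (cases "y \<in> orthant")
        case True
        then have ae: "AE t in lborel. y $ i < t \<longrightarrow> ftc_between (\<lambda>t. u (upd i y t)) (\<lambda>t. U (upd i y t) $ i) (y $ i) t"
          using elim by simp
        have "ennreal (gamma_prod \<alpha> y) * (\<integral>\<^sup>+t. ennreal (g t) * ennreal (if y $ i < t then (u y - u (upd i y t))\<^sup>2 else 0) \<partial>lborel)
          = (\<integral>\<^sup>+t. ennreal (gamma_prod \<alpha> y) * (ennreal (g t) * ennreal (if y $ i < t then (u y - u (upd i y t))\<^sup>2 else 0)) \<partial>lborel)"
          by (rule nn_integral_cmult[symmetric]) auto
        also have "\<dots> \<le> (\<integral>\<^sup>+t. \<integral>\<^sup>+\<tau>. ennreal (\<Psi> y \<tau> t) \<partial>lborel \<partial>lborel)"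
        proof (rule nn_integral_mono_AE)
          show "AE t in lborel. ennreal (gamma_prod \<alpha> y) * (ennreal (g t) * ennreal (if y $ i < t then (u y - u (upd i y t))\<^sup>2 else 0))
            \<le> (\<integral>\<^sup>+\<tau>. ennreal (\<Psi> y \<tau> t) \<partial>lborel)"
            using ae
          proof eventually_elim
            case (elim t)
            show ?case
            proof (cases "y $ i < t")
              case True
              have "ennreal ((u y - u (upd i y t))\<^sup>2)
                  \<le> ennreal (t - y $ i) * (\<integral>\<^sup>+\<tau>. ennreal (if y $ i \<le> \<tau> \<and> \<tau> \<le> t then (U (upd i y \<tau>) $ i)\<^sup>2 else 0) \<partial>lborel)"
                using ftc_between_square_le[OF elim[rule_format, OF True] True] by (simp add: power2_commute)
              then have "ennreal (gamma_prod \<alpha> y) * (ennreal (g t) * ennreal ((u y - u (upd i y t))\<^sup>2))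
                \<le> ennreal (gamma_prod \<alpha> y) * (ennreal (g t) * (ennreal (t - y $ i) * (\<integral>\<^sup>+\<tau>. ennreal (if y $ i \<le> \<tau> \<and> \<tau> \<le> t then (U (upd i y \<tau>) $ i)\<^sup>2 else 0) \<partial>lborel)))"
                by (intro mult_left_mono) auto
              also have "\<dots> = (\<integral>\<^sup>+\<tau>. ennreal (gamma_prod \<alpha> y * g t * (t - y $ i)) * ennreal (if y $ i \<le> \<tau> \<and> \<tau> \<le> t then (U (upd i y \<tau>) $ i)\<^sup>2 else 0) \<partial>lborel)"
                using True g0[of t] g0[of "y $ i"] R0[of y]
                by (subst nn_integral_cmult) (auto simp: gR ennreal_mult mult.assoc)
              also have "\<dots> = (\<integral>\<^sup>+\<tau>. ennreal (\<Psi> y \<tau> t) \<partial>lborel)"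
                using True g0[of t] g0[of "y $ i"] R0[of y]
                by (intro nn_integral_cong) (auto simp: \<Psi>_def gR ennreal_mult[symmetric] mult_ac)
              finally show ?thesis using True by simp
            qed simp
          qed
        qed
        finally show ?thesis .
      qed (simp add: gamma_prod_not_in_orthant)
    qed
  qed
  also have "\<dots> = (\<integral>\<^sup>+y. \<integral>\<^sup>+\<tau>. \<integral>\<^sup>+t. ennreal (\<Psi> y \<tau> t) \<partial>lborel \<partial>lborel \<partial>lborel)"
    by (intro nn_integral_cong lborel_pair.Fubini') measurable
  also have "\<dots> = (\<integral>\<^sup>+y. \<integral>\<^sup>+\<tau>. \<integral>\<^sup>+t. ennreal (\<Psi> (upd i y \<tau>) (y $ i) t) \<partial>lborel \<partial>lborel \<partial>lborel)"
    by (rule nn_integral_swap_coordinate[where \<Phi> = "\<lambda>y \<tau>. \<integral>\<^sup>+t. ennreal (\<Psi> y \<tau> t) \<partial>lborel"]) measurable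
  also have "\<dots> = (\<integral>\<^sup>+y. ennreal (gamma_prod \<alpha> y) * ennreal (y $ i * (U y $ i)\<^sup>2) \<partial>lborel)"
  proof (rule nn_integral_cong)
    fix y :: "real ^ 'n"
    show "(\<integral>\<^sup>+\<tau>. \<integral>\<^sup>+t. ennreal (\<Psi> (upd i y \<tau>) (y $ i) t) \<partial>lborel \<partial>lborel) = ennreal (gamma_prod \<alpha> y) * ennreal (y $ i * (U y $ i)\<^sup>2)"
    proof (cases "y \<in> orthant")
      case True
      then have yi: "0 < y $ i" by (simp add: orthant_def)
      have "(\<integral>\<^sup>+\<tau>. \<integral>\<^sup>+t. ennreal (\<Psi> (upd i y \<tau>) (y $ i) t) \<partial>lborel \<partial>lborel)
        = (\<integral>\<^sup>+\<tau>. \<integral>\<^sup>+t. ennreal (R y * (U y $ i)\<^sup>2) * ennreal (if \<tau> \<le> y $ i \<and> y $ i \<le> t then (t - \<tau>) * g \<tau> * g t else 0) \<partial>lborel \<partial>lborel)"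
        using R0 g0 by (intro nn_integral_cong) (auto simp: \<Psi>_def R_upd ennreal_mult[symmetric])
      also have "\<dots> = ennreal (R y * (U y $ i)\<^sup>2) * (\<integral>\<^sup>+\<tau>. \<integral>\<^sup>+t. ennreal (if \<tau> \<le> y $ i \<and> y $ i \<le> t then (t - \<tau>) * g \<tau> * g t else 0) \<partial>lborel \<partial>lborel)"
        by (simp add: nn_integral_cmult)
      also have "\<dots> = ennreal (R y * (U y $ i)\<^sup>2) * ennreal (y $ i * g (y $ i))"
        unfolding g_def by (simp only: gamma_kernel[OF \<alpha>i yi])
      also have "\<dots> = ennreal (gamma_prod \<alpha> y) * ennreal (y $ i * (U y $ i)\<^sup>2)"
        using R0[of y] g0[of "y $ i"] yi by (simp add: gR ennreal_mult[symmetric] mult_ac)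
      finally show ?thesis .
    qed (simp add: \<Psi>_def U0)
  qed
  also have "\<dots> = (\<integral>\<^sup>+y. ennreal (y $ i * (U y $ i)\<^sup>2) \<partial>gamma_measure \<alpha>)"
    unfolding gamma_measure_def by (rule nn_integral_density[symmetric]) auto
  finally show ?thesis by (simp only: g_def)
qed

text \<open>
  The difference \<open>u y - u (upd i y t)\<close> is symmetric under the exchange of \<open>y $ i\<close> and \<open>t\<close>, so half its mean
  square is the mean over \<open>y $ i < t\<close>, which the coordinate energy bounds.
\<close>

lemma gamma_poincare:
  fixes u :: "real ^ 'n \<Rightarrow> real" and U :: "real ^ 'n \<Rightarrow> real ^ 'n"
  assumes wg: "weak_gradient orthant u U"
    and [measurable]: "u \<in> borel_measurable borel" "U \<in> borel_measurable borel"
    and u0: "\<And>x. x \<notin> orthant \<Longrightarrow> u x = 0" and U0: "\<And>x. x \<notin> orthant \<Longrightarrow> U x = 0"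
    and u2: "integrable (gamma_measure \<alpha>) (\<lambda>y. (u y)\<^sup>2)"
    and energy: "\<And>i. integrable (gamma_measure \<alpha>) (\<lambda>y. y $ i * (U y $ i)\<^sup>2)"
  shows "Var (gamma_measure \<alpha>) u \<le> (\<Sum>i\<in>UNIV. LINT y|gamma_measure \<alpha>. y $ i * (U y $ i)\<^sup>2)"
proof -
  interpret \<gamma>: prob_space "gamma_measure \<alpha>" by (rule prob_space_gamma_measure[OF alpha_pos])
  interpret pair_prob_space "gamma_measure \<alpha>" "gamma_measure \<alpha>" ..
  let ?N = "gamma_measure \<alpha> \<Otimes>\<^sub>M gamma_measure \<alpha>"
  have sets: "sets ?N = sets borel"
    by (simp only: pair_gamma_measure[OF alpha_pos] sets_density sets_lborel)
  note [measurable] = borel_measurable_fst_snd[where 'a = "real ^ 'n" and 'b = "real ^ 'n"]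
  have "(LINT z|?N. (u (fst z) - u (fst (exchange {i} z)))\<^sup>2) / 2 \<le> (LINT y|gamma_measure \<alpha>. y $ i * (U y $ i)\<^sup>2)" for i
  proof -
    define d where "d = (\<lambda>z. (u (fst z) - u (upd i (fst z) (snd z $ i)))\<^sup>2)"
    have d_eq: "(u (fst z) - u (fst (exchange {i} z)))\<^sup>2 = d z" for z
      by (simp add: d_def fst_exchange_singleton)
    have d_int: "integrable ?N d"
      using efron_stein(2)[OF alpha_pos assms(2) u2, of i] unfolding d_eq .
    have d_m [measurable]: "d \<in> borel_measurable borel"
      using borel_measurable_integrable[OF d_int] by (simp only: measurable_cong_sets[OF sets refl])
    define d1 where "d1 = (\<lambda>z. ennreal (if fst z $ i < snd z $ i then d z else 0))"
    have d1_m [measurable]: "d1 \<in> borel_measurable borel"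
      unfolding d1_def by measurable
    have d1_ex: "d1 (exchange {i} z) = ennreal (if snd z $ i < fst z $ i then d z else 0)" for z
    proof -
      have "d (exchange {i} z) = d z"
        unfolding d_eq[symmetric] by (simp add: exchange_exchange power2_commute)
      then show ?thesis by (simp add: d1_def exchange_def)
    qed
    have "(\<integral>\<^sup>+z. ennreal (d z) \<partial>?N) = (\<integral>\<^sup>+z. d1 z + d1 (exchange {i} z) \<partial>?N)"
    proof (rule nn_integral_cong)
      fix z
      have "d z = 0" if "fst z $ i = snd z $ i"
        unfolding d_def that[symmetric] by simp
      then show "ennreal (d z) = d1 z + d1 (exchange {i} z)"
        unfolding d1_ex unfolding d1_def
        by (cases "fst z $ i" "snd z $ i" rule: linorder_cases) auto
    qed
    also have "\<dots> = (\<integral>\<^sup>+z. d1 z \<partial>?N) + (\<integral>\<^sup>+z. d1 (exchange {i} z) \<partial>?N)"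
      by (rule nn_integral_add) (simp_all add: measurable_cong_sets[OF sets refl])
    also have "(\<integral>\<^sup>+z. d1 (exchange {i} z) \<partial>?N) = (\<integral>\<^sup>+z. d1 z \<partial>distr ?N borel (exchange {i}))"
      by (rule nn_integral_distr[symmetric]) (simp_all add: measurable_cong_sets[OF sets refl])
    also have "\<dots> = (\<integral>\<^sup>+z. d1 z \<partial>?N)"
      by (simp only: distr_exchange_gamma[OF alpha_pos])
    finally have "(\<integral>\<^sup>+z. ennreal (d z) \<partial>?N) = 2 * (\<integral>\<^sup>+z. d1 z \<partial>?N)"
      by (simp add: mult_2)
    also have "(\<integral>\<^sup>+z. d1 z \<partial>?N) = (\<integral>\<^sup>+y. \<integral>\<^sup>+y'. d1 (y, y') \<partial>gamma_measure \<alpha> \<partial>gamma_measure \<alpha>)"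
      by (rule \<gamma>.nn_integral_fst[symmetric]) (simp only: measurable_cong_sets[OF sets refl] d1_m)
    also have "\<dots> = (\<integral>\<^sup>+y. \<integral>\<^sup>+t. ennreal (gamma_density (\<alpha> $ i) t) *
      ennreal (if y $ i < t then (u y - u (upd i y t))\<^sup>2 else 0) \<partial>lborel \<partial>gamma_measure \<alpha>)"
    proof (rule nn_integral_cong)
      fix y
      show "(\<integral>\<^sup>+y'. d1 (y, y') \<partial>gamma_measure \<alpha>) = (\<integral>\<^sup>+t. ennreal (gamma_density (\<alpha> $ i) t) *
        ennreal (if y $ i < t then (u y - u (upd i y t))\<^sup>2 else 0) \<partial>lborel)"
        unfolding d1_def d_def fst_conv snd_conv
        by (rule nn_integral_gamma_marginal[OF alpha_pos, where h = "\<lambda>t. ennreal (if y $ i < t then (u y - u (upd i y t))\<^sup>2 else 0)"]) measurable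
    qed
    also have "\<dots> \<le> (\<integral>\<^sup>+y. ennreal (y $ i * (U y $ i)\<^sup>2) \<partial>gamma_measure \<alpha>)"
      by (rule gamma_coordinate_energy[OF wg assms(2,3) u0 U0])
    finally have "(\<integral>\<^sup>+z. ennreal (d z) \<partial>?N) \<le> 2 * (\<integral>\<^sup>+y. ennreal (y $ i * (U y $ i)\<^sup>2) \<partial>gamma_measure \<alpha>)"
      by (simp add: mult_left_mono)
    moreover have "(\<integral>\<^sup>+z. ennreal (d z) \<partial>?N) = ennreal (LINT z|?N. d z)"
      using d_int by (intro nn_integral_eq_integral) (auto simp: d_def)
    moreover have nn: "0 \<le> y $ i * (U y $ i)\<^sup>2" for y
      using U0[of y] by (cases "y \<in> orthant") (auto simp: orthant_def less_imp_le)
    moreover have "(\<integral>\<^sup>+y. ennreal (y $ i * (U y $ i)\<^sup>2) \<partial>gamma_measure \<alpha>) = ennreal (LINT y|gamma_measure \<alpha>. y $ i * (U y $ i)\<^sup>2)"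
      using energy[of i] nn by (intro nn_integral_eq_integral) auto
    ultimately have "ennreal (LINT z|?N. d z) \<le> ennreal (2 * (LINT y|gamma_measure \<alpha>. y $ i * (U y $ i)\<^sup>2))"
      by (simp add: ennreal_mult')
    then have "(LINT z|?N. d z) \<le> 2 * (LINT y|gamma_measure \<alpha>. y $ i * (U y $ i)\<^sup>2)"
      using nn by (subst (asm) ennreal_le_iff) (auto intro!: integral_nonneg_AE)
    then show ?thesis by (simp add: d_eq)
  qed
  then have "(\<Sum>i\<in>UNIV. (LINT z|?N. (u (fst z) - u (fst (exchange {i} z)))\<^sup>2) / 2)
      \<le> (\<Sum>i\<in>UNIV. LINT y|gamma_measure \<alpha>. y $ i * (U y $ i)\<^sup>2)"
    by (rule sum_mono)
  with efron_stein(1)[OF alpha_pos assms(2) u2] show ?thesis by (rule order_trans)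
qed

end

section \<open>Polar coordinates adapted to the coordinate sum\<close>

text \<open>
  The Jacobian of the inverse of \<open>(y, s) \<mapsto> (s / coord_sum y, (s / coord_sum y) *\<^sub>R y)\<close> at \<open>(r, x)\<close>.
\<close>

definition polar_jacobian :: "real \<Rightarrow> real ^ 'n \<Rightarrow> real" where
  "polar_jacobian r x = (if 0 < r then coord_sum x / r ^ Suc CARD('n) else 0)"

lemma coord_sum_scaleR [simp]: "coord_sum (c *\<^sub>R x) = c * coord_sum x"
  by (simp add: coord_sum_def sum_distrib_left)

lemma scaleR_in_orthant: "0 < c \<Longrightarrow> c *\<^sub>R x \<in> orthant \<longleftrightarrow> x \<in> orthant"
  using scale_in_orthant_iff[of c UNIV x] by (simp add: scale_UNIV)

text \<open>
  A function of a direction \<open>y\<close> and a radius \<open>s\<close> is expressed through the point \<open>x\<close> of radius \<open>s\<close> on the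
  ray through \<open>y\<close> and the ratio \<open>r\<close> between \<open>x\<close> and \<open>y\<close>. The vector \<open>y\<close> is not normalized, so the map is a
  bijection of sets of the same dimension and no surface measure is needed.
\<close>

lemma nn_integral_polar:
  fixes h :: "real ^ 'n \<Rightarrow> real \<Rightarrow> ennreal"
  assumes [measurable]: "case_prod h \<in> borel_measurable (borel \<Otimes>\<^sub>M borel)"
    and 0: "\<And>y s. \<not> (y \<in> orthant \<and> 0 < s) \<Longrightarrow> h y s = 0"
  shows "(\<integral>\<^sup>+y. \<integral>\<^sup>+s. h y s \<partial>lborel \<partial>lborel)
    = (\<integral>\<^sup>+r. \<integral>\<^sup>+x. ennreal (polar_jacobian r x) * h ((1 / r) *\<^sub>R x) (coord_sum x) \<partial>lborel \<partial>lborel)"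
proof -
  have "(\<integral>\<^sup>+y. \<integral>\<^sup>+s. h y s \<partial>lborel \<partial>lborel)
    = (\<integral>\<^sup>+y. \<integral>\<^sup>+r. ennreal (coord_sum y) * h y (coord_sum y * r) \<partial>lborel \<partial>lborel)"
  proof (rule nn_integral_cong)
    fix y :: "real ^ 'n"
    show "(\<integral>\<^sup>+s. h y s \<partial>lborel) = (\<integral>\<^sup>+r. ennreal (coord_sum y) * h y (coord_sum y * r) \<partial>lborel)"
    proof (cases "y \<in> orthant")
      case True
      note c = coord_sum_pos[OF True]
      have "(\<integral>\<^sup>+s. h y s \<partial>lborel) = ennreal \<bar>coord_sum y\<bar> * (\<integral>\<^sup>+r. h y (0 + coord_sum y * r) \<partial>lborel)"
        using c by (intro nn_integral_real_affine) auto
      then show ?thesis using c by (simp add: nn_integral_cmult)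
    qed (simp add: 0)
  qed
  also have "\<dots> = (\<integral>\<^sup>+r. \<integral>\<^sup>+y. ennreal (coord_sum y) * h y (coord_sum y * r) \<partial>lborel \<partial>lborel)"
    by (rule lborel_pair.Fubini'[symmetric]) measurable
  also have "\<dots> = (\<integral>\<^sup>+r. \<integral>\<^sup>+x. ennreal (polar_jacobian r x) * h ((1 / r) *\<^sub>R x) (coord_sum x) \<partial>lborel \<partial>lborel)"
  proof (rule nn_integral_cong)
    fix r :: real
    show "(\<integral>\<^sup>+y. ennreal (coord_sum y) * h y (coord_sum y * r) \<partial>lborel)
      = (\<integral>\<^sup>+x. ennreal (polar_jacobian r x) * h ((1 / r) *\<^sub>R x) (coord_sum x) \<partial>lborel)"
    proof (cases "0 < r")
      case True
      have "(\<integral>\<^sup>+y. ennreal (coord_sum y) * h y (coord_sum y * r) \<partial>lborel)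
          = (\<integral>\<^sup>+y. (\<lambda>x. ennreal (coord_sum x / r) * h ((1 / r) *\<^sub>R x) (coord_sum x)) (scale UNIV r y) \<partial>lborel)"
        using True by (simp add: scale_UNIV mult.commute)
      also have "\<dots> = ennreal (1 / r ^ CARD('n)) * (\<integral>\<^sup>+x. ennreal (coord_sum x / r) * h ((1 / r) *\<^sub>R x) (coord_sum x) \<partial>lborel)"
        by (rule nn_integral_scale[OF _ True]) measurable
      also have "\<dots> = (\<integral>\<^sup>+x. ennreal (1 / r ^ CARD('n)) * (ennreal (coord_sum x / r) * h ((1 / r) *\<^sub>R x) (coord_sum x)) \<partial>lborel)"
        by (rule nn_integral_cmult[symmetric]) measurable
      also have "\<dots> = (\<integral>\<^sup>+x. ennreal (polar_jacobian r x) * h ((1 / r) *\<^sub>R x) (coord_sum x) \<partial>lborel)"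
      proof (rule nn_integral_cong)
        fix x :: "real ^ 'n"
        have "ennreal (1 / r ^ CARD('n)) * ennreal (coord_sum x / r) = ennreal (polar_jacobian r x)"
        proof -
          have "ennreal (1 / r ^ CARD('n)) * ennreal (coord_sum x / r) = ennreal (1 / r ^ CARD('n) * (coord_sum x / r))"
            using True by (intro ennreal_mult'[symmetric]) simp
          then show ?thesis
            using True by (simp add: polar_jacobian_def mult.commute)
        qed
        then show "ennreal (1 / r ^ CARD('n)) * (ennreal (coord_sum x / r) * h ((1 / r) *\<^sub>R x) (coord_sum x))
            = ennreal (polar_jacobian r x) * h ((1 / r) *\<^sub>R x) (coord_sum x)"
          by (simp only: mult.assoc[symmetric])
      qed
      finally show ?thesis .
    next
      case False
      have zero: "ennreal (coord_sum y) * h y (coord_sum y * r) = 0" for y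
      proof (cases "y \<in> orthant")
        case True
        then have "coord_sum y * r \<le> 0"
          using coord_sum_pos[OF True] False by (simp add: mult_le_0_iff)
        then show ?thesis by (simp add: 0)
      qed (simp add: 0)
      show ?thesis
        using False by (simp only: zero polar_jacobian_def if_False ennreal_0 mult_zero_left)
    qed
  qed
  finally show ?thesis .
qed

lemma
  fixes h :: "real ^ 'n \<Rightarrow> real \<Rightarrow> real"
  assumes [measurable]: "case_prod h \<in> borel_measurable (borel \<Otimes>\<^sub>M borel)"
    and 0: "\<And>y s. \<not> (y \<in> orthant \<and> 0 < s) \<Longrightarrow> h y s = 0"
    and int: "integrable (lborel \<Otimes>\<^sub>M lborel) (\<lambda>(r, x). polar_jacobian r x * h ((1 / r) *\<^sub>R x) (coord_sum x))"
  shows integrable_polar: "integrable (lborel \<Otimes>\<^sub>M lborel) (\<lambda>(y, s). h y s)"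
    and integral_polar: "(LINT y|lborel. LINT s|lborel. h y s)
      = (LINT r|lborel. LINT x|lborel. polar_jacobian r x * h ((1 / r) *\<^sub>R x) (coord_sum x))"
proof -
  let ?k = "\<lambda>(r, x :: real ^ 'n). polar_jacobian r x * h ((1 / r) *\<^sub>R x) (coord_sum x)"
  have [measurable]: "(\<lambda>w. polar_jacobian (fst w) (snd w)) \<in> borel_measurable (borel \<Otimes>\<^sub>M borel)"
    unfolding polar_jacobian_def by measurable
  \<comment> \<open>Coefficients \<open>c = 1, d = 0\<close> give absolute values, \<open>c = 1 / 2, d = 1\<close> and \<open>c = 1 / 2, d = - 1\<close> the positive and negative parts.\<close>
  have key: "(\<integral>\<^sup>+z. ennreal (c * (case z of (y, s) \<Rightarrow> \<bar>h y s\<bar> + d * h y s)) \<partial>(lborel \<Otimes>\<^sub>M lborel))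
      = (\<integral>\<^sup>+z. ennreal (c * (\<bar>?k z\<bar> + d * ?k z)) \<partial>(lborel \<Otimes>\<^sub>M lborel))"
    if c: "0 \<le> c" and d: "\<bar>d\<bar> \<le> 1" for c d
  proof -
    have "(\<integral>\<^sup>+z. ennreal (c * (case z of (y, s) \<Rightarrow> \<bar>h y s\<bar> + d * h y s)) \<partial>(lborel \<Otimes>\<^sub>M lborel))
        = (\<integral>\<^sup>+y. \<integral>\<^sup>+s. ennreal (c * (\<bar>h y s\<bar> + d * h y s)) \<partial>lborel \<partial>lborel)"
      by (subst lborel.nn_integral_fst[symmetric]) auto
    also have "\<dots> = (\<integral>\<^sup>+r. \<integral>\<^sup>+x. ennreal (polar_jacobian r x) * ennreal (c * (\<bar>h ((1 / r) *\<^sub>R x) (coord_sum x)\<bar> + d * h ((1 / r) *\<^sub>R x) (coord_sum x))) \<partial>lborel \<partial>lborel)"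
      using 0 by (intro nn_integral_polar) auto
    also have "\<dots> = (\<integral>\<^sup>+r. \<integral>\<^sup>+x. ennreal (c * (\<bar>?k (r, x)\<bar> + d * ?k (r, x))) \<partial>lborel \<partial>lborel)"
    proof (intro nn_integral_cong)
      fix r :: real and x :: "real ^ 'n"
      let ?h = "h ((1 / r) *\<^sub>R x) (coord_sum x)"
      show "ennreal (polar_jacobian r x) * ennreal (c * (\<bar>?h\<bar> + d * ?h)) = ennreal (c * (\<bar>?k (r, x)\<bar> + d * ?k (r, x)))"
      proof (cases "0 < r \<and> x \<in> orthant")
        case True
        then have J: "0 \<le> polar_jacobian r x"
          using coord_sum_pos[of x] by (simp add: polar_jacobian_def)
        have "\<bar>d * ?h\<bar> \<le> \<bar>?h\<bar>"
          using d by (simp add: abs_mult mult_left_le_one_le)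
        then have "0 \<le> c * (\<bar>?h\<bar> + d * ?h)"
          using c by (intro mult_nonneg_nonneg) auto
        then show ?thesis
          using J by (simp add: ennreal_mult'[symmetric] abs_mult algebra_simps)
      next
        case False
        then have "polar_jacobian r x = 0 \<or> ?h = 0"
          using 0[of "(1 / r) *\<^sub>R x"] scaleR_in_orthant[of "1 / r" x] by (auto simp: polar_jacobian_def)
        then show ?thesis by auto
      qed
    qed
    also have "\<dots> = (\<integral>\<^sup>+z. ennreal (c * (\<bar>?k z\<bar> + d * ?k z)) \<partial>(lborel \<Otimes>\<^sub>M lborel))"
      by (subst lborel.nn_integral_fst[symmetric]) auto
    finally show ?thesis .
  qed
  show h_int: "integrable (lborel \<Otimes>\<^sub>M lborel) (\<lambda>(y, s). h y s)"
  proof (rule integrableI_bounded)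
    have "(\<integral>\<^sup>+z. ennreal (norm (case z of (y, s) \<Rightarrow> h y s)) \<partial>(lborel \<Otimes>\<^sub>M lborel)) = (\<integral>\<^sup>+z. ennreal (norm (?k z)) \<partial>(lborel \<Otimes>\<^sub>M lborel))"
      using key[of 1 0] by (simp add: case_prod_unfold)
    then show "(\<integral>\<^sup>+z. ennreal (norm (case z of (y, s) \<Rightarrow> h y s)) \<partial>(lborel \<Otimes>\<^sub>M lborel)) < \<infinity>"
      using int unfolding integrable_iff_bounded by simp
  qed simp
  have pos: "\<And>t :: real. 1 / 2 * (\<bar>t\<bar> + 1 * t) = max 0 t" and neg: "\<And>t :: real. 1 / 2 * (\<bar>t\<bar> + (- 1) * t) = max 0 (- t)"
    by (auto simp: max_def)
  have max0: "ennreal (max 0 t) = ennreal t" for t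
    by (cases "0 \<le> t") (auto simp: max_def ennreal_neg)
  have "(LINT z|(lborel \<Otimes>\<^sub>M lborel). (case z of (y, s) \<Rightarrow> h y s)) = (LINT z|(lborel \<Otimes>\<^sub>M lborel). ?k z)"
    unfolding real_lebesgue_integral_def[OF h_int] real_lebesgue_integral_def[OF int]
    using key[of "1 / 2" 1] key[of "1 / 2" "- 1"] unfolding case_prod_unfold pos neg max0 by simp
  then show "(LINT y|lborel. LINT s|lborel. h y s)
      = (LINT r|lborel. LINT x|lborel. polar_jacobian r x * h ((1 / r) *\<^sub>R x) (coord_sum x))"
    using lborel_pair.integral_fst[OF h_int] lborel_pair.integral_fst[OF int] by simp
qed

text \<open>
  Substitution \<open>t = c / r\<close> in the Gamma integral.
\<close>

lemma nn_integral_inverse_gamma: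
  assumes b: "0 < b" and c: "0 < c"
  shows "(\<integral>\<^sup>+r. ennreal (if 0 < r then r powr (- (b + 1)) * exp (- (c / r)) else 0) \<partial>lborel) = ennreal (Gamma b / c powr b)"
proof -
  define f where "f = (\<lambda>t. t powr (b - 1) * exp (- t) :: real)"
  have im: "(\<lambda>r. c / r) ` {0<..} = {0<..}"
  proof safe
    fix t :: real assume "0 < t"
    then show "t \<in> (\<lambda>r. c / r) ` {0<..}" using c by (intro image_eqI[of _ _ "c / t"]) auto
  qed (use c in auto)
  have "(f has_integral Gamma b) {0..}"
    using Gamma_integral_real[OF b] by (simp add: f_def exp_minus field_simps)
  moreover have "((f has_integral Gamma b) {0..}) = ((f has_integral Gamma b) {0<..})"
    by (rule has_integral_spike_set_eq) (auto intro: negligible_subset[of "{0}"])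
  ultimately have fI: "(f has_integral Gamma b) {0<..}" by simp
  then have fa: "f absolutely_integrable_on {0<..}" "integral {0<..} f = Gamma b"
    by (auto simp: f_def intro!: nonnegative_absolutely_integrable_1)
  have "(\<lambda>r. \<bar>- c / r\<^sup>2\<bar> * f (c / r)) absolutely_integrable_on {0<..} \<and> integral {0<..} (\<lambda>r. \<bar>- c / r\<^sup>2\<bar> * f (c / r)) = Gamma b
    \<longleftrightarrow> f absolutely_integrable_on ((\<lambda>r. c / r) ` {0<..}) \<and> integral ((\<lambda>r. c / r) ` {0<..}) f = Gamma b"
  proof (rule has_absolute_integral_change_of_variables_1')
    show "((\<lambda>r. c / r) has_field_derivative - c / r\<^sup>2) (at r within {0<..})" if "r \<in> {0<..}" for r
      using that by (auto intro!: derivative_eq_intros simp: power2_eq_square)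
    show "inj_on (\<lambda>r. c / r) {0<..}"
      using c by (auto simp: inj_on_def)
  qed simp
  then have "(\<lambda>r. \<bar>- c / r\<^sup>2\<bar> * f (c / r)) absolutely_integrable_on {0<..} \<and> integral {0<..} (\<lambda>r. \<bar>- c / r\<^sup>2\<bar> * f (c / r)) = Gamma b"
    using fa unfolding im by blast
  then have "((\<lambda>r. \<bar>- c / r\<^sup>2\<bar> * f (c / r)) has_integral Gamma b) {0<..}"
    using integrable_integral[OF set_lebesgue_integral_eq_integral(1)] by metis
  then have "((\<lambda>r. (1 / c powr b) * (\<bar>- c / r\<^sup>2\<bar> * f (c / r))) has_integral 1 / c powr b * Gamma b) {0<..}"
    by (rule has_integral_mult_right)
  then have "((\<lambda>r. if r \<in> {0<..} then (1 / c powr b) * (\<bar>- c / r\<^sup>2\<bar> * f (c / r)) else 0) has_integral 1 / c powr b * Gamma b) UNIV"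
    by (simp only: has_integral_restrict_UNIV)
  also have "(\<lambda>r. if r \<in> {0<..} then (1 / c powr b) * (\<bar>- c / r\<^sup>2\<bar> * f (c / r)) else 0)
      = (\<lambda>r. if 0 < r then r powr (- (b + 1)) * exp (- (c / r)) else 0)"
  proof (rule ext)
    fix r :: real
    have "(1 / c powr b) * (c / r\<^sup>2 * (c / r) powr (b - 1)) = r powr (- (b + 1))" if "0 < r"
    proof -
      have e1: "(c / r) powr (b - 1) = (c powr b / c) / (r powr b / r)"
        using c that by (simp add: powr_divide powr_diff)
      have e2: "r powr (- (b + 1)) = 1 / (r powr b * r)"
        unfolding powr_minus_divide powr_add using that by simp
      show ?thesis
        unfolding e1 e2 using c that by (simp add: power2_eq_square field_simps)
    qed
    moreover have "(1 / c powr b) * (\<bar>- c / r\<^sup>2\<bar> * f (c / r)) = ((1 / c powr b) * (c / r\<^sup>2 * (c / r) powr (b - 1))) * exp (- (c / r))"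
      using c by (simp add: f_def)
    ultimately show "(if r \<in> {0<..} then (1 / c powr b) * (\<bar>- c / r\<^sup>2\<bar> * f (c / r)) else 0) = (if 0 < r then r powr (- (b + 1)) * exp (- (c / r)) else 0)"
      by (cases "0 < r") (simp_all only: greaterThan_iff if_True if_False simp_thms)
  qed
  finally show ?thesis
    by (subst nn_integral_has_integral_lborel) auto
qed

text \<open>
  The densities are extended by zero to the whole space, which keeps all later integrals over Lebesgue
  measure without indicator functions.
\<close>

definition liouville_density :: "real ^ 'n \<Rightarrow> (real \<Rightarrow> real) \<Rightarrow> real ^ 'n \<Rightarrow> real" where
  "liouville_density \<alpha> g x = (if x \<in> orthant then liouville_kernel \<alpha> g x else 0)"

definition radial_density :: "real ^ 'n \<Rightarrow> (real \<Rightarrow> real) \<Rightarrow> real \<Rightarrow> real" where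
  "radial_density \<alpha> g s = (if 0 < s then s powr (coord_sum \<alpha> - 1) * g s else 0)"

lemma gamma_prod_scale_inverse:
  fixes \<alpha> :: "real ^ 'n"
  assumes x: "x \<in> orthant" and r: "0 < r"
  shows "gamma_prod \<alpha> ((1 / r) *\<^sub>R x) = (\<Prod>i\<in>UNIV. x $ i powr (\<alpha> $ i - 1)) / (\<Prod>i\<in>UNIV. Gamma (\<alpha> $ i))
    * (r ^ CARD('n) * r powr (- coord_sum \<alpha>) * exp (- (coord_sum x / r)))"
proof -
  have "gamma_density (\<alpha> $ i) (((1 / r) *\<^sub>R x) $ i)
      = x $ i powr (\<alpha> $ i - 1) * (r * r powr (- \<alpha> $ i) * exp (- (x $ i / r))) / Gamma (\<alpha> $ i)" for i
    using x r by (simp add: gamma_density_def orthant_def powr_divide powr_diff powr_minus_divide mult_ac)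
  then have "gamma_prod \<alpha> ((1 / r) *\<^sub>R x) = (\<Prod>i\<in>UNIV. x $ i powr (\<alpha> $ i - 1))
      * ((\<Prod>i\<in>(UNIV :: 'n set). r) * (\<Prod>i\<in>UNIV. r powr (- \<alpha> $ i)) * (\<Prod>i\<in>UNIV. exp (- (x $ i / r)))) / (\<Prod>i\<in>UNIV. Gamma (\<alpha> $ i))"
    by (simp only: gamma_prod_def prod.distrib prod_dividef)
  also have "(\<Prod>i\<in>UNIV. r powr (- \<alpha> $ i)) = r powr (- coord_sum \<alpha>)"
    using r by (simp add: powr_sum[symmetric] sum_negf coord_sum_def)
  also have "(\<Prod>i\<in>UNIV. exp (- (x $ i / r))) = exp (- (coord_sum x / r))"
    by (simp add: exp_sum[symmetric] sum_negf coord_sum_def sum_divide_distrib)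
  finally show ?thesis by simp
qed

text \<open>
  In polar coordinates the Gamma density splits off the factor \<open>\<Prod>i. x\<^sub>i powr (\<alpha>\<^sub>i - 1)\<close> of the Liouville
  kernel, and what remains depends on \<open>x\<close> only through \<open>coord_sum x\<close> and integrates in \<open>r\<close> to an inverse
  Gamma integral. The power \<open>k\<close> provides, by the same computation, the moments of \<open>coord_sum\<close> together
  with their independence of the direction.
\<close>

lemma nn_integral_liouville_polar:
  fixes \<alpha> :: "real ^ 'n" and F :: "real ^ 'n \<Rightarrow> ennreal"
  assumes alpha_pos: "\<And>i. 0 < \<alpha> $ i" and k: "0 \<le> k"
    and [measurable]: "F \<in> borel_measurable borel" "liouville_density \<alpha> g \<in> borel_measurable borel"
      "radial_density \<alpha> g \<in> borel_measurable borel"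
    and g0: "\<And>s. 0 < s \<Longrightarrow> 0 \<le> g s"
  shows "(\<integral>\<^sup>+y. \<integral>\<^sup>+s. ennreal (radial_density \<alpha> g s) * (ennreal (coord_sum y powr k) * F ((s / coord_sum y) *\<^sub>R y)) \<partial>lborel \<partial>gamma_measure \<alpha>)
    = ennreal (Gamma (coord_sum \<alpha> + k) / (\<Prod>i\<in>UNIV. Gamma (\<alpha> $ i))) * (\<integral>\<^sup>+x. ennreal (liouville_density \<alpha> g x) * F x \<partial>lborel)"
proof -
  define a where "a = coord_sum \<alpha>"
  have a: "0 < a" unfolding a_def by (rule coord_sum_pos) (simp add: orthant_def alpha_pos)
  define P where "P = (\<Prod>i\<in>UNIV. Gamma (\<alpha> $ i))"
  have P: "0 < P" unfolding P_def by (intro prod_pos Gamma_real_pos ballI alpha_pos)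
  define rd where "rd = radial_density \<alpha> g"
  have rd0: "0 \<le> rd s" for s using g0 by (simp add: rd_def radial_density_def)
  have [measurable]: "rd \<in> borel_measurable borel" by (simp add: rd_def)
  have [measurable]: "orthant \<in> sets (borel :: (real ^ 'n) measure)"
    using open_orthant by (rule borel_open)
  have gp0: "0 \<le> gamma_prod \<alpha> y" for y by (rule gamma_prod_nonneg[OF alpha_pos])
  define h where "h = (\<lambda>y s. ennreal (gamma_prod \<alpha> y) * (ennreal (rd s) * (ennreal (coord_sum y powr k) * F ((s / coord_sum y) *\<^sub>R y))))"
  have h_m: "case_prod h \<in> borel_measurable (borel \<Otimes>\<^sub>M borel)"
    unfolding h_def by measurable
  have "(\<integral>\<^sup>+y. \<integral>\<^sup>+s. ennreal (rd s) * (ennreal (coord_sum y powr k) * F ((s / coord_sum y) *\<^sub>R y)) \<partial>lborel \<partial>gamma_measure \<alpha>)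
    = (\<integral>\<^sup>+y. ennreal (gamma_prod \<alpha> y) * (\<integral>\<^sup>+s. ennreal (rd s) * (ennreal (coord_sum y powr k) * F ((s / coord_sum y) *\<^sub>R y)) \<partial>lborel) \<partial>lborel)"
    unfolding gamma_measure_def by (rule nn_integral_density) auto
  also have "\<dots> = (\<integral>\<^sup>+y. \<integral>\<^sup>+s. h y s \<partial>lborel \<partial>lborel)"
    unfolding h_def by (intro nn_integral_cong nn_integral_cmult[symmetric]) auto
  also have "\<dots> = (\<integral>\<^sup>+r. \<integral>\<^sup>+x. ennreal (polar_jacobian r x) * h ((1 / r) *\<^sub>R x) (coord_sum x) \<partial>lborel \<partial>lborel)"
    by (rule nn_integral_polar[OF h_m]) (auto simp: h_def gamma_prod_not_in_orthant rd_def radial_density_def)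
  also have "\<dots> = (\<integral>\<^sup>+r. \<integral>\<^sup>+x. ennreal (liouville_density \<alpha> g x * coord_sum x powr (a + k) / P)
      * ennreal (if 0 < r then r powr (- (a + k + 1)) * exp (- (coord_sum x / r)) else 0) * F x \<partial>lborel \<partial>lborel)"
  proof (intro nn_integral_cong)
    fix r :: real and x :: "real ^ 'n"
    show "ennreal (polar_jacobian r x) * h ((1 / r) *\<^sub>R x) (coord_sum x)
      = ennreal (liouville_density \<alpha> g x * coord_sum x powr (a + k) / P)
      * ennreal (if 0 < r then r powr (- (a + k + 1)) * exp (- (coord_sum x / r)) else 0) * F x"
    proof (cases "0 < r \<and> x \<in> orthant")
      case True
      then have r: "0 < r" and x: "x \<in> orthant" by auto
      define c where "c = coord_sum x"
      have c: "0 < c" unfolding c_def by (rule coord_sum_pos[OF x])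
      define X where "X = (\<Prod>i\<in>UNIV. x $ i powr (\<alpha> $ i - 1))"
      have X: "0 \<le> X" unfolding X_def by (intro prod_nonneg) simp
      have gp: "gamma_prod \<alpha> ((1 / r) *\<^sub>R x) = X / P * (r ^ CARD('n) * r powr (- a) * exp (- (c / r)))"
        unfolding X_def P_def c_def a_def by (rule gamma_prod_scale_inverse[OF x r])
      have id: "(c / coord_sum ((1 / r) *\<^sub>R x)) *\<^sub>R ((1 / r) *\<^sub>R x) = x"
        using c r by (simp flip: c_def)
      have "ennreal (polar_jacobian r x) * h ((1 / r) *\<^sub>R x) c
         = ennreal (polar_jacobian r x * (gamma_prod \<alpha> ((1 / r) *\<^sub>R x) * (rd c * (coord_sum ((1 / r) *\<^sub>R x) powr k)))) * F x"
      proof -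
        have "0 \<le> polar_jacobian r x"
          using r c by (simp add: polar_jacobian_def c_def)
        then show ?thesis
          unfolding h_def id using rd0[of c] gp0[of "(1 / r) *\<^sub>R x"]
          by (simp add: ennreal_mult mult.assoc del: coord_sum_scaleR)
      qed
      also have "polar_jacobian r x * (gamma_prod \<alpha> ((1 / r) *\<^sub>R x) * (rd c * (coord_sum ((1 / r) *\<^sub>R x) powr k)))
         = (liouville_density \<alpha> g x * c powr (a + k) / P) * (r powr (- (a + k + 1)) * exp (- (c / r)))"
      proof -
        have e1: "coord_sum ((1 / r) *\<^sub>R x) powr k = c powr k / r powr k"
          using r c by (simp add: powr_divide flip: c_def)
        have e2: "r powr (- (a + k + 1)) = r powr (- a) / r powr k / r"
        proof -
          have "r powr (- a - k - 1) = r powr (- a) / r powr k / r"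
            using r by (simp add: powr_diff)
          then show ?thesis by simp
        qed
        have e3: "rd c = c powr a / c * g c"
          using c by (simp add: rd_def radial_density_def powr_diff flip: a_def)
        have e4: "liouville_density \<alpha> g x = X * g c"
          using x by (simp add: liouville_density_def liouville_kernel_def X_def c_def)
        have e5: "polar_jacobian r x = c / (r * r ^ CARD('n))"
          using r by (simp add: polar_jacobian_def c_def)
        show ?thesis
          unfolding e1 e2 e3 e4 e5 gp powr_add using r c P by (simp add: mult_ac)
      qed
      also have "ennreal \<dots> = ennreal (liouville_density \<alpha> g x * c powr (a + k) / P) * ennreal (r powr (- (a + k + 1)) * exp (- (c / r)))"
        using x P X g0[OF c] by (intro ennreal_mult) (auto simp: liouville_density_def liouville_kernel_def X_def c_def)
      finally show ?thesis using r by (simp add: c_def)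
    next
      case False
      then have "polar_jacobian r x = 0 \<or> h ((1 / r) *\<^sub>R x) (coord_sum x) = 0"
        using scaleR_in_orthant[of "1 / r" x] by (auto simp: polar_jacobian_def h_def gamma_prod_not_in_orthant)
      then show ?thesis using False by (auto simp: liouville_density_def)
    qed
  qed
  also have "\<dots> = (\<integral>\<^sup>+x. \<integral>\<^sup>+r. ennreal (liouville_density \<alpha> g x * coord_sum x powr (a + k) / P)
      * ennreal (if 0 < r then r powr (- (a + k + 1)) * exp (- (coord_sum x / r)) else 0) * F x \<partial>lborel \<partial>lborel)"
    by (rule lborel_pair.Fubini'[symmetric]) measurable
  also have "\<dots> = (\<integral>\<^sup>+x. ennreal (Gamma (a + k) / P) * (ennreal (liouville_density \<alpha> g x) * F x) \<partial>lborel)"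
  proof (rule nn_integral_cong)
    fix x :: "real ^ 'n"
    show "(\<integral>\<^sup>+r. ennreal (liouville_density \<alpha> g x * coord_sum x powr (a + k) / P)
      * ennreal (if 0 < r then r powr (- (a + k + 1)) * exp (- (coord_sum x / r)) else 0) * F x \<partial>lborel)
      = ennreal (Gamma (a + k) / P) * (ennreal (liouville_density \<alpha> g x) * F x)"
    proof (cases "x \<in> orthant")
      case True
      note c = coord_sum_pos[OF True]
      have L: "0 \<le> liouville_density \<alpha> g x"
        using g0[OF c] True by (auto simp: liouville_density_def liouville_kernel_def intro!: mult_nonneg_nonneg prod_nonneg)
      have "(\<integral>\<^sup>+r. ennreal (liouville_density \<alpha> g x * coord_sum x powr (a + k) / P)
        * ennreal (if 0 < r then r powr (- (a + k + 1)) * exp (- (coord_sum x / r)) else 0) * F x \<partial>lborel)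
        = ennreal (liouville_density \<alpha> g x * coord_sum x powr (a + k) / P)
        * (\<integral>\<^sup>+r. ennreal (if 0 < r then r powr (- (a + k + 1)) * exp (- (coord_sum x / r)) else 0) \<partial>lborel) * F x"
        by (subst nn_integral_multc, measurable) (subst nn_integral_cmult, measurable)
      also have "\<dots> = ennreal (liouville_density \<alpha> g x * coord_sum x powr (a + k) / P) * ennreal (Gamma (a + k) / coord_sum x powr (a + k)) * F x"
        using a k c by (subst nn_integral_inverse_gamma) auto
      also have "ennreal (liouville_density \<alpha> g x * coord_sum x powr (a + k) / P) * ennreal (Gamma (a + k) / coord_sum x powr (a + k))
          = ennreal (Gamma (a + k) / P) * ennreal (liouville_density \<alpha> g x)"
        using L P a k c Gamma_real_pos[of "a + k"] by (simp add: ennreal_mult'[symmetric] ennreal_mult''[symmetric] field_simps)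
      finally show ?thesis by (simp only: mult.assoc)
    qed (simp add: liouville_density_def)
  qed
  also have "\<dots> = ennreal (Gamma (a + k) / P) * (\<integral>\<^sup>+x. ennreal (liouville_density \<alpha> g x) * F x \<partial>lborel)"
    by (rule nn_integral_cmult) measurable
  finally show ?thesis by (simp add: rd_def a_def P_def)
qed

section \<open>Weak gradients of averages over rays\<close>

lemma integrable_strip_bounded:
  fixes f :: "real ^ 'n \<Rightarrow> real" and c :: "real \<Rightarrow> real ^ 'n \<Rightarrow> real"
  assumes f: "locally_integrable_on orthant f" and [measurable]: "f \<in> borel_measurable borel"
      "(\<lambda>w. c (fst w) (snd w)) \<in> borel_measurable (borel \<Otimes>\<^sub>M borel)"
    and L: "compact L" "L \<subseteq> orthant"
    and c0: "\<And>r x. \<not> (p \<le> r \<and> r \<le> q \<and> x \<in> L) \<Longrightarrow> c r x = 0"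
    and B: "\<And>r x. \<bar>c r x\<bar> \<le> B"
  shows "integrable (lborel \<Otimes>\<^sub>M lborel) (\<lambda>(r, x). c r x * f x)"
proof (rule integrable_strip[where C = "ennreal B * (\<integral>\<^sup>+x. ennreal \<bar>indicator L x * f x\<bar> \<partial>lborel)"])
  have int: "integrable lborel (\<lambda>x. indicator L x * f x)"
    using f L by (auto simp: locally_integrable_on_def set_integrable_def)
  have B0: "0 \<le> B" using B[of 0 0] by simp
  show "ennreal B * (\<integral>\<^sup>+x. ennreal \<bar>indicator L x * f x\<bar> \<partial>lborel) < \<infinity>"
    using int unfolding integrable_iff_bounded by (simp add: ennreal_mult_less_top)
  show "(\<lambda>(r, x). c r x * f x) \<in> borel_measurable (borel \<Otimes>\<^sub>M borel)"
    unfolding case_prod_unfold by measurable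
  fix r
  show "(\<integral>\<^sup>+x. ennreal \<bar>case (r, x) of (r, x) \<Rightarrow> c r x * f x\<bar> \<partial>lborel)
      \<le> ennreal B * (\<integral>\<^sup>+x. ennreal \<bar>indicator L x * f x\<bar> \<partial>lborel) * indicator {p..q} r"
  proof (cases "p \<le> r \<and> r \<le> q")
    case True
    have "ennreal \<bar>c r x * f x\<bar> \<le> ennreal B * ennreal \<bar>indicator L x * f x\<bar>" for x
    proof (cases "x \<in> L")
      case True
      have "\<bar>c r x\<bar> * \<bar>f x\<bar> \<le> B * \<bar>f x\<bar>"
        by (intro mult_right_mono B) simp
      then show ?thesis
        using True B0 by (simp add: abs_mult ennreal_mult[symmetric] ennreal_leI)
    qed (simp add: c0)
    then have "(\<integral>\<^sup>+x. ennreal \<bar>c r x * f x\<bar> \<partial>lborel) \<le> (\<integral>\<^sup>+x. ennreal B * ennreal \<bar>indicator L x * f x\<bar> \<partial>lborel)"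
      by (rule nn_integral_mono)
    also have "\<dots> = ennreal B * (\<integral>\<^sup>+x. ennreal \<bar>indicator L x * f x\<bar> \<partial>lborel)"
      using int by (intro nn_integral_cmult) auto
    finally show ?thesis using True by simp
  qed (auto simp: c0)
qed

lemma bounded_linear_coord_sum: "bounded_linear coord_sum"
  unfolding coord_sum_def by (intro bounded_linear_sum bounded_linear_vec_nth)

lemma coord_sum_axis: "coord_sum (axis i 1) = 1"
  by (simp add: coord_sum_def axis_def)

text \<open>
  The vector field \<open>x \<mapsto> coord_sum x * axis i 1 - x\<close> is tangential to the level sets of \<open>coord_sum\<close>.
  Therefore a factor \<open>\<eta> (coord_sum x)\<close> can be put into the weak identity along this field without its
  derivative appearing: the contributions of \<open>\<eta>'\<close> from the two terms cancel.
\<close>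

lemma tangential_weak_identity:
  fixes f :: "real ^ 'n \<Rightarrow> real" and G :: "real ^ 'n \<Rightarrow> real ^ 'n" and \<eta> :: "real \<Rightarrow> real"
  assumes wg: "weak_gradient orthant f G"
    and f0: "\<And>x. x \<notin> orthant \<Longrightarrow> f x = 0" and G0: "\<And>x. x \<notin> orthant \<Longrightarrow> G x = 0"
    and \<phi>: "test_function orthant \<phi>" and \<eta>: "\<And>k. C_k k \<eta>"
  shows "(LINT x|lborel. \<eta> (coord_sum x) * (f x * (\<phi> x + coord_sum x * frechet_derivative \<phi> (at x) (axis i 1))
      + (coord_sum x * G x $ i - (\<Sum>j\<in>UNIV. x $ j * G x $ j)) * \<phi> x))
    = (LINT x|lborel. f x * (\<eta> (coord_sum x) * euler UNIV \<phi> x))"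
proof -
  define \<xi> where "\<xi> = (\<lambda>x. \<eta> (coord_sum x) * \<phi> x)"
  define \<eta>' where "\<eta>' = (\<lambda>s. frechet_derivative \<eta> (at s) 1)"
  have smooth_cs: "C_k k (\<lambda>x :: real ^ 'n. coord_sum x)" for k
    by (rule C_k_bounded_linear[OF bounded_linear_coord_sum])
  have smooth_\<eta>: "C_k k (\<lambda>x :: real ^ 'n. \<eta> (coord_sum x))" for k
    by (rule smooth_compose[OF \<eta> smooth_cs])
  have smooth_\<xi>: "C_k k \<xi>" for k
    unfolding \<xi>_def by (rule C_k_mult[OF smooth_\<eta> test_function_smooth[OF \<phi>]])
  note supp = compact_support[OF \<phi>] support_subset[OF \<phi>]
  have \<xi>: "test_function orthant \<xi>"
    by (rule test_functionI[OF smooth_\<xi> supp]) (simp add: \<xi>_def not_in_support)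
  have c\<xi>: "test_function orthant (\<lambda>x. coord_sum x * \<xi> x)"
    by (rule test_functionI[OF C_k_mult[OF smooth_cs smooth_\<xi>] supp]) (simp add: \<xi>_def not_in_support)
  have D\<phi>: "(\<phi> has_derivative frechet_derivative \<phi> (at x)) (at x)" for x
    using test_function_differentiable[OF \<phi>] by (simp add: frechet_derivative_works)
  have D\<eta>: "(\<eta> has_derivative (\<lambda>h. \<eta>' s * h)) (at s)" for s
  proof -
    have D: "(\<eta> has_derivative frechet_derivative \<eta> (at s)) (at s)"
      using \<eta>[of 1] by (simp add: frechet_derivative_works)
    have "frechet_derivative \<eta> (at s) u = \<eta>' s * u" for u
      using linear_scale[OF has_derivative_linear[OF D], of u 1] by (simp add: \<eta>'_def mult.commute)
    then have "frechet_derivative \<eta> (at s) = (\<lambda>h. \<eta>' s * h)" by (rule ext)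
    with D show ?thesis by simp
  qed
  have Dcs: "(coord_sum has_derivative coord_sum) (at x)" for x :: "real ^ 'n"
    by (rule bounded_linear_imp_has_derivative[OF bounded_linear_coord_sum])
  have "((\<lambda>x. \<eta> (coord_sum x)) has_derivative (\<lambda>h. \<eta>' (coord_sum x) * coord_sum h)) (at x)" for x :: "real ^ 'n"
    using has_derivative_compose[OF Dcs D\<eta>] by simp
  from has_derivative_mult[OF this D\<phi>]
  have D\<xi>: "(\<xi> has_derivative (\<lambda>h. \<eta> (coord_sum x) * frechet_derivative \<phi> (at x) h + \<eta>' (coord_sum x) * coord_sum h * \<phi> x)) (at x)" for x
    unfolding \<xi>_def .
  have d\<xi>: "frechet_derivative \<xi> (at x) (axis j 1)
      = \<eta> (coord_sum x) * frechet_derivative \<phi> (at x) (axis j 1) + \<eta>' (coord_sum x) * \<phi> x" for x j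
    using fun_cong[OF frechet_derivative_at[OF D\<xi>[of x]], of "axis j 1"] by (simp add: coord_sum_axis)
  have dc\<xi>: "frechet_derivative (\<lambda>x. coord_sum x * \<xi> x) (at x) (axis i 1)
      = coord_sum x * (\<eta> (coord_sum x) * frechet_derivative \<phi> (at x) (axis i 1) + \<eta>' (coord_sum x) * \<phi> x) + \<xi> x" for x
    using fun_cong[OF frechet_derivative_at[OF has_derivative_mult[OF Dcs[of x] D\<xi>[of x]]], of "axis i 1"]
    by (simp add: coord_sum_axis)
  have eu: "euler UNIV \<xi> x = \<eta> (coord_sum x) * euler UNIV \<phi> x + coord_sum x * \<eta>' (coord_sum x) * \<phi> x" for x
  proof -
    have "euler UNIV \<xi> x = CARD('n) * \<xi> x
        + (\<Sum>j\<in>UNIV. x $ j * (\<eta> (coord_sum x) * frechet_derivative \<phi> (at x) (axis j 1) + \<eta>' (coord_sum x) * \<phi> x))"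
      by (simp only: euler_def d\<xi>)
    also have "(\<Sum>j\<in>UNIV. x $ j * (\<eta> (coord_sum x) * frechet_derivative \<phi> (at x) (axis j 1) + \<eta>' (coord_sum x) * \<phi> x))
        = \<eta> (coord_sum x) * (\<Sum>j\<in>UNIV. x $ j * frechet_derivative \<phi> (at x) (axis j 1)) + coord_sum x * (\<eta>' (coord_sum x) * \<phi> x)"
      unfolding coord_sum_def[of x]
      by (simp add: distrib_left sum.distrib sum_distrib_left sum_distrib_right mult_ac)
    finally show ?thesis
      by (simp add: euler_def \<xi>_def algebra_simps)
  qed
  have f_loc: "locally_integrable_on orthant f" and G_loc: "locally_integrable_on orthant (\<lambda>x. G x $ j)" for j
    using weak_partial_axis[OF wg] by (auto simp: weak_partial_def)
  have g_loc: "locally_integrable_on orthant (\<lambda>x. \<Sum>j\<in>UNIV. x $ j * G x $ j)"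
    by (intro locally_integrable_on_sum locally_integrable_on_mult_continuous G_loc continuous_on_component continuous_on_id)
  have zero: "indicator orthant x * f x = f x" "indicator orthant x * G x $ i = G x $ i" for x
    using f0[of x] G0[of x] by (auto simp: indicator_def)
  have W1: "(LINT x|lborel. f x * frechet_derivative (\<lambda>x. coord_sum x * \<xi> x) (at x) (axis i 1))
      = - (LINT x|lborel. G x $ i * (coord_sum x * \<xi> x))"
    using weak_partial_axis[OF wg, of i, unfolded weak_partial_def, THEN conjunct2, THEN conjunct2, rule_format, OF c\<xi>]
    by (simp only: set_lebesgue_integral_def real_scaleR_def mult.assoc[symmetric] zero)
  have W2: "(LINT x|lborel. f x * euler UNIV \<xi> x) = - (LINT x|lborel. (\<Sum>j\<in>UNIV. x $ j * G x $ j) * \<xi> x)"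
    by (rule euler_weak_gradient[OF wg \<xi>]) (auto intro: f0 G0)
  have i1: "integrable lborel (\<lambda>x. f x * frechet_derivative (\<lambda>x. coord_sum x * \<xi> x) (at x) (axis i 1))"
    by (rule integrable_mult_compact_support[OF f_loc continuous_on_test_function_derivative[OF c\<xi> axis_in_Basis]
          compact_support[OF c\<xi>] support_subset[OF c\<xi>] derivative_not_in_support])
  have i2: "integrable lborel (\<lambda>x. f x * euler UNIV \<xi> x)"
    by (rule integrable_mult_compact_support[OF f_loc continuous_on_euler[OF \<xi>]
          compact_support[OF \<xi>] support_subset[OF \<xi>] euler_not_in_support])
  have i3: "integrable lborel (\<lambda>x. G x $ i * (coord_sum x * \<xi> x))"
    by (rule integrable_mult_test_function[OF G_loc c\<xi>])
  have i4: "integrable lborel (\<lambda>x. (\<Sum>j\<in>UNIV. x $ j * G x $ j) * \<xi> x)"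
    by (rule integrable_mult_test_function[OF g_loc \<xi>])
  have cont_\<eta>: "continuous_on UNIV (\<lambda>x :: real ^ 'n. \<eta> (coord_sum x))"
    using smooth_\<eta>[of 0] by simp
  have i5: "integrable lborel (\<lambda>x. f x * (\<eta> (coord_sum x) * euler UNIV \<phi> x))"
    by (rule integrable_mult_compact_support[OF f_loc continuous_on_mult[OF cont_\<eta> continuous_on_euler[OF \<phi>]] supp])
       (simp add: euler_not_in_support)
  have "(LINT x|lborel. \<eta> (coord_sum x) * (f x * (\<phi> x + coord_sum x * frechet_derivative \<phi> (at x) (axis i 1))
      + (coord_sum x * G x $ i - (\<Sum>j\<in>UNIV. x $ j * G x $ j)) * \<phi> x))
    = (LINT x|lborel. f x * frechet_derivative (\<lambda>x. coord_sum x * \<xi> x) (at x) (axis i 1) - f x * euler UNIV \<xi> x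
      + (G x $ i * (coord_sum x * \<xi> x) - (\<Sum>j\<in>UNIV. x $ j * G x $ j) * \<xi> x)
      + f x * (\<eta> (coord_sum x) * euler UNIV \<phi> x))"
  proof (rule Bochner_Integration.integral_cong[OF refl])
    fix x :: "real ^ 'n"
    show "\<eta> (coord_sum x) * (f x * (\<phi> x + coord_sum x * frechet_derivative \<phi> (at x) (axis i 1))
        + (coord_sum x * G x $ i - (\<Sum>j\<in>UNIV. x $ j * G x $ j)) * \<phi> x)
      = f x * frechet_derivative (\<lambda>x. coord_sum x * \<xi> x) (at x) (axis i 1) - f x * euler UNIV \<xi> x
        + (G x $ i * (coord_sum x * \<xi> x) - (\<Sum>j\<in>UNIV. x $ j * G x $ j) * \<xi> x)
        + f x * (\<eta> (coord_sum x) * euler UNIV \<phi> x)"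
      unfolding dc\<xi> eu unfolding \<xi>_def by (simp add: algebra_simps)
  qed
  also have "\<dots> = (LINT x|lborel. f x * (\<eta> (coord_sum x) * euler UNIV \<phi> x))"
    using i1 i2 i3 i4 i5 W1 W2 by simp
  finally show ?thesis .
qed

text \<open>
  For almost every radius \<open>s\<close>, the extension of degree one \<open>y \<mapsto> coord_sum y * f ((s / coord_sum y) *\<^sub>R y)\<close> has
  the weak partial derivative that the chain rule predicts. To exploit the weak gradient of \<open>f\<close>, which is
  an identity for integrals over the full space, the claim is tested in \<open>s\<close> against \<open>\<psi>\<close> and rewritten in
  polar coordinates \<open>(r, x)\<close>, where \<open>y = x / r\<close>. For fixed \<open>r\<close>, \<open>tangential_weak_identity\<close> removes the
  gradient of \<open>f\<close>; what is left is, for fixed \<open>x\<close>, the integral over \<open>r\<close> of the derivative of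
  \<open>r \<mapsto> \<phi> (x / r) / r ^ n\<close>, which vanishes because \<open>\<phi>\<close> has compact support.
\<close>

lemma AE_spherical_weak_identity:
  fixes f :: "real ^ 'n \<Rightarrow> real" and G :: "real ^ 'n \<Rightarrow> real ^ 'n" and i :: 'n
  assumes wg: "weak_gradient orthant f G"
    and [measurable]: "f \<in> borel_measurable borel" "G \<in> borel_measurable borel"
    and f0: "\<And>x. x \<notin> orthant \<Longrightarrow> f x = 0" and G0: "\<And>x. x \<notin> orthant \<Longrightarrow> G x = 0"
    and \<phi>: "test_function orthant \<phi>"
  defines "T \<equiv> \<lambda>y s. f ((s / coord_sum y) *\<^sub>R y) + s * (G ((s / coord_sum y) *\<^sub>R y) $ i
      - (\<Sum>j\<in>UNIV. y $ j / coord_sum y * G ((s / coord_sum y) *\<^sub>R y) $ j))"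
  shows "AE s in lborel. 0 < s \<longrightarrow> (LINT y|lborel. coord_sum y * f ((s / coord_sum y) *\<^sub>R y) * frechet_derivative \<phi> (at y) (axis i 1)
     + T y s * \<phi> y) = 0"
proof -
  define d\<phi> where "d\<phi> = (\<lambda>x. frechet_derivative \<phi> (at x) (axis i 1))"
  define W where "W = (\<lambda>y s. coord_sum y * f ((s / coord_sum y) *\<^sub>R y) * d\<phi> y + T y s * \<phi> y)"
  note K = compact_support[OF \<phi>] support_subset[OF \<phi>]
  have cont: "continuous_on UNIV \<phi>" "continuous_on UNIV d\<phi>" "continuous_on UNIV (euler UNIV \<phi>)"
    unfolding d\<phi>_def
    by (rule continuous_on_test_function[OF \<phi>] continuous_on_test_function_derivative[OF \<phi> axis_in_Basis] continuous_on_euler[OF \<phi>])+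
  have [measurable]: "\<phi> \<in> borel_measurable borel" "d\<phi> \<in> borel_measurable borel" "euler UNIV \<phi> \<in> borel_measurable borel"
    using cont by (auto intro: borel_measurable_continuous_onI)
  have [measurable]: "(\<lambda>w. T (a w) (b w)) \<in> borel_measurable M"
    if [measurable]: "a \<in> borel_measurable M" "b \<in> borel_measurable M" for a b and M :: "'z measure"
    unfolding T_def by measurable
  have [measurable]: "(\<lambda>w. W (a w) (b w)) \<in> borel_measurable M"
    if [measurable]: "a \<in> borel_measurable M" "b \<in> borel_measurable M" for a b and M :: "'z measure"
    unfolding W_def by measurable
  have [measurable]: "(\<lambda>w. polar_jacobian (a w) (b w)) \<in> borel_measurable M"
    if [measurable]: "a \<in> borel_measurable M" "b \<in> borel_measurable M" for a and b :: "'z \<Rightarrow> real ^ 'n" and M :: "'z measure"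
    unfolding polar_jacobian_def by measurable
  have \<phi>0: "\<phi> x = 0" "d\<phi> x = 0" "euler UNIV \<phi> x = 0" if "x \<notin> support \<phi>" for x
    using that by (auto simp: d\<phi>_def not_in_support derivative_not_in_support euler_not_in_support)
  have f_loc: "locally_integrable_on orthant f" and G_loc: "locally_integrable_on orthant (\<lambda>x. G x $ j)" for j
    using weak_partial_axis[OF wg] by (auto simp: weak_partial_def)
  obtain m M where mM: "0 < m" "\<And>z. z \<in> support \<phi> \<Longrightarrow> m \<le> coord_sum z \<and> coord_sum z \<le> M"
  proof (cases "support \<phi> = {}")
    case False
    have c: "continuous_on (support \<phi>) coord_sum"
      by (rule linear_continuous_on[OF bounded_linear_coord_sum])
    obtain z1 where "z1 \<in> support \<phi>" "\<And>z. z \<in> support \<phi> \<Longrightarrow> coord_sum z1 \<le> coord_sum z"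
      using continuous_attains_inf[OF K(1) False c] by blast
    moreover obtain z2 where "z2 \<in> support \<phi>" "\<And>z. z \<in> support \<phi> \<Longrightarrow> coord_sum z \<le> coord_sum z2"
      using continuous_attains_sup[OF K(1) False c] by blast
    ultimately show ?thesis
      using that[of "coord_sum z1" "coord_sum z2"] coord_sum_pos K(2) by blast
  qed (use that[of 1 1] in auto)
  \<comment> \<open>The integrand \<open>W\<close> in polar coordinates.\<close>
  define V where "V = (\<lambda>r x. f x * ((coord_sum x / r) * d\<phi> ((1 / r) *\<^sub>R x) + \<phi> ((1 / r) *\<^sub>R x))
      + (coord_sum x * G x $ i - (\<Sum>j\<in>UNIV. x $ j * G x $ j)) * \<phi> ((1 / r) *\<^sub>R x))"
  have W_polar: "W ((1 / r) *\<^sub>R x) (coord_sum x) = V r x" if "0 < r" "x \<in> orthant" for r x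
  proof -
    have c: "0 < coord_sum x" by (rule coord_sum_pos[OF that(2)])
    have id: "(coord_sum x / coord_sum ((1 / r) *\<^sub>R x)) *\<^sub>R ((1 / r) *\<^sub>R x) = x"
      using c that by simp
    have ratio: "((1 / r) *\<^sub>R x) $ j / coord_sum ((1 / r) *\<^sub>R x) = x $ j / coord_sum x" for j
      using c that by simp
    have "coord_sum x * (\<Sum>j\<in>UNIV. x $ j / coord_sum x * G x $ j) = (\<Sum>j\<in>UNIV. x $ j * G x $ j)"
      using c by (simp add: sum_distrib_left)
    then show ?thesis
      unfolding W_def T_def V_def id ratio by (simp add: right_diff_distrib left_diff_distrib distrib_right distrib_left mult_ac)
  qed
  \<comment> \<open>Both the support of \<open>\<phi>\<close> and that of \<open>\<psi>\<close> stay away from \<open>0\<close> and infinity, so \<open>r\<close> is confined to an interval \<open>[p, q]\<close> and all integrands live on a compact set.\<close>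
  have polar: "integrable (lborel \<Otimes>\<^sub>M lborel) (\<lambda>(r, x). polar_jacobian r x * (W ((1 / r) *\<^sub>R x) (coord_sum x) * \<psi> (coord_sum x)))
      \<and> (\<exists>p q. 0 < p \<and> p \<le> q \<and> (\<forall>r x. 0 < r \<longrightarrow> \<psi> (coord_sum x) \<noteq> 0 \<longrightarrow> (1 / r) *\<^sub>R x \<in> support \<phi> \<longrightarrow> p \<le> r \<and> r \<le> q)
        \<and> integrable (lborel \<Otimes>\<^sub>M lborel) (\<lambda>(r, x). (if p \<le> r \<and> r \<le> q then \<psi> (coord_sum x) * coord_sum x * euler UNIV \<phi> ((1 / r) *\<^sub>R x) / r ^ Suc CARD('n) else 0) * f x))"
    if \<psi>_m [measurable]: "\<psi> \<in> borel_measurable borel" and b: "0 < b" and \<psi>0: "\<And>s. \<not> (b \<le> s \<and> s \<le> c) \<Longrightarrow> \<psi> s = 0"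
      and B: "\<And>s. \<bar>\<psi> s\<bar> \<le> B" for \<psi> :: "real \<Rightarrow> real" and b c B
  proof -
    define p where "p = b / max M 1"
    define q where "q = max p (c / m)"
    have p: "0 < p" using b by (simp add: p_def)
    have pq: "p \<le> q" by (simp add: q_def)
    have range: "p \<le> r \<and> r \<le> q" if r: "0 < r" and "\<psi> (coord_sum x) \<noteq> 0" and z: "(1 / r) *\<^sub>R x \<in> support \<phi>" for r and x :: "real ^ 'n"
    proof -
      have bc: "b \<le> coord_sum x" "coord_sum x \<le> c" using \<psi>0[of "coord_sum x"] that(2) by auto
      have z': "m * r \<le> coord_sum x" "coord_sum x \<le> M * r"
        using mM(2)[OF z] r by (auto simp: field_simps)
      have "b \<le> max M 1 * r" using bc z' r by (meson max.cobounded1 mult_right_mono less_imp_le order_trans)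
      moreover have "m * r \<le> c" using bc z' by simp
      ultimately show ?thesis
        using mM(1) by (auto simp: p_def q_def field_simps le_max_iff_disj)
    qed
    obtain L where L: "compact L" "L \<subseteq> orthant" "\<And>r x. p \<le> r \<Longrightarrow> r \<le> q \<Longrightarrow> x \<in> support \<phi> \<Longrightarrow> scale UNIV r x \<in> L"
      using compact_scale_image[OF K p] by blast
    have inL: "x \<in> L" if r: "0 < r" and "\<psi> (coord_sum x) \<noteq> 0" and z: "(1 / r) *\<^sub>R x \<in> support \<phi>" for r x
      using L(3)[of r "(1 / r) *\<^sub>R x"] range[OF that] z r by (simp add: scale_UNIV)
    have strip: "integrable (lborel \<Otimes>\<^sub>M lborel) (\<lambda>(r, x). (if p \<le> r \<and> r \<le> q then \<psi> (coord_sum x) * A r x else 0) * u x)"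
      if u: "locally_integrable_on orthant u" and [measurable]: "u \<in> borel_measurable borel"
        and cA: "continuous_on ({p..q} \<times> L) (\<lambda>w. A (fst w) (snd w))"
        and [measurable]: "(\<lambda>w. A (fst w) (snd w)) \<in> borel_measurable (borel \<Otimes>\<^sub>M borel)"
        and A0: "\<And>r x. 0 < r \<Longrightarrow> (1 / r) *\<^sub>R x \<notin> support \<phi> \<Longrightarrow> A r x = 0" for u A
    proof -
      have "bounded ((\<lambda>w. A (fst w) (snd w)) ` ({p..q} \<times> L))"
        by (intro compact_imp_bounded compact_continuous_image cA compact_Times compact_Icc L(1))
      then obtain B' where B': "\<And>r x. p \<le> r \<Longrightarrow> r \<le> q \<Longrightarrow> x \<in> L \<Longrightarrow> \<bar>A r x\<bar> \<le> B'"
        unfolding bounded_iff by fastforce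
      let ?c = "\<lambda>r x. if p \<le> r \<and> r \<le> q then \<psi> (coord_sum x) * A r x else 0"
      have c0: "?c r x = 0" if "\<not> (p \<le> r \<and> r \<le> q \<and> x \<in> L)" for r x
      proof (cases "p \<le> r \<and> r \<le> q")
        case True
        then have "0 < r" using p by simp
        then have "\<psi> (coord_sum x) = 0 \<or> A r x = 0"
          using inL[of r x] A0[of r x] that True by blast
        then show ?thesis by auto
      qed auto
      have "\<bar>?c r x\<bar> \<le> B * max B' 0" for r x
      proof (cases "p \<le> r \<and> r \<le> q \<and> x \<in> L")
        case True
        have B0: "0 \<le> B" using B[of 0] by simp
        have "\<bar>\<psi> (coord_sum x)\<bar> * \<bar>A r x\<bar> \<le> B * max B' 0"
          using B B0 B'[of r x] True by (intro mult_mono) (auto simp: le_max_iff_disj)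
        then show ?thesis using True by (simp add: abs_mult)
      next
        case False
        have "0 \<le> B" using B[of 0] by simp
        then show ?thesis unfolding c0[OF False] by simp
      qed
      note bound = this
      show ?thesis
      proof (rule integrable_strip_bounded[of u ?c L p q "B * max B' 0", OF u _ _ L(1,2)])
        show "u \<in> borel_measurable borel" by measurable
        show "(\<lambda>w. ?c (fst w) (snd w)) \<in> borel_measurable (borel \<Otimes>\<^sub>M borel)" by measurable
      qed (fact c0 bound)+
    qed
    have c1: "continuous_on ({p..q} \<times> L) (\<lambda>w. u ((1 / fst w) *\<^sub>R snd w))" if "continuous_on UNIV u" for u :: "real ^ 'n \<Rightarrow> real"
      using p by (intro continuous_on_compose2[OF that] continuous_intros) auto
    have c2: "continuous_on ({p..q} \<times> L) (\<lambda>w. coord_sum (snd w))"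
      unfolding coord_sum_def by (intro continuous_intros)
    have c3: "continuous_on ({p..q} \<times> L) (\<lambda>w. 1 / fst w)" "continuous_on ({p..q} \<times> L) (\<lambda>w. 1 / fst w ^ Suc CARD('n))"
      using p by (intro continuous_intros; auto)+
    let ?k = "\<lambda>r x. coord_sum x * (1 / r ^ Suc CARD('n))"
    let ?\<phi> = "\<lambda>r x. \<phi> ((1 / r) *\<^sub>R x)"
    define A where "A = (\<lambda>r x. ?k r x * ((coord_sum x * (1 / r)) * d\<phi> ((1 / r) *\<^sub>R x) + ?\<phi> r x))"
    define A' where "A' = (\<lambda>j r x. ?k r x * ((coord_sum x * (if j = i then 1 else 0) - x $ j) * ?\<phi> r x))"
    have sA: "integrable (lborel \<Otimes>\<^sub>M lborel) (\<lambda>(r, x). (if p \<le> r \<and> r \<le> q then \<psi> (coord_sum x) * A r x else 0) * f x)"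
    proof (rule strip[OF f_loc])
      show "continuous_on ({p..q} \<times> L) (\<lambda>w. A (fst w) (snd w))"
        unfolding A_def by (intro continuous_on_mult continuous_on_add c2 c3 c1[OF cont(1)] c1[OF cont(2)])
    qed (auto simp: A_def \<phi>0)
    have sA': "integrable (lborel \<Otimes>\<^sub>M lborel) (\<lambda>(r, x). (if p \<le> r \<and> r \<le> q then \<psi> (coord_sum x) * A' j r x else 0) * G x $ j)" for j
    proof (rule strip[OF G_loc])
      show "continuous_on ({p..q} \<times> L) (\<lambda>w. A' j (fst w) (snd w))"
        unfolding A'_def by (intro continuous_on_mult continuous_on_diff c2 c3 c1[OF cont(1)] continuous_intros)
    qed (auto simp: A'_def \<phi>0)
    have sE: "integrable (lborel \<Otimes>\<^sub>M lborel) (\<lambda>(r, x). (if p \<le> r \<and> r \<le> q then \<psi> (coord_sum x) * (?k r x * euler UNIV \<phi> ((1 / r) *\<^sub>R x)) else 0) * f x)"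
    proof (rule strip[OF f_loc])
      show "continuous_on ({p..q} \<times> L) (\<lambda>w. ?k (fst w) (snd w) * euler UNIV \<phi> ((1 / fst w) *\<^sub>R snd w))"
        by (intro continuous_on_mult c2 c3 c1[OF cont(3)])
    qed (auto simp: \<phi>0)
    have "integrable (lborel \<Otimes>\<^sub>M lborel) (\<lambda>w. (case w of (r, x) \<Rightarrow> (if p \<le> r \<and> r \<le> q then \<psi> (coord_sum x) * A r x else 0) * f x)
        + (\<Sum>j\<in>UNIV. case w of (r, x) \<Rightarrow> (if p \<le> r \<and> r \<le> q then \<psi> (coord_sum x) * A' j r x else 0) * G x $ j))"
      by (intro Bochner_Integration.integrable_add Bochner_Integration.integrable_sum sA sA')
    also have "(\<lambda>w. (case w of (r, x) \<Rightarrow> (if p \<le> r \<and> r \<le> q then \<psi> (coord_sum x) * A r x else 0) * f x)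
        + (\<Sum>j\<in>UNIV. case w of (r, x) \<Rightarrow> (if p \<le> r \<and> r \<le> q then \<psi> (coord_sum x) * A' j r x else 0) * G x $ j))
        = (\<lambda>(r, x). polar_jacobian r x * (W ((1 / r) *\<^sub>R x) (coord_sum x) * \<psi> (coord_sum x)))"
    proof (rule ext, clarify)
      fix r :: real and x :: "real ^ 'n"
      show "(if p \<le> r \<and> r \<le> q then \<psi> (coord_sum x) * A r x else 0) * f x
          + (\<Sum>j\<in>UNIV. (if p \<le> r \<and> r \<le> q then \<psi> (coord_sum x) * A' j r x else 0) * G x $ j)
          = polar_jacobian r x * (W ((1 / r) *\<^sub>R x) (coord_sum x) * \<psi> (coord_sum x))"
      proof (cases "0 < r")
        case r: True
        show ?thesis
        proof (cases "(1 / r) *\<^sub>R x \<in> support \<phi> \<and> \<psi> (coord_sum x) \<noteq> 0")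
          case True
          then have pqr: "p \<le> r \<and> r \<le> q" using range[OF r] by blast
          have x: "x \<in> orthant"
            using True K(2) scaleR_in_orthant[of "1 / r" x] r by auto
          have sum_A': "(\<Sum>j\<in>UNIV. A' j r x * G x $ j) = ?k r x * ((coord_sum x * G x $ i - (\<Sum>j\<in>UNIV. x $ j * G x $ j)) * ?\<phi> r x)"
          proof -
            have "(\<Sum>j\<in>UNIV. A' j r x * G x $ j)
              = (\<Sum>j\<in>UNIV. ?k r x * ?\<phi> r x * ((if j = i then coord_sum x * G x $ j else 0) - x $ j * G x $ j))"
              by (intro sum.cong) (auto simp: A'_def algebra_simps)
            also have "\<dots> = ?k r x * ?\<phi> r x * (coord_sum x * G x $ i - (\<Sum>j\<in>UNIV. x $ j * G x $ j))"
              unfolding sum_distrib_left[symmetric] sum_subtractf by simp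
            finally show ?thesis by (simp add: mult_ac)
          qed
          have "\<psi> (coord_sum x) * (A r x * f x + (\<Sum>j\<in>UNIV. A' j r x * G x $ j)) = \<psi> (coord_sum x) * (?k r x * V r x)"
            unfolding sum_A' by (simp add: A_def V_def algebra_simps)
          moreover have "polar_jacobian r x = ?k r x"
            using r by (simp add: polar_jacobian_def)
          ultimately show ?thesis
            using pqr W_polar[OF r x] by (simp add: sum_distrib_left distrib_left mult_ac)
        next
          case False
          then show ?thesis
            by (auto simp: A_def A'_def W_def \<phi>0)
        qed
      next
        case False
        then show ?thesis using p by (auto simp: polar_jacobian_def)
      qed
    qed
    finally have "integrable (lborel \<Otimes>\<^sub>M lborel) (\<lambda>(r, x). polar_jacobian r x * (W ((1 / r) *\<^sub>R x) (coord_sum x) * \<psi> (coord_sum x)))" .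
    moreover have "integrable (lborel \<Otimes>\<^sub>M lborel) (\<lambda>(r, x). (if p \<le> r \<and> r \<le> q then \<psi> (coord_sum x) * coord_sum x * euler UNIV \<phi> ((1 / r) *\<^sub>R x) / r ^ Suc CARD('n) else 0) * f x)"
    proof -
      have "(\<lambda>(r, x). (if p \<le> r \<and> r \<le> q then \<psi> (coord_sum x) * (?k r x * euler UNIV \<phi> ((1 / r) *\<^sub>R x)) else 0) * f x)
        = (\<lambda>(r, x). (if p \<le> r \<and> r \<le> q then \<psi> (coord_sum x) * coord_sum x * euler UNIV \<phi> ((1 / r) *\<^sub>R x) / r ^ Suc CARD('n) else 0) * f x)"
        by (auto simp: fun_eq_iff)
      with sE show ?thesis by (simp only:)
    qed
    ultimately show ?thesis
      using p pq range by blast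
  qed
  have W0: "W y s * \<psi> s = 0" if "\<not> (y \<in> orthant \<and> 0 < s)" "\<And>s. \<not> 0 < s \<Longrightarrow> \<psi> s = 0" for y s \<psi>
    using that \<phi>0[of y] K(2) by (cases "y \<in> support \<phi>") (auto simp: W_def)
  define Q where "Q = (\<lambda>s. LINT y|lborel. W y s)"
  have Q_loc: "locally_integrable_on {0<..} Q"
    unfolding locally_integrable_on_def
  proof safe
    fix C :: "real set" assume C: "compact C" "C \<subseteq> {0<..}"
    have [measurable]: "C \<in> sets borel" using C(1) by (rule borel_compact)
    obtain b c where bc: "0 < b" "C \<subseteq> {b..c}"
      using compact_subset_halfline[OF C] by blast
    have "integrable (lborel \<Otimes>\<^sub>M lborel) (\<lambda>(r, x). polar_jacobian r x * (W ((1 / r) *\<^sub>R x) (coord_sum x) * indicator C (coord_sum x)))"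
    proof (rule polar[of "indicator C" b c 1, THEN conjunct1])
      show "indicator C s = (0 :: real)" if "\<not> (b \<le> s \<and> s \<le> c)" for s
        using that bc(2) by (auto simp: indicator_def)
      show "\<bar>indicator C s :: real\<bar> \<le> 1" for s
        by (simp add: indicator_def)
    qed (use bc(1) in measurable)
    then have "integrable (lborel \<Otimes>\<^sub>M lborel) (\<lambda>(y, s). W y s * indicator C s)"
    proof (rule integrable_polar[rotated 2])
      show "W y s * indicator C s = 0" if "\<not> (y \<in> orthant \<and> 0 < s)" for y s
        using that C(2) by (intro W0) (auto simp: indicator_def)
    qed measurable
    from lborel_pair.integrable_snd[OF this] show "set_integrable lborel C Q"
      by (simp add: set_integrable_def Q_def mult.commute)
  qed
  have "AE s in lborel. s \<in> {0<..} \<longrightarrow> Q s = 0"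
  proof (rule fundamental_lemma[OF _ Q_loc])
    fix \<psi> :: "real \<Rightarrow> real" assume \<psi>: "test_function {0<..} \<psi>"
    have cont_\<psi>: "continuous_on UNIV \<psi>" by (rule continuous_on_test_function[OF \<psi>])
    then have [measurable]: "\<psi> \<in> borel_measurable borel" by (rule borel_measurable_continuous_onI)
    obtain b c where bc: "0 < b" "support \<psi> \<subseteq> {b..c}"
      using compact_subset_halfline[OF compact_support[OF \<psi>] support_subset[OF \<psi>]] by blast
    have \<psi>0: "\<psi> s = 0" if "\<not> (b \<le> s \<and> s \<le> c)" for s
      using bc(2) not_in_support[of s \<psi>] that by (cases "s \<in> support \<psi>") auto
    have "bounded (\<psi> ` {b..c})"
      by (intro compact_imp_bounded compact_continuous_image continuous_on_subset[OF cont_\<psi>]) auto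
    then obtain B where "\<And>s. b \<le> s \<Longrightarrow> s \<le> c \<Longrightarrow> \<bar>\<psi> s\<bar> \<le> B"
      unfolding bounded_iff by fastforce
    then have B: "\<bar>\<psi> s\<bar> \<le> max B 0" for s
      using \<psi>0[of s] by (cases "b \<le> s \<and> s \<le> c") (auto simp: le_max_iff_disj)
    note polar_\<psi> = polar[of \<psi> b c "max B 0", OF \<open>\<psi> \<in> borel_measurable borel\<close> bc(1) \<psi>0 B]
    have pol: "integrable (lborel \<Otimes>\<^sub>M lborel) (\<lambda>(r, x). polar_jacobian r x * (W ((1 / r) *\<^sub>R x) (coord_sum x) * \<psi> (coord_sum x)))"
      using polar_\<psi> by (rule conjunct1)
    from polar_\<psi>[THEN conjunct2] obtain p q where pq: "0 < p" "p \<le> q" "\<And>r x. 0 < r \<Longrightarrow> \<psi> (coord_sum x) \<noteq> 0 \<Longrightarrow> (1 / r) *\<^sub>R x \<in> support \<phi> \<Longrightarrow> p \<le> r \<and> r \<le> q"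
      and sE: "integrable (lborel \<Otimes>\<^sub>M lborel) (\<lambda>(r, x). (if p \<le> r \<and> r \<le> q then \<psi> (coord_sum x) * coord_sum x * euler UNIV \<phi> ((1 / r) *\<^sub>R x) / r ^ Suc CARD('n) else 0) * f x)"
      by blast
    let ?E = "\<lambda>r x. (if p \<le> r \<and> r \<le> q then \<psi> (coord_sum x) * coord_sum x * euler UNIV \<phi> ((1 / r) *\<^sub>R x) / r ^ Suc CARD('n) else 0) * f x"
    have Wz: "\<And>y s. \<not> (y \<in> orthant \<and> 0 < s) \<Longrightarrow> W y s * \<psi> s = 0"
      using bc(1) \<psi>0 by (intro W0) auto
    have W_int: "integrable (lborel \<Otimes>\<^sub>M lborel) (\<lambda>(y, s). W y s * \<psi> s)"
      by (rule integrable_polar[OF _ Wz pol]) auto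
    have slice: "(LINT x|lborel. polar_jacobian r x * (W ((1 / r) *\<^sub>R x) (coord_sum x) * \<psi> (coord_sum x))) = (LINT x|lborel. ?E r x)" for r
    proof (cases "0 < r")
      case r: True
      define \<phi>r where "\<phi>r = (\<lambda>x. \<phi> (scale UNIV (1 / r) x))"
      have \<phi>r: "test_function orthant \<phi>r"
        unfolding \<phi>r_def by (rule test_function_scale[OF \<phi> r])
      have d\<phi>r: "frechet_derivative \<phi>r (at x) (axis i 1) = (1 / r) * d\<phi> ((1 / r) *\<^sub>R x)" for x
      proof -
        have "(\<phi>r has_derivative (\<lambda>h. frechet_derivative \<phi> (at ((1 / r) *\<^sub>R x)) ((1 / r) *\<^sub>R h))) (at x)"
          using has_derivative_compose[OF bounded_linear_imp_has_derivative[OF bounded_linear_scaleR_right[of "1 / r"]],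
              of \<phi> "frechet_derivative \<phi> (at ((1 / r) *\<^sub>R x))" x UNIV] test_function_differentiable[OF \<phi>, of "(1 / r) *\<^sub>R x"]
          by (simp add: frechet_derivative_works \<phi>r_def scale_UNIV)
        from fun_cong[OF frechet_derivative_at[OF this], of "axis i 1"] show ?thesis
          using linear_scale[OF linear_frechet_derivative[OF test_function_differentiable[OF \<phi>]]]
          by (simp add: d\<phi>_def)
      qed
      have smooth_\<eta>: "C_k k (\<lambda>s. s * \<psi> s)" for k
        by (rule C_k_mult[OF C_k_bounded_linear[OF bounded_linear_ident] test_function_smooth[OF \<psi>]])
      have lhs: "polar_jacobian r x * (W ((1 / r) *\<^sub>R x) (coord_sum x) * \<psi> (coord_sum x))
          = ((coord_sum x * \<psi> (coord_sum x)) * (f x * (\<phi>r x + coord_sum x * frechet_derivative \<phi>r (at x) (axis i 1))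
        + (coord_sum x * G x $ i - (\<Sum>j\<in>UNIV. x $ j * G x $ j)) * \<phi>r x)) / r ^ Suc CARD('n)" for x
      proof (cases "x \<in> orthant")
        case True
        have \<phi>r_x: "\<phi> ((1 / r) *\<^sub>R x) = \<phi>r x"
          by (simp add: \<phi>r_def scale_UNIV)
        show ?thesis
          using r unfolding W_polar[OF r True] d\<phi>r V_def \<phi>r_x by (simp add: polar_jacobian_def ac_simps)
      next
        case False
        then have "(1 / r) *\<^sub>R x \<notin> orthant" using scaleR_in_orthant[of "1 / r" x] r by simp
        then have "(1 / r) *\<^sub>R x \<notin> support \<phi>" using K(2) by blast
        then show ?thesis by (simp add: W_def \<phi>0 d\<phi>r) (simp add: \<phi>r_def scale_UNIV \<phi>0)
      qed
      have rhs: "?E r x = (f x * ((coord_sum x * \<psi> (coord_sum x)) * euler UNIV \<phi>r x)) / r ^ Suc CARD('n)" for x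
      proof -
        have eu: "euler UNIV \<phi>r x = euler UNIV \<phi> ((1 / r) *\<^sub>R x)"
          using euler_scale[OF test_function_differentiable[OF \<phi>] r, of UNIV x] by (simp add: \<phi>r_def scale_UNIV)
        show ?thesis
        proof (cases "p \<le> r \<and> r \<le> q")
          case False
          then have "\<psi> (coord_sum x) = 0 \<or> (1 / r) *\<^sub>R x \<notin> support \<phi>"
            using pq(3)[OF r] by blast
          then show ?thesis using False by (auto simp: eu \<phi>0)
        qed (simp add: eu mult_ac)
      qed
      show ?thesis
        unfolding lhs rhs
        using tangential_weak_identity[OF wg f0 G0 \<phi>r smooth_\<eta>, of i] by simp
    next
      case False
      then show ?thesis using pq(1) by (simp add: polar_jacobian_def)
    qed
    \<comment> \<open>The interval is enlarged to \<open>[p / 2, q + 1]\<close>, at whose end points the test function vanishes.\<close>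
    have radial: "(LINT r|lborel. ?E r x) = 0" for x
    proof (cases "x \<in> orthant \<and> \<psi> (coord_sum x) \<noteq> 0")
      case True
      have end0: "\<phi> ((1 / r) *\<^sub>R x) = 0" if "0 < r" "\<not> (p \<le> r \<and> r \<le> q)" for r
        using pq(3)[OF that(1), of x] True that(2) by (intro \<phi>0) auto
      have end1: "euler UNIV \<phi> ((1 / r) *\<^sub>R x) = 0" if "0 < r" "\<not> (p \<le> r \<and> r \<le> q)" for r
        using pq(3)[OF that(1), of x] True that(2) by (intro \<phi>0) auto
      have "(LINT r|lborel. indicator {p / 2..q + 1} r *\<^sub>R (- euler UNIV \<phi> (scale UNIV (1 / r) x) / r ^ Suc CARD('n)))
          = \<phi> (scale UNIV (1 / (q + 1)) x) / (q + 1) ^ CARD('n) - \<phi> (scale UNIV (1 / (p / 2)) x) / (p / 2) ^ CARD('n)"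
      proof (rule integral_FTC_Icc)
        show "p / 2 \<le> q + 1" using pq by simp
        fix r assume "p / 2 \<le> r" "r \<le> q + 1"
        then have r: "0 < r" using pq by simp
        show "((\<lambda>r. \<phi> (scale UNIV (1 / r) x) / r ^ CARD('n)) has_vector_derivative - euler UNIV \<phi> (scale UNIV (1 / r) x) / r ^ Suc CARD('n)) (at r within {p / 2..q + 1})"
          using has_derivative_scale_test[OF test_function_differentiable[OF \<phi>] r, of UNIV x]
          by (auto simp: has_real_derivative_iff_has_vector_derivative intro: has_vector_derivative_at_within)
      next
        have "continuous_on {p / 2..q + 1} (\<lambda>r. euler UNIV \<phi> ((1 / r) *\<^sub>R x))"
          using pq by (intro continuous_on_compose2[OF cont(3)] continuous_intros) auto
        then show "continuous_on {p / 2..q + 1} (\<lambda>r. - euler UNIV \<phi> (scale UNIV (1 / r) x) / r ^ Suc CARD('n))"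
          using pq unfolding scale_UNIV by (intro continuous_intros) auto
      qed
      also have "\<dots> = 0"
        using end0[of "q + 1"] end0[of "p / 2"] pq by (simp add: scale_UNIV)
      finally have 0: "(LINT r|lborel. indicator {p / 2..q + 1} r *\<^sub>R (- euler UNIV \<phi> (scale UNIV (1 / r) x) / r ^ Suc CARD('n))) = 0" .
      have "?E r x = - (\<psi> (coord_sum x) * coord_sum x * f x) * (indicator {p / 2..q + 1} r *\<^sub>R (- euler UNIV \<phi> (scale UNIV (1 / r) x) / r ^ Suc CARD('n)))" for r
      proof (cases "p \<le> r \<and> r \<le> q")
        case True
        then have "r \<in> {p / 2..q + 1}" using pq by auto
        then show ?thesis using True by (simp add: scale_UNIV mult_ac)
      next
        case False
        then have "r \<notin> {p / 2..q + 1} \<or> euler UNIV \<phi> ((1 / r) *\<^sub>R x) = 0"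
          using end1[of r] pq by auto
        then show ?thesis using False by (auto simp: scale_UNIV)
      qed
      then have "(LINT r|lborel. ?E r x) = - (\<psi> (coord_sum x) * coord_sum x * f x)
          * (LINT r|lborel. indicator {p / 2..q + 1} r *\<^sub>R (- euler UNIV \<phi> (scale UNIV (1 / r) x) / r ^ Suc CARD('n)))"
        by (simp only: integral_mult_right_zero)
      with 0 show ?thesis by simp
    next
      case False
      then have "f x = 0 \<or> \<psi> (coord_sum x) = 0" using f0 by blast
      then have "?E r x = 0" for r by auto
      then show ?thesis by (simp only: Bochner_Integration.integral_zero)
    qed
    have "(LINT s|lborel. Q s * \<psi> s) = (LINT s|lborel. LINT y|lborel. W y s * \<psi> s)"
      by (simp add: Q_def)
    also have "\<dots> = (LINT y|lborel. LINT s|lborel. W y s * \<psi> s)"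
      by (rule lborel_pair.Fubini_integral[OF W_int])
    also have "\<dots> = (LINT r|lborel. LINT x|lborel. polar_jacobian r x * (W ((1 / r) *\<^sub>R x) (coord_sum x) * \<psi> (coord_sum x)))"
      by (rule integral_polar[OF _ Wz pol]) auto
    also have "\<dots> = (LINT r|lborel. LINT x|lborel. ?E r x)"
      by (simp only: slice)
    also have "\<dots> = (LINT x|lborel. LINT r|lborel. ?E r x)"
      by (rule lborel_pair.Fubini_integral[OF sE, symmetric])
    also have "\<dots> = 0"
      by (simp only: radial Bochner_Integration.integral_zero)
    finally have "(LINT s|lborel. Q s * \<psi> s) = 0" .
    moreover have "indicator {0<..} s *\<^sub>R (Q s * \<psi> s) = Q s * \<psi> s" for s
      using bc(1) \<psi>0[of s] by (auto simp: indicator_def)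
    ultimately show "(LINT s:{0<..}|lborel. Q s * \<psi> s) = 0"
      by (simp only: set_lebesgue_integral_def)
  qed simp
  then show ?thesis
    by (simp add: Q_def W_def d\<phi>_def)
qed

lemma locally_integrable_on_cong:
  assumes "\<And>x. x \<in> \<Omega> \<Longrightarrow> f x = g x"
  shows "locally_integrable_on \<Omega> f \<longleftrightarrow> locally_integrable_on \<Omega> g"
proof -
  have "set_integrable lborel K f \<longleftrightarrow> set_integrable lborel K g" if "K \<subseteq> \<Omega>" for K
    unfolding set_integrable_def using assms that
    by (intro Bochner_Integration.integrable_cong refl) (auto simp: indicator_def)
  then show ?thesis by (auto simp: locally_integrable_on_def)
qed

lemma integrable_compact_coefficient:
  fixes v :: "(real ^ 'n) \<times> real \<Rightarrow> real" and c :: "real ^ 'n \<Rightarrow> real"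
  assumes v: "integrable (lborel \<Otimes>\<^sub>M lborel) (\<lambda>(y, s). indicator K y * v (y, s))"
    and [measurable]: "c \<in> borel_measurable borel"
    and c: "continuous_on K c" "compact K" and c0: "\<And>y. y \<notin> K \<Longrightarrow> c y = 0"
  shows "integrable (lborel \<Otimes>\<^sub>M lborel) (\<lambda>(y, s). c y * v (y, s))"
proof -
  have "bounded (c ` K)"
    by (intro compact_imp_bounded compact_continuous_image c)
  then obtain B where B: "\<And>y. y \<in> K \<Longrightarrow> \<bar>c y\<bar> \<le> B"
    unfolding bounded_iff by auto
  have "integrable (lborel \<Otimes>\<^sub>M lborel) (\<lambda>w. c (fst w) * (case w of (y, s) \<Rightarrow> indicator K y * v (y, s)))"
  proof (rule Bochner_Integration.integrable_bound)
    show "integrable (lborel \<Otimes>\<^sub>M lborel) (\<lambda>w. B * (case w of (y, s) \<Rightarrow> indicator K y * v (y, s)))"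
      using v by simp
    show "(\<lambda>w. c (fst w) * (case w of (y, s) \<Rightarrow> indicator K y * v (y, s))) \<in> borel_measurable (lborel \<Otimes>\<^sub>M lborel)"
      using borel_measurable_integrable[OF v] by (intro borel_measurable_times) (auto simp del: split_paired_All)
    show "AE w in lborel \<Otimes>\<^sub>M lborel. norm (c (fst w) * (case w of (y, s) \<Rightarrow> indicator K y * v (y, s)))
        \<le> norm (B * (case w of (y, s) \<Rightarrow> indicator K y * v (y, s)))"
    proof (rule AE_I2, clarify)
      fix y s
      show "norm (c (fst (y, s)) * (indicator K y * v (y, s))) \<le> norm (B * (indicator K y * v (y, s)))"
        using B[of y] by (cases "y \<in> K") (auto simp: abs_mult intro!: mult_right_mono)
    qed
  qed
  also have "(\<lambda>w. c (fst w) * (case w of (y, s) \<Rightarrow> indicator K y * v (y, s))) = (\<lambda>(y, s). c y * v (y, s))"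
  proof (rule ext, clarify)
    fix y s show "c (fst (y, s)) * (indicator K y * v (y, s)) = c y * v (y, s)"
      using c0[of y] by (cases "y \<in> K") auto
  qed
  finally show ?thesis .
qed

text \<open>
  \<open>AE_spherical_weak_identity\<close> integrated over \<open>s\<close> with the weight \<open>d\<close>. The chain rule explains the
  formula: \<open>F\<close> comes from differentiating the factor \<open>coord_sum y\<close>, the rest from the dependence of the
  direction \<open>y / coord_sum y\<close> on \<open>y\<close>.
\<close>

lemma weak_gradient_spherical_average:
  fixes f :: "real ^ 'n \<Rightarrow> real" and G :: "real ^ 'n \<Rightarrow> real ^ 'n" and d :: "real \<Rightarrow> real"
  assumes wg: "weak_gradient orthant f G"
    and [measurable]: "f \<in> borel_measurable borel" "G \<in> borel_measurable borel" "d \<in> borel_measurable borel"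
    and f0: "\<And>x. x \<notin> orthant \<Longrightarrow> f x = 0" and G0: "\<And>x. x \<notin> orthant \<Longrightarrow> G x = 0"
    and d0: "\<And>s. s \<le> 0 \<Longrightarrow> d s = 0"
    and f_int: "\<And>K. compact K \<Longrightarrow> K \<subseteq> orthant \<Longrightarrow>
      integrable (lborel \<Otimes>\<^sub>M lborel) (\<lambda>(y, s). indicator K y * (d s * f ((s / coord_sum y) *\<^sub>R y)))"
    and G_int: "\<And>K j. compact K \<Longrightarrow> K \<subseteq> orthant \<Longrightarrow>
      integrable (lborel \<Otimes>\<^sub>M lborel) (\<lambda>(y, s). indicator K y * (d s * (s * G ((s / coord_sum y) *\<^sub>R y) $ j)))"
  defines "F \<equiv> \<lambda>y. LINT s|lborel. d s * f ((s / coord_sum y) *\<^sub>R y)"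
    and "H \<equiv> \<lambda>y. \<chi> j. LINT s|lborel. d s * (s * G ((s / coord_sum y) *\<^sub>R y) $ j)"
  shows "weak_gradient orthant (\<lambda>y. if y \<in> orthant then coord_sum y * F y else 0)
    (\<lambda>y. if y \<in> orthant then \<chi> i. F y + (H y $ i - (\<Sum>j\<in>UNIV. y $ j / coord_sum y * H y $ j)) else 0)"
    (is "weak_gradient orthant ?u ?U")
  unfolding weak_gradient_def
proof
  fix b :: "real ^ 'n" assume "b \<in> Basis"
  then obtain i where b: "b = axis i 1" by (auto simp: Basis_vec_def)
  let ?X = "\<lambda>y s. (s / coord_sum y) *\<^sub>R y"
  define Ui where "Ui = (\<lambda>y. F y + (H y $ i - (\<Sum>j\<in>UNIV. y $ j / coord_sum y * H y $ j)))"
  have F_loc: "locally_integrable_on orthant F"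
    unfolding locally_integrable_on_def
  proof safe
    fix K :: "(real ^ 'n) set" assume K: "compact K" "K \<subseteq> orthant"
    from lborel_pair.integrable_fst[OF f_int[OF K]] show "set_integrable lborel K F"
      by (simp add: set_integrable_def F_def)
  qed
  have H_loc: "locally_integrable_on orthant (\<lambda>y. H y $ j)" for j
    unfolding locally_integrable_on_def
  proof safe
    fix K :: "(real ^ 'n) set" assume K: "compact K" "K \<subseteq> orthant"
    from lborel_pair.integrable_fst[OF G_int[OF K, of j]] show "set_integrable lborel K (\<lambda>y. H y $ j)"
      by (simp add: set_integrable_def H_def)
  qed
  have pos: "0 < coord_sum y" "0 \<le> y $ j" "y $ j \<le> coord_sum y" if "y \<in> orthant" for y :: "real ^ 'n" and j
  proof -
    show "0 < coord_sum y" by (rule coord_sum_pos[OF that])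
    show "0 \<le> y $ j" using that by (simp add: orthant_def less_imp_le)
    have "\<And>j. 0 \<le> y $ j" using that by (simp add: orthant_def less_imp_le)
    then show "y $ j \<le> coord_sum y"
      unfolding coord_sum_def by (intro member_le_sum) auto
  qed
  have cont_ratio: "continuous_on K (\<lambda>y :: real ^ 'n. y $ j / coord_sum y)" if "K \<subseteq> orthant" for K and j :: 'n
  proof (intro continuous_on_divide continuous_intros)
    show "continuous_on K (\<lambda>y :: real ^ 'n. coord_sum y)"
      by (rule linear_continuous_on[OF bounded_linear_coord_sum])
    show "\<forall>y\<in>K. coord_sum y \<noteq> 0"
      using that pos(1) by force
  qed
  have Ui_loc: "locally_integrable_on orthant Ui"
  proof -
    have R: "locally_integrable_on orthant (\<lambda>y. y $ j / coord_sum y * H y $ j)" for j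
      unfolding locally_integrable_on_def
    proof safe
      fix K :: "(real ^ 'n) set" assume K: "compact K" "K \<subseteq> orthant"
      have [measurable]: "K \<in> sets borel" using K(1) by (rule borel_compact)
      have int: "integrable lborel (\<lambda>y. indicator K y * H y $ j)"
        using H_loc[of j] K by (simp add: locally_integrable_on_def set_integrable_def)
      have "integrable lborel (\<lambda>y. y $ j / coord_sum y * (indicator K y * H y $ j))"
      proof (rule Bochner_Integration.integrable_bound[OF int])
        show "(\<lambda>y. y $ j / coord_sum y * (indicator K y * H y $ j)) \<in> borel_measurable lborel"
          using borel_measurable_integrable[OF int] by simp
        show "AE y in lborel. norm (y $ j / coord_sum y * (indicator K y * H y $ j)) \<le> norm (indicator K y * H y $ j)"
        proof (rule AE_I2)
          fix y :: "real ^ 'n"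
          show "norm (y $ j / coord_sum y * (indicator K y * H y $ j)) \<le> norm (indicator K y * H y $ j)"
          proof (cases "y \<in> K")
            case True
            then have "\<bar>y $ j / coord_sum y\<bar> \<le> 1"
              using K(2) pos(1)[of y] pos(2,3)[of y j] by (auto simp: field_simps)
            then have "\<bar>y $ j / coord_sum y\<bar> * \<bar>H y $ j\<bar> \<le> 1 * \<bar>H y $ j\<bar>"
              by (intro mult_right_mono) auto
            then show ?thesis
              using True by (simp add: abs_mult)
          qed simp
        qed
      qed
      then show "set_integrable lborel K (\<lambda>y. y $ j / coord_sum y * H y $ j)"
        by (simp add: set_integrable_def mult.left_commute)
    qed
    have "locally_integrable_on orthant (\<lambda>y. \<Sum>j\<in>UNIV. y $ j / coord_sum y * H y $ j)"
      by (intro locally_integrable_on_sum R)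
    with F_loc H_loc[of i] show ?thesis
      unfolding Ui_def locally_integrable_on_def by (auto intro!: set_integral_add set_integral_diff)
  qed
  have u_loc: "locally_integrable_on orthant (\<lambda>y. coord_sum y * F y)"
    by (rule locally_integrable_on_mult_continuous[OF F_loc linear_continuous_on[OF bounded_linear_coord_sum]])
  have U_b: "?U y \<bullet> b = (if y \<in> orthant then Ui y else 0)" for y
    by (simp add: b inner_axis Ui_def)
  have "(LINT y:orthant|lborel. ?u y * frechet_derivative \<phi> (at y) b) = - (LINT y:orthant|lborel. (?U y \<bullet> b) * \<phi> y)"
    if \<phi>: "test_function orthant \<phi>" for \<phi>
  proof -
    define d\<phi> where "d\<phi> = (\<lambda>y. frechet_derivative \<phi> (at y) (axis i 1))"
    note K = compact_support[OF \<phi>] support_subset[OF \<phi>]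
    have cont: "continuous_on UNIV \<phi>" "continuous_on UNIV d\<phi>"
      unfolding d\<phi>_def
      by (rule continuous_on_test_function[OF \<phi>] continuous_on_test_function_derivative[OF \<phi> axis_in_Basis])+
    then have [measurable]: "\<phi> \<in> borel_measurable borel" "d\<phi> \<in> borel_measurable borel"
      by (auto intro: borel_measurable_continuous_onI)
    have \<phi>0: "\<phi> y = 0" "d\<phi> y = 0" if "y \<notin> support \<phi>" for y
      using that by (auto simp: d\<phi>_def not_in_support derivative_not_in_support)
    have contK: "continuous_on (support \<phi>) \<phi>" "continuous_on (support \<phi>) d\<phi>" "continuous_on (support \<phi>) coord_sum"
      using cont linear_continuous_on[OF bounded_linear_coord_sum] by (auto intro: continuous_on_subset)
    define T where "T = (\<lambda>y s. f (?X y s) + s * (G (?X y s) $ i - (\<Sum>j\<in>UNIV. y $ j / coord_sum y * G (?X y s) $ j)))"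
    define W where "W = (\<lambda>y s. coord_sum y * f (?X y s) * d\<phi> y + T y s * \<phi> y)"
    have AE0: "AE s in lborel. 0 < s \<longrightarrow> (LINT y|lborel. W y s) = 0"
      unfolding W_def T_def d\<phi>_def
      by (rule AE_spherical_weak_identity[OF wg _ _ _ _ \<phi>]) (auto intro: f0 G0)
    note fK = f_int[OF K] and GK = G_int[OF K]
    have i1: "integrable (lborel \<Otimes>\<^sub>M lborel) (\<lambda>(y, s). (coord_sum y * d\<phi> y + \<phi> y) * (d s * f (?X y s)))"
      using integrable_compact_coefficient[where K = "support \<phi>" and v = "\<lambda>(y, s). d s * f (?X y s)" and c = "\<lambda>y. coord_sum y * d\<phi> y + \<phi> y"] fK
      by (simp add: \<phi>0 K(1) continuous_on_add continuous_on_mult contK)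
    have i2: "integrable (lborel \<Otimes>\<^sub>M lborel) (\<lambda>(y, s). \<phi> y * (d s * (s * G (?X y s) $ i)))"
      using integrable_compact_coefficient[where K = "support \<phi>" and v = "\<lambda>(y, s). d s * (s * G (?X y s) $ i)" and c = \<phi>] GK[of i]
      by (simp add: \<phi>0 K(1) contK)
    have i3: "integrable (lborel \<Otimes>\<^sub>M lborel) (\<lambda>(y, s). (\<phi> y * (y $ j / coord_sum y)) * (d s * (s * G (?X y s) $ j)))" for j
      using integrable_compact_coefficient[where K = "support \<phi>" and v = "\<lambda>(y, s). d s * (s * G (?X y s) $ j)" and c = "\<lambda>y. \<phi> y * (y $ j / coord_sum y)"] GK[of j]
      by (simp add: \<phi>0 K(1) continuous_on_mult contK cont_ratio[OF K(2)] del: times_divide_eq_right)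
    have W_eq: "d s * W y s = (coord_sum y * d\<phi> y + \<phi> y) * (d s * f (?X y s)) + \<phi> y * (d s * (s * G (?X y s) $ i))
        - (\<Sum>j\<in>UNIV. (\<phi> y * (y $ j / coord_sum y)) * (d s * (s * G (?X y s) $ j)))" for y s
    proof -
      have "(\<Sum>j\<in>UNIV. (\<phi> y * (y $ j / coord_sum y)) * (d s * (s * G (?X y s) $ j)))
          = \<phi> y * d s * s * (\<Sum>j\<in>UNIV. y $ j / coord_sum y * G (?X y s) $ j)"
        unfolding sum_distrib_left by (intro sum.cong refl) (simp only: mult_ac)
      then show ?thesis
        by (simp only: W_def T_def) (simp add: algebra_simps)
    qed
    have W_int: "integrable (lborel \<Otimes>\<^sub>M lborel) (\<lambda>(y, s). d s * W y s)"
      unfolding W_eq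
    proof -
      have "integrable (lborel \<Otimes>\<^sub>M lborel) (\<lambda>w. \<Sum>j\<in>UNIV. case w of (y, s) \<Rightarrow> (\<phi> y * (y $ j / coord_sum y)) * (d s * (s * G (?X y s) $ j)))"
        by (intro Bochner_Integration.integrable_sum i3)
      from Bochner_Integration.integrable_diff[OF Bochner_Integration.integrable_add[OF i1 i2] this]
      show "integrable (lborel \<Otimes>\<^sub>M lborel) (\<lambda>(y, s). (coord_sum y * d\<phi> y + \<phi> y) * (d s * f (?X y s)) + \<phi> y * (d s * (s * G (?X y s) $ i))
        - (\<Sum>j\<in>UNIV. (\<phi> y * (y $ j / coord_sum y)) * (d s * (s * G (?X y s) $ j))))"
        unfolding case_prod_unfold .
    qed
    have "AE y in lborel. (LINT s|lborel. d s * W y s) = coord_sum y * F y * d\<phi> y + Ui y * \<phi> y"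
    proof -
      have "AE y in lborel. \<forall>j. integrable lborel (\<lambda>s. indicator (support \<phi>) y * (d s * (s * G (?X y s) $ j)))"
        unfolding AE_all_countable by (intro allI lborel_pair.AE_integrable_fst GK)
      with lborel_pair.AE_integrable_fst[OF fK] show ?thesis
      proof eventually_elim
        case (elim y)
        show ?case
        proof (cases "y \<in> support \<phi>")
          case True
          then have if': "integrable lborel (\<lambda>s. d s * f (?X y s))" and iG: "\<And>j. integrable lborel (\<lambda>s. d s * (s * G (?X y s) $ j))"
            using elim by auto
          have "(LINT s|lborel. d s * W y s) = (coord_sum y * d\<phi> y + \<phi> y) * F y + \<phi> y * H y $ i
              - (\<Sum>j\<in>UNIV. (\<phi> y * (y $ j / coord_sum y)) * H y $ j)"
            unfolding W_eq F_def H_def vec_lambda_beta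
            by (subst Bochner_Integration.integral_diff Bochner_Integration.integral_add Bochner_Integration.integral_sum integral_mult_right_zero
                | intro Bochner_Integration.integrable_add Bochner_Integration.integrable_sum integrable_mult_right if' iG | simp only:)+
          then show ?thesis
            by (simp add: Ui_def algebra_simps sum_distrib_left)
        qed (simp add: W_def \<phi>0)
      qed
    qed
    then have "(LINT y|lborel. LINT s|lborel. d s * W y s) = (LINT y|lborel. coord_sum y * F y * d\<phi> y + Ui y * \<phi> y)"
    proof (rule integral_cong_AE[rotated 2])
      show "(\<lambda>y. LINT s|lborel. d s * W y s) \<in> borel_measurable lborel"
        using lborel_pair.integrable_fst[OF W_int] by auto
      show "(\<lambda>y. coord_sum y * F y * d\<phi> y + Ui y * \<phi> y) \<in> borel_measurable lborel"
        unfolding Ui_def F_def H_def vec_lambda_beta by measurable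
    qed
    moreover have "(LINT y|lborel. LINT s|lborel. d s * W y s) = (LINT s|lborel. LINT y|lborel. d s * W y s)"
      by (rule lborel_pair.Fubini_integral[OF W_int, symmetric])
    moreover have "(LINT s|lborel. LINT y|lborel. d s * W y s) = integral\<^sup>L lborel (\<lambda>s :: real. 0)"
    proof (rule integral_cong_AE)
      show "(\<lambda>s. LINT y|lborel. d s * W y s) \<in> borel_measurable lborel"
        using lborel_pair.integrable_snd[OF W_int] by auto
      show "AE s in lborel. (LINT y|lborel. d s * W y s) = 0"
        using AE0
      proof eventually_elim
        case (elim s)
        then show ?case using d0[of s] by (cases "0 < s") auto
      qed
    qed simp
    ultimately have main: "(LINT y|lborel. coord_sum y * F y * d\<phi> y + Ui y * \<phi> y) = 0"
      by simp
    have j1: "integrable lborel (\<lambda>y. coord_sum y * F y * d\<phi> y)"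
      by (rule integrable_mult_compact_support[OF u_loc cont(2) K \<phi>0(2)])
    have j2: "integrable lborel (\<lambda>y. Ui y * \<phi> y)"
      by (rule integrable_mult_test_function[OF Ui_loc \<phi>])
    have "(LINT y:orthant|lborel. ?u y * frechet_derivative \<phi> (at y) b) = (LINT y|lborel. coord_sum y * F y * d\<phi> y)"
      unfolding set_lebesgue_integral_def
    proof (rule Bochner_Integration.integral_cong[OF refl])
      fix y show "indicator orthant y *\<^sub>R (?u y * frechet_derivative \<phi> (at y) b) = coord_sum y * F y * d\<phi> y"
        using \<phi>0[of y] K(2) by (auto simp: b d\<phi>_def indicator_def)
    qed
    moreover have "(LINT y:orthant|lborel. (?U y \<bullet> b) * \<phi> y) = (LINT y|lborel. Ui y * \<phi> y)"
      unfolding set_lebesgue_integral_def U_b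
    proof (rule Bochner_Integration.integral_cong[OF refl])
      fix y show "indicator orthant y *\<^sub>R ((if y \<in> orthant then Ui y else 0) * \<phi> y) = Ui y * \<phi> y"
        using \<phi>0[of y] K(2) by (auto simp: indicator_def)
    qed
    ultimately show ?thesis
      using main j1 j2 by simp
  qed
  moreover have "locally_integrable_on orthant ?u"
    using u_loc by (subst locally_integrable_on_cong[where g = "\<lambda>y. coord_sum y * F y"]) auto
  moreover have "locally_integrable_on orthant (\<lambda>y. ?U y \<bullet> b)"
    unfolding U_b using Ui_loc by (subst locally_integrable_on_cong[where g = Ui]) auto
  ultimately show "weak_partial orthant b ?u (\<lambda>y. ?U y \<bullet> b)"
    unfolding weak_partial_def by blast
qed

section \<open>The Liouville distribution as a mixture over rays\<close>

text \<open>
  Measures on \<open>\<Omega>\<close> are replaced by measures on the whole space with density zero off \<open>\<Omega>\<close>, for which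
  measurability is Borel measurability.
\<close>

lemma
  fixes h F :: "'a::euclidean_space \<Rightarrow> real"
  assumes \<Omega>: "\<Omega> \<in> sets borel"
    and k [measurable]: "(\<lambda>x. if x \<in> \<Omega> then h x else 0) \<in> borel_measurable borel"
  defines "D \<equiv> density lborel (\<lambda>x. ennreal ((if x \<in> \<Omega> then h x else 0) / (LINT x|lborel. (if x \<in> \<Omega> then h x else 0))))"
  shows normalized_measure_eq: "normalized_measure \<Omega> h = restrict_space D \<Omega>"
    and integrable_normalized_measure_iff: "integrable (normalized_measure \<Omega> h) F \<longleftrightarrow> integrable D (\<lambda>x. if x \<in> \<Omega> then F x else 0)"
    and integral_normalized_measure: "(LINT x|normalized_measure \<Omega> h. F x) = (LINT x|D. (if x \<in> \<Omega> then F x else 0))"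
proof -
  define Z where "Z = (LINT x|lborel. (if x \<in> \<Omega> then h x else 0))"
  have ind: "indicator \<Omega> x *\<^sub>R u x = (if x \<in> \<Omega> then u x else 0)" for x and u :: "'a \<Rightarrow> real"
    by (simp add: indicator_def)
  have Z_eq: "(LINT y:\<Omega>|lborel. h y) = Z"
    by (simp only: Z_def set_lebesgue_integral_def ind)
  have h_m [measurable]: "h \<in> borel_measurable (restrict_space lborel \<Omega>)"
    using \<Omega> k by (subst borel_measurable_restrict_space_iff) (simp_all only: ind, simp_all)
  show eq: "normalized_measure \<Omega> h = restrict_space D \<Omega>"
  proof (rule measure_eqI)
    show "sets (normalized_measure \<Omega> h) = sets (restrict_space D \<Omega>)"
      unfolding normalized_measure_def D_def by (simp add: sets_restrict_space)
    fix A assume "A \<in> sets (normalized_measure \<Omega> h)"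
    then have A: "A \<in> sets (restrict_space lborel \<Omega>)"
      by (simp add: normalized_measure_def)
    then have A': "A \<subseteq> \<Omega>" "A \<in> sets borel"
      using \<Omega> by (auto simp: sets_restrict_space_iff)
    have "emeasure (normalized_measure \<Omega> h) A = (\<integral>\<^sup>+x. ennreal (h x / Z) * indicator A x \<partial>restrict_space lborel \<Omega>)"
      unfolding normalized_measure_def Z_eq by (rule emeasure_density) (use A in auto)
    also have "\<dots> = (\<integral>\<^sup>+x. ennreal (h x / Z) * indicator A x * indicator \<Omega> x \<partial>lborel)"
      using \<Omega> by (intro nn_integral_restrict_space) simp
    also have "\<dots> = (\<integral>\<^sup>+x. ennreal ((if x \<in> \<Omega> then h x else 0) / Z) * indicator A x \<partial>lborel)"
      using A' by (intro nn_integral_cong) (auto simp: indicator_def)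
    also have "\<dots> = emeasure D A"
      unfolding D_def Z_def[symmetric] by (rule emeasure_density[symmetric]) (use A' in auto)
    also have "\<dots> = emeasure (restrict_space D \<Omega>) A"
      using A' \<Omega> by (intro emeasure_restrict_space[symmetric]) (auto simp: D_def)
    finally show "emeasure (normalized_measure \<Omega> h) A = emeasure (restrict_space D \<Omega>) A" .
  qed
  have "\<Omega> \<inter> space D \<in> sets D" using \<Omega> by (simp add: D_def)
  then show "integrable (normalized_measure \<Omega> h) F \<longleftrightarrow> integrable D (\<lambda>x. if x \<in> \<Omega> then F x else 0)"
    and "(LINT x|normalized_measure \<Omega> h. F x) = (LINT x|D. (if x \<in> \<Omega> then F x else 0))"
    unfolding eq by (simp_all only: integrable_restrict_space integral_restrict_space set_integrable_def set_lebesgue_integral_def ind)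
qed

lemma borel_measurable_vec_lambda [measurable]:
  fixes f :: "'a \<Rightarrow> 'n::finite \<Rightarrow> real"
  assumes "\<And>i. (\<lambda>x. f x i) \<in> borel_measurable M"
  shows "(\<lambda>x. \<chi> i. f x i) \<in> borel_measurable M"
proof (subst borel_measurable_euclidean_space, intro ballI)
  fix b :: "real ^ 'n" assume "b \<in> Basis"
  then obtain i where "b = axis i 1" by (auto simp: Basis_vec_def)
  then show "(\<lambda>x. (\<chi> i. f x i) \<bullet> b) \<in> borel_measurable M"
    using assms by (simp add: inner_axis)
qed

text \<open>
  Nonnegativity of the mean of \<open>w (t - l s / w)\<^sup>2\<close> for the optimal \<open>l\<close>.
\<close>

lemma weighted_cauchy_schwarz:
  fixes s t w :: "'a \<Rightarrow> real"
  assumes w: "AE x in M. 0 < w x"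
    and A: "integrable M (\<lambda>x. (s x)\<^sup>2 / w x)" and B: "integrable M (\<lambda>x. w x * (t x)\<^sup>2)"
    and [measurable]: "s \<in> borel_measurable M" "t \<in> borel_measurable M" "w \<in> borel_measurable M"
  shows "integrable M (\<lambda>x. s x * t x)"
    and "(LINT x|M. s x * t x)\<^sup>2 \<le> (LINT x|M. (s x)\<^sup>2 / w x) * (LINT x|M. w x * (t x)\<^sup>2)"
proof -
  have young: "\<bar>a * b\<bar> \<le> a\<^sup>2 / v + v * b\<^sup>2" if "0 < v" for a b v :: real
  proof -
    have "0 \<le> (\<bar>a\<bar> - v * \<bar>b\<bar>)\<^sup>2" by simp
    then have "2 * v * (\<bar>a\<bar> * \<bar>b\<bar>) \<le> a\<^sup>2 + v\<^sup>2 * b\<^sup>2"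
      by (simp add: power2_diff power_mult_distrib mult_ac)
    then have "2 * (\<bar>a\<bar> * \<bar>b\<bar>) \<le> a\<^sup>2 / v + v * b\<^sup>2"
      using that by (simp add: field_simps power2_eq_square)
    moreover have "0 \<le> \<bar>a\<bar> * \<bar>b\<bar>" by simp
    ultimately show ?thesis unfolding abs_mult by linarith
  qed
  show C: "integrable M (\<lambda>x. s x * t x)"
  proof (rule Bochner_Integration.integrable_bound)
    show "integrable M (\<lambda>x. (s x)\<^sup>2 / w x + w x * (t x)\<^sup>2)" using A B by simp
    show "AE x in M. norm (s x * t x) \<le> norm ((s x)\<^sup>2 / w x + w x * (t x)\<^sup>2)"
      using w
    proof eventually_elim
      case (elim x)
      then show ?case using young[of "w x" "s x" "t x"] by simp
    qed
  qed simp
  let ?A = "LINT x|M. (s x)\<^sup>2 / w x" and ?B = "LINT x|M. w x * (t x)\<^sup>2" and ?C = "LINT x|M. s x * t x"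
  have A0: "AE x in M. 0 \<le> (s x)\<^sup>2 / w x"
    using w by eventually_elim simp
  show "?C\<^sup>2 \<le> ?A * ?B"
  proof (cases "?A = 0")
    case True
    then have "AE x in M. (s x)\<^sup>2 / w x = 0"
      using integral_nonneg_eq_0_iff_AE[OF A A0] by simp
    with w have "AE x in M. s x * t x = 0"
      by eventually_elim auto
    then have "?C = 0" by (rule integral_eq_zero_AE)
    then show ?thesis using True by simp
  next
    case False
    have "0 \<le> ?A" by (rule integral_nonneg_AE[OF A0])
    with False have Ap: "0 < ?A" by simp
    define l where "l = ?C / ?A"
    have "0 \<le> (LINT x|M. w x * (t x)\<^sup>2 - 2 * l * (s x * t x) + l\<^sup>2 * ((s x)\<^sup>2 / w x))"
    proof (rule integral_nonneg_AE)
      show "AE x in M. 0 \<le> w x * (t x)\<^sup>2 - 2 * l * (s x * t x) + l\<^sup>2 * ((s x)\<^sup>2 / w x)"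
        using w
      proof eventually_elim
        case (elim x)
        have "w x * (t x)\<^sup>2 - 2 * l * (s x * t x) + l\<^sup>2 * ((s x)\<^sup>2 / w x) = w x * (t x - l * s x / w x)\<^sup>2"
          using elim by (simp add: power2_eq_square field_simps)
        also have "0 \<le> \<dots>" using elim by simp
        finally show ?case .
      qed
    qed
    also have "\<dots> = ?B - 2 * l * ?C + l\<^sup>2 * ?A"
      using A B C by (simp del: times_divide_eq_right times_divide_eq_left)
    also have "\<dots> = ?B - ?C\<^sup>2 / ?A"
      using Ap by (simp add: l_def power2_eq_square)
    finally show ?thesis
      using Ap by (simp add: field_simps)
  qed
qed

definition radial_prob :: "real ^ 'n \<Rightarrow> (real \<Rightarrow> real) \<Rightarrow> real measure" where
  "radial_prob \<alpha> g = density lborel (\<lambda>s. ennreal (radial_density \<alpha> g s / (LINT s|lborel. radial_density \<alpha> g s)))"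

definition liouville_prob :: "real ^ 'n \<Rightarrow> (real \<Rightarrow> real) \<Rightarrow> (real ^ 'n) measure" where
  "liouville_prob \<alpha> g = density lborel (\<lambda>x. ennreal (liouville_density \<alpha> g x / (LINT x|lborel. liouville_density \<alpha> g x)))"

lemma sets_radial_prob [simp, measurable_cong]: "sets (radial_prob \<alpha> g) = sets borel"
  by (simp add: radial_prob_def)

lemma sets_liouville_prob [simp, measurable_cong]: "sets (liouville_prob \<alpha> g) = sets borel"
  by (simp add: liouville_prob_def)

lemma space_radial_prob [simp]: "space (radial_prob \<alpha> g) = UNIV"
  by (simp add: radial_prob_def)

lemma space_liouville_prob [simp]: "space (liouville_prob \<alpha> g) = UNIV"
  by (simp add: liouville_prob_def)

lemma AE_gamma_measure:
  assumes "AE y in lborel. y \<in> orthant \<longrightarrow> P y"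
  shows "AE y in gamma_measure \<alpha>. y \<in> orthant \<and> P y"
proof -
  have m: "(\<lambda>y. ennreal (gamma_prod \<alpha> y)) \<in> borel_measurable lborel"
    by measurable
  show ?thesis
    unfolding gamma_measure_def AE_density[OF m] using assms
  proof eventually_elim
    case (elim y)
    then show ?case using gamma_prod_not_in_orthant[of y \<alpha>] by (cases "y \<in> orthant") auto
  qed
qed

lemma AE_radial_prob:
  assumes [measurable]: "radial_density \<alpha> g \<in> borel_measurable borel"
  shows "AE s in radial_prob \<alpha> g. 0 < s"
proof -
  have m: "(\<lambda>s. ennreal (radial_density \<alpha> g s / c)) \<in> borel_measurable lborel" for c
    by measurable
  have "0 < ennreal (radial_density \<alpha> g s / c) \<longrightarrow> 0 < s" for s c
    by (simp add: radial_density_def)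
  then show ?thesis
    unfolding radial_prob_def AE_density[OF m] by (intro AE_I2)
qed

text \<open>
  The point with coordinate sum \<open>s\<close> on the ray through \<open>y\<close>.
\<close>

definition dilate :: "real ^ 'n \<Rightarrow> real \<Rightarrow> real ^ 'n" where
  "dilate y s = (s / coord_sum y) *\<^sub>R y"

lemma measurable_dilate [measurable]:
  assumes [measurable]: "f \<in> borel_measurable M" "h \<in> borel_measurable M"
  shows "(\<lambda>x. dilate (f x) (h x)) \<in> borel_measurable M"
  unfolding dilate_def by measurable

text \<open>
  Measurability is imposed on the densities extended by zero, since \<open>g\<close> itself is given on the positive
  half-line only.
\<close>

locale liouville_data =
  fixes \<alpha> :: "real ^ 'n" and g :: "real \<Rightarrow> real"
  assumes alpha_pos: "\<And>i. 0 < \<alpha> $ i"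
    and g_pos: "\<And>s. 0 < s \<Longrightarrow> 0 < g s"
    and rd_m: "radial_density \<alpha> g \<in> borel_measurable borel"
    and ld_m: "liouville_density \<alpha> g \<in> borel_measurable borel"
    and ld_int: "integrable lborel (liouville_density \<alpha> g)"
begin

lemma total_alpha_pos: "0 < coord_sum \<alpha>"
  by (rule coord_sum_pos) (simp add: orthant_def alpha_pos)

lemma liouville_density_pos: "x \<in> orthant \<Longrightarrow> 0 < liouville_density \<alpha> g x"
proof -
  assume x: "x \<in> orthant"
  have "x $ i \<noteq> 0" for i
  proof -
    have "0 < x $ i" using x by (simp add: orthant_def)
    then show ?thesis by simp
  qed
  then have "0 < (\<Prod>i\<in>UNIV. x $ i powr (\<alpha> $ i - 1))"
    by (intro prod_pos) simp
  then show ?thesis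
    using g_pos[OF coord_sum_pos[OF x]] x by (simp add: liouville_density_def liouville_kernel_def)
qed

lemma liouville_density_nonneg: "0 \<le> liouville_density \<alpha> g x"
  using liouville_density_pos[of x] by (cases "x \<in> orthant") (auto simp: liouville_density_def)

lemma radial_density_nonneg: "0 \<le> radial_density \<alpha> g s"
  using g_pos[of s] by (auto simp: radial_density_def)

text \<open>
  The density is positive on the orthant, which contains a unit cube.
\<close>

lemma liouville_total_pos: "0 < (LINT x|lborel. liouville_density \<alpha> g x)"
proof -
  have "(LINT x|lborel. liouville_density \<alpha> g x) \<noteq> 0"
  proof
    assume "(LINT x|lborel. liouville_density \<alpha> g x) = 0"
    then have "AE x in lborel. liouville_density \<alpha> g x = 0"
      using integral_nonneg_eq_0_iff_AE[OF ld_int] liouville_density_nonneg by simp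
    then have "AE x in lborel. \<not> x \<in> (orthant :: (real ^ 'n) set)"
      by eventually_elim (use liouville_density_pos in force)
    then have "emeasure lborel {x \<in> space lborel. x \<in> (orthant :: (real ^ 'n) set)} = 0"
      by (rule emeasure_eq_0_AE)
    moreover have "box 0 One \<subseteq> {x \<in> space lborel. x \<in> (orthant :: (real ^ 'n) set)}"
    proof
      fix x :: "real ^ 'n" assume "x \<in> box 0 One"
      then have box: "\<forall>b\<in>Basis. 0 \<bullet> b < x \<bullet> b \<and> x \<bullet> b < One \<bullet> b"
        by (simp only: mem_box)
      have "0 < x $ i" for i
        using bspec[OF box axis_in_Basis[of i]] by (simp add: inner_axis)
      then show "x \<in> {x \<in> space lborel. x \<in> orthant}"
        by (simp add: orthant_def)
    qed
    then have "emeasure lborel (box 0 One :: (real ^ 'n) set) \<le> emeasure lborel {x \<in> space lborel. x \<in> (orthant :: (real ^ 'n) set)}"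
      using borel_open[OF open_orthant] by (intro emeasure_mono) auto
    ultimately show False
      by (simp add: emeasure_lborel_box_eq)
  qed
  moreover have "0 \<le> (LINT x|lborel. liouville_density \<alpha> g x)"
    by (intro integral_nonneg_AE AE_I2 liouville_density_nonneg)
  ultimately show ?thesis by simp
qed

text \<open>
  Both normalizing constants come out of \<open>nn_integral_liouville_polar\<close> itself: with the constant function
  \<open>F = 1\<close> and \<open>k = 0\<close> it computes the mass of the radial density.
\<close>

lemma
  shows prob_space_radial_prob: "prob_space (radial_prob \<alpha> g)"
    and nn_integral_dilate: "F \<in> borel_measurable borel \<Longrightarrow> 0 \<le> k \<Longrightarrow>
      (\<integral>\<^sup>+y. \<integral>\<^sup>+s. ennreal (coord_sum y powr k) * F (dilate y s) \<partial>radial_prob \<alpha> g \<partial>gamma_measure \<alpha>)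
      = ennreal (Gamma (coord_sum \<alpha> + k) / Gamma (coord_sum \<alpha>)) * (\<integral>\<^sup>+x. F x \<partial>liouville_prob \<alpha> g)"
proof -
  note [measurable] = rd_m ld_m
  define a where "a = coord_sum \<alpha>"
  have a: "0 < a" unfolding a_def by (rule total_alpha_pos)
  define P where "P = (\<Prod>i\<in>UNIV. Gamma (\<alpha> $ i))"
  have P: "0 < P" unfolding P_def by (intro prod_pos Gamma_real_pos ballI alpha_pos)
  interpret \<gamma>: prob_space "gamma_measure \<alpha>" by (rule prob_space_gamma_measure[OF alpha_pos])
  define ZL where "ZL = (LINT x|lborel. liouville_density \<alpha> g x)"
  have ZL: "0 < ZL" unfolding ZL_def by (rule liouville_total_pos)
  have raw: "(\<integral>\<^sup>+y. \<integral>\<^sup>+s. ennreal (radial_density \<alpha> g s) * (ennreal (coord_sum y powr k) * F (dilate y s)) \<partial>lborel \<partial>gamma_measure \<alpha>)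
      = ennreal (Gamma (a + k) / P) * (\<integral>\<^sup>+x. ennreal (liouville_density \<alpha> g x) * F x \<partial>lborel)"
    if "F \<in> borel_measurable borel" "0 \<le> k" for F :: "real ^ 'n \<Rightarrow> ennreal" and k
    unfolding a_def P_def dilate_def
    by (rule nn_integral_liouville_polar[OF alpha_pos that(2,1) ld_m rd_m]) (simp add: g_pos less_imp_le)
  have "(\<integral>\<^sup>+y. \<integral>\<^sup>+s. ennreal (radial_density \<alpha> g s) * (ennreal (coord_sum y powr 0) * 1) \<partial>lborel \<partial>gamma_measure \<alpha>)
      = (\<integral>\<^sup>+y. \<integral>\<^sup>+s. ennreal (radial_density \<alpha> g s) \<partial>lborel \<partial>gamma_measure \<alpha>)"
  proof (rule nn_integral_cong_AE)
    have "AE y in gamma_measure \<alpha>. y \<in> orthant \<and> True" by (rule AE_gamma_measure) simp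
    then show "AE y in gamma_measure \<alpha>. (\<integral>\<^sup>+s. ennreal (radial_density \<alpha> g s) * (ennreal (coord_sum y powr 0) * 1) \<partial>lborel)
        = (\<integral>\<^sup>+s. ennreal (radial_density \<alpha> g s) \<partial>lborel)"
    proof eventually_elim
      case (elim y)
      then have "coord_sum y powr 0 = 1" using coord_sum_pos[of y] by simp
      then show ?case by simp
    qed
  qed
  also have "\<dots> = (\<integral>\<^sup>+s. ennreal (radial_density \<alpha> g s) \<partial>lborel)"
    by (simp add: \<gamma>.emeasure_space_1[unfolded space_gamma_measure])
  finally have "(\<integral>\<^sup>+s. ennreal (radial_density \<alpha> g s) \<partial>lborel) = ennreal (Gamma a / P) * (\<integral>\<^sup>+x. ennreal (liouville_density \<alpha> g x) \<partial>lborel)"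
    using raw[of "\<lambda>_. 1" 0] by simp
  also have "(\<integral>\<^sup>+x. ennreal (liouville_density \<alpha> g x) \<partial>lborel) = ennreal ZL"
    unfolding ZL_def using ld_int liouville_density_nonneg by (intro nn_integral_eq_integral) auto
  finally have rd_nn: "(\<integral>\<^sup>+s. ennreal (radial_density \<alpha> g s) \<partial>lborel) = ennreal (Gamma a / P * ZL)"
    using ZL P Gamma_real_pos[OF a] by (simp add: ennreal_mult[symmetric])
  define ZS where "ZS = (LINT s|lborel. radial_density \<alpha> g s)"
  have "has_bochner_integral lborel (radial_density \<alpha> g) (Gamma a / P * ZL)"
    using rd_nn ZL P Gamma_real_pos[OF a] radial_density_nonneg by (intro has_bochner_integral_nn_integral) auto
  then have ZS_eq: "ZS = Gamma a / P * ZL"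
    by (simp add: ZS_def has_bochner_integral_integral_eq)
  then have ZS: "0 < ZS" using ZL P Gamma_real_pos[OF a] by simp
  have nn_S: "(\<integral>\<^sup>+s. h s \<partial>radial_prob \<alpha> g) = ennreal (1 / ZS) * (\<integral>\<^sup>+s. ennreal (radial_density \<alpha> g s) * h s \<partial>lborel)"
    if [measurable]: "h \<in> borel_measurable borel" for h
  proof -
    have "(\<integral>\<^sup>+s. h s \<partial>radial_prob \<alpha> g) = (\<integral>\<^sup>+s. ennreal (radial_density \<alpha> g s / ZS) * h s \<partial>lborel)"
      unfolding radial_prob_def ZS_def by (rule nn_integral_density) measurable
    also have "\<dots> = (\<integral>\<^sup>+s. ennreal (1 / ZS) * (ennreal (radial_density \<alpha> g s) * h s) \<partial>lborel)"
      using ZS radial_density_nonneg by (intro nn_integral_cong) (simp add: mult.assoc[symmetric] ennreal_mult[symmetric])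
    also have "\<dots> = ennreal (1 / ZS) * (\<integral>\<^sup>+s. ennreal (radial_density \<alpha> g s) * h s \<partial>lborel)"
      by (rule nn_integral_cmult) measurable
    finally show ?thesis .
  qed
  have nn_L: "(\<integral>\<^sup>+x. h x \<partial>liouville_prob \<alpha> g) = ennreal (1 / ZL) * (\<integral>\<^sup>+x. ennreal (liouville_density \<alpha> g x) * h x \<partial>lborel)"
    if [measurable]: "h \<in> borel_measurable borel" for h
  proof -
    have "(\<integral>\<^sup>+x. h x \<partial>liouville_prob \<alpha> g) = (\<integral>\<^sup>+x. ennreal (liouville_density \<alpha> g x / ZL) * h x \<partial>lborel)"
      unfolding liouville_prob_def ZL_def by (rule nn_integral_density) measurable
    also have "\<dots> = (\<integral>\<^sup>+x. ennreal (1 / ZL) * (ennreal (liouville_density \<alpha> g x) * h x) \<partial>lborel)"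
      using ZL liouville_density_nonneg by (intro nn_integral_cong) (simp add: mult.assoc[symmetric] ennreal_mult[symmetric])
    also have "\<dots> = ennreal (1 / ZL) * (\<integral>\<^sup>+x. ennreal (liouville_density \<alpha> g x) * h x \<partial>lborel)"
      by (rule nn_integral_cmult) measurable
    finally show ?thesis .
  qed
  show "prob_space (radial_prob \<alpha> g)"
  proof
    have "emeasure (radial_prob \<alpha> g) (space (radial_prob \<alpha> g)) = (\<integral>\<^sup>+s. 1 \<partial>radial_prob \<alpha> g)" by simp
    also have "\<dots> = ennreal (1 / ZS) * ennreal ZS"
      using nn_S[of "\<lambda>_. 1"] rd_nn ZS_eq by simp
    also have "\<dots> = 1" using ZS by (simp add: ennreal_mult[symmetric])
    finally show "emeasure (radial_prob \<alpha> g) (space (radial_prob \<alpha> g)) = 1" .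
  qed
  show "(\<integral>\<^sup>+y. \<integral>\<^sup>+s. ennreal (coord_sum y powr k) * F (dilate y s) \<partial>radial_prob \<alpha> g \<partial>gamma_measure \<alpha>)
      = ennreal (Gamma (coord_sum \<alpha> + k) / Gamma (coord_sum \<alpha>)) * (\<integral>\<^sup>+x. F x \<partial>liouville_prob \<alpha> g)"
    if [measurable]: "F \<in> borel_measurable borel" and k: "0 \<le> k"
  proof -
    have G: "0 < Gamma (a + k)" using a k by (intro Gamma_real_pos) simp
    have "(\<integral>\<^sup>+y. \<integral>\<^sup>+s. ennreal (coord_sum y powr k) * F (dilate y s) \<partial>radial_prob \<alpha> g \<partial>gamma_measure \<alpha>)
        = (\<integral>\<^sup>+y. ennreal (1 / ZS) * (\<integral>\<^sup>+s. ennreal (radial_density \<alpha> g s) * (ennreal (coord_sum y powr k) * F (dilate y s)) \<partial>lborel) \<partial>gamma_measure \<alpha>)"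
      by (intro nn_integral_cong nn_S) measurable
    also have "\<dots> = ennreal (1 / ZS) * (ennreal (Gamma (a + k) / P) * (\<integral>\<^sup>+x. ennreal (liouville_density \<alpha> g x) * F x \<partial>lborel))"
      by (subst nn_integral_cmult) (measurable, simp only: raw[OF that])
    also have "\<dots> = ennreal (Gamma (a + k) / Gamma a) * (ennreal (1 / ZL) * (\<integral>\<^sup>+x. ennreal (liouville_density \<alpha> g x) * F x \<partial>lborel))"
      using ZL P G Gamma_real_pos[OF a] by (simp add: mult.assoc[symmetric] ennreal_mult[symmetric] ZS_eq)
    finally show ?thesis by (simp only: nn_L[OF that(1)] a_def)
  qed
qed

end

lemma dilate_scaleR: "0 < c \<Longrightarrow> y \<in> orthant \<Longrightarrow> dilate (c *\<^sub>R y) s = dilate y s"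
  using coord_sum_pos[of y] by (simp add: dilate_def)

lemma dilate_eq_scaleR: "dilate y s = (s / coord_sum y) *\<^sub>R y"
  by (simp add: dilate_def)

lemma dilate_in_orthant:
  assumes y: "y \<in> orthant"
  shows "dilate y s \<in> orthant \<longleftrightarrow> 0 < s"
proof -
  have p: "0 < y $ i" for i using y by (simp add: orthant_def)
  show ?thesis
    using coord_sum_pos[OF y]
    by (simp add: dilate_def orthant_def zero_less_mult_iff zero_less_divide_iff p less_not_sym[OF p])
qed

lemma coord_sum_dilate: "y \<in> orthant \<Longrightarrow> coord_sum (dilate y s) = s"
  using coord_sum_pos[of y] by (simp add: dilate_def)

context liouville_data
begin

text \<open>
  If \<open>Y\<close> has the Gamma law and \<open>S\<close> the radial law, independently, then \<open>dilate Y S\<close> has the Liouville law.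
\<close>

lemma nn_integral_dilate_powr_0:
  assumes [measurable]: "F \<in> borel_measurable borel"
  shows "(\<integral>\<^sup>+y. \<integral>\<^sup>+s. F (dilate y s) \<partial>radial_prob \<alpha> g \<partial>gamma_measure \<alpha>) = (\<integral>\<^sup>+x. F x \<partial>liouville_prob \<alpha> g)"
proof -
  have a: "0 < coord_sum \<alpha>" by (rule total_alpha_pos)
  have "(\<integral>\<^sup>+y. \<integral>\<^sup>+s. F (dilate y s) \<partial>radial_prob \<alpha> g \<partial>gamma_measure \<alpha>)
      = (\<integral>\<^sup>+y. \<integral>\<^sup>+s. ennreal (coord_sum y powr 0) * F (dilate y s) \<partial>radial_prob \<alpha> g \<partial>gamma_measure \<alpha>)"
  proof (rule nn_integral_cong_AE)
    have "AE y in gamma_measure \<alpha>. y \<in> orthant \<and> True" by (rule AE_gamma_measure) simp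
    then show "AE y in gamma_measure \<alpha>. (\<integral>\<^sup>+s. F (dilate y s) \<partial>radial_prob \<alpha> g) = (\<integral>\<^sup>+s. ennreal (coord_sum y powr 0) * F (dilate y s) \<partial>radial_prob \<alpha> g)"
    proof eventually_elim
      case (elim y)
      then have "coord_sum y powr 0 = 1" using coord_sum_pos[of y] by simp
      then show ?case by simp
    qed
  qed
  also have "\<dots> = ennreal (Gamma (coord_sum \<alpha> + 0) / Gamma (coord_sum \<alpha>)) * (\<integral>\<^sup>+x. F x \<partial>liouville_prob \<alpha> g)"
    by (rule nn_integral_dilate) auto
  also have "Gamma (coord_sum \<alpha> + 0) / Gamma (coord_sum \<alpha>) = 1"
    using Gamma_real_pos[OF a] by simp
  finally show ?thesis by simp
qed

lemma
  fixes F :: "real ^ 'n \<Rightarrow> real"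
  assumes [measurable]: "F \<in> borel_measurable borel" and F: "integrable (liouville_prob \<alpha> g) F"
  shows integrable_dilate: "integrable (gamma_measure \<alpha> \<Otimes>\<^sub>M radial_prob \<alpha> g) (\<lambda>(y, s). F (dilate y s))"
    and integral_dilate: "(LINT y|gamma_measure \<alpha>. LINT s|radial_prob \<alpha> g. F (dilate y s)) = (LINT x|liouville_prob \<alpha> g. F x)"
proof -
  interpret \<gamma>: prob_space "gamma_measure \<alpha>" by (rule prob_space_gamma_measure[OF alpha_pos])
  interpret S: prob_space "radial_prob \<alpha> g" by (rule prob_space_radial_prob)
  interpret pair_prob_space "gamma_measure \<alpha>" "radial_prob \<alpha> g" ..
  let ?N = "gamma_measure \<alpha> \<Otimes>\<^sub>M radial_prob \<alpha> g"
  have X: "(\<lambda>z. dilate (fst z) (snd z)) \<in> measurable ?N (liouville_prob \<alpha> g)"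
    by measurable
  have distr: "distr ?N (liouville_prob \<alpha> g) (\<lambda>z. dilate (fst z) (snd z)) = liouville_prob \<alpha> g"
  proof (rule measure_eqI)
    fix A assume "A \<in> sets (distr ?N (liouville_prob \<alpha> g) (\<lambda>z. dilate (fst z) (snd z)))"
    then have A [measurable]: "A \<in> sets borel" by simp
    have "emeasure (distr ?N (liouville_prob \<alpha> g) (\<lambda>z. dilate (fst z) (snd z))) A
        = (\<integral>\<^sup>+x. indicator A x \<partial>distr ?N (liouville_prob \<alpha> g) (\<lambda>z. dilate (fst z) (snd z)))"
      by simp
    also have "\<dots> = (\<integral>\<^sup>+z. indicator A (dilate (fst z) (snd z)) \<partial>?N)"
      by (rule nn_integral_distr[OF X]) simp
    also have "\<dots> = (\<integral>\<^sup>+y. \<integral>\<^sup>+s. indicator A (dilate y s) \<partial>radial_prob \<alpha> g \<partial>gamma_measure \<alpha>)"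
      by (subst S.nn_integral_fst[symmetric]) auto
    also have "\<dots> = (\<integral>\<^sup>+x. indicator A x \<partial>liouville_prob \<alpha> g)"
      by (rule nn_integral_dilate_powr_0) simp
    finally show "emeasure (distr ?N (liouville_prob \<alpha> g) (\<lambda>z. dilate (fst z) (snd z))) A = emeasure (liouville_prob \<alpha> g) A"
      by simp
  qed simp
  have Fm: "F \<in> borel_measurable (liouville_prob \<alpha> g)" by simp
  have "integrable ?N (\<lambda>z. F (dilate (fst z) (snd z)))"
    by (rule integrable_distr[OF X]) (simp only: distr F)
  then show int: "integrable ?N (\<lambda>(y, s). F (dilate y s))"
    by (simp only: case_prod_unfold)
  have "(LINT z|?N. F (dilate (fst z) (snd z))) = (LINT x|liouville_prob \<alpha> g. F x)"
    using integral_distr[OF X Fm] by (simp only: distr)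
  then show "(LINT y|gamma_measure \<alpha>. LINT s|radial_prob \<alpha> g. F (dilate y s)) = (LINT x|liouville_prob \<alpha> g. F x)"
    using integral_fst[OF int] by (simp only: case_prod_unfold)
qed

text \<open>
  The coordinate sum of a Gamma vector is independent of its direction. A function \<open>\<Phi>\<close> of the direction
  takes the same value at \<open>y\<close> and at \<open>dilate y s\<close>, so both integrals over \<open>y\<close> turn into the integral of
  \<open>\<Phi>\<close> against the Liouville law, up to the factor given by the moments.
\<close>

lemma nn_integral_homogeneous:
  fixes \<Phi> :: "real ^ 'n \<Rightarrow> ennreal"
  assumes [measurable]: "\<Phi> \<in> borel_measurable borel"
    and hom: "\<And>c y. 0 < c \<Longrightarrow> y \<in> orthant \<Longrightarrow> \<Phi> (c *\<^sub>R y) = \<Phi> y" and k: "0 \<le> k"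
  shows "(\<integral>\<^sup>+y. ennreal (coord_sum y powr k) * \<Phi> y \<partial>gamma_measure \<alpha>)
    = ennreal (Gamma (coord_sum \<alpha> + k) / Gamma (coord_sum \<alpha>)) * (\<integral>\<^sup>+y. \<Phi> y \<partial>gamma_measure \<alpha>)"
proof -
  interpret S: prob_space "radial_prob \<alpha> g" by (rule prob_space_radial_prob)
  have orth: "AE y in gamma_measure \<alpha>. y \<in> orthant \<and> True" by (rule AE_gamma_measure) simp
  have inner: "(\<integral>\<^sup>+s. c * \<Phi> (dilate y s) \<partial>radial_prob \<alpha> g) = c * \<Phi> y" if y: "y \<in> orthant" for y and c :: ennreal
  proof -
    have "(\<integral>\<^sup>+s. c * \<Phi> (dilate y s) \<partial>radial_prob \<alpha> g) = (\<integral>\<^sup>+s. c * \<Phi> y \<partial>radial_prob \<alpha> g)"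
    proof (rule nn_integral_cong_AE)
      show "AE s in radial_prob \<alpha> g. c * \<Phi> (dilate y s) = c * \<Phi> y"
        using AE_radial_prob[OF rd_m]
      proof eventually_elim
        case (elim s)
        then show ?case using hom[OF _ y, of "s / coord_sum y"] coord_sum_pos[OF y] by (simp add: dilate_def)
      qed
    qed
    also have "\<dots> = c * \<Phi> y"
      using S.emeasure_space_1 by simp
    finally show ?thesis .
  qed
  have "(\<integral>\<^sup>+y. ennreal (coord_sum y powr k) * \<Phi> y \<partial>gamma_measure \<alpha>)
      = (\<integral>\<^sup>+y. \<integral>\<^sup>+s. ennreal (coord_sum y powr k) * \<Phi> (dilate y s) \<partial>radial_prob \<alpha> g \<partial>gamma_measure \<alpha>)"
    using orth by (intro nn_integral_cong_AE) (auto elim!: eventually_mono simp: inner)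
  also have "\<dots> = ennreal (Gamma (coord_sum \<alpha> + k) / Gamma (coord_sum \<alpha>)) * (\<integral>\<^sup>+x. \<Phi> x \<partial>liouville_prob \<alpha> g)"
    by (rule nn_integral_dilate[OF assms(1) k])
  also have "(\<integral>\<^sup>+x. \<Phi> x \<partial>liouville_prob \<alpha> g) = (\<integral>\<^sup>+y. \<integral>\<^sup>+s. \<Phi> (dilate y s) \<partial>radial_prob \<alpha> g \<partial>gamma_measure \<alpha>)"
    by (rule nn_integral_dilate_powr_0[OF assms(1), symmetric])
  also have "\<dots> = (\<integral>\<^sup>+y. \<Phi> y \<partial>gamma_measure \<alpha>)"
    using orth inner[of _ 1] by (intro nn_integral_cong_AE) (auto elim!: eventually_mono)
  finally show ?thesis .
qed

lemma
  fixes \<Phi> :: "real ^ 'n \<Rightarrow> real"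
  assumes [measurable]: "\<Phi> \<in> borel_measurable borel"
    and hom: "\<And>c y. 0 < c \<Longrightarrow> y \<in> orthant \<Longrightarrow> \<Phi> (c *\<^sub>R y) = \<Phi> y" and k: "0 \<le> k"
    and int: "integrable (gamma_measure \<alpha>) \<Phi>"
  shows integrable_homogeneous: "integrable (gamma_measure \<alpha>) (\<lambda>y. coord_sum y powr k * \<Phi> y)"
    and integral_homogeneous: "(LINT y|gamma_measure \<alpha>. coord_sum y powr k * \<Phi> y)
      = Gamma (coord_sum \<alpha> + k) / Gamma (coord_sum \<alpha>) * (LINT y|gamma_measure \<alpha>. \<Phi> y)"
proof -
  have a: "0 < coord_sum \<alpha>" by (rule total_alpha_pos)
  let ?C = "Gamma (coord_sum \<alpha> + k) / Gamma (coord_sum \<alpha>)"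
  have C: "0 \<le> ?C"
    using Gamma_real_pos[OF a] Gamma_real_pos[of "coord_sum \<alpha> + k"] a k by simp
  have nn: "(\<integral>\<^sup>+y. ennreal (coord_sum y powr k * \<Psi> y) \<partial>gamma_measure \<alpha>) = ennreal ?C * (\<integral>\<^sup>+y. ennreal (\<Psi> y) \<partial>gamma_measure \<alpha>)"
    if [measurable]: "\<Psi> \<in> borel_measurable borel" and "\<And>c y. 0 < c \<Longrightarrow> y \<in> orthant \<Longrightarrow> \<Psi> (c *\<^sub>R y) = \<Psi> y" for \<Psi>
    using nn_integral_homogeneous[of "\<lambda>y. ennreal (\<Psi> y)" k] that k by (simp add: ennreal_mult')
  show int': "integrable (gamma_measure \<alpha>) (\<lambda>y. coord_sum y powr k * \<Phi> y)"
  proof (rule integrableI_bounded)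
    have "(\<integral>\<^sup>+y. ennreal (norm (coord_sum y powr k * \<Phi> y)) \<partial>gamma_measure \<alpha>)
        = (\<integral>\<^sup>+y. ennreal (coord_sum y powr k * \<bar>\<Phi> y\<bar>) \<partial>gamma_measure \<alpha>)"
      by (simp add: abs_mult)
    also have "\<dots> = ennreal ?C * (\<integral>\<^sup>+y. ennreal \<bar>\<Phi> y\<bar> \<partial>gamma_measure \<alpha>)"
      using hom by (intro nn) auto
    also have "\<dots> < \<infinity>"
      using int unfolding integrable_iff_bounded by (simp add: ennreal_mult_less_top)
    finally show "(\<integral>\<^sup>+y. ennreal (norm (coord_sum y powr k * \<Phi> y)) \<partial>gamma_measure \<alpha>) < \<infinity>" .
  qed simp
  have pos: "(\<integral>\<^sup>+y. ennreal (coord_sum y powr k * \<Phi> y) \<partial>gamma_measure \<alpha>) = ennreal ?C * (\<integral>\<^sup>+y. ennreal (\<Phi> y) \<partial>gamma_measure \<alpha>)"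
    by (rule nn[OF assms(1) hom])
  have neg: "(\<integral>\<^sup>+y. ennreal (- (coord_sum y powr k * \<Phi> y)) \<partial>gamma_measure \<alpha>) = ennreal ?C * (\<integral>\<^sup>+y. ennreal (- \<Phi> y) \<partial>gamma_measure \<alpha>)"
    using nn[of "\<lambda>y. - \<Phi> y"] hom by simp
  show "(LINT y|gamma_measure \<alpha>. coord_sum y powr k * \<Phi> y) = ?C * (LINT y|gamma_measure \<alpha>. \<Phi> y)"
    unfolding real_lebesgue_integral_def[OF int'] real_lebesgue_integral_def[OF int] pos neg
      enn2real_mult enn2real_ennreal[OF C] by (rule right_diff_distrib[symmetric])
qed

text \<open>
  On a compact subset of the orthant the Gamma density and \<open>c\<close> are bounded below, so integrability with
  respect to the Gamma law gives local integrability with respect to Lebesgue measure. The factor \<open>c\<close>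
  serves to undo the weight \<open>y\<^sub>j / coord_sum y\<close> under which \<open>s * \<partial>\<^sub>j f\<close> is known to be integrable.
\<close>

lemma integrable_lborel_compact_coefficient:
  fixes v :: "real ^ 'n \<Rightarrow> real \<Rightarrow> real" and c :: "real ^ 'n \<Rightarrow> real"
  defines "d \<equiv> \<lambda>s. radial_density \<alpha> g s / (LINT s|lborel. radial_density \<alpha> g s)"
  assumes v: "integrable (gamma_measure \<alpha> \<Otimes>\<^sub>M radial_prob \<alpha> g) (\<lambda>(y, s). c y * v y s)"
    and [measurable]: "c \<in> borel_measurable borel"
    and K: "compact K" "K \<subseteq> orthant" and c: "continuous_on orthant c" "\<And>y. y \<in> orthant \<Longrightarrow> 0 < c y"
  shows "integrable (lborel \<Otimes>\<^sub>M lborel) (\<lambda>(y, s). indicator K y * (d s * v y s))"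
proof -
  note [measurable] = rd_m
  have [measurable]: "d \<in> borel_measurable borel" unfolding d_def by measurable
  have [measurable]: "K \<in> sets borel" using K(1) by (rule borel_compact)
  interpret S: prob_space "radial_prob \<alpha> g" by (rule prob_space_radial_prob)
  have "0 \<le> (LINT s|lborel. radial_density \<alpha> g s)"
    by (intro integral_nonneg_AE AE_I2 radial_density_nonneg)
  then have d0: "0 \<le> d s" for s unfolding d_def by (intro divide_nonneg_nonneg radial_density_nonneg)
  have gp0: "0 \<le> gamma_prod \<alpha> y" for y by (rule gamma_prod_nonneg[OF alpha_pos])
  have dS: "radial_prob \<alpha> g = density lborel (\<lambda>s. ennreal (d s))"
    by (simp add: radial_prob_def d_def)
  have "sigma_finite_measure (density lborel (\<lambda>s. ennreal (d s)))"
    using S.sigma_finite_measure_axioms by (simp only: dS)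
  then have N: "gamma_measure \<alpha> \<Otimes>\<^sub>M radial_prob \<alpha> g = density (lborel \<Otimes>\<^sub>M lborel) (\<lambda>z. ennreal (gamma_prod \<alpha> (fst z) * d (snd z)))"
  proof -
    have "gamma_measure \<alpha> \<Otimes>\<^sub>M radial_prob \<alpha> g
        = density (lborel \<Otimes>\<^sub>M lborel) (\<lambda>(y, s). ennreal (gamma_prod \<alpha> y) * ennreal (d s))"
      unfolding gamma_measure_def dS
      by (rule pair_measure_density[OF _ _ sigma_finite_lborel \<open>sigma_finite_measure (density lborel (\<lambda>s. ennreal (d s)))\<close>]) measurable
    then show ?thesis
      by (simp only: case_prod_unfold ennreal_mult[OF gp0 d0])
  qed
  have vm: "(\<lambda>(y, s). c y * v y s) \<in> borel_measurable (borel \<Otimes>\<^sub>M borel)"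
  proof -
    have "sets (gamma_measure \<alpha> \<Otimes>\<^sub>M radial_prob \<alpha> g) = sets (borel \<Otimes>\<^sub>M borel)"
      by (intro sets_pair_measure_cong) simp_all
    from measurable_cong_sets[OF this refl] show ?thesis
      using borel_measurable_integrable[OF v] by blast
  qed
  have v': "integrable (lborel \<Otimes>\<^sub>M lborel) (\<lambda>z. (gamma_prod \<alpha> (fst z) * d (snd z)) * (case z of (y, s) \<Rightarrow> c y * v y s))"
    using v unfolding N
  proof (rule integrable_real_density[THEN iffD1, rotated 3])
    show "(\<lambda>z. gamma_prod \<alpha> (fst z) * d (snd z)) \<in> borel_measurable (lborel \<Otimes>\<^sub>M lborel)"
      by measurable
    show "AE z in lborel \<Otimes>\<^sub>M lborel. 0 \<le> gamma_prod \<alpha> (fst z) * d (snd z)"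
      by (intro AE_I2 mult_nonneg_nonneg gp0 d0)
    have "sets (lborel \<Otimes>\<^sub>M lborel) = sets (borel \<Otimes>\<^sub>M borel :: ((real ^ 'n) \<times> real) measure)"
      by (intro sets_pair_measure_cong) simp_all
    from measurable_cong_sets[OF this refl]
    show "(\<lambda>(y, s). c y * v y s) \<in> borel_measurable (lborel \<Otimes>\<^sub>M lborel)"
      using vm by blast
  qed
  define b where "b = (\<lambda>y. if y \<in> K then 1 / (gamma_prod \<alpha> y * c y) else 0)"
  have gp_pos: "0 < gamma_prod \<alpha> y" if "y \<in> orthant" for y
    unfolding gamma_prod_def
  proof (intro prod_pos ballI)
    fix i
    have p: "0 < y $ i" using that by (simp add: orthant_def)
    then have "0 < y $ i powr (\<alpha> $ i - 1)" by simp
    then show "0 < gamma_density (\<alpha> $ i) (y $ i)"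
      using p Gamma_real_pos[OF alpha_pos, of i] by (simp only: gamma_density_def if_True) (simp del: powr_gt_zero)
  qed
  have gp_cont: "continuous_on K (gamma_prod \<alpha>)"
  proof -
    have pos: "0 < y $ i" if "y \<in> K" for y i using that K(2) by (auto simp: orthant_def)
    have ne_K: "y $ i \<noteq> 0" if "y \<in> K" for y i using pos[OF that, of i] by simp
    have ne_G: "Gamma (\<alpha> $ i) \<noteq> 0" for i using Gamma_real_pos[OF alpha_pos, of i] by linarith
    have "continuous_on K (\<lambda>y. \<Prod>i\<in>UNIV. y $ i powr (\<alpha> $ i - 1) * exp (- (y $ i)) / Gamma (\<alpha> $ i))"
      by (intro continuous_on_prod continuous_on_divide continuous_on_mult continuous_on_powr continuous_on_exp
          continuous_on_minus continuous_on_component continuous_on_id continuous_on_const ballI)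
        (use ne_K ne_G in simp_all)
    also have "?this \<longleftrightarrow> continuous_on K (gamma_prod \<alpha>)"
      using pos by (intro continuous_on_cong) (auto simp: gamma_prod_def gamma_density_def)
    finally show ?thesis .
  qed
  have "integrable (lborel \<Otimes>\<^sub>M lborel) (\<lambda>(y, s). b y * (case (y, s) of (y, s) \<Rightarrow> (gamma_prod \<alpha> y * d s) * (c y * v y s)))"
  proof (rule integrable_compact_coefficient)
    have "integrable (lborel \<Otimes>\<^sub>M lborel) (\<lambda>z. indicator (K \<times> UNIV) z *\<^sub>R ((gamma_prod \<alpha> (fst z) * d (snd z)) * (case z of (y, s) \<Rightarrow> c y * v y s)))"
      by (intro integrable_mult_indicator v') measurable
    also have "(\<lambda>z. indicator (K \<times> UNIV) z *\<^sub>R ((gamma_prod \<alpha> (fst z) * d (snd z)) * (case z of (y, s) \<Rightarrow> c y * v y s)))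
        = (\<lambda>(y, s). indicator K y * (case (y, s) of (y, s) \<Rightarrow> (gamma_prod \<alpha> y * d s) * (c y * v y s)))"
      by (auto simp: fun_eq_iff indicator_def)
    finally show "integrable (lborel \<Otimes>\<^sub>M lborel) (\<lambda>(y, s). indicator K y * (case (y, s) of (y, s) \<Rightarrow> (gamma_prod \<alpha> y * d s) * (c y * v y s)))" .
    show "b \<in> borel_measurable borel" unfolding b_def by measurable
    have "continuous_on K (\<lambda>y. 1 / (gamma_prod \<alpha> y * c y))"
    proof (intro continuous_on_divide continuous_on_const continuous_on_mult gp_cont continuous_on_subset[OF c(1) K(2)] ballI)
      show "gamma_prod \<alpha> y * c y \<noteq> 0" if "y \<in> K" for y
        using gp_pos[of y] c(2)[of y] that K(2) by force
    qed
    then show "continuous_on K b"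
      by (subst continuous_on_cong[where g = "\<lambda>y. 1 / (gamma_prod \<alpha> y * c y)"]) (auto simp: b_def)
  qed (use K in \<open>auto simp: b_def\<close>)
  also have "(\<lambda>(y, s). b y * (case (y, s) of (y, s) \<Rightarrow> (gamma_prod \<alpha> y * d s) * (c y * v y s))) = (\<lambda>(y, s). indicator K y * (d s * v y s))"
  proof (rule ext, clarify)
    fix y s
    show "b y * ((gamma_prod \<alpha> y * d s) * (c y * v y s)) = indicator K y * (d s * v y s)"
    proof (cases "y \<in> K")
      case True
      then have "0 < gamma_prod \<alpha> y" "0 < c y" using gp_pos[of y] c(2)[of y] K(2) by auto
      then show ?thesis using True by (simp add: b_def)
    qed (simp add: b_def)
  qed
  finally show ?thesis .
qed

end

section \<open>Radial and angular parts of the variance\<close>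

context liouville_data
begin

text \<open>
  The estimate on one ray. With the weights \<open>D i\<close>, which sum to one, the radial derivative \<open>h\<close> is the mean
  of the partial derivatives \<open>e i\<close>, and \<open>T i\<close> is the integral of \<open>s * (e i - h)\<close>. So the energy \<open>N\<close>
  splits into \<open>R\<close> for \<open>h\<close>, which pays for the variance on the ray, and \<open>N - R\<close> for the deviations from
  \<open>h\<close>, which pays for \<open>T\<close>.
\<close>

lemma radial_estimate:
  fixes f :: "real ^ 'n \<Rightarrow> real" and G :: "real ^ 'n \<Rightarrow> real ^ 'n" and w :: "real \<Rightarrow> real" and CP :: real
  assumes y: "y \<in> orthant"
    and [measurable]: "f \<in> borel_measurable borel" "G \<in> borel_measurable borel" "w \<in> borel_measurable borel"
    and w_pos: "\<And>s. 0 < s \<Longrightarrow> 0 < w s"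
    and wg: "weak_gradient {0<..} (\<lambda>s. f (dilate y s)) (\<lambda>s. \<Sum>i\<in>UNIV. y $ i / coord_sum y * G (dilate y s) $ i)"
    and f2: "integrable (radial_prob \<alpha> g) (\<lambda>s. (f (dilate y s))\<^sup>2)"
    and energy: "integrable (radial_prob \<alpha> g) (\<lambda>s. w s * (\<Sum>i\<in>UNIV. y $ i / coord_sum y * (G (dilate y s) $ i)\<^sup>2))"
    and K_int: "integrable (radial_prob \<alpha> g) (\<lambda>s. s\<^sup>2 / w s)"
    and poincare: "\<And>F h. F \<in> borel_measurable borel \<Longrightarrow> h \<in> borel_measurable borel \<Longrightarrow> weak_gradient {0<..} F h \<Longrightarrow>
      integrable (radial_prob \<alpha> g) (\<lambda>s. (F s)\<^sup>2) \<Longrightarrow> integrable (radial_prob \<alpha> g) (\<lambda>s. w s * (h s)\<^sup>2) \<Longrightarrow>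
      Var (radial_prob \<alpha> g) F \<le> CP * (LINT s|radial_prob \<alpha> g. w s * (h s)\<^sup>2)"
  defines "T \<equiv> \<lambda>i. (LINT s|radial_prob \<alpha> g. s * G (dilate y s) $ i)
      - (\<Sum>j\<in>UNIV. y $ j / coord_sum y * (LINT s|radial_prob \<alpha> g. s * G (dilate y s) $ j))"
    and "K \<equiv> LINT s|radial_prob \<alpha> g. s\<^sup>2 / w s"
  shows "(LINT s|radial_prob \<alpha> g. (f (dilate y s))\<^sup>2) - (LINT s|radial_prob \<alpha> g. f (dilate y s))\<^sup>2
      + (\<Sum>i\<in>UNIV. y $ i / coord_sum y * (T i)\<^sup>2) / coord_sum \<alpha>
    \<le> max CP (K / coord_sum \<alpha>) *
      (LINT s|radial_prob \<alpha> g. w s * (\<Sum>i\<in>UNIV. y $ i / coord_sum y * (G (dilate y s) $ i)\<^sup>2))"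
proof -
  interpret S: prob_space "radial_prob \<alpha> g" by (rule prob_space_radial_prob)
  let ?S = "radial_prob \<alpha> g"
  define D where "D = (\<lambda>i. y $ i / coord_sum y)"
  define e where "e = (\<lambda>i s. G (dilate y s) $ i)"
  define h where "h = (\<lambda>s. \<Sum>i\<in>UNIV. D i * e i s)"
  define N where "N = (LINT s|?S. w s * (\<Sum>i\<in>UNIV. D i * (e i s)\<^sup>2))"
  define R where "R = (LINT s|?S. w s * (h s)\<^sup>2)"
  have cs: "0 < coord_sum y" by (rule coord_sum_pos[OF y])
  have D_pos: "0 < D i" for i using y cs by (simp add: D_def orthant_def)
  have D_sum: "(\<Sum>i\<in>UNIV. D i) = 1"
    using cs by (simp add: D_def sum_divide_distrib[symmetric] coord_sum_def[symmetric])
  have [measurable]: "\<And>i. e i \<in> borel_measurable borel" "h \<in> borel_measurable borel"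
    unfolding e_def h_def by measurable
  have AE_pos: "AE s in ?S. 0 < s" by (rule AE_radial_prob[OF rd_m])
  have AE_w: "AE s in ?S. 0 < w s" using AE_pos by eventually_elim (rule w_pos)
  have variance: "(\<Sum>i\<in>UNIV. D i * (e i s - h s)\<^sup>2) = (\<Sum>i\<in>UNIV. D i * (e i s)\<^sup>2) - (h s)\<^sup>2" for s
  proof -
    have "(\<Sum>i\<in>UNIV. D i * (e i s - h s)\<^sup>2)
        = (\<Sum>i\<in>UNIV. D i * (e i s)\<^sup>2 - 2 * h s * (D i * e i s) + (h s)\<^sup>2 * D i)"
      by (intro sum.cong refl) (simp add: power2_diff algebra_simps)
    also have "\<dots> = (\<Sum>i\<in>UNIV. D i * (e i s)\<^sup>2) - 2 * h s * (\<Sum>i\<in>UNIV. D i * e i s) + (h s)\<^sup>2 * (\<Sum>i\<in>UNIV. D i)"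
      by (simp only: sum.distrib sum_subtractf sum_distrib_left)
    also have "\<dots> = (\<Sum>i\<in>UNIV. D i * (e i s)\<^sup>2) - (h s)\<^sup>2"
      by (simp add: D_sum h_def power2_eq_square)
    finally show ?thesis .
  qed
  have e_int: "integrable ?S (\<lambda>s. w s * (\<Sum>i\<in>UNIV. D i * (e i s)\<^sup>2))"
    using energy by (simp only: D_def e_def)
  have diff_int: "integrable ?S (\<lambda>s. w s * (e i s - h s)\<^sup>2)"
    and h_int: "integrable ?S (\<lambda>s. w s * (h s)\<^sup>2)"
    and ei_int: "integrable ?S (\<lambda>s. w s * (e i s)\<^sup>2)" for i
  proof -
    have *: "D i * (e i s - h s)\<^sup>2 \<le> (\<Sum>i\<in>UNIV. D i * (e i s)\<^sup>2)" "(h s)\<^sup>2 \<le> (\<Sum>i\<in>UNIV. D i * (e i s)\<^sup>2)"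
       "D i * (e i s)\<^sup>2 \<le> (\<Sum>i\<in>UNIV. D i * (e i s)\<^sup>2)" for s i
    proof -
      have nn: "0 \<le> D j * c\<^sup>2" for j c using D_pos[of j] by simp
      have "D i * (e i s - h s)\<^sup>2 \<le> (\<Sum>i\<in>UNIV. D i * (e i s - h s)\<^sup>2)"
        "D i * (e i s)\<^sup>2 \<le> (\<Sum>i\<in>UNIV. D i * (e i s)\<^sup>2)"
        "0 \<le> (\<Sum>i\<in>UNIV. D i * (e i s - h s)\<^sup>2)"
        by (intro member_le_sum sum_nonneg nn; simp)+
      then show "D i * (e i s - h s)\<^sup>2 \<le> (\<Sum>i\<in>UNIV. D i * (e i s)\<^sup>2)" "(h s)\<^sup>2 \<le> (\<Sum>i\<in>UNIV. D i * (e i s)\<^sup>2)"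
       "D i * (e i s)\<^sup>2 \<le> (\<Sum>i\<in>UNIV. D i * (e i s)\<^sup>2)"
        unfolding variance using zero_le_power2[of "h s"] by linarith+
    qed
    have dom: "integrable ?S (\<lambda>s. w s * (c s)\<^sup>2)"
      if [measurable]: "c \<in> borel_measurable borel" and k: "0 < k" and le: "\<And>s. k * (c s)\<^sup>2 \<le> (\<Sum>i\<in>UNIV. D i * (e i s)\<^sup>2)" for c k
    proof (rule Bochner_Integration.integrable_bound)
      show "integrable ?S (\<lambda>s. (1 / k) * (w s * (\<Sum>i\<in>UNIV. D i * (e i s)\<^sup>2)))"
        using e_int by (rule integrable_mult_right)
      show "AE s in ?S. norm (w s * (c s)\<^sup>2) \<le> norm ((1 / k) * (w s * (\<Sum>i\<in>UNIV. D i * (e i s)\<^sup>2)))"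
        using AE_w
      proof eventually_elim
        case (elim s)
        have "(c s)\<^sup>2 \<le> (1 / k) * (\<Sum>i\<in>UNIV. D i * (e i s)\<^sup>2)"
          using le[of s] k by (simp add: field_simps)
        then have "w s * (c s)\<^sup>2 \<le> w s * ((1 / k) * (\<Sum>i\<in>UNIV. D i * (e i s)\<^sup>2))"
          using elim by (intro mult_left_mono) auto
        also have "\<dots> = (1 / k) * (w s * (\<Sum>i\<in>UNIV. D i * (e i s)\<^sup>2))"
          by (rule mult.left_commute)
        also have "\<dots> \<le> norm \<dots>" unfolding real_norm_def by (rule abs_ge_self)
        finally show ?case using elim by simp
      qed
    qed measurable
    show "integrable ?S (\<lambda>s. w s * (e i s - h s)\<^sup>2)" by (rule dom[OF _ D_pos *(1)]) measurable
    show "integrable ?S (\<lambda>s. w s * (h s)\<^sup>2)" by (rule dom[of _ 1]) (use *(2) in auto)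
    show "integrable ?S (\<lambda>s. w s * (e i s)\<^sup>2)" by (rule dom[OF _ D_pos *(3)]) measurable
  qed
  have R0: "0 \<le> R" unfolding R_def
    using AE_w by (intro integral_nonneg_AE) (auto elim!: eventually_mono)
  have T_eq: "T i = (LINT s|?S. s * (e i s - h s))" for i
  proof -
    have int: "integrable ?S (\<lambda>s. s * e i s)" for i
      by (rule weighted_cauchy_schwarz(1)[OF AE_w K_int ei_int]) measurable
    have "(LINT s|?S. s * (e i s - h s)) = (LINT s|?S. s * e i s - (\<Sum>j\<in>UNIV. D j * (s * e j s)))"
      by (intro Bochner_Integration.integral_cong refl) (simp add: h_def sum_distrib_left right_diff_distrib mult_ac)
    also have "\<dots> = (LINT s|?S. s * e i s) - (\<Sum>j\<in>UNIV. D j * (LINT s|?S. s * e j s))"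
      using int by simp
    finally show ?thesis by (simp add: T_def e_def D_def)
  qed
  have tangential: "(\<Sum>i\<in>UNIV. D i * (T i)\<^sup>2) \<le> K * (N - R)"
  proof -
    have "(\<Sum>i\<in>UNIV. D i * (T i)\<^sup>2) \<le> (\<Sum>i\<in>UNIV. D i * (K * (LINT s|?S. w s * (e i s - h s)\<^sup>2)))"
    proof (intro sum_mono mult_left_mono)
      fix i
      show "(T i)\<^sup>2 \<le> K * (LINT s|?S. w s * (e i s - h s)\<^sup>2)"
        unfolding T_eq K_def
        by (rule weighted_cauchy_schwarz(2)[OF AE_w K_int diff_int]) measurable
    qed (rule less_imp_le[OF D_pos])
    also have "\<dots> = K * (LINT s|?S. (\<Sum>i\<in>UNIV. D i * (w s * (e i s - h s)\<^sup>2)))"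
      using diff_int by (simp add: sum_distrib_left mult_ac)
    also have "(LINT s|?S. (\<Sum>i\<in>UNIV. D i * (w s * (e i s - h s)\<^sup>2)))
        = (LINT s|?S. w s * (\<Sum>i\<in>UNIV. D i * (e i s)\<^sup>2) - w s * (h s)\<^sup>2)"
    proof (intro Bochner_Integration.integral_cong refl)
      fix s
      have "(\<Sum>i\<in>UNIV. D i * (w s * (e i s - h s)\<^sup>2)) = w s * (\<Sum>i\<in>UNIV. D i * (e i s - h s)\<^sup>2)"
        by (simp add: sum_distrib_left mult_ac)
      then show "(\<Sum>i\<in>UNIV. D i * (w s * (e i s - h s)\<^sup>2)) = w s * (\<Sum>i\<in>UNIV. D i * (e i s)\<^sup>2) - w s * (h s)\<^sup>2"
        by (simp add: variance right_diff_distrib)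
    qed
    also have "\<dots> = N - R"
      unfolding N_def R_def by (rule Bochner_Integration.integral_diff[OF e_int h_int])
    finally show ?thesis .
  qed
  have "R \<le> N" unfolding R_def N_def
  proof (rule integral_mono_AE[OF h_int e_int])
    show "AE s in ?S. w s * (h s)\<^sup>2 \<le> w s * (\<Sum>i\<in>UNIV. D i * (e i s)\<^sup>2)"
      using AE_w
    proof eventually_elim
      case (elim s)
      have "0 \<le> (\<Sum>i\<in>UNIV. D i * (e i s - h s)\<^sup>2)"
        using D_pos by (intro sum_nonneg mult_nonneg_nonneg) (auto intro: less_imp_le)
      then show ?case using elim by (intro mult_left_mono) (auto simp: variance)
    qed
  qed
  have radial: "Var ?S (\<lambda>s. f (dilate y s)) \<le> CP * R"
    unfolding R_def by (rule poincare[OF _ _ _ f2 h_int]) (use wg in \<open>auto simp: h_def D_def e_def\<close>)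
  let ?C = "max CP (K / coord_sum \<alpha>)"
  have "(\<Sum>i\<in>UNIV. D i * (T i)\<^sup>2) / coord_sum \<alpha> \<le> K / coord_sum \<alpha> * (N - R)"
    using tangential total_alpha_pos by (simp add: field_simps)
  also have "\<dots> \<le> ?C * (N - R)"
    using \<open>R \<le> N\<close> by (intro mult_right_mono) auto
  finally have "(\<Sum>i\<in>UNIV. D i * (T i)\<^sup>2) / coord_sum \<alpha> \<le> ?C * (N - R)" .
  moreover have "CP * R \<le> ?C * R"
    using R0 by (intro mult_right_mono) auto
  ultimately have "Var ?S (\<lambda>s. f (dilate y s)) + (\<Sum>i\<in>UNIV. D i * (T i)\<^sup>2) / coord_sum \<alpha> \<le> ?C * N"
    using radial by (simp add: right_diff_distrib)
  then show ?thesis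
    by (simp only: Var_def D_def N_def e_def)
qed

lemma integrable_radial_function:
  fixes \<phi> :: "real \<Rightarrow> real"
  assumes [measurable]: "\<phi> \<in> borel_measurable borel" and \<phi>: "integrable (radial_prob \<alpha> g) \<phi>"
  shows "integrable (liouville_prob \<alpha> g) (\<lambda>x. \<phi> (coord_sum x))"
proof (rule integrableI_bounded)
  interpret \<gamma>: prob_space "gamma_measure \<alpha>" by (rule prob_space_gamma_measure[OF alpha_pos])
  have orth: "AE y in gamma_measure \<alpha>. y \<in> orthant \<and> True" by (rule AE_gamma_measure) simp
  have "(\<integral>\<^sup>+x. ennreal (norm (\<phi> (coord_sum x))) \<partial>liouville_prob \<alpha> g)
      = (\<integral>\<^sup>+y. \<integral>\<^sup>+s. ennreal (norm (\<phi> (coord_sum (dilate y s)))) \<partial>radial_prob \<alpha> g \<partial>gamma_measure \<alpha>)"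
    by (rule nn_integral_dilate_powr_0[symmetric]) measurable
  also have "\<dots> = (\<integral>\<^sup>+y. (\<integral>\<^sup>+s. ennreal (norm (\<phi> s)) \<partial>radial_prob \<alpha> g) \<partial>gamma_measure \<alpha>)"
    using orth by (intro nn_integral_cong_AE) (auto elim!: eventually_mono simp: coord_sum_dilate)
  also have "\<dots> = (\<integral>\<^sup>+s. ennreal (norm (\<phi> s)) \<partial>radial_prob \<alpha> g)"
    by (simp add: \<gamma>.emeasure_space_1[unfolded space_gamma_measure])
  also have "\<dots> < \<infinity>" using \<phi> by (simp add: integrable_iff_bounded)
  finally show "(\<integral>\<^sup>+x. ennreal (norm (\<phi> (coord_sum x))) \<partial>liouville_prob \<alpha> g) < \<infinity>" .
qed measurable

lemma prob_space_liouville_prob: "prob_space (liouville_prob \<alpha> g)"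
proof
  interpret \<gamma>: prob_space "gamma_measure \<alpha>" by (rule prob_space_gamma_measure[OF alpha_pos])
  interpret S: prob_space "radial_prob \<alpha> g" by (rule prob_space_radial_prob)
  show "emeasure (liouville_prob \<alpha> g) (space (liouville_prob \<alpha> g)) = 1"
    using nn_integral_dilate_powr_0[of "\<lambda>_. 1"] \<gamma>.emeasure_space_1 S.emeasure_space_1 by simp
qed

text \<open>
  Integration of \<open>radial_estimate\<close> over the directions, combined with the Poincare inequality for the
  Gamma law applied to \<open>u y = coord_sum y * F0 y\<close>, where \<open>F0 y\<close> is the mean of \<open>f\<close> on the ray through \<open>y\<close>.
\<close>

lemma liouville_variance_bound:
  fixes f :: "real ^ 'n \<Rightarrow> real" and G :: "real ^ 'n \<Rightarrow> real ^ 'n" and w :: "real \<Rightarrow> real" and CP :: real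
  assumes wg: "weak_gradient orthant f G"
    and [measurable]: "f \<in> borel_measurable borel" "G \<in> borel_measurable borel" "w \<in> borel_measurable borel"
    and f0: "\<And>x. x \<notin> orthant \<Longrightarrow> f x = 0" and G0: "\<And>x. x \<notin> orthant \<Longrightarrow> G x = 0"
    and w_pos: "\<And>s. 0 < s \<Longrightarrow> 0 < w s"
    and f2: "integrable (liouville_prob \<alpha> g) (\<lambda>x. (f x)\<^sup>2)"
    and energy: "integrable (liouville_prob \<alpha> g) (\<lambda>x. w (coord_sum x) / coord_sum x * (\<Sum>i\<in>UNIV. x $ i * (G x $ i)\<^sup>2))"
    and K_int: "integrable (radial_prob \<alpha> g) (\<lambda>s. s\<^sup>2 / w s)"
    and poincare: "\<And>F h. F \<in> borel_measurable borel \<Longrightarrow> h \<in> borel_measurable borel \<Longrightarrow> weak_gradient {0<..} F h \<Longrightarrow>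
      integrable (radial_prob \<alpha> g) (\<lambda>s. (F s)\<^sup>2) \<Longrightarrow> integrable (radial_prob \<alpha> g) (\<lambda>s. w s * (h s)\<^sup>2) \<Longrightarrow>
      Var (radial_prob \<alpha> g) F \<le> CP * (LINT s|radial_prob \<alpha> g. w s * (h s)\<^sup>2)"
  defines "K \<equiv> LINT s|radial_prob \<alpha> g. s\<^sup>2 / w s"
  shows "Var (liouville_prob \<alpha> g) f \<le> max CP (K / coord_sum \<alpha>) *
      (LINT x|liouville_prob \<alpha> g. w (coord_sum x) / coord_sum x * (\<Sum>i\<in>UNIV. x $ i * (G x $ i)\<^sup>2))"
proof -
  let ?S = "radial_prob \<alpha> g" and ?L = "liouville_prob \<alpha> g" and ?\<gamma> = "gamma_measure \<alpha>"
  interpret S: prob_space ?S by (rule prob_space_radial_prob)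
  interpret L: prob_space ?L by (rule prob_space_liouville_prob)
  interpret \<gamma>: prob_space ?\<gamma> by (rule prob_space_gamma_measure[OF alpha_pos])
  interpret pair_prob_space ?\<gamma> ?S ..
  note [measurable] = rd_m
  have [measurable]: "(orthant :: (real ^ 'n) set) \<in> sets borel" by (rule borel_open[OF open_orthant])
  define a where "a = coord_sum \<alpha>"
  have a: "0 < a" unfolding a_def by (rule total_alpha_pos)
  define C where "C = max CP (K / a)"
  define e where "e = (\<lambda>x. w (coord_sum x) / coord_sum x * (\<Sum>i\<in>UNIV. x $ i * (G x $ i)\<^sup>2))"
  have [measurable]: "e \<in> borel_measurable borel" unfolding e_def by measurable
  have e_int: "integrable ?L e" using energy by (simp only: e_def)
  have f_int: "integrable ?L f"
    by (rule L.square_integrable_imp_integrable[OF _ f2]) measurable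
  have e_dilate: "e (dilate y s) = w s * (\<Sum>i\<in>UNIV. y $ i / coord_sum y * (G (dilate y s) $ i)\<^sup>2)"
    if y: "y \<in> orthant" for y s
  proof (cases "0 < s")
    case True
    have "e (dilate y s) = w s / s * (\<Sum>i\<in>UNIV. dilate y s $ i * (G (dilate y s) $ i)\<^sup>2)"
      by (simp only: e_def coord_sum_dilate[OF y])
    also have "\<dots> = (\<Sum>i\<in>UNIV. w s / s * (dilate y s $ i * (G (dilate y s) $ i)\<^sup>2))"
      by (rule sum_distrib_left)
    also have "\<dots> = (\<Sum>i\<in>UNIV. w s * (y $ i / coord_sum y * (G (dilate y s) $ i)\<^sup>2))"
      using True by (intro sum.cong refl) (simp add: dilate_eq_scaleR)
    finally show ?thesis by (simp only: sum_distrib_left)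
  next
    case False
    then have "G (dilate y s) = 0" using dilate_in_orthant[OF y] by (intro G0) simp
    then show ?thesis unfolding e_def by simp
  qed

  define F0 where "F0 = (\<lambda>y. LINT s|?S. f (dilate y s))"
  define Q where "Q = (\<lambda>y. LINT s|?S. (f (dilate y s))\<^sup>2)"
  define N where "N = (\<lambda>y. LINT s|?S. e (dilate y s))"
  define H where "H = (\<lambda>y j. LINT s|?S. s * G (dilate y s) $ j)"
  define T where "T = (\<lambda>y i. H y i - (\<Sum>j\<in>UNIV. y $ j / coord_sum y * H y j))"
  define \<Gamma> where "\<Gamma> = (\<lambda>y. \<Sum>i\<in>UNIV. y $ i / coord_sum y * (T y i)\<^sup>2)"
  have [measurable]: "F0 \<in> borel_measurable borel" "Q \<in> borel_measurable borel" "N \<in> borel_measurable borel"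
    "\<And>j. (\<lambda>y. H y j) \<in> borel_measurable borel"
    unfolding F0_def Q_def N_def H_def by measurable
  have [measurable]: "\<And>j. (\<lambda>y. T y j) \<in> borel_measurable borel" unfolding T_def by measurable
  have [measurable]: "\<Gamma> \<in> borel_measurable borel" unfolding \<Gamma>_def by measurable

  have hom: "F0 (c *\<^sub>R y) = F0 y" "\<Gamma> (c *\<^sub>R y) = \<Gamma> y" if "0 < c" "y \<in> orthant" for c y
  proof -
    have D: "(c *\<^sub>R y) $ i / coord_sum (c *\<^sub>R y) = y $ i / coord_sum y" for i
      using that by (simp add: coord_sum_def sum_distrib_left[symmetric])
    have "H (c *\<^sub>R y) = H y" by (simp only: H_def dilate_scaleR[OF that])
    then have T: "T (c *\<^sub>R y) = T y" by (simp only: T_def D)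
    show "F0 (c *\<^sub>R y) = F0 y" by (simp only: F0_def dilate_scaleR[OF that])
    show "\<Gamma> (c *\<^sub>R y) = \<Gamma> y" by (simp only: \<Gamma>_def T D)
  qed

  have AE_orthant: "AE y in ?\<gamma>. y \<in> orthant \<and> True" by (rule AE_gamma_measure) simp
  have AE_wg: "AE y in ?\<gamma>. y \<in> orthant \<and> weak_gradient {0<..} (\<lambda>s. f (dilate y s))
      (\<lambda>s. \<Sum>i\<in>UNIV. y $ i / coord_sum y * G (dilate y s) $ i)"
    unfolding dilate_eq_scaleR
    by (rule AE_gamma_measure, rule radial_weak_gradient[OF wg assms(2,3) f0 G0])
  have f_N: "integrable (?\<gamma> \<Otimes>\<^sub>M ?S) (\<lambda>(y, s). f (dilate y s))"
    and f2_N: "integrable (?\<gamma> \<Otimes>\<^sub>M ?S) (\<lambda>(y, s). (f (dilate y s))\<^sup>2)"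
    and e_N: "integrable (?\<gamma> \<Otimes>\<^sub>M ?S) (\<lambda>(y, s). e (dilate y s))"
    by (rule integrable_dilate[OF _ f_int] integrable_dilate[OF _ f2] integrable_dilate[OF _ e_int], measurable)+
  have F0_int: "integrable ?\<gamma> F0" and Q_int: "integrable ?\<gamma> Q" and N_int: "integrable ?\<gamma> N"
    unfolding F0_def Q_def N_def
    using integrable_fst'[OF f_N] integrable_fst'[OF f2_N] integrable_fst'[OF e_N] by (simp_all only: prod.case)
  have F0_mean: "(LINT y|?\<gamma>. F0 y) = (LINT x|?L. f x)" and Q_mean: "(LINT y|?\<gamma>. Q y) = (LINT x|?L. (f x)\<^sup>2)"
    and N_mean: "(LINT y|?\<gamma>. N y) = (LINT x|?L. e x)"
    unfolding F0_def Q_def N_def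
    by (intro integral_dilate f_int f2 e_int; measurable)+
  have AE_f: "AE y in ?\<gamma>. integrable ?S (\<lambda>s. f (dilate y s))"
    and AE_f2: "AE y in ?\<gamma>. integrable ?S (\<lambda>s. (f (dilate y s))\<^sup>2)"
    and AE_e: "AE y in ?\<gamma>. integrable ?S (\<lambda>s. e (dilate y s))"
    using AE_integrable_fst'[OF f_N] AE_integrable_fst'[OF f2_N] AE_integrable_fst'[OF e_N] by (simp_all only: prod.case)
  \<comment> \<open>The last summand on the left is kept, since it will compensate the variance of \<open>F0\<close>.\<close>
  have ray: "AE y in ?\<gamma>. Q y - (F0 y)\<^sup>2 + \<Gamma> y / a \<le> C * N y"
    using AE_wg AE_f2 AE_e
  proof eventually_elim
    case (elim y)
    then have y: "y \<in> orthant" by simp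
    have "integrable ?S (\<lambda>s. w s * (\<Sum>i\<in>UNIV. y $ i / coord_sum y * (G (dilate y s) $ i)\<^sup>2))"
      using elim(3) by (simp only: e_dilate[OF y])
    from radial_estimate[where f = f and G = G and w = w and CP = CP, OF y assms(2,3,4) w_pos
        conjunct2[OF elim(1)] elim(2) this K_int poincare]
    have "Q y - (F0 y)\<^sup>2 + \<Gamma> y / a
        \<le> C * (LINT s|?S. w s * (\<Sum>i\<in>UNIV. y $ i / coord_sum y * (G (dilate y s) $ i)\<^sup>2))"
      unfolding Q_def F0_def \<Gamma>_def T_def H_def C_def K_def a_def .
    then show ?case unfolding N_def e_dilate[OF y] .
  qed
  have \<Gamma>0: "AE y in ?\<gamma>. 0 \<le> \<Gamma> y"
    using AE_orthant
  proof eventually_elim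
    case (elim y)
    then have "0 \<le> y $ i / coord_sum y" for i
      using coord_sum_pos[of y] by (simp add: orthant_def less_imp_le)
    then show ?case unfolding \<Gamma>_def by (intro sum_nonneg mult_nonneg_nonneg) simp_all
  qed
  have F0_Q: "AE y in ?\<gamma>. (F0 y)\<^sup>2 \<le> Q y"
    using AE_f AE_f2
  proof eventually_elim
    case (elim y)
    have "0 \<le> (LINT s|?S. (f (dilate y s) - F0 y)\<^sup>2)" by (intro integral_nonneg_AE) simp
    also have "\<dots> = Q y - (F0 y)\<^sup>2"
      unfolding F0_def Q_def by (rule S.variance_eq[OF elim])
    finally show ?case by simp
  qed
  have F02_int: "integrable ?\<gamma> (\<lambda>y. (F0 y)\<^sup>2)"
  proof (rule Bochner_Integration.integrable_bound[OF Q_int])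
    show "AE y in ?\<gamma>. norm ((F0 y)\<^sup>2) \<le> norm (Q y)" using F0_Q by eventually_elim simp
  qed measurable
  have \<Gamma>_int: "integrable ?\<gamma> \<Gamma>"
  proof (rule Bochner_Integration.integrable_bound)
    show "integrable ?\<gamma> (\<lambda>y. a * (C * N y))" using N_int by simp
    show "AE y in ?\<gamma>. norm (\<Gamma> y) \<le> norm (a * (C * N y))"
      using ray F0_Q \<Gamma>0
    proof eventually_elim
      case (elim y)
      then have "\<Gamma> y / a \<le> C * N y" by simp
      then have "\<Gamma> y \<le> a * (C * N y)" using a by (simp add: field_simps)
      then show ?case using elim(3) by simp
    qed
  qed measurable

  define u where "u = (\<lambda>y. if y \<in> orthant then coord_sum y * F0 y else 0)"
  define U where "U = (\<lambda>y. if y \<in> orthant then \<chi> i. F0 y + T y i else 0)"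
  have [measurable]: "u \<in> borel_measurable borel" "U \<in> borel_measurable borel"
    unfolding u_def U_def by measurable
  have wg_u: "weak_gradient orthant u U"
  proof -
    define d where "d = (\<lambda>s. radial_density \<alpha> g s / (LINT s|lborel. radial_density \<alpha> g s))"
    have [measurable]: "d \<in> borel_measurable borel" unfolding d_def by measurable
    have "0 \<le> (LINT s|lborel. radial_density \<alpha> g s)"
      by (intro integral_nonneg_AE AE_I2 radial_density_nonneg)
    then have d0: "0 \<le> d s" for s unfolding d_def by (intro divide_nonneg_nonneg radial_density_nonneg)
    have S_d: "(LINT s|?S. \<phi> s) = (LINT s|lborel. d s * \<phi> s)" if [measurable]: "\<phi> \<in> borel_measurable borel" for \<phi> :: "real \<Rightarrow> real"
    proof -
      have "?S = density lborel (\<lambda>s. ennreal (d s))" by (simp only: radial_prob_def d_def)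
      then show ?thesis using d0 by (simp only:) (intro integral_real_density; simp)
    qed
    have f_loc: "integrable (lborel \<Otimes>\<^sub>M lborel) (\<lambda>(y, s). indicator K y * (d s * f ((s / coord_sum y) *\<^sub>R y)))"
      if K: "compact K" "K \<subseteq> orthant" for K
      using integrable_lborel_compact_coefficient[of "\<lambda>_. 1" "\<lambda>y s. f (dilate y s)" K] f_N K
      by (simp add: d_def dilate_eq_scaleR)
    \<comment> \<open>Young inequality: \<open>x\<^sub>j \<bar>G\<^sub>j\<bar> \<le> x\<^sub>j (s / w + (w / s) G\<^sub>j\<^sup>2)\<close> with \<open>x\<^sub>j \<le> s\<close>, and the two terms have finite means by the assumptions on \<open>K\<close> and on the energy.\<close>
    have xG: "integrable ?L (\<lambda>x. x $ j * G x $ j)" for j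
    proof (rule Bochner_Integration.integrable_bound)
      show "integrable ?L (\<lambda>x. (coord_sum x)\<^sup>2 / w (coord_sum x) + e x)"
        by (intro Bochner_Integration.integrable_add e_int integrable_radial_function K_int) measurable
      show "AE x in ?L. norm (x $ j * G x $ j) \<le> norm ((coord_sum x)\<^sup>2 / w (coord_sum x) + e x)"
      proof (rule AE_I2)
        fix x
        show "norm (x $ j * G x $ j) \<le> norm ((coord_sum x)\<^sup>2 / w (coord_sum x) + e x)"
        proof (cases "x \<in> orthant")
          case True
          then have x: "0 < x $ i" for i by (simp add: orthant_def)
          define s where "s = coord_sum x"
          define b where "b = G x $ j"
          have s: "0 < s" unfolding s_def by (rule coord_sum_pos[OF True])
          have w: "0 < w s" by (rule w_pos[OF s])
          have xs: "x $ j \<le> s"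
            unfolding s_def coord_sum_def using x by (intro member_le_sum) (auto intro: less_imp_le)
          have "x $ j * \<bar>b\<bar> \<le> x $ j * (s / w + w / s * b\<^sup>2)" if "0 < w" for w :: real
          proof (intro mult_left_mono less_imp_le[OF x])
            have "0 \<le> (s - w * \<bar>b\<bar>)\<^sup>2" by simp
            then have "2 * (w * s * \<bar>b\<bar>) \<le> s\<^sup>2 + w\<^sup>2 * b\<^sup>2"
              by (simp add: power2_diff power_mult_distrib mult_ac)
            moreover have "0 \<le> w * s * \<bar>b\<bar>" using that s by simp
            ultimately have "w * s * \<bar>b\<bar> \<le> s\<^sup>2 + w\<^sup>2 * b\<^sup>2" by linarith
            then show "\<bar>b\<bar> \<le> s / w + w / s * b\<^sup>2"
              using that s by (simp add: field_simps power2_eq_square)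
          qed
          from this[OF w] have "x $ j * \<bar>b\<bar> \<le> x $ j * (s / w s) + w s / s * (x $ j * b\<^sup>2)"
            by (simp add: ring_distribs mult_ac)
          also have "x $ j * (s / w s) \<le> s\<^sup>2 / w s"
            using mult_right_mono[OF xs, of "s / w s"] s w by (simp add: power2_eq_square)
          also have "w s / s * (x $ j * b\<^sup>2) \<le> e x"
          proof -
            have nn: "0 \<le> x $ i * (G x $ i)\<^sup>2" for i using x[of i] by simp
            have "x $ j * b\<^sup>2 \<le> (\<Sum>i\<in>UNIV. x $ i * (G x $ i)\<^sup>2)"
              unfolding b_def by (rule member_le_sum) (simp_all add: nn)
            then show ?thesis
              unfolding e_def s_def[symmetric] using s w by (intro mult_left_mono) simp_all
          qed
          finally have "\<bar>x $ j * b\<bar> \<le> s\<^sup>2 / w s + e x"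
            using x[of j] by (simp add: abs_mult)
          then show ?thesis unfolding s_def b_def real_norm_def by linarith
        next
          case False
          then show ?thesis by (simp add: G0)
        qed
      qed
    qed measurable
    have G_loc: "integrable (lborel \<Otimes>\<^sub>M lborel) (\<lambda>(y, s). indicator K y * (d s * (s * G ((s / coord_sum y) *\<^sub>R y) $ j)))"
      if K: "compact K" "K \<subseteq> orthant" for K j
    proof -
      have "integrable (?\<gamma> \<Otimes>\<^sub>M ?S) (\<lambda>(y, s). dilate y s $ j * G (dilate y s) $ j)"
        by (rule integrable_dilate[OF _ xG]) measurable
      also have "(\<lambda>(y, s). dilate y s $ j * G (dilate y s) $ j) = (\<lambda>(y, s). y $ j / coord_sum y * (s * G (dilate y s) $ j))"
        by (simp add: dilate_eq_scaleR fun_eq_iff)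
      finally have "integrable (?\<gamma> \<Otimes>\<^sub>M ?S) (\<lambda>(y, s). y $ j / coord_sum y * (s * G (dilate y s) $ j))" .
      then show ?thesis
        unfolding d_def dilate_eq_scaleR[symmetric]
      proof (rule integrable_lborel_compact_coefficient)
        have "continuous_on orthant (\<lambda>y :: real ^ 'n. y $ j / (\<Sum>i\<in>UNIV. y $ i))"
          using coord_sum_pos by (intro continuous_intros) (force simp: coord_sum_def)
        then show "continuous_on orthant (\<lambda>y :: real ^ 'n. y $ j / coord_sum y)"
          by (simp only: coord_sum_def)
        show "0 < y $ j / coord_sum y" if "y \<in> orthant" for y :: "real ^ 'n"
          using that coord_sum_pos[OF that] by (simp add: orthant_def)
      qed (use K in measurable)
    qed
    have H_d: "H y j = (LINT s|lborel. d s * (s * G ((s / coord_sum y) *\<^sub>R y) $ j))" for y j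
      unfolding H_def dilate_eq_scaleR[symmetric] by (rule S_d) measurable
    have F0_d: "F0 y = (LINT s|lborel. d s * f ((s / coord_sum y) *\<^sub>R y))" for y
      unfolding F0_def dilate_eq_scaleR[symmetric] by (rule S_d) measurable
    have d_neg: "d s = 0" if "s \<le> 0" for s using that by (simp add: d_def radial_density_def)
    note average = weak_gradient_spherical_average[where d = d, OF wg assms(2,3) \<open>d \<in> borel_measurable borel\<close>]
    show ?thesis
      unfolding u_def U_def T_def H_d F0_d
      by (rule average[unfolded vec_lambda_beta]) (assumption | rule f0 G0 d_neg f_loc G_loc)+
  qed

  have Gam1: "Gamma (a + 1) / Gamma a = a" and Gam2: "Gamma (a + 2) / Gamma a = a * (a + 1)"
  proof -
    have G: "Gamma a \<noteq> 0" using Gamma_real_pos[OF a] by simp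
    have "Gamma (a + 1) = a * Gamma a" using a by (intro Gamma_plus1) (auto elim!: nonpos_Ints_cases)
    moreover have "Gamma (a + 1 + 1) = (a + 1) * Gamma (a + 1)" using a by (intro Gamma_plus1) (auto elim!: nonpos_Ints_cases)
    ultimately show "Gamma (a + 1) / Gamma a = a" "Gamma (a + 2) / Gamma a = a * (a + 1)"
      using G by (simp_all add: add.assoc)
  qed
  have powr1: "coord_sum y powr 1 = coord_sum y" and powr2: "coord_sum y powr 2 = (coord_sum y)\<^sup>2"
    if "y \<in> orthant" for y :: "real ^ 'n"
    using coord_sum_pos[OF that] by (simp_all add: powr_numeral)
  have u_AE: "AE y in ?\<gamma>. coord_sum y powr 1 * F0 y = u y" "AE y in ?\<gamma>. coord_sum y powr 2 * (F0 y)\<^sup>2 = (u y)\<^sup>2"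
    using AE_orthant by (eventually_elim, simp only: u_def powr1 powr2 power_mult_distrib simp_thms if_True)+
  have sum_D: "(\<Sum>i\<in>UNIV. y $ i / coord_sum y) = 1" if "y \<in> orthant" for y :: "real ^ 'n"
    using coord_sum_pos[OF that] by (simp add: sum_divide_distrib[symmetric] coord_sum_def[symmetric])
  \<comment> \<open>The mixed term \<open>2 F0 (\<Sum>i. D i * T y i)\<close> vanishes because \<open>T\<close> is tangential.\<close>
  have U_AE: "AE y in ?\<gamma>. coord_sum y powr 1 * ((F0 y)\<^sup>2 + \<Gamma> y) = (\<Sum>i\<in>UNIV. y $ i * (U y $ i)\<^sup>2)"
    using AE_orthant
  proof eventually_elim
    case (elim y)
    then have y: "y \<in> orthant" by simp
    note cs = coord_sum_pos[OF y]
    define D where "D = (\<lambda>i. y $ i / coord_sum y)"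
    have D1: "(\<Sum>i\<in>UNIV. D i) = 1" unfolding D_def by (rule sum_D[OF y])
    have T: "T y i = H y i - (\<Sum>j\<in>UNIV. D j * H y j)" for i by (simp add: T_def D_def)
    have DT: "(\<Sum>i\<in>UNIV. D i * T y i) = 0"
      by (simp add: T right_diff_distrib sum_subtractf sum_distrib_right[symmetric] D1)
    have "(\<Sum>i\<in>UNIV. y $ i * (U y $ i)\<^sup>2) = (\<Sum>i\<in>UNIV. coord_sum y * (D i * (F0 y)\<^sup>2 + 2 * F0 y * (D i * T y i) + D i * (T y i)\<^sup>2))"
      using cs y by (intro sum.cong refl) (simp add: U_def D_def power2_sum field_simps)
    also have "\<dots> = coord_sum y * ((\<Sum>i\<in>UNIV. D i) * (F0 y)\<^sup>2 + 2 * F0 y * (\<Sum>i\<in>UNIV. D i * T y i) + (\<Sum>i\<in>UNIV. D i * (T y i)\<^sup>2))"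
      by (simp only: sum_distrib_left[symmetric] sum.distrib sum_distrib_right)
    also have "\<dots> = coord_sum y * ((F0 y)\<^sup>2 + \<Gamma> y)"
    proof -
      have "\<Gamma> y = (\<Sum>i\<in>UNIV. D i * (T y i)\<^sup>2)" by (simp only: \<Gamma>_def D_def)
      then show ?thesis by (simp add: D1 DT)
    qed
    finally show ?case by (simp only: powr1[OF y])
  qed
  have one: "(0::real) \<le> 1" and two: "(0::real) \<le> 2" by simp_all
  have u_mean: "(LINT y|?\<gamma>. u y) = a * (LINT y|?\<gamma>. F0 y)"
  proof -
    have "(LINT y|?\<gamma>. u y) = (LINT y|?\<gamma>. coord_sum y powr 1 * F0 y)"
      using u_AE(1) by (intro integral_cong_AE) (auto elim!: eventually_mono)
    also have "\<dots> = Gamma (coord_sum \<alpha> + 1) / Gamma (coord_sum \<alpha>) * (LINT y|?\<gamma>. F0 y)"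
      by (rule integral_homogeneous[OF _ hom(1) one F0_int]) measurable
    finally show ?thesis by (simp only: a_def[symmetric] Gam1)
  qed
  have hom2: "(F0 (c *\<^sub>R y))\<^sup>2 = (F0 y)\<^sup>2" "(F0 (c *\<^sub>R y))\<^sup>2 + \<Gamma> (c *\<^sub>R y) = (F0 y)\<^sup>2 + \<Gamma> y"
    if "0 < c" "y \<in> orthant" for c y
    by (simp_all only: hom[OF that])
  have u2_int: "integrable ?\<gamma> (\<lambda>y. (u y)\<^sup>2)" and u2_mean: "(LINT y|?\<gamma>. (u y)\<^sup>2) = a * (a + 1) * (LINT y|?\<gamma>. (F0 y)\<^sup>2)"
  proof -
    have "integrable ?\<gamma> (\<lambda>y. coord_sum y powr 2 * (F0 y)\<^sup>2)"
      by (rule integrable_homogeneous[OF _ hom2(1) two F02_int]) measurable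
    also have "?this \<longleftrightarrow> integrable ?\<gamma> (\<lambda>y. (u y)\<^sup>2)"
      using u_AE(2) by (intro integrable_cong_AE) measurable
    finally show "integrable ?\<gamma> (\<lambda>y. (u y)\<^sup>2)" .
    have "(LINT y|?\<gamma>. (u y)\<^sup>2) = (LINT y|?\<gamma>. coord_sum y powr 2 * (F0 y)\<^sup>2)"
      using u_AE(2) by (intro integral_cong_AE) (auto elim!: eventually_mono)
    also have "\<dots> = Gamma (coord_sum \<alpha> + 2) / Gamma (coord_sum \<alpha>) * (LINT y|?\<gamma>. (F0 y)\<^sup>2)"
      by (rule integral_homogeneous[OF _ hom2(1) two F02_int]) measurable
    finally show "(LINT y|?\<gamma>. (u y)\<^sup>2) = a * (a + 1) * (LINT y|?\<gamma>. (F0 y)\<^sup>2)" by (simp only: a_def[symmetric] Gam2)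
  qed
  have F\<Gamma>_int: "integrable ?\<gamma> (\<lambda>y. (F0 y)\<^sup>2 + \<Gamma> y)" using F02_int \<Gamma>_int by simp
  have U_int: "integrable ?\<gamma> (\<lambda>y. \<Sum>i\<in>UNIV. y $ i * (U y $ i)\<^sup>2)"
    and U_mean: "(LINT y|?\<gamma>. (\<Sum>i\<in>UNIV. y $ i * (U y $ i)\<^sup>2)) = a * ((LINT y|?\<gamma>. (F0 y)\<^sup>2) + (LINT y|?\<gamma>. \<Gamma> y))"
  proof -
    have "integrable ?\<gamma> (\<lambda>y. coord_sum y powr 1 * ((F0 y)\<^sup>2 + \<Gamma> y))"
      by (rule integrable_homogeneous[OF _ hom2(2) one F\<Gamma>_int]) measurable
    also have "?this \<longleftrightarrow> integrable ?\<gamma> (\<lambda>y. \<Sum>i\<in>UNIV. y $ i * (U y $ i)\<^sup>2)"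
      using U_AE by (intro integrable_cong_AE) measurable
    finally show "integrable ?\<gamma> (\<lambda>y. \<Sum>i\<in>UNIV. y $ i * (U y $ i)\<^sup>2)" .
    have "(LINT y|?\<gamma>. (\<Sum>i\<in>UNIV. y $ i * (U y $ i)\<^sup>2)) = (LINT y|?\<gamma>. coord_sum y powr 1 * ((F0 y)\<^sup>2 + \<Gamma> y))"
      using U_AE by (intro integral_cong_AE) (auto elim!: eventually_mono)
    also have "\<dots> = Gamma (coord_sum \<alpha> + 1) / Gamma (coord_sum \<alpha>) * (LINT y|?\<gamma>. (F0 y)\<^sup>2 + \<Gamma> y)"
      by (rule integral_homogeneous[OF _ hom2(2) one F\<Gamma>_int]) measurable
    also have "(LINT y|?\<gamma>. (F0 y)\<^sup>2 + \<Gamma> y) = (LINT y|?\<gamma>. (F0 y)\<^sup>2) + (LINT y|?\<gamma>. \<Gamma> y)"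
      by (rule Bochner_Integration.integral_add[OF F02_int \<Gamma>_int])
    finally show "(LINT y|?\<gamma>. (\<Sum>i\<in>UNIV. y $ i * (U y $ i)\<^sup>2)) = a * ((LINT y|?\<gamma>. (F0 y)\<^sup>2) + (LINT y|?\<gamma>. \<Gamma> y))"
      by (simp only: a_def[symmetric] Gam1)
  qed
  have Ui_int: "integrable ?\<gamma> (\<lambda>y. y $ i * (U y $ i)\<^sup>2)" for i
  proof (rule Bochner_Integration.integrable_bound[OF U_int])
    show "AE y in ?\<gamma>. norm (y $ i * (U y $ i)\<^sup>2) \<le> norm (\<Sum>i\<in>UNIV. y $ i * (U y $ i)\<^sup>2)"
      using AE_orthant
    proof eventually_elim
      case (elim y)
      then have nn: "0 \<le> y $ j * (U y $ j)\<^sup>2" for j by (simp add: orthant_def less_imp_le)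
      have "y $ i * (U y $ i)\<^sup>2 \<le> (\<Sum>i\<in>UNIV. y $ i * (U y $ i)\<^sup>2)"
        using nn by (intro member_le_sum) simp_all
      then show ?case using nn[of i] by simp
    qed
  qed measurable
  have "Var ?\<gamma> u \<le> (\<Sum>i\<in>UNIV. LINT y|?\<gamma>. y $ i * (U y $ i)\<^sup>2)"
    by (rule gamma_poincare[OF alpha_pos wg_u _ _ _ _ u2_int Ui_int]) (simp_all add: u_def U_def)
  also have "\<dots> = (LINT y|?\<gamma>. (\<Sum>i\<in>UNIV. y $ i * (U y $ i)\<^sup>2))"
    using Ui_int by simp
  finally have "a * (a + 1) * (LINT y|?\<gamma>. (F0 y)\<^sup>2) - (a * (LINT x|?L. f x))\<^sup>2
      \<le> a * ((LINT y|?\<gamma>. (F0 y)\<^sup>2) + (LINT y|?\<gamma>. \<Gamma> y))"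
    by (simp only: Var_def u2_mean u_mean U_mean F0_mean)
  then have "a * (a * (LINT y|?\<gamma>. (F0 y)\<^sup>2) - a * (LINT x|?L. f x)\<^sup>2) \<le> a * (LINT y|?\<gamma>. \<Gamma> y)"
    by (simp only: algebra_simps power2_eq_square)
  then have "a * (LINT y|?\<gamma>. (F0 y)\<^sup>2) - a * (LINT x|?L. f x)\<^sup>2 \<le> (LINT y|?\<gamma>. \<Gamma> y)"
    using a by (rule mult_left_le_imp_le)
  then have angular: "(LINT y|?\<gamma>. (F0 y)\<^sup>2) - (LINT x|?L. f x)\<^sup>2 \<le> (LINT y|?\<gamma>. \<Gamma> y) / a"
    using a by (simp add: field_simps)
  have CN_int: "integrable ?\<gamma> (\<lambda>y. C * N y)" using N_int by (rule integrable_mult_right)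
  have \<Gamma>a_int: "integrable ?\<gamma> (\<lambda>y. \<Gamma> y / a)" using \<Gamma>_int by (rule integrable_divide)
  note QF_int = Bochner_Integration.integrable_diff[OF Q_int F02_int]
  have "(LINT y|?\<gamma>. Q y - (F0 y)\<^sup>2 + \<Gamma> y / a) \<le> (LINT y|?\<gamma>. C * N y)"
    by (rule integral_mono_AE[OF Bochner_Integration.integrable_add[OF QF_int \<Gamma>a_int] CN_int ray])
  then have "(LINT y|?\<gamma>. Q y) - (LINT y|?\<gamma>. (F0 y)\<^sup>2) + (LINT y|?\<gamma>. \<Gamma> y) / a \<le> C * (LINT y|?\<gamma>. N y)"
    by (simp only: Bochner_Integration.integral_add[OF QF_int \<Gamma>a_int] Bochner_Integration.integral_diff[OF Q_int F02_int]
      integral_divide_zero integral_mult_right_zero)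
  with angular have "Var ?L f \<le> C * (LINT x|?L. e x)"
    unfolding Var_def Q_mean N_mean by linarith
  then show ?thesis by (simp only: C_def a_def e_def)
qed

end

section \<open>Passage to functions defined on the orthant only\<close>

text \<open>
  An open set is a countable union of closed boxes, on each of which the function is measurable.
\<close>

lemma borel_measurable_locally_integrable:
  fixes h :: "'a::euclidean_space \<Rightarrow> real"
  assumes \<Omega>: "open \<Omega>" and h: "locally_integrable_on \<Omega> h"
  shows "(\<lambda>x. if x \<in> \<Omega> then h x else 0) \<in> borel_measurable borel"
proof -
  obtain \<D> where \<D>: "countable \<D>" "\<D> \<subseteq> Pow \<Omega>" "\<And>X. X \<in> \<D> \<Longrightarrow> \<exists>a b. X = cbox a b" "\<Union>\<D> = \<Omega>"
    by (rule open_countable_Union_open_cbox[OF \<Omega>]) blast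
  show ?thesis
  proof (rule measurable_piecewise_restrict[where C = "insert (- \<Omega>) \<D>"])
    show "countable (insert (- \<Omega>) \<D>)" using \<D>(1) by simp
    show "space borel \<subseteq> \<Union>(insert (- \<Omega>) \<D>)" using \<D>(4) by auto
    show X_borel: "X \<inter> space borel \<in> sets borel" if "X \<in> insert (- \<Omega>) \<D>" for X
      using that \<D>(3)[of X] \<Omega> by auto
    fix X assume X: "X \<in> insert (- \<Omega>) \<D>"
    have "(\<lambda>x. indicator X x *\<^sub>R (if x \<in> \<Omega> then h x else 0)) \<in> borel_measurable borel"
    proof (cases "X = - \<Omega>")
      case True
      then have "(\<lambda>x. indicator X x *\<^sub>R (if x \<in> \<Omega> then h x else 0)) = (\<lambda>_. 0)"
        by (auto simp: indicator_def fun_eq_iff)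
      then show ?thesis by (simp only: borel_measurable_const)
    next
      case False
      then have "X \<in> \<D>" using X by simp
      then have "compact X" "X \<subseteq> \<Omega>" using \<D>(2) \<D>(3)[of X] by (auto simp: compact_cbox)
      then have "(\<lambda>x. indicator X x *\<^sub>R h x) \<in> borel_measurable lborel"
        using h unfolding locally_integrable_on_def set_integrable_def by (blast intro: borel_measurable_integrable)
      moreover have "(\<lambda>x. indicator X x *\<^sub>R (if x \<in> \<Omega> then h x else 0)) = (\<lambda>x. indicator X x *\<^sub>R h x)"
        using \<open>X \<subseteq> \<Omega>\<close> by (auto simp: indicator_def fun_eq_iff)
      ultimately show ?thesis by simp
    qed
    then show "(\<lambda>x. if x \<in> \<Omega> then h x else 0) \<in> borel_measurable (restrict_space borel X)"
      using borel_measurable_restrict_space_iff[OF X_borel[OF X]] by blast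
  qed
qed

lemma weak_gradient_cong:
  assumes "\<And>x. x \<in> \<Omega> \<Longrightarrow> f x = f' x" and "\<And>x. x \<in> \<Omega> \<Longrightarrow> G x = G' x"
  shows "weak_gradient \<Omega> f G \<longleftrightarrow> weak_gradient \<Omega> f' G'"
proof -
  have "weak_partial \<Omega> b f (\<lambda>x. G x \<bullet> b) \<longleftrightarrow> weak_partial \<Omega> b f' (\<lambda>x. G' x \<bullet> b)" for b
  proof -
    have loc: "locally_integrable_on \<Omega> f \<longleftrightarrow> locally_integrable_on \<Omega> f'"
      "locally_integrable_on \<Omega> (\<lambda>x. G x \<bullet> b) \<longleftrightarrow> locally_integrable_on \<Omega> (\<lambda>x. G' x \<bullet> b)"
      using assms by (intro locally_integrable_on_cong; simp)+
    have int: "(LINT x:\<Omega>|lborel. f x * \<phi> x) = (LINT x:\<Omega>|lborel. f' x * \<phi> x)"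
      "(LINT x:\<Omega>|lborel. (G x \<bullet> b) * \<phi> x) = (LINT x:\<Omega>|lborel. (G' x \<bullet> b) * \<phi> x)" for \<phi> :: "'a \<Rightarrow> real"
      unfolding set_lebesgue_integral_def
      using assms by (auto intro!: Bochner_Integration.integral_cong simp: indicator_def)
    show ?thesis unfolding weak_partial_def loc int ..
  qed
  then show ?thesis by (simp only: weak_gradient_def)
qed

lemma
  fixes F :: "real ^ 'n \<Rightarrow> real"
  assumes ld: "liouville_density \<alpha> g \<in> borel_measurable borel"
  shows liouville_eq: "liouville \<alpha> g = restrict_space (liouville_prob \<alpha> g) orthant"
    and integrable_liouville_iff: "integrable (liouville \<alpha> g) F \<longleftrightarrow>
      integrable (liouville_prob \<alpha> g) (\<lambda>x. if x \<in> orthant then F x else 0)"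
    and integral_liouville: "(LINT x|liouville \<alpha> g. F x) = (LINT x|liouville_prob \<alpha> g. (if x \<in> orthant then F x else 0))"
proof -
  have eq: "liouville_density \<alpha> g = (\<lambda>x. if x \<in> orthant then liouville_kernel \<alpha> g x else 0)"
    by (simp add: fun_eq_iff liouville_density_def)
  have prob_eq: "liouville_prob \<alpha> g = density lborel (\<lambda>x. ennreal ((if x \<in> orthant then liouville_kernel \<alpha> g x else 0)
      / (LINT x|lborel. (if x \<in> orthant then liouville_kernel \<alpha> g x else 0))))"
    by (simp only: liouville_prob_def eq)
  note orthant_borel = borel_open[OF open_orthant] and ld' = ld[unfolded eq]
  show "liouville \<alpha> g = restrict_space (liouville_prob \<alpha> g) orthant"
    unfolding liouville_def prob_eq by (rule normalized_measure_eq[OF orthant_borel ld'])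
  show "integrable (liouville \<alpha> g) F \<longleftrightarrow> integrable (liouville_prob \<alpha> g) (\<lambda>x. if x \<in> orthant then F x else 0)"
    unfolding liouville_def prob_eq by (rule integrable_normalized_measure_iff[OF orthant_borel ld'])
  show "(LINT x|liouville \<alpha> g. F x) = (LINT x|liouville_prob \<alpha> g. (if x \<in> orthant then F x else 0))"
    unfolding liouville_def prob_eq by (rule integral_normalized_measure[OF orthant_borel ld'])
qed

lemma
  fixes \<phi> \<psi> :: "real \<Rightarrow> real"
  assumes rd: "radial_density \<alpha> g \<in> borel_measurable borel"
    and [measurable]: "\<phi> \<in> borel_measurable borel" and eq: "\<And>s. 0 < s \<Longrightarrow> \<psi> s = \<phi> s"
  shows integrable_liouville_radial_iff: "integrable (liouville_radial \<alpha> g) \<psi> \<longleftrightarrow> integrable (radial_prob \<alpha> g) \<phi>"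
    and integral_liouville_radial: "(LINT s|liouville_radial \<alpha> g. \<psi> s) = (LINT s|radial_prob \<alpha> g. \<phi> s)"
proof -
  have rd_eq: "radial_density \<alpha> g = (\<lambda>s. if s \<in> {0<..} then s powr (coord_sum \<alpha> - 1) * g s else 0)"
    by (simp add: fun_eq_iff radial_density_def)
  have prob_eq: "radial_prob \<alpha> g = density lborel (\<lambda>s. ennreal ((if s \<in> {0<..} then s powr (coord_sum \<alpha> - 1) * g s else 0)
      / (LINT s|lborel. (if s \<in> {0<..} then s powr (coord_sum \<alpha> - 1) * g s else 0))))"
    by (simp only: radial_prob_def rd_eq)
  have half: "{0::real<..} \<in> sets borel" by simp
  have trunc: "(\<lambda>s. if s \<in> {0<..} then \<psi> s else 0) = (\<lambda>s. if s \<in> {0<..} then \<phi> s else 0)"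
    using eq by auto
  have AE_eq: "AE s in radial_prob \<alpha> g. (if s \<in> {0<..} then \<phi> s else 0) = \<phi> s"
    using AE_radial_prob[OF rd] by eventually_elim simp
  have "integrable (liouville_radial \<alpha> g) \<psi> \<longleftrightarrow> integrable (radial_prob \<alpha> g) (\<lambda>s. if s \<in> {0<..} then \<psi> s else 0)"
    unfolding liouville_radial_def prob_eq by (rule integrable_normalized_measure_iff[OF half rd[unfolded rd_eq]])
  also have "\<dots> \<longleftrightarrow> integrable (radial_prob \<alpha> g) \<phi>"
    unfolding trunc using AE_eq by (intro integrable_cong_AE) measurable
  finally show "integrable (liouville_radial \<alpha> g) \<psi> \<longleftrightarrow> integrable (radial_prob \<alpha> g) \<phi>" .
  have "(LINT s|liouville_radial \<alpha> g. \<psi> s) = (LINT s|radial_prob \<alpha> g. (if s \<in> {0<..} then \<psi> s else 0))"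
    unfolding liouville_radial_def prob_eq by (rule integral_normalized_measure[OF half rd[unfolded rd_eq]])
  also have "\<dots> = (LINT s|radial_prob \<alpha> g. \<phi> s)"
    unfolding trunc using AE_eq by (intro integral_cong_AE) measurable
  finally show "(LINT s|liouville_radial \<alpha> g. \<psi> s) = (LINT s|radial_prob \<alpha> g. \<phi> s)" .
qed

text \<open>
  The infimum of the admissible constants is admissible in the inequality, although the constant itself
  may be zero and hence not satisfy \<open>weighted_poincare\<close>.
\<close>

lemma poincare_const_bound:
  assumes ex: "weighted_poincare \<Omega> \<mu> W C0" and f: "L2 \<mu> f" "weak_gradient \<Omega> f G"
    and int: "integrable \<mu> (\<lambda>x. (weighted_norm (W x) (G x))\<^sup>2)"
  shows "Var \<mu> f \<le> poincare_const \<Omega> \<mu> W * (LINT x|\<mu>. (weighted_norm (W x) (G x))\<^sup>2)"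
proof -
  define I where "I = (LINT x|\<mu>. (weighted_norm (W x) (G x))\<^sup>2)"
  have le: "Var \<mu> f \<le> C * I" if "weighted_poincare \<Omega> \<mu> W C" for C
    using that f int unfolding weighted_poincare_def I_def by blast
  have "0 \<le> I" unfolding I_def by simp
  then consider "I = 0" | "0 < I" by linarith
  then show ?thesis
  proof cases
    case 1
    then show ?thesis using le[OF ex] by (simp add: I_def)
  next
    case 2
    have "Var \<mu> f / I \<le> poincare_const \<Omega> \<mu> W"
      unfolding poincare_const_def
    proof (rule cInf_greatest)
      show "Var \<mu> f / I \<le> C" if "C \<in> {C. weighted_poincare \<Omega> \<mu> W C}" for C
        using le[of C] that 2 by (simp add: field_simps)
    qed (use ex in blast)
    then show ?thesis using 2 by (simp add: field_simps I_def)
  qed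
qed

theorem theorem3p1:
  fixes \<alpha> :: "real ^ 'n" and g wS :: "real \<Rightarrow> real" and K CP :: real
  assumes alpha_pos: "\<And>i. 0 < \<alpha> $ i"
    and g_measurable: "g \<in> borel_measurable (restrict_space borel {0<..})"
    and g_pos: "\<And>s. 0 < s \<Longrightarrow> 0 < g s"
    and normalizable: "set_integrable lborel orthant (liouville_kernel \<alpha> g)"
    and wS_measurable: "wS \<in> borel_measurable (restrict_space borel {0<..})"
    and wS_pos: "\<And>s. 0 < s \<Longrightarrow> 0 < wS s"
    and poincare_S: "\<exists>C. weighted_poincare {0<..} (liouville_radial \<alpha> g) (\<lambda>s v. wS s * v) C"
    and CP_def: "CP = poincare_const {0<..} (liouville_radial \<alpha> g) (\<lambda>s v. wS s * v)"
    and K_finite: "integrable (liouville_radial \<alpha> g) (\<lambda>s. s\<^sup>2 / wS s)"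
    and K_def: "K = (LINT s|liouville_radial \<alpha> g. s\<^sup>2 / wS s)"
  shows "\<forall>f G. L2 (liouville \<alpha> g) f \<and> weak_gradient orthant f G \<and>
      integrable (liouville \<alpha> g)
        (\<lambda>x. wS (coord_sum x) / coord_sum x * (\<Sum>i\<in>UNIV. x $ i * (G x $ i)\<^sup>2)) \<longrightarrow>
      Var (liouville \<alpha> g) f \<le> max CP (K / coord_sum \<alpha>) *
        (LINT x|liouville \<alpha> g.
          wS (coord_sum x) / coord_sum x * (\<Sum>i\<in>UNIV. x $ i * (G x $ i)\<^sup>2))"
proof (intro allI impI, elim conjE)
  fix f :: "real ^ 'n \<Rightarrow> real" and G :: "real ^ 'n \<Rightarrow> real ^ 'n"
  assume f: "L2 (liouville \<alpha> g) f" and wg: "weak_gradient orthant f G"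
    and energy: "integrable (liouville \<alpha> g)
      (\<lambda>x. wS (coord_sum x) / coord_sum x * (\<Sum>i\<in>UNIV. x $ i * (G x $ i)\<^sup>2))"
  have [measurable]: "(orthant :: (real ^ 'n) set) \<in> sets borel" by (rule borel_open[OF open_orthant])
  have extend: "(\<lambda>s. if 0 < s then h s else 0) \<in> borel_measurable borel"
    if "h \<in> borel_measurable (restrict_space borel {0<..})" for h :: "real \<Rightarrow> real"
  proof -
    have "(\<lambda>s. indicator {0<..} s *\<^sub>R h s) \<in> borel_measurable borel"
      using that by (subst (asm) borel_measurable_restrict_space_iff) simp_all
    also have "(\<lambda>s. indicator {0<..} s *\<^sub>R h s) = (\<lambda>s. if 0 < s then h s else 0)"
      by (auto simp: indicator_def fun_eq_iff)
    finally show ?thesis .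
  qed
  \<comment> \<open>Everything is extended by zero, so that Borel measurable functions on the whole space result. For \<open>G\<close>, measurability is a consequence of local integrability.\<close>
  define g0 where "g0 = (\<lambda>s. if 0 < s then g s else 0)"
  define w where "w = (\<lambda>s. if 0 < s then wS s else 0)"
  have [measurable]: "g0 \<in> borel_measurable borel" "w \<in> borel_measurable borel"
    unfolding g0_def w_def by (rule extend[OF g_measurable], rule extend[OF wS_measurable])
  have w_pos: "0 < s \<Longrightarrow> 0 < w s" for s using wS_pos by (simp add: w_def)
  have rd: "radial_density \<alpha> g \<in> borel_measurable borel"
  proof -
    have "radial_density \<alpha> g = (\<lambda>s. s powr (coord_sum \<alpha> - 1) * g0 s)"
      by (auto simp: fun_eq_iff radial_density_def g0_def)
    then show ?thesis by (simp only:) measurable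
  qed
  have ld: "liouville_density \<alpha> g \<in> borel_measurable borel"
  proof -
    have "liouville_density \<alpha> g = (\<lambda>x. if x \<in> orthant then (\<Prod>i\<in>UNIV. (x $ i) powr (\<alpha> $ i - 1)) * g0 (coord_sum x) else 0)"
      using coord_sum_pos by (auto simp: fun_eq_iff liouville_density_def liouville_kernel_def g0_def)
    then show ?thesis by (simp only:) measurable
  qed
  have ld_int: "integrable lborel (liouville_density \<alpha> g)"
  proof -
    have "liouville_density \<alpha> g = (\<lambda>x. indicator orthant x *\<^sub>R liouville_kernel \<alpha> g x)"
      by (auto simp: fun_eq_iff liouville_density_def indicator_def)
    then show ?thesis using normalizable by (simp only: set_integrable_def)
  qed
  interpret liouville_data \<alpha> g
    by standard (rule alpha_pos g_pos rd ld ld_int; assumption?)+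

  define f0 where "f0 = (\<lambda>x. if x \<in> orthant then f x else 0)"
  define G0 where "G0 = (\<lambda>x. if x \<in> orthant then G x else 0)"
  have f0_m: "f0 \<in> borel_measurable borel"
  proof -
    have "f \<in> borel_measurable (restrict_space (liouville_prob \<alpha> g) orthant)"
      using f by (simp only: L2_def liouville_eq[OF ld])
    then have "(\<lambda>x. indicator orthant x *\<^sub>R f x) \<in> borel_measurable borel"
      by (subst (asm) borel_measurable_restrict_space_iff) simp_all
    also have "(\<lambda>x. indicator orthant x *\<^sub>R f x) = f0"
      by (auto simp: f0_def indicator_def fun_eq_iff)
    finally show ?thesis .
  qed
  have G0_m: "G0 \<in> borel_measurable borel"
  proof (subst borel_measurable_euclidean_space, intro ballI)
    fix b :: "real ^ 'n" assume "b \<in> Basis"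
    then have "locally_integrable_on orthant (\<lambda>x. G x \<bullet> b)"
      using wg unfolding weak_gradient_def weak_partial_def by blast
    then have "(\<lambda>x. if x \<in> orthant then G x \<bullet> b else 0) \<in> borel_measurable borel"
      by (rule borel_measurable_locally_integrable[OF open_orthant])
    also have "(\<lambda>x. if x \<in> orthant then G x \<bullet> b else 0) = (\<lambda>x. G0 x \<bullet> b)"
      by (auto simp: G0_def fun_eq_iff)
    finally show "(\<lambda>x. G0 x \<bullet> b) \<in> borel_measurable borel" .
  qed
  have wg0: "weak_gradient orthant f0 G0"
    using wg weak_gradient_cong[where f = f0 and f' = f and G = G0 and G' = G and \<Omega> = orthant] by (simp add: f0_def G0_def)
  have sq: "(\<lambda>x. if x \<in> orthant then (f x)\<^sup>2 else 0) = (\<lambda>x. (f0 x)\<^sup>2)"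
    by (auto simp: f0_def fun_eq_iff)
  have en: "(\<lambda>x. if x \<in> orthant then wS (coord_sum x) / coord_sum x * (\<Sum>i\<in>UNIV. x $ i * (G x $ i)\<^sup>2) else 0)
      = (\<lambda>x. w (coord_sum x) / coord_sum x * (\<Sum>i\<in>UNIV. x $ i * (G0 x $ i)\<^sup>2))"
    using coord_sum_pos by (auto simp: G0_def w_def fun_eq_iff)
  have Kw: "s\<^sup>2 / wS s = s\<^sup>2 / w s" if "0 < s" for s using that by (simp add: w_def)
  have Kw_m: "(\<lambda>s. s\<^sup>2 / w s) \<in> borel_measurable borel" by measurable
  \<comment> \<open>The hypothesis on the radial law, with its optimal constant, for functions on the real line.\<close>
  have poincare: "Var (radial_prob \<alpha> g) F \<le> CP * (LINT s|radial_prob \<alpha> g. w s * (h s)\<^sup>2)"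
    if F [measurable]: "F \<in> borel_measurable borel" and [measurable]: "h \<in> borel_measurable borel"
      and Fh: "weak_gradient {0<..} F h" and F2: "integrable (radial_prob \<alpha> g) (\<lambda>s. (F s)\<^sup>2)"
      and h2: "integrable (radial_prob \<alpha> g) (\<lambda>s. w s * (h s)\<^sup>2)" for F h
  proof -
    obtain C where C: "weighted_poincare {0<..} (liouville_radial \<alpha> g) (\<lambda>s v. wS s * v) C"
      using poincare_S by blast
    have norm_eq: "(weighted_norm ((*) (wS s)) (h s))\<^sup>2 = w s * (h s)\<^sup>2" if "0 < s" for s
      using that wS_pos[OF that] by (simp add: weighted_norm_def w_def power2_eq_square mult.assoc)
    have Fm: "(\<lambda>s. (F s)\<^sup>2) \<in> borel_measurable borel" and hm: "(\<lambda>s. w s * (h s)\<^sup>2) \<in> borel_measurable borel"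
      by measurable
    have "F \<in> borel_measurable (liouville_radial \<alpha> g)"
      unfolding liouville_radial_def normalized_measure_def using F
      by (simp add: measurable_restrict_space1)
    then have "L2 (liouville_radial \<alpha> g) F"
      using F2 by (simp add: L2_def integrable_liouville_radial_iff[OF rd Fm])
    from poincare_const_bound[OF C this Fh] h2
    have "Var (liouville_radial \<alpha> g) F \<le> CP * (LINT s|liouville_radial \<alpha> g. (weighted_norm ((*) (wS s)) (h s))\<^sup>2)"
      by (simp add: CP_def integrable_liouville_radial_iff[OF rd hm norm_eq])
    then show ?thesis
      by (simp add: Var_def integral_liouville_radial[OF rd F refl] integral_liouville_radial[OF rd Fm refl]
        integral_liouville_radial[OF rd hm norm_eq])
  qed
  have "Var (liouville_prob \<alpha> g) f0 \<le> max CP ((LINT s|radial_prob \<alpha> g. s\<^sup>2 / w s) / coord_sum \<alpha>) *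
      (LINT x|liouville_prob \<alpha> g. w (coord_sum x) / coord_sum x * (\<Sum>i\<in>UNIV. x $ i * (G0 x $ i)\<^sup>2))"
  proof (rule liouville_variance_bound[OF wg0 f0_m G0_m _ _ _ w_pos _ _ _ poincare])
    show "integrable (liouville_prob \<alpha> g) (\<lambda>x. (f0 x)\<^sup>2)"
      using f by (simp only: L2_def integrable_liouville_iff[OF ld] sq)
    show "integrable (liouville_prob \<alpha> g) (\<lambda>x. w (coord_sum x) / coord_sum x * (\<Sum>i\<in>UNIV. x $ i * (G0 x $ i)\<^sup>2))"
      using energy by (simp only: integrable_liouville_iff[OF ld] en)
    show "integrable (radial_prob \<alpha> g) (\<lambda>s. s\<^sup>2 / w s)"
      using K_finite by (simp only: integrable_liouville_radial_iff[OF rd Kw_m Kw])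
  qed (simp_all add: f0_def G0_def)
  moreover have "(LINT s|radial_prob \<alpha> g. s\<^sup>2 / w s) = K"
    unfolding K_def by (rule integral_liouville_radial[OF rd Kw_m Kw, symmetric])
  moreover have "Var (liouville \<alpha> g) f = Var (liouville_prob \<alpha> g) f0"
    unfolding Var_def integral_liouville[OF ld] sq by (simp only: f0_def)
  ultimately show "Var (liouville \<alpha> g) f \<le> max CP (K / coord_sum \<alpha>) *
      (LINT x|liouville \<alpha> g. wS (coord_sum x) / coord_sum x * (\<Sum>i\<in>UNIV. x $ i * (G x $ i)\<^sup>2))"
    by (simp only: integral_liouville[OF ld] en)
qed

end
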